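(* Let the unit disk $M$ be equipped with the metric $g_\kappa$ for $\kappa\in(-1,1)$ fixed, and let $C_-=\frac12A_-^*H_-A_-$. Then the operator $id+C_-^2$ is the $L^2(\partial_+SM,d\Sigma^2)$ orthogonal projection operator onto the range of $I_0$.
   Context: Setting. $M=\{z\in\mathbb{C}:|z|\le1\}$ with metric $g_\kappa(z)=(1+\kappa|z|^2)^{-2}|dz|^2$ (constant curvature $4\kappa$). The boundary $\partial SM$ of the unit circle bundle is parameterized by fan-beam coordinates $(\beta,\alpha)\in(\mathbb{R}/2\pi\mathbb{Z})^2$: base point $e^{i\beta}$, unit vector $(1+\kappa)e^{i(\beta+\pi+\alpha)}$. The inward boundary is $\partial_+SM=\{\alpha\in[-\pi/2,\pi/2]\}$, the outward boundary is $\partial_-SM=\{\alpha\in[\pi/2,3\pi/2]\}$, and $d\Sigma^2=(1+\kappa)^{-1}d\beta\,d\alpha$. X-ray transform: $I_0\colon C^\infty(M)\to C^\infty(\partial_+SM)$, $I_0f(x,v)=\int_0^{\tau(x,v)}f(\gamma_{x,v}(t))\,dt$, where $\gamma_{x,v}$ is the unit-speed $g_\kappa$-geodesic with initial conditions $(x,v)\in\partial_+SM$ and $\tau(x,v)$ is its first exit time from $M$. Scattering relation: $\mathcal{S}(\beta,\alpha)=(\beta+\pi+2\mathfrak{s}(\alpha),\pi-\alpha)$, where $\mathfrak{s}(\alpha)=\tan^{-1}\left(\frac{1-\kappa}{1+\kappa}\tan\alpha\right)$ on $(-\pi/2,\pi/2)$, extended smoothly by $\mathfrak{s}(\alpha+\pi)=\mathfrak{s}(\alpha)+\pi$;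 it maps a boundary vector to the one at the other end of its geodesic. Operators: for $u$ on $\partial_+SM$, $A_-u$ is the function on $\partial SM$ equal to $u$ on $\partial_+SM$ and to $-u\circ\mathcal{S}$ on $\partial_-SM$; for $u$ on $\partial SM$, $A_-^*u=(u-u\circ\mathcal{S})|_{\partial_+SM}$. The fiberwise Hilbert transform on $\partial SM$ is $Hu=\sum_{k\in\mathbb{Z}}-i\,\mathrm{sign}(k)u_k(\beta)e^{ik\alpha}$ for $u=\sum_ku_k(\beta)e^{ik\alpha}$, with $\mathrm{sign}(0)=0$; $H_-$ is its restriction to odd Fourier modes in $\alpha$ (zero on even modes). The operator $C_-=\frac12A_-^*H_-A_-$ is defined in the smooth setting from $\{u\in C^\infty(\partial_+SM):A_-u\in C^\infty(\partial SM)\}$ to $C^\infty(\partial_+SM)$, and is also viewed as a bounded operator from $L^2(\partial_+SM,d\Sigma^2)$ into itself.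
   Formalization: Restricted to u on ∂_+SM invariant under reversing the geodesic, u(S(β,α+π))=u(β,α) a.e.; for u changing sign under it, C_-u=0 though u is orthogonal to the range. The projection is onto the L² closure of the range of I_0; smooth u with A_-u smooth land in the range. *)

theory Defs
  imports "HOL-Analysis.Analysis"
begin

section \<open>Smooth functions\<close>

text \<open>
  Derivatives are taken relative to \<^term>\<open>S\<close>. For \<^term>\<open>S = UNIV\<close> this is the usual notion; for a
  closed convex set with nonempty interior it is smoothness up to and including the boundary.
\<close>

coinductive smooth_on :: "'a::real_normed_vector set \<Rightarrow> ('a \<Rightarrow> 'b::real_normed_vector) \<Rightarrow> bool"
  for S where
  "(\<And>x. x \<in> S \<Longrightarrow> (f has_derivative f' x) (at x within S)) \<Longrightarrow>
   (\<And>h. smooth_on S (\<lambda>x. f' x h)) \<Longrightarrow> smooth_on S f"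

definition C_inf_disk :: "(complex \<Rightarrow> complex) set" where
  "C_inf_disk = {f. smooth_on (cball 0 1) f}"


section \<open>The metric, its geodesics and the X-ray transform\<close>

definition disk_metric :: "real \<Rightarrow> complex \<Rightarrow> complex \<Rightarrow> complex \<Rightarrow> real" where
  "disk_metric \<kappa> z v w = (v \<bullet> w) / (1 + \<kappa> * (norm z)\<^sup>2)\<^sup>2"

text \<open>Christoffel symbols of the first kind of a metric \<^term>\<open>g\<close>, as a trilinear form.\<close>

definition christoffel ::
  "('a::euclidean_space \<Rightarrow> 'a \<Rightarrow> 'a \<Rightarrow> real) \<Rightarrow> 'a \<Rightarrow> 'a \<Rightarrow> 'a \<Rightarrow> 'a \<Rightarrow> real" where
  "christoffel g x u v w =
     (frechet_derivative (\<lambda>y. g y v w) (at x) u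
      + frechet_derivative (\<lambda>y. g y u w) (at x) v
      - frechet_derivative (\<lambda>y. g y u v) (at x) w) / 2"

text \<open>The geodesic equation, tested against all vectors \<^term>\<open>w\<close>; \<^term>\<open>\<gamma>'\<close> is the velocity of \<^term>\<open>\<gamma>\<close>.\<close>

definition geodesic_on ::
  "('a::euclidean_space \<Rightarrow> 'a \<Rightarrow> 'a \<Rightarrow> real) \<Rightarrow> real set \<Rightarrow> (real \<Rightarrow> 'a) \<Rightarrow> (real \<Rightarrow> 'a) \<Rightarrow> bool" where
  "geodesic_on g J \<gamma> \<gamma>' \<longleftrightarrow>
     (\<exists>\<gamma>''. \<forall>t\<in>J.
        (\<gamma> has_vector_derivative \<gamma>' t) (at t within J) \<and>
        (\<gamma>' has_vector_derivative \<gamma>'' t) (at t within J) \<and>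
        (\<forall>w. g (\<gamma> t) (\<gamma>'' t) w + christoffel g (\<gamma> t) (\<gamma>' t) (\<gamma>' t) w = 0))"

definition geodesic_in_disk ::
  "real \<Rightarrow> complex \<Rightarrow> complex \<Rightarrow> real \<Rightarrow> (real \<Rightarrow> complex) \<Rightarrow> bool" where
  "geodesic_in_disk \<kappa> x v T \<gamma> \<longleftrightarrow>
     (\<exists>\<gamma>'. geodesic_on (disk_metric \<kappa>) {0..T} \<gamma> \<gamma>' \<and> \<gamma> 0 = x \<and> \<gamma>' 0 = v) \<and>
     \<gamma> ` {0..T} \<subseteq> cball 0 1"

text \<open>
  The first exit time is the largest time up to which the geodesic stays in the closed disk
  (it is \<open>0\<close> for vectors tangent to the boundary, the boundary being strictly convex).
\<close>

definition exit_time :: "real \<Rightarrow> complex \<Rightarrow> complex \<Rightarrow> real" where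
  "exit_time \<kappa> x v = Sup {T. 0 \<le> T \<and> (\<exists>\<gamma>. geodesic_in_disk \<kappa> x v T \<gamma>)}"

text \<open>
  Points of the boundary of the unit circle bundle are given by fan-beam coordinates \<open>(\<beta>, \<alpha>)\<close>,
  lifted from the torus to the plane: a function on the torus is a function on the plane that is
  \<open>2\<pi>\<close>-periodic in both variables, and a function on the inward boundary is a function on the
  strip \<open>\<bar>\<alpha>\<bar> \<le> \<pi>/2\<close>, \<open>2\<pi>\<close>-periodic in \<open>\<beta>\<close>. The values of the latter off the strip are irrelevant.
\<close>

definition xray :: "real \<Rightarrow> (complex \<Rightarrow> complex) \<Rightarrow> real \<times> real \<Rightarrow> complex" where
  "xray \<kappa> f = (\<lambda>(\<beta>, \<alpha>).
     let x = cis \<beta>;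
         v = of_real (1 + \<kappa>) * cis (\<beta> + pi + \<alpha>);
         \<tau> = exit_time \<kappa> x v;
         \<gamma> = (SOME \<gamma>. geodesic_in_disk \<kappa> x v \<tau> \<gamma>)
     in integral {0..\<tau>} (\<lambda>t. f (\<gamma> t)))"


section \<open>Function spaces on the boundary of the unit circle bundle\<close>

definition influx_strip :: "(real \<times> real) set" where
  "influx_strip = UNIV \<times> {- (pi/2)..pi/2}"

definition periodic_influx :: "(real \<times> real \<Rightarrow> 'a) \<Rightarrow> bool" where
  "periodic_influx u \<longleftrightarrow> (\<forall>\<beta> \<alpha>. \<bar>\<alpha>\<bar> \<le> pi/2 \<longrightarrow> u (\<beta> + 2*pi, \<alpha>) = u (\<beta>, \<alpha>))"

definition periodic_bdry :: "(real \<times> real \<Rightarrow> 'a) \<Rightarrow> bool" where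
  "periodic_bdry w \<longleftrightarrow>
     (\<forall>\<beta> \<alpha>. w (\<beta> + 2*pi, \<alpha>) = w (\<beta>, \<alpha>) \<and> w (\<beta>, \<alpha> + 2*pi) = w (\<beta>, \<alpha>))"

definition C_inf_influx :: "(real \<times> real \<Rightarrow> complex) set" where
  "C_inf_influx = {u. periodic_influx u \<and> smooth_on influx_strip u}"

definition C_inf_bdry :: "(real \<times> real \<Rightarrow> complex) set" where
  "C_inf_bdry = {w. periodic_bdry w \<and> smooth_on UNIV w}"

text \<open>The measure \<open>(1 + \<kappa>)\<^sup>-\<^sup>1 d\<beta> d\<alpha>\<close> on fundamental domains.\<close>

definition influx_measure :: "real \<Rightarrow> (real \<times> real) measure" where
  "influx_measure \<kappa> =
     density (restrict_space lborel ({0..2*pi} \<times> {- (pi/2)..pi/2})) (\<lambda>_. ennreal (1 / (1 + \<kappa>)))"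

definition bdry_measure :: "real \<Rightarrow> (real \<times> real) measure" where
  "bdry_measure \<kappa> =
     density (restrict_space lborel ({0..2*pi} \<times> {- (pi/2)..3*pi/2})) (\<lambda>_. ennreal (1 / (1 + \<kappa>)))"

definition square_integrable :: "'a measure \<Rightarrow> ('a \<Rightarrow> complex) \<Rightarrow> bool" where
  "square_integrable M u \<longleftrightarrow> u \<in> borel_measurable M \<and> integrable M (\<lambda>x. (norm (u x))\<^sup>2)"

definition L2_inner :: "'a measure \<Rightarrow> ('a \<Rightarrow> complex) \<Rightarrow> ('a \<Rightarrow> complex) \<Rightarrow> complex" where
  "L2_inner M u w = integral\<^sup>L M (\<lambda>x. u x * cnj (w x))"

definition L2_norm :: "'a measure \<Rightarrow> ('a \<Rightarrow> complex) \<Rightarrow> real" where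
  "L2_norm M u = sqrt (integral\<^sup>L M (\<lambda>x. (norm (u x))\<^sup>2))"

definition L2_influx :: "real \<Rightarrow> (real \<times> real \<Rightarrow> complex) set" where
  "L2_influx \<kappa> = {u. periodic_influx u \<and> square_integrable (influx_measure \<kappa>) u}"

definition L2_bdry :: "real \<Rightarrow> (real \<times> real \<Rightarrow> complex) set" where
  "L2_bdry \<kappa> = {w. periodic_bdry w \<and> square_integrable (bdry_measure \<kappa>) w}"

text \<open>
  Elements of \<^term>\<open>W\<close> are representatives of \<open>L\<^sup>2\<close> classes. The condition says that \<^term>\<open>P\<close> is the
  orthogonal projection of \<^term>\<open>W\<close> onto the \<open>L\<^sup>2\<close>-closure of the subspace \<^term>\<open>R\<close>; it determines
  \<^term>\<open>P u\<close> up to null sets. The closure is part of the notion, since the range of an orthogonal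
  projection of a Hilbert space is closed.
\<close>

definition L2_closure ::
  "'a measure \<Rightarrow> ('a \<Rightarrow> complex) set \<Rightarrow> ('a \<Rightarrow> complex) set \<Rightarrow> ('a \<Rightarrow> complex) set" where
  "L2_closure M W R = {w \<in> W. \<forall>e>0. \<exists>r\<in>R. L2_norm M (\<lambda>x. w x - r x) < e}"

definition L2_orthogonal_projection_onto ::
  "'a measure \<Rightarrow> ('a \<Rightarrow> complex) set \<Rightarrow> (('a \<Rightarrow> complex) \<Rightarrow> 'a \<Rightarrow> complex) \<Rightarrow>
   ('a \<Rightarrow> complex) set \<Rightarrow> bool" where
  "L2_orthogonal_projection_onto M W P R \<longleftrightarrow>
     R \<subseteq> W \<and>
     (\<forall>u\<in>W. P u \<in> L2_closure M W R \<and> (\<forall>r\<in>R. L2_inner M (\<lambda>x. u x - P u x) r = 0))"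


section \<open>The scattering relation\<close>

text \<open>
  On \<open>(-\<pi>/2, \<pi>/2)\<close> the floor vanishes; the case \<^term>\<open>cos \<alpha> = 0\<close> supplies the values of the smooth
  extension at \<open>\<pi>/2 + k\<pi>\<close>, where \<^term>\<open>tan \<alpha> = 0\<close> by convention.
\<close>

definition scat_angle :: "real \<Rightarrow> real \<Rightarrow> real" where
  "scat_angle \<kappa> \<alpha> =
     (if cos \<alpha> = 0 then \<alpha>
      else arctan ((1 - \<kappa>) / (1 + \<kappa>) * tan \<alpha>) + pi * of_int \<lfloor>\<alpha> / pi + 1/2\<rfloor>)"

definition scattering :: "real \<Rightarrow> real \<times> real \<Rightarrow> real \<times> real" where
  "scattering \<kappa> = (\<lambda>(\<beta>, \<alpha>). (\<beta> + pi + 2 * scat_angle \<kappa> \<alpha>, pi - \<alpha>))"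

text \<open>
  The antipodal scattering relation sends an inward vector to the inward vector generating the same
  geodesic with the opposite orientation: reverse the vector, then scatter.
\<close>

definition antipodal_scattering :: "real \<Rightarrow> real \<times> real \<Rightarrow> real \<times> real" where
  "antipodal_scattering \<kappa> = (\<lambda>(\<beta>, \<alpha>). scattering \<kappa> (\<beta>, \<alpha> + pi))"

text \<open>
  Every \<^term>\<open>xray \<kappa> f\<close> is invariant under reversing the geodesic, so functions on the inward boundary
  are considered as functions of unoriented geodesics. The restriction is needed: if \<open>u\<close> changes
  sign under \<^term>\<open>antipodal_scattering \<kappa>\<close>, then \<open>A\<^sub>- u\<close> has only even Fourier modes in \<open>\<alpha>\<close>, so
  \<open>C\<^sub>- u = 0\<close>, although \<open>u\<close> is orthogonal to the range of the X-ray transform.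
\<close>

definition unoriented :: "real \<Rightarrow> (real \<times> real \<Rightarrow> complex) \<Rightarrow> bool" where
  "unoriented \<kappa> u \<longleftrightarrow> (AE p in influx_measure \<kappa>. u (antipodal_scattering \<kappa> p) = u p)"

definition L2_unoriented :: "real \<Rightarrow> (real \<times> real \<Rightarrow> complex) set" where
  "L2_unoriented \<kappa> = {u \<in> L2_influx \<kappa>. unoriented \<kappa> u}"


section \<open>The boundary operators\<close>

text \<open>Here \<open>\<alpha>\<close> is first reduced to \<open>[-\<pi>/2, 3\<pi>/2)\<close> modulo \<open>2\<pi>\<close>.\<close>

definition A_minus :: "real \<Rightarrow> (real \<times> real \<Rightarrow> complex) \<Rightarrow> real \<times> real \<Rightarrow> complex" where
  "A_minus \<kappa> u = (\<lambda>(\<beta>, \<alpha>).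
     let a = \<alpha> - 2 * pi * of_int \<lfloor>(\<alpha> + pi/2) / (2*pi)\<rfloor>
     in if a \<le> pi/2 then u (\<beta>, a) else - u (scattering \<kappa> (\<beta>, a)))"

definition A_minus_adj :: "real \<Rightarrow> (real \<times> real \<Rightarrow> complex) \<Rightarrow> real \<times> real \<Rightarrow> complex" where
  "A_minus_adj \<kappa> w = (\<lambda>p. w p - w (scattering \<kappa> p))"

definition fiber_coeff :: "(real \<times> real \<Rightarrow> complex) \<Rightarrow> int \<Rightarrow> real \<Rightarrow> complex" where
  "fiber_coeff w k \<beta> =
     of_real (1 / (2*pi)) *
     (LINT \<alpha>:{- (pi/2)..3*pi/2}|lborel. w (\<beta>, \<alpha>) * cis (- (of_int k * \<alpha>)))"

definition hilbert_partial_sum ::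
  "int set \<Rightarrow> nat \<Rightarrow> (real \<times> real \<Rightarrow> complex) \<Rightarrow> real \<times> real \<Rightarrow> complex" where
  "hilbert_partial_sum K N w = (\<lambda>(\<beta>, \<alpha>).
     \<Sum>k \<in> K \<inter> {- int N..int N}.
       - \<i> * of_int (sgn k) * fiber_coeff w k \<beta> * cis (of_int k * \<alpha>))"

text \<open>
  The fiberwise Hilbert transform restricted to the modes in \<^term>\<open>K\<close>: a representative of the sum of
  the Fourier series in \<open>L\<^sup>2\<close>.
\<close>

definition fiber_hilbert ::
  "int set \<Rightarrow> real \<Rightarrow> (real \<times> real \<Rightarrow> complex) \<Rightarrow> real \<times> real \<Rightarrow> complex" where
  "fiber_hilbert K \<kappa> w = (SOME h. h \<in> L2_bdry \<kappa> \<and>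
     (\<lambda>N. L2_norm (bdry_measure \<kappa>) (\<lambda>p. h p - hilbert_partial_sum K N w p)) \<longlonglongrightarrow> 0)"

definition H_minus :: "real \<Rightarrow> (real \<times> real \<Rightarrow> complex) \<Rightarrow> real \<times> real \<Rightarrow> complex" where
  "H_minus = fiber_hilbert {k. odd k}"

definition C_minus :: "real \<Rightarrow> (real \<times> real \<Rightarrow> complex) \<Rightarrow> real \<times> real \<Rightarrow> complex" where
  "C_minus \<kappa> u = (\<lambda>p. 1/2 * A_minus_adj \<kappa> (H_minus \<kappa> (A_minus \<kappa> u)) p)"

definition id_plus_C_minus_sq ::
  "real \<Rightarrow> (real \<times> real \<Rightarrow> complex) \<Rightarrow> real \<times> real \<Rightarrow> complex" where
  "id_plus_C_minus_sq \<kappa> u = (\<lambda>p. u p + C_minus \<kappa> (C_minus \<kappa> u) p)"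

text \<open>The domain of \<open>C\<^sub>-\<close> in the smooth setting.\<close>

definition C_inf_minus :: "real \<Rightarrow> (real \<times> real \<Rightarrow> complex) set" where
  "C_inf_minus \<kappa> = {u \<in> C_inf_influx. A_minus \<kappa> u \<in> C_inf_bdry}"

end

theory Submission
  imports Defs "HOL-Computational_Algebra.Polynomial"
begin

text \<open>
  The functions \<open>e\<^sub>p\<^sub>,\<^sub>m(\<beta>, \<alpha>) = e\<^sup>i\<^sup>p\<^sup>\<beta> e\<^sup>i\<^sup>m\<^sup>s / \<rho>\<close>, where \<open>s\<close> is the scattering angle of \<open>\<alpha>\<close> and \<open>s' = (1 - \<kappa>\<^sup>2) / \<rho>\<^sup>2\<close>,
  form an orthogonal basis on the boundary. Scattering exchanges \<open>e\<^sub>p\<^sub>,\<^sub>m\<close> and \<open>e\<^sub>p\<^sub>,\<^sub>2\<^sub>p\<^sub>-\<^sub>m\<close> up to sign. For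
  odd \<open>m > 0\<close> the function \<open>e\<^sub>p\<^sub>,\<^sub>m\<close> has only positive Fourier modes in \<open>\<alpha>\<close>, so the Hilbert transform
  multiplies it by \<open>-i sgn m\<close>. Hence \<open>C\<^sub>-\<close> is diagonal, with eigenvalue
  \<open>-i (sgn m + sgn (2p - m)) / 2\<close>, and \<open>id + C\<^sub>-\<^sup>2\<close> keeps exactly the frequencies with \<open>m\<close> and \<open>2p - m\<close> of
  opposite sign.

  A projective change of variables turns geodesics into chords and the X-ray transform into a
  weighted integral over chords. It maps the Zernike polynomials to multiples of the basis elements
  that are kept, which gives density of the range. Ridge Chebyshev polynomials have chord integrals
  in their span, and every continuous function is a uniform limit of combinations of ridge
  functions, which gives orthogonality. Smooth data have rapidly decaying coefficients, so their
  Zernike series converges to a smooth preimage.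
\<close>

section \<open>The scattering angle\<close>

text \<open>Two operators have to be diagonalized together: the fibrewise Hilbert transform is
  diagonal in \<alpha>, while scattering is simple only in the angle s. The weight 1/\<rho>
  reconciles them. Up to a constant it is the square root of ds/d\<alpha>, so the change of angle
  preserves orthogonality; and it is also exactly the weight for which e^{is}/\<rho> extends
  holomorphically in e^{2i\<alpha>}, because \<bar>\<kappa>\<bar> < 1. The X-ray transform is given
  by an arbitrary choice of a geodesic on a maximal time interval, so nothing can be computed before
  existence, uniqueness and strict convexity of the boundary are settled. Uniqueness is obtained
  from quantities along a geodesic that satisfy linear equations. The two conclusions differ in
  kind. For square-integrable data an approximate preimage is enough. For smooth data the preimage
  has to be smooth up to the boundary of the disk, where the derivatives of Zernike polynomials
  grow; polynomial growth in the degree is beaten by rapid decay of the coefficients.\<close>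

locale curved_disk =
  fixes \<kappa> :: real
  assumes kappa_gt: "-1 < \<kappa>" and kappa_lt: "\<kappa> < 1"
begin

text \<open>The modulus of \<open>cis \<alpha> + \<kappa> * cis (- \<alpha>)\<close>, whose argument
  is the scattering angle.\<close>

definition rho :: "real => real" where
  "rho \<alpha> = sqrt (((1 + \<kappa>) * cos \<alpha>)\<^sup>2 + ((1 - \<kappa>) * sin \<alpha>)\<^sup>2)"

abbreviation sct :: "real => real" where "sct \<equiv> scat_angle \<kappa>"

lemma rho_arg_pos: "((1 + \<kappa>) * cos \<alpha>)\<^sup>2 + ((1 - \<kappa>) * sin \<alpha>)\<^sup>2 > 0"
proof (cases "cos \<alpha> = 0")
  case True
  then have "sin \<alpha> ~= 0" using sin_cos_squared_add[of \<alpha>] by auto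
  then show ?thesis using True kappa_lt by simp
next
  case False
  then show ?thesis using kappa_gt by (simp add: add_pos_nonneg)
qed

lemma rho_pos: "rho \<alpha> > 0"
  unfolding rho_def using rho_arg_pos by simp

lemma rho_square: "(rho \<alpha>)\<^sup>2 = ((1 + \<kappa>) * cos \<alpha>)\<^sup>2 + ((1 - \<kappa>) * sin \<alpha>)\<^sup>2"
  unfolding rho_def using rho_arg_pos[of \<alpha>] by simp

lemma rho_plus_pi: "rho (\<alpha> + pi) = rho \<alpha>" and rho_minus: "rho (- \<alpha>) = rho \<alpha>"
  and rho_pi_minus: "rho (pi - \<alpha>) = rho \<alpha>"
  by (simp_all add: rho_def)

lemma continuous_rho: "continuous_on A rho"
  unfolding rho_def by (intro continuous_intros)

lemma scat_plus_pi: "sct (\<alpha> + pi) = sct \<alpha> + pi"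
proof -
  have "(\<alpha> + pi) / pi + 1/2 = (\<alpha> / pi + 1/2) + of_int 1" by (simp add: add_divide_distrib)
  then have "\<lfloor>(\<alpha> + pi) / pi + 1/2\<rfloor> = \<lfloor>\<alpha> / pi + 1/2\<rfloor> + 1" by (simp only: floor_add_int)
  moreover have "tan (\<alpha> + pi) = tan \<alpha>" by (simp add: tan_def)
  ultimately show ?thesis by (simp add: scat_angle_def algebra_simps)
qed

lemma scat_plus_int_pi: "sct (\<alpha> + of_int n * pi) = sct \<alpha> + of_int n * pi"
proof (induction n rule: int_induct[where k=0])
  case (step1 i)
  have "sct (\<alpha> + of_int (i + 1) * pi) = sct ((\<alpha> + of_int i * pi) + pi)" by (simp add: algebra_simps)
  also have "\<dots> = sct (\<alpha> + of_int i * pi) + pi" by (rule scat_plus_pi)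
  finally show ?case using step1 by (simp add: algebra_simps)
next
  case (step2 i)
  have "sct ((\<alpha> + of_int (i - 1) * pi) + pi) = sct (\<alpha> + of_int i * pi)" by (simp add: algebra_simps)
  then show ?case using step2 scat_plus_pi[of "\<alpha> + of_int (i - 1) * pi"] by (simp add: algebra_simps)
qed simp

lemma scat_plus_2pi: "sct (\<alpha> + 2 * pi) = sct \<alpha> + 2 * pi"
  using scat_plus_int_pi[of \<alpha> 2] by simp

lemma half_open_reduction:
  obtains n :: int and a where "\<alpha> = a + of_int n * pi" "- (pi/2) \<le> a" "a < pi/2"
proof -
  define n where "n = \<lfloor>\<alpha> / pi + 1/2\<rfloor>"
  have "of_int n \<le> \<alpha> / pi + 1/2" "\<alpha> / pi + 1/2 < of_int n + 1" unfolding n_def by linarith+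
  then have "of_int n * pi \<le> \<alpha> + pi/2" "\<alpha> + pi/2 < (of_int n + 1) * pi"
    by (simp_all add: field_simps)
  then show thesis using that[of "\<alpha> - of_int n * pi" n] by (simp add: algebra_simps)
qed

lemma scat_arctan:
  assumes "- (pi/2) < a" "a < pi/2"
  shows "sct a = arctan ((1 - \<kappa>) / (1 + \<kappa>) * tan a)"
proof -
  have "cos a > 0" using assms by (intro cos_gt_zero_pi) auto
  moreover have "\<lfloor>a / pi + 1/2\<rfloor> = 0" using assms by (intro floor_unique) (auto simp: field_simps)
  ultimately show ?thesis by (simp add: scat_angle_def)
qed

lemma scat_half_pi: "sct (pi/2) = pi/2" "sct (- (pi/2)) = - (pi/2)"
  by (simp_all add: scat_angle_def)

lemma scat_minus: "sct (- \<alpha>) = - sct \<alpha>"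
proof -
  obtain n :: int and a where a: "\<alpha> = a + of_int n * pi" "- (pi/2) \<le> a" "a < pi/2"
    by (rule half_open_reduction)
  have m: "sct (- a) = - sct a"
  proof (cases "a = - (pi/2)")
    case True then show ?thesis by (simp add: scat_half_pi)
  next
    case False
    then show ?thesis using a scat_arctan[of a] scat_arctan[of "-a"]
      by (simp add: arctan_minus[symmetric])
  qed
  have "sct (- \<alpha>) = sct (- a + of_int (- n) * pi)" by (simp add: a)
  also have "\<dots> = - sct a - of_int n * pi" by (subst scat_plus_int_pi) (simp add: m)
  also have "\<dots> = - sct \<alpha>" unfolding a(1) by (subst scat_plus_int_pi) simp
  finally show ?thesis .
qed

lemma scat_pi_minus: "sct (pi - \<alpha>) = pi - sct \<alpha>"
  using scat_plus_pi[of "- \<alpha>"] by (simp add: scat_minus algebra_simps)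

text \<open>Polar form of (1 + \<kappa>) cos \<alpha> + i (1 - \<kappa>) sin \<alpha>. All four
  expressions change sign when \<alpha> grows by \<pi>, so arctan is needed on one half-open period
  only; afterwards the floor and the case distinction in \<open>scat_angle\<close> never have to be
  opened for trigonometric purposes.\<close>

lemma rho_cos_sin_scat:
  "rho \<alpha> * cos (sct \<alpha>) = (1 + \<kappa>) * cos \<alpha> \<and> rho \<alpha> * sin (sct \<alpha>) = (1 - \<kappa>) * sin \<alpha>"
proof -
  have step: "(rho (x + pi) * cos (sct (x + pi)) = (1 + \<kappa>) * cos (x + pi) \<and>
      rho (x + pi) * sin (sct (x + pi)) = (1 - \<kappa>) * sin (x + pi)) \<longleftrightarrow>
     (rho x * cos (sct x) = (1 + \<kappa>) * cos x \<and> rho x * sin (sct x) = (1 - \<kappa>) * sin x)" for x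
    by (simp add: rho_plus_pi scat_plus_pi)
  have fundamental: "rho a * cos (sct a) = (1 + \<kappa>) * cos a \<and> rho a * sin (sct a) = (1 - \<kappa>) * sin a"
    if "- (pi/2) \<le> a" "a < pi/2" for a
  proof (cases "a = - (pi/2)")
    case True
    then have "sct a = - (pi/2)" "rho a = 1 - \<kappa>" using kappa_lt by (simp_all add: scat_half_pi rho_def)
    then show ?thesis using True by simp
  next
    case False
    then have s: "sct a = arctan ((1 - \<kappa>) / (1 + \<kappa>) * tan a)" using that scat_arctan by simp
    have c: "cos a > 0" using False that by (intro cos_gt_zero_pi) auto
    have "1 + ((1 - \<kappa>) / (1 + \<kappa>) * tan a)\<^sup>2 = (rho a / ((1 + \<kappa>) * cos a))\<^sup>2"
      using c kappa_gt
      by (simp add: power_divide rho_square tan_def times_divide_times_eq add_divide_distrib)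
    then have sq: "sqrt (1 + ((1 - \<kappa>) / (1 + \<kappa>) * tan a)\<^sup>2) = rho a / ((1 + \<kappa>) * cos a)"
      using c kappa_gt rho_pos[of a] by simp
    show ?thesis unfolding s cos_arctan sin_arctan sq
      using c kappa_gt rho_pos[of a] by (simp add: tan_def)
  qed
  obtain n :: int and a where a: "\<alpha> = a + of_int n * pi" "- (pi/2) \<le> a" "a < pi/2"
    by (rule half_open_reduction)
  have "rho (a + of_int n * pi) * cos (sct (a + of_int n * pi)) = (1 + \<kappa>) * cos (a + of_int n * pi) \<and>
      rho (a + of_int n * pi) * sin (sct (a + of_int n * pi)) = (1 - \<kappa>) * sin (a + of_int n * pi)"
  proof (induction n rule: int_induct[where k=0])
    case base then show ?case using fundamental[OF a(2,3)] by simp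
  next
    case (step1 i)
    then show ?case using step[of "a + of_int i * pi"] by (simp add: algebra_simps)
  next
    case (step2 i)
    then show ?case using step[of "a + of_int (i - 1) * pi"] by (simp add: algebra_simps)
  qed
  then show ?thesis by (simp add: a)
qed

lemma cos_scat: "cos (sct \<alpha>) = (1 + \<kappa>) * cos \<alpha> / rho \<alpha>"
  and sin_scat: "sin (sct \<alpha>) = (1 - \<kappa>) * sin \<alpha> / rho \<alpha>"
  using rho_cos_sin_scat[of \<alpha>] rho_pos[of \<alpha>] by (simp_all add: field_simps)

lemma cis_scat: "cis (sct \<alpha>) = (cis \<alpha> + of_real \<kappa> * cis (- \<alpha>)) / of_real (rho \<alpha>)"
  by (simp add: complex_eq_iff cos_scat sin_scat algebra_simps)

text \<open>The points (cos \<alpha>, sin \<alpha>) and (cos \<alpha>', sin \<alpha>') are positive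
  multiples of each other with ratio t, and both are unit vectors, so t = 1. This makes functions of
  e^{is} separate the points of a fibre.\<close>

lemma cis_scat_inj:
  assumes "cis (sct \<alpha>) = cis (sct \<alpha>')"
  shows "cis \<alpha> = cis \<alpha>'"
proof -
  have c: "(1 + \<kappa>) * cos \<alpha> / rho \<alpha> = (1 + \<kappa>) * cos \<alpha>' / rho \<alpha>'"
    and s: "(1 - \<kappa>) * sin \<alpha> / rho \<alpha> = (1 - \<kappa>) * sin \<alpha>' / rho \<alpha>'"
    using assms by (simp_all add: complex_eq_iff cos_scat sin_scat)
  define t where "t = rho \<alpha> / rho \<alpha>'"
  have t: "t > 0" using rho_pos by (simp add: t_def)
  have "cos \<alpha> = t * cos \<alpha>'" "sin \<alpha> = t * sin \<alpha>'"
    using c s kappa_gt kappa_lt rho_pos[of \<alpha>] rho_pos[of \<alpha>']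
    by (simp_all add: t_def divide_eq_eq eq_divide_eq)
  moreover from this have "t\<^sup>2 = 1"
    using sin_cos_squared_add[of \<alpha>] sin_cos_squared_add[of \<alpha>']
    by (simp add: power_mult_distrib distrib_left[symmetric])
  then have "t = 1" using t by (simp add: power2_eq_1_iff)
  ultimately show ?thesis by (simp add: complex_eq_iff)
qed

lemma continuous_cis_scat: "continuous_on A (%\<alpha>. cis (sct \<alpha>))"
  unfolding cis_scat using rho_pos
  by (intro continuous_intros continuous_rho) (auto simp: less_imp_neq[THEN not_sym])

lemma continuous_cis_mult_scat: "continuous_on A (%\<alpha>. cis (of_int m * sct \<alpha>))"
  unfolding cis_power_int[symmetric]
  by (intro continuous_intros continuous_cis_scat) auto

lemma has_vector_derivative_rho:
  "(rho has_vector_derivative (- (4 * \<kappa> * sin \<alpha> * cos \<alpha>) / rho \<alpha>)) (at \<alpha>)"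
proof -
  have "(rho has_real_derivative
     (inverse (sqrt (((1 + \<kappa>) * cos \<alpha>)\<^sup>2 + ((1 - \<kappa>) * sin \<alpha>)\<^sup>2)) / 2 *
       (2 * ((1 + \<kappa>) * cos \<alpha>) * (- (1 + \<kappa>) * sin \<alpha>) + 2 * ((1 - \<kappa>) * sin \<alpha>) * ((1 - \<kappa>) * cos \<alpha>)))) (at \<alpha>)"
    unfolding rho_def
    by (rule DERIV_chain2, rule DERIV_real_sqrt, rule rho_arg_pos)
       (auto intro!: derivative_eq_intros simp: algebra_simps)
  also have "(inverse (sqrt (((1 + \<kappa>) * cos \<alpha>)\<^sup>2 + ((1 - \<kappa>) * sin \<alpha>)\<^sup>2)) / 2 *
       (2 * ((1 + \<kappa>) * cos \<alpha>) * (- (1 + \<kappa>) * sin \<alpha>) + 2 * ((1 - \<kappa>) * sin \<alpha>) * ((1 - \<kappa>) * cos \<alpha>)))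
     = - (4 * \<kappa> * sin \<alpha> * cos \<alpha>) / rho \<alpha>"
    unfolding rho_def[symmetric] using rho_pos[of \<alpha>] by (simp add: divide_simps) algebra
  finally show ?thesis by (simp add: has_real_derivative_iff_has_vector_derivative)
qed

text \<open>The closed form of e^{is} is differentiable everywhere, whereas the formula for s itself
  hides its smoothness behind floor and tan. For this reason only e^{is} and its powers are ever
  differentiated.\<close>

lemma has_vector_derivative_cis_scat:
  "((%\<alpha>. cis (sct \<alpha>)) has_vector_derivative
     (\<i> * of_real ((1 - \<kappa>\<^sup>2) / (rho \<alpha>)\<^sup>2) * cis (sct \<alpha>))) (at \<alpha>)"
proof -
  let ?r = "rho \<alpha>"
  have r0: "?r ~= 0" using rho_pos[of \<alpha>] by simp
  have dr: "(rho has_real_derivative (- (4 * \<kappa> * sin \<alpha> * cos \<alpha>) / ?r)) (at \<alpha>)"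
    using has_vector_derivative_rho by (simp add: has_real_derivative_iff_has_vector_derivative)
  have sq: "?r * ?r = ((1 + \<kappa>) * cos \<alpha>)\<^sup>2 + ((1 - \<kappa>) * sin \<alpha>)\<^sup>2"
    using rho_square[of \<alpha>] by (simp add: power2_eq_square)
  have sc: "sin \<alpha> * sin \<alpha> + cos \<alpha> * cos \<alpha> = 1" using sin_cos_squared_add[of \<alpha>] by (simp add: power2_eq_square)
  have c: "((%\<alpha>. cos (sct \<alpha>)) has_real_derivative - ((1 - \<kappa>\<^sup>2) / ?r\<^sup>2 * sin (sct \<alpha>))) (at \<alpha>)"
  proof -
    have "((%\<alpha>. cos (sct \<alpha>)) has_real_derivative
       (((1 + \<kappa>) * - sin \<alpha> * ?r - (1 + \<kappa>) * cos \<alpha> * (- (4 * \<kappa> * sin \<alpha> * cos \<alpha>) / ?r)) / (?r * ?r))) (at \<alpha>)"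
      unfolding cos_scat using r0 by (auto intro!: derivative_eq_intros dr)
    also have "(((1 + \<kappa>) * - sin \<alpha> * ?r - (1 + \<kappa>) * cos \<alpha> * (- (4 * \<kappa> * sin \<alpha> * cos \<alpha>) / ?r)) / (?r * ?r))
       = - ((1 - \<kappa>\<^sup>2) / ?r\<^sup>2 * sin (sct \<alpha>))"
      unfolding sin_scat using r0
      by (simp add: divide_simps power2_eq_square) (use sq sc in algebra)
    finally show ?thesis .
  qed
  have s: "((%\<alpha>. sin (sct \<alpha>)) has_real_derivative ((1 - \<kappa>\<^sup>2) / ?r\<^sup>2 * cos (sct \<alpha>))) (at \<alpha>)"
  proof -
    have "((%\<alpha>. sin (sct \<alpha>)) has_real_derivative
       (((1 - \<kappa>) * cos \<alpha> * ?r - (1 - \<kappa>) * sin \<alpha> * (- (4 * \<kappa> * sin \<alpha> * cos \<alpha>) / ?r)) / (?r * ?r))) (at \<alpha>)"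
      unfolding sin_scat using r0 by (auto intro!: derivative_eq_intros dr)
    also have "(((1 - \<kappa>) * cos \<alpha> * ?r - (1 - \<kappa>) * sin \<alpha> * (- (4 * \<kappa> * sin \<alpha> * cos \<alpha>) / ?r)) / (?r * ?r))
       = (1 - \<kappa>\<^sup>2) / ?r\<^sup>2 * cos (sct \<alpha>)"
      unfolding cos_scat using r0
      by (simp add: divide_simps power2_eq_square) (use sq sc in algebra)
    finally show ?thesis .
  qed
  have "((%\<alpha>. Complex (cos (sct \<alpha>)) (sin (sct \<alpha>))) has_vector_derivative
     Complex (- ((1 - \<kappa>\<^sup>2) / ?r\<^sup>2 * sin (sct \<alpha>))) ((1 - \<kappa>\<^sup>2) / ?r\<^sup>2 * cos (sct \<alpha>))) (at \<alpha>)"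
    using c s by (simp add: has_vector_derivative_complex_iff has_real_derivative_iff_has_vector_derivative)
  moreover have "(%\<alpha>. Complex (cos (sct \<alpha>)) (sin (sct \<alpha>))) = (%\<alpha>. cis (sct \<alpha>))"
    by (simp add: fun_eq_iff complex_eq_iff)
  moreover have "Complex (- ((1 - \<kappa>\<^sup>2) / ?r\<^sup>2 * sin (sct \<alpha>))) ((1 - \<kappa>\<^sup>2) / ?r\<^sup>2 * cos (sct \<alpha>))
     = \<i> * of_real ((1 - \<kappa>\<^sup>2) / ?r\<^sup>2) * cis (sct \<alpha>)"
    by (simp add: complex_eq_iff)
  ultimately show ?thesis by simp
qed

lemma has_vector_derivative_cis_mult_scat:
  "((%\<alpha>. cis (of_int m * sct \<alpha>)) has_vector_derivative
     (\<i> * of_int m * of_real ((1 - \<kappa>\<^sup>2) / (rho \<alpha>)\<^sup>2) * cis (of_int m * sct \<alpha>))) (at \<alpha>)"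
proof -
  have "((%z. z powi m) has_field_derivative (of_int m * cis (sct \<alpha>) powi (m - 1) * 1)) (at (cis (sct \<alpha>)))"
    by (rule derivative_eq_intros | simp)+
  from field_vector_diff_chain_at[OF has_vector_derivative_cis_scat this]
  have "((%\<alpha>. cis (sct \<alpha>) powi m) has_vector_derivative
      (\<i> * of_real ((1 - \<kappa>\<^sup>2) / (rho \<alpha>)\<^sup>2) * cis (sct \<alpha>)) * (of_int m * cis (sct \<alpha>) powi (m - 1))) (at \<alpha>)"
    by (simp add: o_def)
  moreover have "(\<i> * of_real ((1 - \<kappa>\<^sup>2) / (rho \<alpha>)\<^sup>2) * cis (sct \<alpha>)) * (of_int m * cis (sct \<alpha>) powi (m - 1))
      = \<i> * of_int m * of_real ((1 - \<kappa>\<^sup>2) / (rho \<alpha>)\<^sup>2) * (cis (sct \<alpha>) * cis (sct \<alpha>) powi (m - 1))"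
    by (simp only: mult_ac)
  moreover have "cis (sct \<alpha>) * cis (sct \<alpha>) powi (m - 1) = cis (sct \<alpha>) powi m"
    by (simp add: power_int_diff)
  ultimately show ?thesis by (simp only: cis_power_int)
qed

lemma measurable_scat [measurable]: "sct \<in> borel_measurable borel"
proof -
  have "scat_angle \<kappa> \<in> borel_measurable borel"
    unfolding scat_angle_def tan_def by measurable
  then show ?thesis by simp
qed

end

section \<open>Smooth functions\<close>

lemma smooth_on_deriv:
  assumes "smooth_on S f"
  shows "\<exists>f'. (\<forall>x\<in>S. (f has_derivative f' x) (at x within S)) \<and> (\<forall>h. smooth_on S (%x. f' x h))"
  using assms by (cases rule: smooth_on.cases) (rename_tac f', rule_tac x = f' in exI, simp)

lemma smooth_on_continuous:
  assumes "smooth_on S f" shows "continuous_on S f"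
proof -
  obtain f' where "\<forall>x\<in>S. (f has_derivative f' x) (at x within S)"
    using smooth_on_deriv[OF assms] by (elim exE conjE)
  then show ?thesis by (intro has_derivative_continuous_on[of S f f']) simp
qed

text \<open>Closure under differentiation holds only up to the operations below, so the coinduction
  is carried out on the smallest class of functions that contains the building blocks and is
  closed under them.\<close>

inductive smooth_closure :: "'a::real_normed_vector set => ('a => complex) => bool" for S where
  base: "smooth_on S f ==> smooth_closure S f"
| add: "smooth_closure S f ==> smooth_closure S g ==> smooth_closure S (%x. f x + g x)"
| mult: "smooth_closure S f ==> smooth_closure S g ==> smooth_closure S (%x. f x * g x)"
| linear: "smooth_closure S f ==> bounded_linear (L :: complex => complex) ==> smooth_closure S (%x. L (f x))"
| inverse: "smooth_closure S f ==> (!!x. x \<in> S ==> f x ~= 0) ==> smooth_closure S (%x. inverse (f x))"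
| compose: "smooth_closure S f ==> f ` S \<subseteq> T ==> smooth_on T F ==> smooth_closure S (%x. F (f x))"
| cong: "smooth_closure S f ==> (!!x. x \<in> S ==> g x = f x) ==> smooth_closure S g"

lemma smooth_closure_deriv:
  assumes "smooth_closure S f"
  shows "\<exists>f'. (\<forall>x\<in>S. (f has_derivative f' x) (at x within S)) \<and> (\<forall>h. smooth_closure S (%x. f' x h))"
  using assms
proof (induction rule: smooth_closure.induct)
  case (base f)
  from smooth_on_deriv[OF this] obtain f' where "\<forall>x\<in>S. (f has_derivative f' x) (at x within S)"
    and "\<forall>h. smooth_on S (%x. f' x h)" by (elim exE conjE)
  then show ?case by (intro exI[of _ f'] conjI allI smooth_closure.base) simp_all
next
  case (add f g)
  obtain f' where f': "!!x. x \<in> S ==> (f has_derivative f' x) (at x within S)" "!!h. smooth_closure S (%x. f' x h)"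
    using add.IH(1) by blast
  obtain g' where g': "!!x. x \<in> S ==> (g has_derivative g' x) (at x within S)" "!!h. smooth_closure S (%x. g' x h)"
    using add.IH(2) by blast
  show ?case
  proof (rule exI[of _ "%x h. f' x h + g' x h"], intro conjI ballI allI)
    show "((%x. f x + g x) has_derivative (%h. f' x h + g' x h)) (at x within S)" if "x \<in> S" for x
      by (rule has_derivative_add[OF f'(1)[OF that] g'(1)[OF that]])
    show "smooth_closure S (%x. f' x h + g' x h)" for h
      by (rule smooth_closure.add[OF f'(2) g'(2)])
  qed
next
  case (mult f g)
  obtain f' where f': "!!x. x \<in> S ==> (f has_derivative f' x) (at x within S)" "!!h. smooth_closure S (%x. f' x h)"
    using mult.IH(1) by blast
  obtain g' where g': "!!x. x \<in> S ==> (g has_derivative g' x) (at x within S)" "!!h. smooth_closure S (%x. g' x h)"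
    using mult.IH(2) by blast
  show ?case
  proof (rule exI[of _ "%x h. f x * g' x h + f' x h * g x"], intro conjI ballI allI)
    show "((%x. f x * g x) has_derivative (%h. f x * g' x h + f' x h * g x)) (at x within S)" if "x \<in> S" for x
      by (rule has_derivative_mult[OF f'(1)[OF that] g'(1)[OF that]])
    show "smooth_closure S (%x. f x * g' x h + f' x h * g x)" for h
      by (rule smooth_closure.add[OF smooth_closure.mult[OF mult.hyps(1) g'(2)] smooth_closure.mult[OF f'(2) mult.hyps(2)]])
  qed
next
  case (linear f L)
  obtain f' where f': "!!x. x \<in> S ==> (f has_derivative f' x) (at x within S)" "!!h. smooth_closure S (%x. f' x h)"
    using linear.IH by blast
  show ?case
  proof (rule exI[of _ "%x h. L (f' x h)"], intro conjI ballI allI)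
    show "((%x. L (f x)) has_derivative (%h. L (f' x h))) (at x within S)" if "x \<in> S" for x
      by (rule bounded_linear.has_derivative[OF linear.hyps(2) f'(1)[OF that]])
    show "smooth_closure S (%x. L (f' x h))" for h
      by (rule smooth_closure.linear[OF f'(2) linear.hyps(2)])
  qed
next
  case (inverse f)
  obtain f' where f': "!!x. x \<in> S ==> (f has_derivative f' x) (at x within S)" "!!h. smooth_closure S (%x. f' x h)"
    using inverse.IH by blast
  have inv: "smooth_closure S (%x. inverse (f x))"
    by (rule smooth_closure.inverse[OF inverse.hyps])
  show ?case
  proof (rule exI[of _ "%x h. - (inverse (f x) * f' x h * inverse (f x))"], intro conjI ballI allI)
    show "((%x. inverse (f x)) has_derivative (%h. - (inverse (f x) * f' x h * inverse (f x)))) (at x within S)"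
      if "x \<in> S" for x
      by (rule Deriv.has_derivative_inverse[OF inverse.hyps(2)[OF that] f'(1)[OF that]])
    show "smooth_closure S (%x. - (inverse (f x) * f' x h * inverse (f x)))" for h
      by (rule smooth_closure.linear[OF smooth_closure.mult[OF smooth_closure.mult[OF inv f'(2)] inv]
            bounded_linear_minus[OF bounded_linear_ident]])
  qed
next
  case (compose f T F)
  then obtain f' where
    f': "\<forall>x\<in>S. (f has_derivative f' x) (at x within S)" "\<forall>h. smooth_closure S (%x. f' x h)"
    by blast
  obtain F' where
    F': "!!x. x \<in> T ==> (F has_derivative F' x) (at x within T)" "!!h. smooth_on T (%x. F' x h)"
    using smooth_on_deriv[OF compose.hyps(3)] by blast
  \<comment> \<open>Smoothness of F gives smooth derivatives in fixed directions only, but the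
    direction f' x h varies with x; expanding it in the real basis 1, i restores fixed directions
    with smooth coefficients.\<close>
  let ?D = "%x h. of_real (Re (f' x h)) * F' (f x) 1 + of_real (Im (f' x h)) * F' (f x) \<i>"
  have cl: "smooth_closure S (%x. ?D x h)" for h
  proof -
    have "bounded_linear (%z. complex_of_real (Re z))" "bounded_linear (%z. complex_of_real (Im z))"
      by (simp_all add: bounded_linear_compose[OF bounded_linear_of_real bounded_linear_Re]
          bounded_linear_compose[OF bounded_linear_of_real bounded_linear_Im])
    then show ?thesis
      by (intro smooth_closure.add smooth_closure.mult smooth_closure.linear[OF f'(2)[rule_format, of h]]
          smooth_closure.compose[OF compose.hyps(1,2) F'(2)])
  qed
  have eq: "F' (f x) (f' x h) = ?D x h" if "x \<in> S" for x h
  proof -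
    interpret bounded_linear "F' (f x)"
      using F'(1)[of "f x"] that compose.hyps(2) has_derivative_bounded_linear by blast
    have "f' x h = Re (f' x h) *\<^sub>R 1 + Im (f' x h) *\<^sub>R \<i>"
      by (simp add: complex_eq_iff)
    then have "F' (f x) (f' x h) = F' (f x) (Re (f' x h) *\<^sub>R 1 + Im (f' x h) *\<^sub>R \<i>)" by metis
    then show ?thesis by (simp only: add scaleR) (simp only: scaleR_conv_of_real)
  qed
  have "((%x. F (f x)) has_derivative (%h. F' (f x) (f' x h))) (at x within S)" if "x \<in> S" for x
  proof -
    have 1: "(f has_derivative f' x) (at x within S)" using f' that by blast
    have "f x \<in> T" using that compose.hyps(2) by blast
    then have 2: "(F has_derivative F' (f x)) (at (f x) within f ` S)"
      using F'(1) has_derivative_subset[OF _ compose.hyps(2)] by blast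
    show ?thesis by (rule has_derivative_in_compose[OF 1 2])
  qed
  moreover have "(%h. F' (f x) (f' x h)) = ?D x" if "x \<in> S" for x using eq that by (simp add: fun_eq_iff)
  ultimately show ?case using cl by (intro exI[of _ ?D]) simp
next
  case (cong f g)
  then obtain f' where
    "\<forall>x\<in>S. (f has_derivative f' x) (at x within S)" "\<forall>h. smooth_closure S (%x. f' x h)"
    by blast
  then show ?case
    by (intro exI[of _ f'] conjI ballI)
       (rule has_derivative_transform[OF _ cong.hyps(2)], simp_all)
qed

lemma smooth_closure_smooth: "smooth_closure S f ==> smooth_on S f"
proof (coinduction arbitrary: f)
  case smooth_on
  then obtain f' where f': "\<forall>x\<in>S. (f has_derivative f' x) (at x within S)" "\<forall>h. smooth_closure S (%x. f' x h)"
    using smooth_closure_deriv[OF smooth_on] by (elim exE conjE)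
  show ?case
  proof (rule exI[of _ f], rule exI[of _ f'], intro conjI allI impI refl disjI1)
    fix x assume "x \<in> S" then show "(f has_derivative f' x) (at x within S)" using f'(1) by blast
  next
    fix h show "\<exists>g. (%x. f' x h) = g \<and> smooth_closure S g"
      by (rule exI[of _ "%x. f' x h"]) (rule conjI[OF refl f'(2)[rule_format]])
  qed
qed

lemma smooth_on_add: "smooth_on S f ==> smooth_on S g ==> smooth_on S (%x. f x + g x :: complex)"
  by (rule smooth_closure_smooth, rule smooth_closure.add; rule smooth_closure.base)

lemma smooth_on_mult: "smooth_on S f ==> smooth_on S g ==> smooth_on S (%x. f x * g x :: complex)"
  by (rule smooth_closure_smooth, rule smooth_closure.mult; rule smooth_closure.base)

lemma smooth_on_linear_comp:
  "smooth_on S f ==> bounded_linear (L :: complex => complex) ==> smooth_on S (%x. L (f x))"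
  by (rule smooth_closure_smooth, rule smooth_closure.linear, rule smooth_closure.base)

lemma smooth_on_inverse:
  "smooth_on S f ==> (!!x. x \<in> S ==> f x ~= 0) ==> smooth_on S (%x. inverse (f x) :: complex)"
  by (rule smooth_closure_smooth, rule smooth_closure.inverse, rule smooth_closure.base)

lemma smooth_on_compose:
  "smooth_on S f ==> f ` S \<subseteq> T ==> smooth_on T F ==> smooth_on S (%x. F (f x :: complex) :: complex)"
  by (rule smooth_closure_smooth, rule smooth_closure.compose[of S f T F], rule smooth_closure.base)

lemma smooth_on_const: "smooth_on S (%x. c)"
proof (coinduction arbitrary: c)
  case smooth_on
  show ?case
    by (rule exI[of _ "%_. c"], rule exI[of _ "%x h. 0"]) auto
qed

lemma smooth_on_bounded_linear: "bounded_linear f ==> smooth_on S f"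
  by (rule smooth_on.intros[of _ _ "%x. f"])
     (auto intro: smooth_on_const bounded_linear.has_derivative[of f, OF _ has_derivative_ident])

section \<open>Geodesics and the X-ray transform\<close>

lemma has_real_derivative_inner:
  fixes f g :: "real => 'a::real_inner"
  assumes "(f has_vector_derivative f') (at t within S)" "(g has_vector_derivative g') (at t within S)"
  shows "((%t. f t \<bullet> g t) has_real_derivative (f t \<bullet> g' + f' \<bullet> g t)) (at t within S)"
  unfolding has_field_derivative_def
  by (rule has_derivative_eq_rhs[OF has_derivative_inner[OF assms[unfolded has_vector_derivative_def]]])
     (simp add: fun_eq_iff algebra_simps)

text \<open>Uniqueness for X'' = -k X by an energy estimate: |X|^2 + |X'|^2, damped by an
  exponential, cannot increase and starts at zero. Derivatives are one-sided at the ends because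
  geodesics live on closed time intervals.\<close>

lemma linear_ode_zero:
  fixes X :: "real => 'a::real_inner"
  assumes X: "!!t. t \<in> {0..T} ==> (X has_vector_derivative X' t) (at t within {0..T})"
    and X': "!!t. t \<in> {0..T} ==> (X' has_vector_derivative - k *\<^sub>R X t) (at t within {0..T})"
    and "X 0 = 0" "X' 0 = 0" and t: "t \<in> {0..T}"
  shows "X t = 0 \<and> X' t = 0"
proof -
  \<comment> \<open>The energy has derivative 2 (1 - k) X \<bullet> X', at most \<bar>1 - k\<bar>
    times the energy; any c \<ge> \<bar>1 - k\<bar> works as damping rate.\<close>
  define c where "c = 1 + \<bar>k\<bar>"
  define E where "E t = exp (- (c * t)) * (X t \<bullet> X t + X' t \<bullet> X' t)" for t
  let ?E' = "%t. - c * exp (- (c * t)) * (X t \<bullet> X t + X' t \<bullet> X' t)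
      + exp (- (c * t)) * (2 * (1 - k) * (X t \<bullet> X' t))"
  have dE: "(E has_real_derivative ?E' s) (at s within {0..T})" if "s \<in> {0..T}" for s
  proof -
    have d1: "((%t. X t \<bullet> X t) has_real_derivative (X s \<bullet> X' s + X' s \<bullet> X s)) (at s within {0..T})"
      by (rule has_real_derivative_inner[OF X[OF that] X[OF that]])
    have d2: "((%t. X' t \<bullet> X' t) has_real_derivative (X' s \<bullet> (- k *\<^sub>R X s) + (- k *\<^sub>R X s) \<bullet> X' s)) (at s within {0..T})"
      by (rule has_real_derivative_inner[OF X'[OF that] X'[OF that]])
    show ?thesis unfolding E_def
      by (rule derivative_eq_intros d1 d2 refl | simp add: algebra_simps inner_commute)+
  qed
  have neg: "?E' s \<le> 0" for s
  proof -
    have ck: "\<bar>1 - k\<bar> \<le> c" "c \<ge> 0" unfolding c_def by arith+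
    have "2 * (1 - k) * (X s \<bullet> X' s) \<le> 2 * \<bar>1 - k\<bar> * \<bar>X s \<bullet> X' s\<bar>"
      by (metis abs_ge_self abs_mult abs_numeral)
    also have "\<dots> \<le> 2 * c * \<bar>X s \<bullet> X' s\<bar>" using ck by (intro mult_right_mono) auto
    also have "2 * \<bar>X s \<bullet> X' s\<bar> \<le> X s \<bullet> X s + X' s \<bullet> X' s"
      using inner_ge_zero[of "X s - X' s"] inner_ge_zero[of "X s + X' s"]
      by (simp add: inner_diff inner_add inner_commute abs_le_iff)
    then have "2 * c * \<bar>X s \<bullet> X' s\<bar> \<le> c * (X s \<bullet> X s + X' s \<bullet> X' s)"
      using mult_left_mono[OF _ ck(2), of "2 * \<bar>X s \<bullet> X' s\<bar>" "X s \<bullet> X s + X' s \<bullet> X' s"] by (simp only: mult_ac)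
    finally have "2 * (1 - k) * (X s \<bullet> X' s) \<le> c * (X s \<bullet> X s + X' s \<bullet> X' s)" .
    then have "exp (- (c * s)) * (2 * (1 - k) * (X s \<bullet> X' s)) \<le> exp (- (c * s)) * (c * (X s \<bullet> X s + X' s \<bullet> X' s))"
      by (intro mult_left_mono) auto
    then show ?thesis by (simp add: algebra_simps)
  qed
  have "E t \<le> E 0"
  proof (cases "t = 0")
    case False
    then have t0: "0 < t" "t \<le> T" using t by auto
    have cont: "continuous_on {0..t} E"
    proof (rule DERIV_continuous_on[where D = ?E'])
      fix s assume s: "s \<in> {0..t}"
      then have "s \<in> {0..T}" "{0..t} \<subseteq> {0..T}" using t0 by auto
      then show "(E has_real_derivative ?E' s) (at s within {0..t})"
        using DERIV_subset[OF dE] by blast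
    qed
    show ?thesis
    proof (rule DERIV_nonpos_imp_decreasing_open[OF less_imp_le[OF t0(1)] _ cont])
      fix s assume "0 < s" "s < t"
      then have "(E has_real_derivative ?E' s) (at s)"
        using dE[of s] t0 at_within_Icc_at[of 0 s T] by auto
      then show "\<exists>y. (E has_real_derivative y) (at s) \<and> y \<le> 0" using neg by blast
    qed
  qed simp
  then have "X t \<bullet> X t + X' t \<bullet> X' t \<le> 0"
    using assms(3,4) by (simp add: E_def mult_le_0_iff)
  then show ?thesis
    using inner_ge_zero[of "X t"] inner_ge_zero[of "X' t"]
    by (metis add_nonneg_eq_0_iff add_nonneg_nonneg inner_eq_zero_iff order_antisym)
qed

context curved_disk
begin

lemma conformal_factor_pos: "norm x \<le> 1 ==> 1 + \<kappa> * (x \<bullet> x) > 0"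
proof -
  assume "norm x \<le> 1"
  then have "x \<bullet> x \<le> 1" by (simp add: power2_norm_eq_inner[symmetric] power_le_one)
  then have "\<bar>\<kappa> * (x \<bullet> x)\<bar> < 1"
    using kappa_gt kappa_lt mult_left_le[of "x \<bullet> x" "\<bar>\<kappa>\<bar>"] by (auto simp: abs_mult)
  then show ?thesis by linarith
qed

lemma christoffel_disk_metric:
  assumes "1 + \<kappa> * (x \<bullet> x) ~= 0"
  shows "christoffel (disk_metric \<kappa>) x v v w
    = - (2 * \<kappa> / (1 + \<kappa> * (x \<bullet> x)) ^ 3) * (2 * (x \<bullet> v) * (v \<bullet> w) - (v \<bullet> v) * (x \<bullet> w))"
proof -
  let ?N = "1 + \<kappa> * (x \<bullet> x)"
  have D: "frechet_derivative (%y. disk_metric \<kappa> y a b) (at x) = (%u. - 4 * \<kappa> * (x \<bullet> u) * (a \<bullet> b) / ?N ^ 3)" for a b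
  proof -
    have "((%y. (a \<bullet> b) / (1 + \<kappa> * (y \<bullet> y))\<^sup>2) has_derivative
       (%u. - ((a \<bullet> b) * (2 * (\<kappa> * (x \<bullet> u + u \<bullet> x)) * ?N)) / (?N\<^sup>2)\<^sup>2)) (at x)"
      using assms by (auto intro!: derivative_eq_intros simp: fun_eq_iff power2_eq_square)
    moreover have "- ((a \<bullet> b) * (2 * (\<kappa> * (x \<bullet> u + u \<bullet> x)) * ?N)) / (?N\<^sup>2)\<^sup>2 = - 4 * \<kappa> * (x \<bullet> u) * (a \<bullet> b) / ?N ^ 3" for u
      using assms by (simp add: inner_commute divide_simps power2_eq_square power3_eq_cube)
    ultimately have "((%y. (a \<bullet> b) / (1 + \<kappa> * (y \<bullet> y))\<^sup>2) has_derivative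
       (%u. - 4 * \<kappa> * (x \<bullet> u) * (a \<bullet> b) / ?N ^ 3)) (at x)" by (simp only:)
    then show ?thesis
      unfolding disk_metric_def power2_norm_eq_inner by (rule frechet_derivative_at[symmetric])
  qed
  show ?thesis unfolding christoffel_def D
    by (simp add: inner_commute diff_divide_distrib add_divide_distrib algebra_simps)
qed

text \<open>Nondegeneracy of the metric: a vector orthogonal to all w vanishes. The weak geodesic
  equation thus becomes an explicit formula for the acceleration, usable both for computing along a
  geodesic and for verifying one.\<close>

lemma geodesic_equation_iff:
  assumes "norm x \<le> 1"
  shows "(\<forall>w. disk_metric \<kappa> x a w + christoffel (disk_metric \<kappa>) x v v w = 0) \<longleftrightarrow>
     a = (2 * \<kappa> / (1 + \<kappa> * (x \<bullet> x))) *\<^sub>R ((2 * (x \<bullet> v)) *\<^sub>R v - (v \<bullet> v) *\<^sub>R x)"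
    (is "_ \<longleftrightarrow> a = ?r")
proof -
  let ?N = "1 + \<kappa> * (x \<bullet> x)"
  have N: "?N ~= 0" using conformal_factor_pos[OF assms] by simp
  have "disk_metric \<kappa> x a w + christoffel (disk_metric \<kappa>) x v v w = ((a - ?r) \<bullet> w) / ?N\<^sup>2" for w
    unfolding christoffel_disk_metric[OF N] disk_metric_def power2_norm_eq_inner using N
    by (simp add: inner_diff_left divide_simps power2_eq_square power3_eq_cube)
  then show ?thesis using N by (simp add: all_zero_iff)
qed

section \<open>Linearization and uniqueness of geodesics, convexity of the boundary\<close>

definition conf :: "complex => real" where "conf z = 1 + \<kappa> * (z \<bullet> z)"

lemma conf_pos: "norm x \<le> 1 ==> conf x > 0"
  unfolding conf_def by (rule conformal_factor_pos)

text \<open>For \<kappa> \<noteq> 0 the quantity z / (1 + \<kappa> |z|^2) and an affine function of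
  |z|^2 / (1 + \<kappa> |z|^2) are, up to scaling, the coordinates of z on the sphere or hyperboloid
  of curvature 4\<kappa>. Unit-speed geodesics there satisfy X'' = -4\<kappa> X, so the nonlinear
  geodesic equation becomes linear; the inhomogeneous 2 in the last equation stems from the affine
  shift, and the formulas remain valid at \<kappa> = 0.\<close>

lemma geodesic_linearization:
  assumes geo: "geodesic_on (disk_metric \<kappa>) {0..T} \<gamma> \<gamma>'"
    and disk: "\<gamma> ` {0..T} \<subseteq> cball 0 1"
    and unit: "\<gamma>' 0 \<bullet> \<gamma>' 0 = (conf (\<gamma> 0))\<^sup>2"
    and t: "t \<in> {0..T}"
  shows "\<gamma>' t \<bullet> \<gamma>' t = (conf (\<gamma> t))\<^sup>2"
    and "((%t. (1 / conf (\<gamma> t)) *\<^sub>R \<gamma> t) has_vector_derivative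
           ((1 / conf (\<gamma> t)) *\<^sub>R \<gamma>' t - (2 * \<kappa> * (\<gamma> t \<bullet> \<gamma>' t) / (conf (\<gamma> t))\<^sup>2) *\<^sub>R \<gamma> t)) (at t within {0..T})"
    and "((%t. (1 / conf (\<gamma> t)) *\<^sub>R \<gamma>' t - (2 * \<kappa> * (\<gamma> t \<bullet> \<gamma>' t) / (conf (\<gamma> t))\<^sup>2) *\<^sub>R \<gamma> t)
           has_vector_derivative - (4 * \<kappa>) *\<^sub>R ((1 / conf (\<gamma> t)) *\<^sub>R \<gamma> t)) (at t within {0..T})"
    and "((%t. (\<gamma> t \<bullet> \<gamma> t) / conf (\<gamma> t)) has_vector_derivative 2 * (\<gamma> t \<bullet> \<gamma>' t) / (conf (\<gamma> t))\<^sup>2) (at t within {0..T})"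
    and "((%t. 2 * (\<gamma> t \<bullet> \<gamma>' t) / (conf (\<gamma> t))\<^sup>2) has_vector_derivative
           2 - 4 * \<kappa> * ((\<gamma> t \<bullet> \<gamma> t) / conf (\<gamma> t))) (at t within {0..T})"
proof -
  define N where "N t = conf (\<gamma> t)" for t
  define p where "p t = \<gamma> t \<bullet> \<gamma>' t" for t
  have N: "N t > 0" if "t \<in> {0..T}" for t
    using that disk unfolding N_def by (intro conf_pos) (auto simp: image_subset_iff)
  obtain \<gamma>'' where
    d1: "!!t. t \<in> {0..T} ==> (\<gamma> has_vector_derivative \<gamma>' t) (at t within {0..T})" and
    d2: "!!t. t \<in> {0..T} ==> (\<gamma>' has_vector_derivative \<gamma>'' t) (at t within {0..T})" and
    eq: "!!t. t \<in> {0..T} ==> (\<forall>w. disk_metric \<kappa> (\<gamma> t) (\<gamma>'' t) w + christoffel (disk_metric \<kappa>) (\<gamma> t) (\<gamma>' t) (\<gamma>' t) w = 0)"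
    using geo unfolding geodesic_on_def by blast
  have g2: "\<gamma>'' t = (2 * \<kappa> / N t) *\<^sub>R ((2 * p t) *\<^sub>R \<gamma>' t - (\<gamma>' t \<bullet> \<gamma>' t) *\<^sub>R \<gamma> t)"
    if "t \<in> {0..T}" for t
    using eq[OF that] that disk geodesic_equation_iff[of "\<gamma> t" "\<gamma>'' t" "\<gamma>' t"]
    by (auto simp: N_def p_def conf_def image_subset_iff)
  have dN: "(N has_real_derivative 2 * \<kappa> * p t) (at t within {0..T})" if "t \<in> {0..T}" for t
  proof -
    have "((%t. 1 + \<kappa> * (\<gamma> t \<bullet> \<gamma> t)) has_real_derivative 0 + \<kappa> * (\<gamma> t \<bullet> \<gamma>' t + \<gamma>' t \<bullet> \<gamma> t)) (at t within {0..T})"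
      by (intro DERIV_add DERIV_const DERIV_cmult has_real_derivative_inner d1[OF that])
    then show ?thesis by (simp add: N_def[abs_def] conf_def p_def inner_commute mult_ac)
  qed
  have dp: "(p has_real_derivative (\<gamma>' t \<bullet> \<gamma>' t + \<gamma> t \<bullet> \<gamma>'' t)) (at t within {0..T})" if "t \<in> {0..T}" for t
    using has_real_derivative_inner[OF d1[OF that] d2[OF that]] unfolding p_def by (simp add: add.commute)
  have dv: "((%t. \<gamma>' t \<bullet> \<gamma>' t) has_real_derivative 2 * (\<gamma>' t \<bullet> \<gamma>'' t)) (at t within {0..T})" if "t \<in> {0..T}" for t
    using has_real_derivative_inner[OF d2[OF that] d2[OF that]] by (simp add: inner_commute)
  \<comment> \<open>Conservation of the Riemannian speed; together with the initial condition it
    removes |\<gamma>'|^2 from all later derivatives.\<close>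
  have const: "\<gamma>' t \<bullet> \<gamma>' t / (N t)\<^sup>2 = \<gamma>' 0 \<bullet> \<gamma>' 0 / (N 0)\<^sup>2" if t: "t \<in> {0..T}" for t
  proof (rule has_field_derivative_zero_constant[where s = "{0..T}", THEN exE])
    fix t assume t: "t \<in> {0..T}"
    have "((%t. \<gamma>' t \<bullet> \<gamma>' t / (N t)\<^sup>2) has_real_derivative
       (2 * (\<gamma>' t \<bullet> \<gamma>'' t) * (N t)\<^sup>2 - (\<gamma>' t \<bullet> \<gamma>' t) * (2 * N t * (2 * \<kappa> * p t))) / ((N t)\<^sup>2 * (N t)\<^sup>2)) (at t within {0..T})"
      using N[OF t] by (auto intro!: derivative_eq_intros dv[OF t] dN[OF t])
    moreover have "(2 * (\<gamma>' t \<bullet> \<gamma>'' t) * (N t)\<^sup>2 - (\<gamma>' t \<bullet> \<gamma>' t) * (2 * N t * (2 * \<kappa> * p t))) = 0"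
      using N[OF t] unfolding g2[OF t]
      by (simp add: inner_diff_right p_def inner_commute field_simps power2_eq_square)
    ultimately show "((%t. \<gamma>' t \<bullet> \<gamma>' t / (N t)\<^sup>2) has_real_derivative 0) (at t within {0..T})"
      by (simp only: div_0)
  qed (use t in auto)
  have speed: "\<gamma>' t \<bullet> \<gamma>' t = (N t)\<^sup>2" if "t \<in> {0..T}" for t
  proof -
    have "0 \<in> {0..T}" using that by auto
    then show ?thesis using const[OF that] unit N[OF that] N[of 0] by (simp add: N_def[symmetric])
  qed
  show "\<gamma>' t \<bullet> \<gamma>' t = (conf (\<gamma> t))\<^sup>2" using speed[OF t] by (simp add: N_def)
  have Nt: "N t ~= 0" using N[OF t] by simp
  have kg: "\<kappa> * (\<gamma> t \<bullet> \<gamma> t) = N t - 1" by (simp add: N_def conf_def)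
  have g2': "\<gamma>'' t = (4 * \<kappa> * p t / N t) *\<^sub>R \<gamma>' t - (2 * \<kappa> * N t) *\<^sub>R \<gamma> t"
    unfolding g2[OF t] speed[OF t] using Nt by (simp add: scaleR_diff_right power2_eq_square mult.assoc)
  have dp': "(p has_real_derivative ((N t)\<^sup>2 + 4 * \<kappa> * (p t)\<^sup>2 / N t - 2 * N t * (N t - 1))) (at t within {0..T})"
  proof -
    have "\<gamma> t \<bullet> \<gamma>'' t = 4 * \<kappa> * (p t)\<^sup>2 / N t - 2 * N t * (\<kappa> * (\<gamma> t \<bullet> \<gamma> t))"
      unfolding g2' by (simp add: inner_diff_right p_def power2_eq_square)
    then have "\<gamma>' t \<bullet> \<gamma>' t + \<gamma> t \<bullet> \<gamma>'' t = (N t)\<^sup>2 + 4 * \<kappa> * (p t)\<^sup>2 / N t - 2 * N t * (N t - 1)"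
      unfolding speed[OF t] kg by simp
    then show ?thesis using dp[OF t] by (simp only:)
  qed
  have dinv: "((%t. 1 / N t) has_real_derivative - (2 * \<kappa> * p t) / (N t)\<^sup>2) (at t within {0..T})"
    using Nt by (auto intro!: derivative_eq_intros dN[OF t] simp: power2_eq_square)
  show "((%t. (1 / conf (\<gamma> t)) *\<^sub>R \<gamma> t) has_vector_derivative
           ((1 / conf (\<gamma> t)) *\<^sub>R \<gamma>' t - (2 * \<kappa> * (\<gamma> t \<bullet> \<gamma>' t) / (conf (\<gamma> t))\<^sup>2) *\<^sub>R \<gamma> t)) (at t within {0..T})"
    using has_vector_derivative_scaleR[OF dinv d1[OF t]] by (simp add: N_def p_def algebra_simps)
  have dq0: "((%t. p t / (N t)\<^sup>2) has_real_derivative (2 - N t) / N t) (at t within {0..T})"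
  proof -
    have "((%t. p t / (N t)\<^sup>2) has_real_derivative
      (((N t)\<^sup>2 + 4 * \<kappa> * (p t)\<^sup>2 / N t - 2 * N t * (N t - 1)) * (N t)\<^sup>2 - p t * (2 * N t * (2 * \<kappa> * p t)))
        / ((N t)\<^sup>2 * (N t)\<^sup>2)) (at t within {0..T})"
      using Nt by (auto intro!: derivative_eq_intros dN[OF t] dp')
    moreover have "(((N t)\<^sup>2 + 4 * \<kappa> * (p t)\<^sup>2 / N t - 2 * N t * (N t - 1)) * (N t)\<^sup>2 - p t * (2 * N t * (2 * \<kappa> * p t)))
        / ((N t)\<^sup>2 * (N t)\<^sup>2) = (2 - N t) / N t"
      using Nt by (simp add: divide_simps) algebra
    ultimately show ?thesis by simp
  qed
  have dq: "((%t. 2 * \<kappa> * p t / (N t)\<^sup>2) has_real_derivative 2 * \<kappa> * ((2 - N t) / N t)) (at t within {0..T})"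
    using DERIV_cmult[OF dq0, of "2 * \<kappa>"] by simp
  have "((%t. (1 / N t) *\<^sub>R \<gamma>' t - (2 * \<kappa> * p t / (N t)\<^sup>2) *\<^sub>R \<gamma> t) has_vector_derivative
     ((1 / N t) *\<^sub>R \<gamma>'' t + (- (2 * \<kappa> * p t) / (N t)\<^sup>2) *\<^sub>R \<gamma>' t) -
     ((2 * \<kappa> * p t / (N t)\<^sup>2) *\<^sub>R \<gamma>' t + (2 * \<kappa> * ((2 - N t) / N t)) *\<^sub>R \<gamma> t)) (at t within {0..T})"
    by (intro has_vector_derivative_diff has_vector_derivative_scaleR[OF dinv d2[OF t]]
      has_vector_derivative_scaleR[OF dq d1[OF t]])
  also have "((1 / N t) *\<^sub>R \<gamma>'' t + (- (2 * \<kappa> * p t) / (N t)\<^sup>2) *\<^sub>R \<gamma>' t) -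
     ((2 * \<kappa> * p t / (N t)\<^sup>2) *\<^sub>R \<gamma>' t + (2 * \<kappa> * ((2 - N t) / N t)) *\<^sub>R \<gamma> t)
     = - (4 * \<kappa>) *\<^sub>R ((1 / N t) *\<^sub>R \<gamma> t)"
  proof -
    have vec: "(a *\<^sub>R (b *\<^sub>R v - c *\<^sub>R g) + (- d) *\<^sub>R v) - (d *\<^sub>R v + f *\<^sub>R g)
      = (a * b - 2 * d) *\<^sub>R v + (- (a * c) - f) *\<^sub>R g" for a b c d f :: real and v g :: complex
      by (simp add: scaleR_conv_of_real algebra_simps)
    have "(1 / N t) * (4 * \<kappa> * p t / N t) - 2 * (2 * \<kappa> * p t / (N t)\<^sup>2) = 0"
      by (simp add: power2_eq_square)
    moreover have "- ((1 / N t) * (2 * \<kappa> * N t)) - 2 * \<kappa> * ((2 - N t) / N t) = - (4 * \<kappa>) * (1 / N t)"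
      using Nt by (simp add: field_simps)
    ultimately show ?thesis
      unfolding g2' minus_divide_left[symmetric] vec by (simp only: scaleR_zero_left add_0_left scaleR_scaleR)
  qed
  finally show "((%t. (1 / conf (\<gamma> t)) *\<^sub>R \<gamma>' t - (2 * \<kappa> * (\<gamma> t \<bullet> \<gamma>' t) / (conf (\<gamma> t))\<^sup>2) *\<^sub>R \<gamma> t)
           has_vector_derivative - (4 * \<kappa>) *\<^sub>R ((1 / conf (\<gamma> t)) *\<^sub>R \<gamma> t)) (at t within {0..T})"
    by (simp add: N_def p_def)
  have dgg: "((%t. \<gamma> t \<bullet> \<gamma> t) has_real_derivative 2 * p t) (at t within {0..T})"
    using has_real_derivative_inner[OF d1[OF t] d1[OF t]] unfolding p_def by (simp add: inner_commute)
  have "((%t. (\<gamma> t \<bullet> \<gamma> t) / N t) has_real_derivative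
       (2 * p t * N t - (\<gamma> t \<bullet> \<gamma> t) * (2 * \<kappa> * p t)) / (N t * N t)) (at t within {0..T})"
    using Nt by (auto intro!: derivative_eq_intros dgg dN[OF t])
  moreover have "2 * p t * N t - (\<gamma> t \<bullet> \<gamma> t) * (2 * \<kappa> * p t) = 2 * p t"
    using kg by algebra
  ultimately show "((%t. (\<gamma> t \<bullet> \<gamma> t) / conf (\<gamma> t)) has_vector_derivative 2 * (\<gamma> t \<bullet> \<gamma>' t) / (conf (\<gamma> t))\<^sup>2) (at t within {0..T})"
    by (simp add: N_def p_def has_real_derivative_iff_has_vector_derivative power2_eq_square)
  have "2 * ((2 - N t) / N t) = 2 - 4 * \<kappa> * ((\<gamma> t \<bullet> \<gamma> t) / N t)"
    using Nt kg by (simp add: field_simps)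
  then show "((%t. 2 * (\<gamma> t \<bullet> \<gamma>' t) / (conf (\<gamma> t))\<^sup>2) has_vector_derivative
           2 - 4 * \<kappa> * ((\<gamma> t \<bullet> \<gamma> t) / conf (\<gamma> t))) (at t within {0..T})"
    using DERIV_cmult[OF dq0, of 2]
    by (simp add: N_def p_def has_real_derivative_iff_has_vector_derivative)
qed

lemma geodesic_on_subset: "geodesic_on g J \<gamma> \<gamma>' ==> I \<subseteq> J ==> geodesic_on g I \<gamma> \<gamma>'"
  unfolding geodesic_on_def by (blast intro: has_vector_derivative_within_subset)

text \<open>Differences of the linear quantities solve X'' = -4\<kappa> X with zero initial data,
  the constant 2 having cancelled. Equality of |\<gamma>|^2 / conf determines conf through 1/conf =
  1 - \<kappa> |\<gamma>|^2 / conf, and then \<gamma> / conf determines \<gamma>.\<close>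

lemma geodesic_unique:
  assumes g: "geodesic_on (disk_metric \<kappa>) {0..T} \<gamma> \<gamma>'" "\<gamma> ` {0..T} \<subseteq> cball 0 1"
    and h: "geodesic_on (disk_metric \<kappa>) {0..T} \<delta> \<delta>'" "\<delta> ` {0..T} \<subseteq> cball 0 1"
    and init: "\<gamma> 0 = \<delta> 0" "\<gamma>' 0 = \<delta>' 0" and unit: "\<gamma>' 0 \<bullet> \<gamma>' 0 = (conf (\<gamma> 0))\<^sup>2"
    and t: "t \<in> {0..T}"
  shows "\<gamma> t = \<delta> t"
proof -
  have unit': "\<delta>' 0 \<bullet> \<delta>' 0 = (conf (\<delta> 0))\<^sup>2" using init unit by simp
  note G = geodesic_linearization[OF g unit]
  note H = geodesic_linearization[OF h unit']
  let ?Y = "%\<gamma> t. (1 / conf (\<gamma> t)) *\<^sub>R \<gamma> t"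
  let ?Y' = "%\<gamma> \<gamma>' t. (1 / conf (\<gamma> t)) *\<^sub>R \<gamma>' t - (2 * \<kappa> * (\<gamma> t \<bullet> \<gamma>' t) / (conf (\<gamma> t))\<^sup>2) *\<^sub>R \<gamma> t"
  let ?Q = "%\<gamma> t. (\<gamma> t \<bullet> \<gamma> t) / conf (\<gamma> t)"
  let ?Q' = "%\<gamma> \<gamma>' t. 2 * (\<gamma> t \<bullet> \<gamma>' t) / (conf (\<gamma> t))\<^sup>2"
  have Y: "?Y \<gamma> t - ?Y \<delta> t = 0 \<and> ?Y' \<gamma> \<gamma>' t - ?Y' \<delta> \<delta>' t = 0"
  proof (rule linear_ode_zero[where T = T and k = "4 * \<kappa>" and X = "%t. ?Y \<gamma> t - ?Y \<delta> t"
        and X' = "%t. ?Y' \<gamma> \<gamma>' t - ?Y' \<delta> \<delta>' t"])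
    fix t assume t: "t \<in> {0..T}"
    show "((%t. ?Y \<gamma> t - ?Y \<delta> t) has_vector_derivative (?Y' \<gamma> \<gamma>' t - ?Y' \<delta> \<delta>' t)) (at t within {0..T})"
      by (rule has_vector_derivative_diff[OF G(2)[OF t] H(2)[OF t]])
    have "((%t. ?Y' \<gamma> \<gamma>' t - ?Y' \<delta> \<delta>' t) has_vector_derivative
        (- (4 * \<kappa>) *\<^sub>R ?Y \<gamma> t - - (4 * \<kappa>) *\<^sub>R ?Y \<delta> t)) (at t within {0..T})"
      by (rule has_vector_derivative_diff[OF G(3)[OF t] H(3)[OF t]])
    then show "((%t. ?Y' \<gamma> \<gamma>' t - ?Y' \<delta> \<delta>' t) has_vector_derivative
        (- (4 * \<kappa>) *\<^sub>R (?Y \<gamma> t - ?Y \<delta> t))) (at t within {0..T})"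
      by (simp only: scaleR_diff_right)
  qed (use init t in simp_all)
  have Q: "?Q \<gamma> t - ?Q \<delta> t = 0 \<and> ?Q' \<gamma> \<gamma>' t - ?Q' \<delta> \<delta>' t = 0"
  proof (rule linear_ode_zero[where T = T and k = "4 * \<kappa>" and X = "%t. ?Q \<gamma> t - ?Q \<delta> t"
        and X' = "%t. ?Q' \<gamma> \<gamma>' t - ?Q' \<delta> \<delta>' t"])
    fix t assume t: "t \<in> {0..T}"
    show "((%t. ?Q \<gamma> t - ?Q \<delta> t) has_vector_derivative (?Q' \<gamma> \<gamma>' t - ?Q' \<delta> \<delta>' t)) (at t within {0..T})"
      by (rule has_vector_derivative_diff[OF G(4)[OF t] H(4)[OF t]])
    have "((%t. ?Q' \<gamma> \<gamma>' t - ?Q' \<delta> \<delta>' t) has_vector_derivative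
        ((2 - 4 * \<kappa> * ?Q \<gamma> t) - (2 - 4 * \<kappa> * ?Q \<delta> t))) (at t within {0..T})"
      by (rule has_vector_derivative_diff[OF G(5)[OF t] H(5)[OF t]])
    moreover have "(2 - 4 * \<kappa> * ?Q \<gamma> t) - (2 - 4 * \<kappa> * ?Q \<delta> t) = - (4 * \<kappa>) *\<^sub>R (?Q \<gamma> t - ?Q \<delta> t)"
      by (simp add: algebra_simps)
    ultimately show "((%t. ?Q' \<gamma> \<gamma>' t - ?Q' \<delta> \<delta>' t) has_vector_derivative
        (- (4 * \<kappa>) *\<^sub>R (?Q \<gamma> t - ?Q \<delta> t))) (at t within {0..T})"
      by (simp only:)
  qed (use init t in simp_all)
  have cp: "conf (\<gamma> t) > 0" "conf (\<delta> t) > 0"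
    using g(2) h(2) t conf_pos by (auto simp: image_subset_iff)
  have inv: "1 / conf (\<epsilon> t) = 1 - \<kappa> * ?Q \<epsilon> t" if "conf (\<epsilon> t) > 0" for \<epsilon>
    using that by (simp add: field_simps) (simp add: conf_def)
  have "1 / conf (\<gamma> t) = 1 / conf (\<delta> t)" using Q unfolding inv[of \<gamma>, OF cp(1)] inv[of \<delta>, OF cp(2)] by simp
  then show ?thesis using Y cp by simp
qed

text \<open>Strict convexity of the boundary. The quantity Q = |\<gamma>|^2 / conf is at most 1/(1 +
  \<kappa>) in the disk, with equality on the circle, and Q'' = 2 - 4\<kappa> Q > 0. Equal values at
  0 and \<tau> give a critical point between them by Rolle, and tangency gives one when \<tau> = 0;
  after it Q increases strictly and would leave the disk immediately after \<tau>.\<close>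

lemma no_geodesic_beyond:
  assumes geo: "geodesic_on (disk_metric \<kappa>) {0..T} \<gamma> \<gamma>'" and disk: "\<gamma> ` {0..T} \<subseteq> cball 0 1"
    and unit: "\<gamma>' 0 \<bullet> \<gamma>' 0 = (conf (\<gamma> 0))\<^sup>2"
    and start: "norm (\<gamma> 0) = 1" and \<tau>: "0 \<le> \<tau>" "norm (\<gamma> \<tau>) = 1"
    and tangent: "\<tau> = 0 ==> \<gamma> 0 \<bullet> \<gamma>' 0 = 0"
  shows "T \<le> \<tau>"
proof (rule ccontr)
  assume "\<not> T \<le> \<tau>"
  then have T: "\<tau> < T" by simp
  note G = geodesic_linearization[OF geo disk unit]
  define Q where "Q t = (\<gamma> t \<bullet> \<gamma> t) / conf (\<gamma> t)" for t
  define Q' where "Q' t = 2 * (\<gamma> t \<bullet> \<gamma>' t) / (conf (\<gamma> t))\<^sup>2" for t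
  have dQ: "(Q has_real_derivative Q' t) (at t within {0..T})" if "t \<in> {0..T}" for t
    using G(4)[OF that] unfolding Q_def Q'_def has_real_derivative_iff_has_vector_derivative .
  have dQ': "(Q' has_real_derivative 2 - 4 * \<kappa> * Q t) (at t within {0..T})" if "t \<in> {0..T}" for t
    using G(5)[OF that] unfolding Q_def Q'_def has_real_derivative_iff_has_vector_derivative .
  have nrm: "norm (\<gamma> t) \<le> 1" if "t \<in> {0..T}" for t using that disk by (auto simp: image_subset_iff)
  have pos: "2 - 4 * \<kappa> * Q t > 0" if "t \<in> {0..T}" for t
  proof -
    have c: "conf (\<gamma> t) > 0" using nrm[OF that] conf_pos by simp
    have "\<gamma> t \<bullet> \<gamma> t \<le> 1" using nrm[OF that] by (simp add: power2_norm_eq_inner[symmetric] power_le_one)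
    then have "\<kappa> * (\<gamma> t \<bullet> \<gamma> t) < 1"
      using kappa_lt kappa_gt inner_ge_zero[of "\<gamma> t"]
      by (smt (verit) mult_left_le mult_less_cancel_right1 mult_nonneg_nonneg mult_less_0_iff)
    moreover have "2 - 4 * \<kappa> * Q t = 2 * (1 - \<kappa> * (\<gamma> t \<bullet> \<gamma> t)) / conf (\<gamma> t)"
      using c by (simp add: Q_def field_simps) (simp add: conf_def)
    ultimately show ?thesis using c by simp
  qed
  have within: "(f has_real_derivative y) (at t)" if "(f has_real_derivative y) (at t within {0..T})" "0 < t" "t < T" for f y t
    using that at_within_Icc_at[of 0 t T] by simp
  have cQ: "continuous_on {0..T} Q" "continuous_on {0..T} Q'"
    by (rule DERIV_continuous_on, erule dQ) (rule DERIV_continuous_on, erule dQ')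
  have Qb: "Q t = 1 / (1 + \<kappa>)" if "norm (\<gamma> t) = 1" for t
    using that by (simp add: Q_def conf_def power2_norm_eq_inner[symmetric])
  have Qle: "Q t \<le> 1 / (1 + \<kappa>)" if "t \<in> {0..T}" for t
  proof -
    have c: "conf (\<gamma> t) > 0" using nrm[OF that] conf_pos by simp
    have "\<gamma> t \<bullet> \<gamma> t \<le> 1" using nrm[OF that] by (simp add: power2_norm_eq_inner[symmetric] power_le_one)
    then have "(\<gamma> t \<bullet> \<gamma> t) * (1 + \<kappa>) \<le> conf (\<gamma> t)" by (simp add: conf_def algebra_simps)
    then show ?thesis using c kappa_gt by (simp add: Q_def field_simps)
  qed
  obtain \<xi> where \<xi>: "0 \<le> \<xi>" "\<xi> \<le> \<tau>" "Q' \<xi> = 0"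
  proof (cases "\<tau> = 0")
    case True
    then show ?thesis using that[of 0] tangent by (simp add: Q'_def)
  next
    case False
    have "\<exists>z. 0 < z \<and> z < \<tau> \<and> (Q has_real_derivative 0) (at z)"
    proof (rule Rolle)
      show "continuous_on {0..\<tau>} Q" using cQ(1) T by (auto intro: continuous_on_subset)
      show "Q differentiable (at x)" if "0 < x" "x < \<tau>" for x
        using within[OF dQ, of x] that T by (auto simp: real_differentiable_def)
    qed (use False \<tau> Qb start in auto)
    then obtain z where z: "0 < z" "z < \<tau>" "(Q has_real_derivative 0) (at z)" by blast
    then have "Q' z = 0" using within[OF dQ, of z] T DERIV_unique by force
    then show ?thesis using that[of z] z by simp
  qed
  have mono: "Q' t > 0" if "\<xi> < t" "t \<le> T" for t
  proof -
    have "Q' \<xi> < Q' t"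
    proof (rule DERIV_pos_imp_increasing_open[OF that(1)])
      show "\<exists>y. (Q' has_real_derivative y) (at x) \<and> 0 < y" if "\<xi> < x" "x < t" for x
        using within[OF dQ', of x] pos[of x] that \<open>t \<le> T\<close> \<xi> by (intro exI[of _ "2 - 4 * \<kappa> * Q x"]) auto
      show "continuous_on {\<xi>..t} Q'" using cQ(2) that \<xi> by (auto intro: continuous_on_subset)
    qed
    then show ?thesis using \<xi> by simp
  qed
  have "Q \<tau> < Q T"
  proof (rule DERIV_pos_imp_increasing_open[OF T])
    show "\<exists>y. (Q has_real_derivative y) (at x) \<and> 0 < y" if "\<tau> < x" "x < T" for x
      using within[OF dQ, of x] mono[of x] that \<xi> \<tau> by (intro exI[of _ "Q' x"]) auto
    show "continuous_on {\<tau>..T} Q" using cQ(1) \<tau> by (auto intro: continuous_on_subset)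
  qed
  then show False using Qle[of T] Qb[OF \<tau>(2)] T \<tau> by simp
qed

section \<open>The projective model: geodesics become chords\<close>

definition klein_root :: "complex => real" where
  "klein_root z = sqrt ((1 - \<kappa>)\<^sup>2 + 4 * \<kappa> * (z \<bullet> z))"

text \<open>Inverse of the radial map w \<mapsto> (1 - \<kappa>) w / (1 - \<kappa> |w|^2), which
  fixes the unit circle and straightens geodesics. The root of the quadratic equation is written
  with the square root in the denominator so that \<kappa> = 0 is not singular.\<close>

definition klein_inv :: "complex => complex" where
  "klein_inv z = (2 / ((1 - \<kappa>) + klein_root z)) *\<^sub>R z"

text \<open>Up to a constant that depends on the geodesic only, 1 / \<open>klein_root\<close>^2 is
  the derivative of arc length with respect to Euclidean length along the chord.\<close>

definition flatten :: "(complex => complex) => complex => complex" where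
  "flatten f z = (1 / (klein_root z)\<^sup>2) *\<^sub>R f (klein_inv z)"

text \<open>The parameter r is Euclidean length from the boundary point e^{i\<beta>}; the chord
  leaves the disk at r = 2 cos s, and r = cos s is its midpoint.\<close>

definition chord :: "real => real => real => complex" where
  "chord \<beta> s r = cis \<beta> - r *\<^sub>R cis (\<beta> + s)"

text \<open>The expression is affine in x, with values (1 - \<kappa>)^2 at 0 and (1 + \<kappa>)^2 at
  1.\<close>

lemma klein_arg_pos:
  assumes "0 \<le> x" "x \<le> 1"
  shows "(1 - \<kappa>)\<^sup>2 + 4 * \<kappa> * x > 0"
proof (cases "\<kappa> \<ge> 0")
  case True
  then have "(1 - \<kappa>)\<^sup>2 > 0" "4 * \<kappa> * x \<ge> 0" using kappa_lt assms by auto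
  then show ?thesis by linarith
next
  case False
  then have "4 * \<kappa> * x \<ge> 4 * \<kappa>" using assms by (simp add: mult_le_cancel_left1)
  moreover have "(1 - \<kappa>)\<^sup>2 + 4 * \<kappa> = (1 + \<kappa>)\<^sup>2" by (simp add: power2_eq_square algebra_simps)
  moreover have "(1 + \<kappa>)\<^sup>2 > 0" using kappa_gt by simp
  ultimately show ?thesis by linarith
qed

lemma inner_self_le_1: "norm (z :: complex) \<le> 1 ==> z \<bullet> z \<le> 1"
  by (simp add: power2_norm_eq_inner[symmetric] power_le_one)

lemma klein_root_square: "norm z \<le> 1 ==> (klein_root z)\<^sup>2 = (1 - \<kappa>)\<^sup>2 + 4 * \<kappa> * (z \<bullet> z)"
  and klein_root_pos: "norm z \<le> 1 ==> klein_root z > 0"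
  unfolding klein_root_def using klein_arg_pos[of "z \<bullet> z"] inner_self_le_1[of z] by simp_all

lemma norm_klein_inv: assumes "norm z \<le> 1" shows "norm (klein_inv z) \<le> 1"
proof -
  let ?n = "norm z" and ?R = "klein_root z"
  have R: "?R > 0" "?R\<^sup>2 = (1 - \<kappa>)\<^sup>2 + 4 * \<kappa> * ?n\<^sup>2"
    using klein_root_pos klein_root_square assms by (simp_all add: power2_norm_eq_inner)
  \<comment> \<open>After squaring, the difference of the two sides is 4 (1 - \<kappa>) (n - n^2)
    with n = |z| \<le> 1.\<close>
  have "2 * ?n - (1 - \<kappa>) \<le> ?R"
  proof (rule power2_le_imp_le)
    have "?n * ?n \<le> ?n * 1" using assms by (intro mult_left_mono) auto
    then have "0 \<le> 4 * (1 - \<kappa>) * (?n - ?n * ?n)" using kappa_lt by simp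
    then show "(2 * ?n - (1 - \<kappa>))\<^sup>2 \<le> ?R\<^sup>2" unfolding R by (simp add: power2_eq_square algebra_simps)
  qed (use R in simp)
  then show ?thesis using R kappa_lt by (simp add: klein_inv_def field_simps)
qed

lemma continuous_klein_root: "continuous_on A klein_root"
  unfolding klein_root_def by (intro continuous_intros)

lemma continuous_flatten:
  assumes "continuous_on (cball 0 1) f" shows "continuous_on (cball 0 1) (flatten f)"
proof -
  have p: "klein_root z ~= 0" "(1 - \<kappa>) + klein_root z ~= 0" if "z \<in> cball 0 1" for z
    using klein_root_pos[of z] that kappa_lt by auto
  have "continuous_on (cball 0 1) klein_inv"
    unfolding klein_inv_def using p by (intro continuous_intros continuous_klein_root) auto
  then have "continuous_on (cball 0 1) (%z. f (klein_inv z))"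
    using norm_klein_inv by (intro continuous_on_compose2[OF assms]) auto
  then show ?thesis
    unfolding flatten_def using p by (intro continuous_intros continuous_klein_root) auto
qed

lemma chord_inner:
  "chord \<beta> s r \<bullet> chord \<beta> s r = 1 - (cos s)\<^sup>2 + (r - cos s)\<^sup>2"
  "(- cis (\<beta> + s)) \<bullet> chord \<beta> s r = r - cos s"
proof -
  have u: "cis x \<bullet> cis x = 1" for x by (simp add: inner_complex_def power2_eq_square[symmetric])
  have c: "cis (\<beta> + s) \<bullet> cis \<beta> = cos s"
    using cos_diff[of "\<beta> + s" \<beta>] by (simp add: inner_complex_def)
  show "chord \<beta> s r \<bullet> chord \<beta> s r = 1 - (cos s)\<^sup>2 + (r - cos s)\<^sup>2"
    unfolding chord_def by (simp add: inner_diff u c inner_commute[of "cis \<beta>"])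
      (simp add: power2_eq_square algebra_simps)
  show "(- cis (\<beta> + s)) \<bullet> chord \<beta> s r = r - cos s"
    unfolding chord_def by (simp add: inner_diff u c)
qed

lemma norm_chord: assumes "0 \<le> r" "r \<le> 2 * cos s" shows "norm (chord \<beta> s r) \<le> 1"
proof -
  have "\<bar>r - cos s\<bar> \<le> \<bar>cos s\<bar>" using assms by auto
  then have "(r - cos s)\<^sup>2 \<le> (cos s)\<^sup>2" by (simp add: abs_le_square_iff)
  then have "(norm (chord \<beta> s r))\<^sup>2 \<le> 1" unfolding power2_norm_eq_inner chord_inner by simp
  then show ?thesis by (simp add: power2_le_imp_le abs_square_le_1)
qed

lemma cos_scat_nonneg: "\<bar>\<alpha>\<bar> \<le> pi/2 ==> cos (sct \<alpha>) \<ge> 0"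
  using cos_ge_zero[of \<alpha>] kappa_gt rho_pos[of \<alpha>] by (simp add: cos_scat)

text \<open>The constant attached to a geodesic is \<open>klein_root\<close> at the midpoint of its
  chord, a point at squared distance 1 - (cos s)^2 from the origin.\<close>

lemma speed_constant: "((1 - \<kappa>\<^sup>2) / rho \<alpha>)\<^sup>2 = (1 - \<kappa>)\<^sup>2 + 4 * \<kappa> * (1 - (cos (sct \<alpha>))\<^sup>2)"
proof -
  have r: "rho \<alpha> ~= 0" using rho_pos[of \<alpha>] by simp
  have sc: "(sin \<alpha>)\<^sup>2 = 1 - (cos \<alpha>)\<^sup>2" by (simp add: sin_squared_eq)
  have "(1 - \<kappa>\<^sup>2)\<^sup>2 = ((1 - \<kappa>)\<^sup>2 + 4 * \<kappa>) * (rho \<alpha>)\<^sup>2 - 4 * \<kappa> * ((1 + \<kappa>) * cos \<alpha>)\<^sup>2"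
    unfolding rho_square power_mult_distrib sc by algebra
  then show ?thesis using r by (simp add: cos_scat power_divide field_simps)
qed

lemma klein_root_chord:
  "(klein_root (chord \<beta> (sct \<alpha>) r)) = sqrt (((1 - \<kappa>\<^sup>2) / rho \<alpha>)\<^sup>2 + 4 * \<kappa> * (r - cos (sct \<alpha>))\<^sup>2)"
  unfolding klein_root_def chord_inner speed_constant by (simp add: algebra_simps)

text \<open>Arc length along the chord: the antiderivative is taken on a larger interval, with the
  integrand frozen outside the chord, so that the inverse function has two-sided derivatives.\<close>

lemma arclength_inverse:
  assumes a: "\<bar>\<alpha>\<bar> \<le> pi/2"
  defines "c \<equiv> (1 - \<kappa>\<^sup>2) / rho \<alpha>" and "C \<equiv> cos (sct \<alpha>)"
  shows "\<exists>tt rr. tt 0 = 0 \<and> 0 \<le> tt (2 * C) \<and>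
    (\<forall>r\<in>{0..2 * C}. (tt has_real_derivative c / (c\<^sup>2 + 4 * \<kappa> * (r - C)\<^sup>2)) (at r)) \<and>
    (\<forall>r\<in>{0..2 * C}. tt r \<in> {0..tt (2 * C)} \<and> rr (tt r) = r) \<and>
    (\<forall>t\<in>{0..tt (2 * C)}. rr t \<in> {0..2 * C} \<and> (rr has_real_derivative (c\<^sup>2 + 4 * \<kappa> * (rr t - C)\<^sup>2) / c) (at t))"
proof -
  have C: "0 \<le> C" "C \<le> 1" using cos_scat_nonneg[OF a] by (simp_all add: C_def)
  have c0: "c > 0" using kappa_gt kappa_lt rho_pos[of \<alpha>]
    by (simp add: c_def abs_square_less_1 abs_less_iff)
  have cpos: "c\<^sup>2 + 4 * \<kappa> * m\<^sup>2 > 0" if "\<bar>m\<bar> \<le> C" for m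
  proof -
    have "m\<^sup>2 \<le> C\<^sup>2" using that C by (simp add: abs_le_square_iff[symmetric])
    moreover have "C\<^sup>2 \<le> 1" using C by (simp add: power_le_one)
    ultimately show ?thesis
      using klein_arg_pos[of "1 - C\<^sup>2 + m\<^sup>2"] speed_constant[of \<alpha>] zero_le_power2[of m]
      by (simp add: c_def C_def algebra_simps)
  qed
  define clamp where "clamp r = max (- C) (min C (r - C))" for r
  have clamp: "\<bar>clamp r\<bar> \<le> C" for r using C by (auto simp: clamp_def abs_le_iff)
  define W where "W r = c / (c\<^sup>2 + 4 * \<kappa> * (clamp r)\<^sup>2)" for r
  have Wpos: "W r > 0" for r using c0 cpos[OF clamp] by (simp add: W_def)
  have Wcont: "continuous_on A W" for A
    unfolding W_def clamp_def using cpos[OF clamp, unfolded clamp_def]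
    by (intro continuous_intros) (auto simp: less_imp_neq[THEN not_sym])
  have Wr: "W r = c / (c\<^sup>2 + 4 * \<kappa> * (r - C)\<^sup>2)" if "r \<in> {0..2 * C}" for r
    using that by (simp add: W_def clamp_def min_def max_def)
  \<comment> \<open>Since 0 \<le> C \<le> 1, the interval [-1, 4] contains [0, 2C] in its interior,
    even when C = 0.\<close>
  define tt where "tt r = integral {-1..r} W - integral {-1..0} W" for r :: real
  have dtt': "(tt has_real_derivative W r) (at r within {-1..4})" if "r \<in> {-1..4}" for r
    unfolding tt_def using integral_has_real_derivative[OF Wcont that]
    by (auto intro!: derivative_eq_intros)
  have dtt: "(tt has_real_derivative W r) (at r)" if "-1 < r" "r < 4" for r
    using dtt'[of r] at_within_Icc_at[of "-1" r 4] that by simp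
  have ctt: "continuous_on {-1..4} tt" by (rule DERIV_continuous_on, erule dtt')
  have mono: "tt x < tt y" if "-1 \<le> x" "x < y" "y \<le> 4" for x y
  proof (rule DERIV_pos_imp_increasing_open[OF that(2)])
    show "\<exists>D. (tt has_real_derivative D) (at z) \<and> 0 < D" if "x < z" "z < y" for z
      using dtt[of z] Wpos that \<open>-1 \<le> x\<close> \<open>y \<le> 4\<close> by (intro exI[of _ "W z"]) auto
    show "continuous_on {x..y} tt" using ctt that by (auto intro: continuous_on_subset)
  qed
  have le_iff: "tt x \<le> tt y \<longleftrightarrow> x \<le> y" if "x \<in> {-1..4}" "y \<in> {-1..4}" for x y
    using mono[of x y] mono[of y x] that by (cases x y rule: linorder_cases) auto
  have inj: "inj_on tt {-1..4}"
    by (rule inj_onI) (metis le_iff order_antisym order_refl)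
  define rr where "rr = the_inv_into {-1..4} tt"
  have rt: "rr (tt r) = r" if "r \<in> {-1..4}" for r
    unfolding rr_def by (rule the_inv_into_f_f[OF inj that])
  have img: "tt ` {-1..4} = {tt (-1)..tt 4}"
  proof
    show "tt ` {-1..4} \<subseteq> {tt (-1)..tt 4}" using le_iff by auto
    show "{tt (-1)..tt 4} \<subseteq> tt ` {-1..4}"
    proof
      fix y assume "y \<in> {tt (-1)..tt 4}"
      then obtain x where "-1 \<le> x" "x \<le> 4" "tt x = y" using IVT'[of tt "-1" y 4] ctt by auto
      then show "y \<in> tt ` {-1..4}" by auto
    qed
  qed
  have tr: "tt (rr t) = t" "rr t \<in> {-1..4}" if "t \<in> {tt (-1)..tt 4}" for t
    using that unfolding img[symmetric] using rt by auto
  have crr: "continuous_on {tt (-1)..tt 4} rr"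
    using continuous_on_inv[OF ctt compact_Icc] rt unfolding img by blast
  have drr: "(rr has_real_derivative inverse (W (rr t))) (at t)" if "tt (-1) < t" "t < tt 4" for t
  proof (rule DERIV_inverse_function[where f = tt and a = "tt (-1)" and b = "tt 4"])
    have t: "t \<in> {tt (-1)..tt 4}" using that by auto
    have "rr t ~= -1" "rr t ~= 4" using tr[OF t] that by auto
    then show "(tt has_real_derivative W (rr t)) (at (rr t))" using tr(2)[OF t] by (intro dtt) auto
    show "W (rr t) ~= 0" using Wpos[of "rr t"] by simp
    have "continuous_on {tt (-1)<..<tt 4} rr" by (rule continuous_on_subset[OF crr]) auto
    then show "isCont rr t" using that by (simp add: continuous_on_eq_continuous_at)
  qed (use that tr in auto)
  have t0: "tt 0 = 0" by (simp add: tt_def)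
  have bnd: "tt (-1) < 0" "tt (2 * C) < tt 4" using mono[of "-1" 0] mono[of "2 * C" 4] C t0 by auto
  have rrange: "rr t \<in> {0..2 * C}" if "t \<in> {0..tt (2 * C)}" for t
  proof -
    have t: "t \<in> {tt (-1)..tt 4}" using that bnd by auto
    have "tt 0 \<le> tt (rr t)" "tt (rr t) \<le> tt (2 * C)" using tr[OF t] that t0 by auto
    then show ?thesis using le_iff[of 0 "rr t"] le_iff[of "rr t" "2 * C"] tr(2)[OF t] C by auto
  qed
  show ?thesis
  proof (rule exI[of _ tt], rule exI[of _ rr], intro conjI ballI)
    show "tt 0 = 0" by (rule t0)
    show "0 \<le> tt (2 * C)" using le_iff[of 0 "2 * C"] C t0 by auto
    show "(tt has_real_derivative c / (c\<^sup>2 + 4 * \<kappa> * (r - C)\<^sup>2)) (at r)" if "r \<in> {0..2 * C}" for r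
      using dtt[of r] Wr[OF that] that C by auto
    show "tt r \<in> {0..tt (2 * C)}" "rr (tt r) = r" if "r \<in> {0..2 * C}" for r
      using le_iff[of 0 r] le_iff[of r "2 * C"] that C t0 rt[of r] by auto
    show "rr t \<in> {0..2 * C}" if "t \<in> {0..tt (2 * C)}" for t by (rule rrange[OF that])
    show "(rr has_real_derivative (c\<^sup>2 + 4 * \<kappa> * (rr t - C)\<^sup>2) / c) (at t)" if "t \<in> {0..tt (2 * C)}" for t
      using drr[of t] that bnd Wr[OF rrange[OF that]] by auto
  qed
qed

text \<open>The chord is run through with dr/dt = R^2 / c, where R^2 = c^2 + 4\<kappa> \<mu>^2 and
  \<mu> is the signed distance from the midpoint, and is pulled back by \<open>klein_inv\<close>.
  Every quantity is then rational in \<mu>, R and d = (1 - \<kappa>) + R, so the geodesic equation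
  reduces to polynomial identities modulo the relation for R^2.\<close>

lemma explicit_geodesic:
  assumes a: "\<bar>\<alpha>\<bar> \<le> pi/2"
  defines "c \<equiv> (1 - \<kappa>\<^sup>2) / rho \<alpha>" and "C \<equiv> cos (sct \<alpha>)"
  shows "\<exists>tt \<gamma> \<gamma>'. tt 0 = 0 \<and> 0 \<le> tt (2 * C) \<and>
    (\<forall>r\<in>{0..2 * C}. (tt has_real_derivative c / (klein_root (chord \<beta> (sct \<alpha>) r))\<^sup>2) (at r)) \<and>
    (\<forall>r\<in>{0..2 * C}. tt r \<in> {0..tt (2 * C)} \<and> \<gamma> (tt r) = klein_inv (chord \<beta> (sct \<alpha>) r)) \<and>
    geodesic_on (disk_metric \<kappa>) {0..tt (2 * C)} \<gamma> \<gamma>' \<and> \<gamma> ` {0..tt (2 * C)} \<subseteq> cball 0 1 \<and>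
    \<gamma> 0 = cis \<beta> \<and> \<gamma>' 0 = of_real (1 + \<kappa>) * cis (\<beta> + pi + \<alpha>)"
proof -
  obtain tt rr where t0: "tt 0 = 0" and tL: "0 \<le> tt (2 * C)"
    and dtt: "!!r. r \<in> {0..2 * C} ==> (tt has_real_derivative c / (c\<^sup>2 + 4 * \<kappa> * (r - C)\<^sup>2)) (at r)"
    and rt: "!!r. r \<in> {0..2 * C} ==> tt r \<in> {0..tt (2 * C)} \<and> rr (tt r) = r"
    and rr: "!!t. t \<in> {0..tt (2 * C)} ==> rr t \<in> {0..2 * C}"
    and drr: "!!t. t \<in> {0..tt (2 * C)} ==> (rr has_real_derivative (c\<^sup>2 + 4 * \<kappa> * (rr t - C)\<^sup>2) / c) (at t)"
    using arclength_inverse[OF a] unfolding c_def C_def by blast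
  have C0: "0 \<le> C" using cos_scat_nonneg[OF a] by (simp add: C_def)
  have c0: "c > 0" using kappa_gt kappa_lt rho_pos[of \<alpha>]
    by (simp add: c_def abs_square_less_1 abs_less_iff)
  let ?s = "sct \<alpha>" let ?T = "tt (2 * C)"
  define k where "k = 1 - \<kappa>"
  have k: "k > 0" using kappa_lt by (simp add: k_def)
  define e where "e = - cis (\<beta> + ?s)"
  define y where "y t = chord \<beta> ?s (rr t)" for t
  define \<mu> where "\<mu> t = rr t - C" for t
  define R where "R t = sqrt (c\<^sup>2 + 4 * \<kappa> * (\<mu> t)\<^sup>2)" for t
  define d where "d t = k + R t" for t
  define \<gamma> where "\<gamma> t = (2 / d t) *\<^sub>R y t" for t
  define \<gamma>' where "\<gamma>' t = (2 / c) *\<^sub>R (((R t)\<^sup>2 / d t) *\<^sub>R e - (4 * \<kappa> * \<mu> t * R t / (d t)\<^sup>2) *\<^sub>R y t)" for t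
  have Rk: "klein_root (chord \<beta> ?s r) = sqrt (c\<^sup>2 + 4 * \<kappa> * (r - C)\<^sup>2)" for r
    unfolding c_def C_def by (rule klein_root_chord)
  have nc: "norm (chord \<beta> ?s r) \<le> 1" if "r \<in> {0..2 * C}" for r
    using that norm_chord[of r ?s] by (simp add: C_def)
  have arg: "c\<^sup>2 + 4 * \<kappa> * (r - C)\<^sup>2 > 0" if "r \<in> {0..2 * C}" for r
    using klein_root_pos[OF nc[OF that]] unfolding Rk by simp
  have y_eq: "y t = cis \<beta> + rr t *\<^sub>R e" for t by (simp add: y_def e_def chord_def)
  have gk: "\<gamma> t = klein_inv (y t)" for t
    unfolding \<gamma>_def klein_inv_def y_def Rk d_def R_def \<mu>_def k_def ..
  have facts: "R t > 0 \<and> (R t)\<^sup>2 = c\<^sup>2 + 4 * \<kappa> * (\<mu> t)\<^sup>2 \<and> d t > 0 \<and>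
      (\<mu> has_real_derivative (R t)\<^sup>2 / c) (at t) \<and>
      (R has_real_derivative 4 * \<kappa> * \<mu> t * R t / c) (at t) \<and>
      (y has_vector_derivative ((R t)\<^sup>2 / c) *\<^sub>R e) (at t)" if t: "t \<in> {0..?T}" for t
  proof -
    have p: "c\<^sup>2 + 4 * \<kappa> * (\<mu> t)\<^sup>2 > 0" using arg[OF rr[OF t]] by (simp add: \<mu>_def)
    have R: "R t > 0" "(R t)\<^sup>2 = c\<^sup>2 + 4 * \<kappa> * (\<mu> t)\<^sup>2" using p by (simp_all add: R_def)
    have m: "(\<mu> has_real_derivative (R t)\<^sup>2 / c) (at t)"
      unfolding \<mu>_def[abs_def] R(2) using drr[OF t] by (auto intro!: derivative_eq_intros simp: \<mu>_def)
    have "((%t. c\<^sup>2 + 4 * \<kappa> * (\<mu> t)\<^sup>2) has_real_derivative 4 * \<kappa> * (2 * \<mu> t * ((R t)\<^sup>2 / c))) (at t)"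
      by (auto intro!: derivative_eq_intros m)
    then have "(R has_real_derivative (inverse (sqrt (c\<^sup>2 + 4 * \<kappa> * (\<mu> t)\<^sup>2)) / 2) * (4 * \<kappa> * (2 * \<mu> t * ((R t)\<^sup>2 / c)))) (at t)"
      unfolding R_def[abs_def] by (rule DERIV_chain2[where f = sqrt and x = t, rotated]) (rule DERIV_real_sqrt[OF p])
    moreover have "(inverse (sqrt (c\<^sup>2 + 4 * \<kappa> * (\<mu> t)\<^sup>2)) / 2) * (4 * \<kappa> * (2 * \<mu> t * ((R t)\<^sup>2 / c))) = 4 * \<kappa> * \<mu> t * R t / c"
      unfolding R_def[symmetric] using R(1) c0 by (simp add: field_simps power2_eq_square)
    ultimately have dR: "(R has_real_derivative 4 * \<kappa> * \<mu> t * R t / c) (at t)" by (simp only:)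
    have "((%t. rr t *\<^sub>R e) has_vector_derivative (rr t *\<^sub>R 0 + ((c\<^sup>2 + 4 * \<kappa> * (rr t - C)\<^sup>2) / c) *\<^sub>R e)) (at t)"
      by (rule has_vector_derivative_scaleR[OF drr[OF t] has_vector_derivative_const])
    from has_vector_derivative_add[OF has_vector_derivative_const this]
    have "(y has_vector_derivative ((R t)\<^sup>2 / c) *\<^sub>R e) (at t)"
      unfolding y_eq[abs_def] R(2) \<mu>_def by (simp only: add_0_left scaleR_zero_right)
    then show ?thesis using R m dR k by (auto simp: d_def)
  qed
  have d1: "(\<gamma> has_vector_derivative \<gamma>' t) (at t)" if t: "t \<in> {0..?T}" for t
  proof -
    note F = facts[OF t]
    have "((%t. 2 / d t) has_real_derivative (- (2 * (4 * \<kappa> * \<mu> t * R t / c)) / (d t)\<^sup>2)) (at t)"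
      unfolding d_def[abs_def] using F by (auto intro!: derivative_eq_intros simp: power2_eq_square d_def)
    then have "(\<gamma> has_vector_derivative ((2 / d t) *\<^sub>R (((R t)\<^sup>2 / c) *\<^sub>R e) + (- (2 * (4 * \<kappa> * \<mu> t * R t / c)) / (d t)\<^sup>2) *\<^sub>R y t)) (at t)"
      unfolding \<gamma>_def[abs_def] using F by (intro has_vector_derivative_scaleR) auto
    moreover have "(2 / d t) *\<^sub>R (((R t)\<^sup>2 / c) *\<^sub>R e) + (- (2 * (4 * \<kappa> * \<mu> t * R t / c)) / (d t)\<^sup>2) *\<^sub>R y t = \<gamma>' t"
      unfolding \<gamma>'_def by (simp add: scaleR_diff_right mult_ac)
    ultimately show ?thesis by simp
  qed
  \<comment> \<open>Written in terms of \<gamma>' and \<gamma> because the geodesic equation has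
    this form; the coefficients are the ones it prescribes once 1 + \<kappa> |\<gamma>|^2 = 2R/d,
    |\<gamma>'| = 2R/d and the value of \<gamma> \<bullet> \<gamma>' are inserted.\<close>
  define \<gamma>'' where "\<gamma>'' t = (8 * \<kappa> * k * \<mu> t / (c * d t)) *\<^sub>R \<gamma>' t - (4 * \<kappa> * R t / d t) *\<^sub>R \<gamma> t" for t
  have d2: "(\<gamma>' has_vector_derivative \<gamma>'' t) (at t)" if t: "t \<in> {0..?T}" for t
  proof -
    note F = facts[OF t]
    let ?R' = "4 * \<kappa> * \<mu> t * R t / c" and ?m' = "(R t)\<^sup>2 / c"
    let ?f1 = "(2 * R t * ?R' * d t - (R t)\<^sup>2 * ?R') / (d t)\<^sup>2"
    let ?f2 = "(4 * \<kappa> * (?m' * R t + \<mu> t * ?R') * (d t)\<^sup>2 - 4 * \<kappa> * \<mu> t * R t * (2 * d t * ?R')) / ((d t)\<^sup>2 * (d t)\<^sup>2)"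
    have dd: "(d has_real_derivative ?R') (at t)"
      unfolding d_def[abs_def] using F by (auto intro!: derivative_eq_intros)
    have f1: "((%t. (R t)\<^sup>2 / d t) has_real_derivative ?f1) (at t)"
      using F by (auto intro!: derivative_eq_intros dd simp: power2_eq_square)
    have f2: "((%t. 4 * \<kappa> * \<mu> t * R t / (d t)\<^sup>2) has_real_derivative ?f2) (at t)"
      using F by (auto intro!: derivative_eq_intros dd simp: algebra_simps)
    have "(\<gamma>' has_vector_derivative (2 / c) *\<^sub>R ((((R t)\<^sup>2 / d t) *\<^sub>R 0 + ?f1 *\<^sub>R e) -
        ((4 * \<kappa> * \<mu> t * R t / (d t)\<^sup>2) *\<^sub>R (?m' *\<^sub>R e) + ?f2 *\<^sub>R y t))) (at t)"
      unfolding \<gamma>'_def[abs_def] using F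
      by (intro bounded_linear.has_vector_derivative[OF bounded_linear_scaleR_right] has_vector_derivative_diff
          has_vector_derivative_scaleR[OF f1] has_vector_derivative_scaleR[OF f2] has_vector_derivative_const) auto
    also have "(2 / c) *\<^sub>R ((((R t)\<^sup>2 / d t) *\<^sub>R 0 + ?f1 *\<^sub>R e) -
        ((4 * \<kappa> * \<mu> t * R t / (d t)\<^sup>2) *\<^sub>R (?m' *\<^sub>R e) + ?f2 *\<^sub>R y t))
      = ((2 / c) * (?f1 - (4 * \<kappa> * \<mu> t * R t / (d t)\<^sup>2) * ?m')) *\<^sub>R e - ((2 / c) * ?f2) *\<^sub>R y t"
      by (simp only: scaleR_zero_right add_0_left scaleR_diff_right scaleR_diff_left scaleR_add_right scaleR_scaleR right_diff_distrib)
         (simp only: algebra_simps)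
    also have "(2 / c) * (?f1 - (4 * \<kappa> * \<mu> t * R t / (d t)\<^sup>2) * ?m') = (8 * \<kappa> * k * \<mu> t / (c * d t)) * ((2 / c) * ((R t)\<^sup>2 / d t))"
    proof -
      have kd: "k = d t - R t" by (simp add: d_def)
      have "d t ~= 0" using F by simp
      then show ?thesis unfolding kd using c0 by (simp add: divide_simps) algebra
    qed
    also have "(2 / c) * ?f2 = (8 * \<kappa> * k * \<mu> t / (c * d t)) * ((2 / c) * (4 * \<kappa> * \<mu> t * R t / (d t)\<^sup>2)) + (4 * \<kappa> * R t / d t) * (2 / d t)"
    proof -
      have kd: "k = d t - R t" by (simp add: d_def)
      have Rsq: "R t * R t = c * c + 4 * \<kappa> * (\<mu> t * \<mu> t)" using F by (simp add: power2_eq_square)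
      have "d t ~= 0" using F by simp
      then show ?thesis unfolding kd using c0 by (simp add: divide_simps) (use Rsq in algebra)
    qed
    also have "((8 * \<kappa> * k * \<mu> t / (c * d t)) * ((2 / c) * ((R t)\<^sup>2 / d t))) *\<^sub>R e -
       ((8 * \<kappa> * k * \<mu> t / (c * d t)) * ((2 / c) * (4 * \<kappa> * \<mu> t * R t / (d t)\<^sup>2)) + (4 * \<kappa> * R t / d t) * (2 / d t)) *\<^sub>R y t = \<gamma>'' t"
      unfolding \<gamma>''_def \<gamma>'_def \<gamma>_def
      by (simp only: scaleR_diff_right scaleR_add_left scaleR_scaleR) (simp only: algebra_simps)
    finally show ?thesis .
  qed
  have nrm: "norm (\<gamma> t) \<le> 1" if "t \<in> {0..?T}" for t
    unfolding gk y_def by (rule norm_klein_inv[OF nc[OF rr[OF that]]])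
  have eq: "\<gamma>'' t = (2 * \<kappa> / (1 + \<kappa> * (\<gamma> t \<bullet> \<gamma> t))) *\<^sub>R ((2 * (\<gamma> t \<bullet> \<gamma>' t)) *\<^sub>R \<gamma>' t - (\<gamma>' t \<bullet> \<gamma>' t) *\<^sub>R \<gamma> t)"
    if t: "t \<in> {0..?T}" for t
  proof -
    note F = facts[OF t]
    have kd: "R t = d t - k" by (simp add: d_def)
    have ee: "e \<bullet> e = 1" by (simp add: e_def inner_complex_def power2_eq_square[symmetric])
    have ey: "e \<bullet> y t = \<mu> t" "y t \<bullet> e = \<mu> t"
      unfolding e_def y_def \<mu>_def C_def by (simp_all only: chord_inner(2) inner_commute[of "chord _ _ _"])
    have yy: "y t \<bullet> y t = 1 - C\<^sup>2 + (\<mu> t)\<^sup>2" unfolding y_def \<mu>_def C_def by (rule chord_inner)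
    have cc: "c\<^sup>2 = k\<^sup>2 + 4 * \<kappa> * (1 - C\<^sup>2)" unfolding c_def k_def C_def by (rule speed_constant)
    \<comment> \<open>Only the product of \<kappa> with |y|^2 is expressed through d and k, so
      \<kappa> = 0 needs no separate treatment.\<close>
    have Ry: "4 * \<kappa> * (y t \<bullet> y t) = (d t - k)\<^sup>2 - k\<^sup>2" unfolding yy kd[symmetric] using F cc by algebra
    have dn: "d t ~= 0" and Rn: "R t ~= 0" using F by simp_all
    have gg: "1 + \<kappa> * (\<gamma> t \<bullet> \<gamma> t) = 2 * R t / d t"
    proof -
      have "1 + \<kappa> * (\<gamma> t \<bullet> \<gamma> t) = 1 + (4 * \<kappa> * (y t \<bullet> y t)) / (d t)\<^sup>2" by (simp add: \<gamma>_def power2_eq_square)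
      then show ?thesis unfolding Ry kd using dn by (simp add: divide_simps) algebra
    qed
    have q: "4 * \<kappa> * \<mu> t * R t / (d t)\<^sup>2 * (y t \<bullet> y t) = \<mu> t * R t / (d t)\<^sup>2 * ((d t - k)\<^sup>2 - k\<^sup>2)"
      unfolding Ry[symmetric] by simp
    have gen1: "(a *\<^sub>R y t) \<bullet> (b *\<^sub>R (p *\<^sub>R e - q *\<^sub>R y t)) = a * b * (p * \<mu> t - q * (y t \<bullet> y t))" for a b p q
      by (simp only: inner_scaleR_left inner_scaleR_right inner_diff_right ey) algebra
    have gen2: "(b *\<^sub>R (p *\<^sub>R e - q *\<^sub>R y t)) \<bullet> (b *\<^sub>R (p *\<^sub>R e - q *\<^sub>R y t))
      = b\<^sup>2 * (p\<^sup>2 - 2 * p * q * \<mu> t + q * (q * (y t \<bullet> y t)))" for b p q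
      by (simp only: inner_scaleR_left inner_scaleR_right inner_diff_left inner_diff_right ey ee) algebra
    have gg': "\<gamma> t \<bullet> \<gamma>' t = 4 * k * \<mu> t * R t / (c * (d t)\<^sup>2)"
      unfolding \<gamma>_def \<gamma>'_def gen1 q unfolding kd using dn c0 by (simp add: divide_simps) algebra
    have g'g': "\<gamma>' t \<bullet> \<gamma>' t = (2 * R t / d t)\<^sup>2"
    proof -
      have mu2: "4 * \<kappa> * (\<mu> t * \<mu> t) = (d t - k) * (d t - k) - c * c"
        using F unfolding kd by (simp add: power2_eq_square)
      show ?thesis
        unfolding \<gamma>'_def gen2 q unfolding kd using dn c0 by (simp add: divide_simps) (use mu2 in algebra)
    qed
    have "(2 * \<kappa> / (2 * R t / d t)) * (2 * (4 * k * \<mu> t * R t / (c * (d t)\<^sup>2))) = 8 * \<kappa> * k * \<mu> t / (c * d t)"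
      using dn Rn c0 by (simp add: divide_simps) algebra
    moreover have "(2 * \<kappa> / (2 * R t / d t)) * (2 * R t / d t)\<^sup>2 = 4 * \<kappa> * R t / d t"
      using dn Rn by (simp add: divide_simps) algebra
    ultimately show ?thesis unfolding gg gg' g'g' \<gamma>''_def by (simp only: scaleR_diff_right scaleR_scaleR)
  qed
  have geo: "geodesic_on (disk_metric \<kappa>) {0..?T} \<gamma> \<gamma>'"
    unfolding geodesic_on_def
  proof (rule exI[of _ \<gamma>''], rule ballI, intro conjI)
    fix t assume t: "t \<in> {0..?T}"
    show "(\<gamma> has_vector_derivative \<gamma>' t) (at t within {0..?T})"
      by (rule has_vector_derivative_at_within[OF d1[OF t]])
    show "(\<gamma>' has_vector_derivative \<gamma>'' t) (at t within {0..?T})"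
      by (rule has_vector_derivative_at_within[OF d2[OF t]])
    show "\<forall>w. disk_metric \<kappa> (\<gamma> t) (\<gamma>'' t) w + christoffel (disk_metric \<kappa>) (\<gamma> t) (\<gamma>' t) (\<gamma>' t) w = 0"
      using geodesic_equation_iff[OF nrm[OF t]] eq[OF t] by blast
  qed
  have zero: "0 \<in> {0..?T}" and r0: "rr 0 = 0" using tL rt[of 0] C0 t0 by auto
  have y0: "y 0 = cis \<beta>" by (simp add: y_eq r0)
  have R0: "R 0 = 1 + \<kappa>"
  proof -
    have "R 0 = klein_root (cis \<beta>)" unfolding R_def \<mu>_def Rk[symmetric] using y0 by (simp add: y_def)
    also have "\<dots> = sqrt ((1 + \<kappa>)\<^sup>2)"
      unfolding klein_root_def
      by (rule arg_cong[of _ _ sqrt]) (simp add: inner_complex_def power2_eq_square[symmetric], simp add: power2_eq_square algebra_simps)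
    finally show ?thesis using kappa_gt by simp
  qed
  have g0: "\<gamma> 0 = cis \<beta>" by (simp add: \<gamma>_def d_def R0 k_def y0)
  have g'0: "\<gamma>' 0 = of_real (1 + \<kappa>) * cis (\<beta> + pi + \<alpha>)"
  proof -
    have "\<gamma>' 0 = ((1 + \<kappa>) / c) *\<^sub>R ((1 + \<kappa>) *\<^sub>R e + (2 * \<kappa> * C) *\<^sub>R cis \<beta>)"
      by (simp add: \<gamma>'_def d_def R0 k_def y0 \<mu>_def r0 scaleR_diff_right scaleR_add_right power2_eq_square)
    also have "(1 + \<kappa>) *\<^sub>R e + (2 * \<kappa> * C) *\<^sub>R cis \<beta> = (- c) *\<^sub>R (cis \<beta> * cis \<alpha>)"
    proof -
      have e': "e = - (cis \<beta> * cis ?s)" by (simp add: e_def cis_mult)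
      \<comment> \<open>Here the chord angle and the fan-beam angle meet: the differential of
        \<open>klein_inv\<close> at the boundary turns the chord direction e^{is} into the direction
        e^{i\<alpha>} exactly when s is the scattering angle of \<alpha>.\<close>
      have "of_real (1 + \<kappa>) * cis ?s - of_real (2 * \<kappa> * C) = of_real c * cis \<alpha>"
        using rho_pos[of \<alpha>]
        by (simp add: complex_eq_iff C_def c_def cos_scat sin_scat field_simps power2_eq_square)
      then have "cis \<beta> * (of_real (1 + \<kappa>) * cis ?s - of_real (2 * \<kappa> * C)) = cis \<beta> * (of_real c * cis \<alpha>)" by simp
      then show ?thesis unfolding e' scaleR_conv_of_real
        by (simp add: algebra_simps)
    qed
    also have "((1 + \<kappa>) / c) *\<^sub>R (- c) *\<^sub>R (cis \<beta> * cis \<alpha>) = (- (1 + \<kappa>)) *\<^sub>R (cis \<beta> * cis \<alpha>)"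
    proof -
      have "(1 + \<kappa>) / c * (- c) = - (1 + \<kappa>)" using c0 by simp
      then show ?thesis by (simp only: scaleR_scaleR)
    qed
    finally show ?thesis
      by (simp add: cis_mult[symmetric] scaleR_conv_of_real) (simp add: algebra_simps)
  qed
  show ?thesis
  proof (rule exI[of _ tt], rule exI[of _ \<gamma>], rule exI[of _ \<gamma>'], intro conjI ballI)
    fix r assume r: "r \<in> {0..2 * C}"
    show "(tt has_real_derivative c / (klein_root (chord \<beta> ?s r))\<^sup>2) (at r)"
      using dtt[OF r] arg[OF r] unfolding Rk by simp
    show "tt r \<in> {0..?T}" using rt[OF r] by simp
    show "\<gamma> (tt r) = klein_inv (chord \<beta> ?s r)" using rt[OF r] by (simp add: gk y_def)
  next
    show "\<gamma> ` {0..?T} \<subseteq> cball 0 1" using nrm by auto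
  qed (use t0 tL geo g0 g'0 in simp_all)
qed

lemma inner_cis: "cis x \<bullet> cis y = cos (x - y)"
  by (simp add: inner_complex_def cos_diff)

lemma conf_cis: "conf (cis \<beta>) = 1 + \<kappa>"
  by (simp add: conf_def inner_cis)

lemma klein_inv_unit: assumes "norm z = 1" shows "klein_inv z = z"
proof -
  have "(1 - \<kappa>)\<^sup>2 + 4 * \<kappa> = (1 + \<kappa>)\<^sup>2" by (simp add: power2_eq_square algebra_simps)
  then have "klein_root z = 1 + \<kappa>"
    using assms kappa_gt by (simp add: klein_root_def power2_norm_eq_inner[symmetric])
  then show ?thesis by (simp add: klein_inv_def)
qed

lemma norm_chord_end: "norm (chord \<beta> s (2 * cos s)) = 1"
proof -
  have "(norm (chord \<beta> s (2 * cos s)))\<^sup>2 = 1" unfolding power2_norm_eq_inner chord_inner by simp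
  then show ?thesis by (intro power2_eq_imp_eq[of _ 1]) simp_all
qed

lemma continuous_chord: "continuous_on A (chord \<beta> s)"
  unfolding chord_def by (intro continuous_intros)

text \<open>The exit time is a supremum and the geodesic an arbitrary choice; the explicit geodesic
  attains the supremum by convexity and equals the chosen one by uniqueness. The substitution of arc
  length by chord length then produces the weight contained in \<open>flatten\<close>.\<close>

lemma xray_formula:
  assumes a: "\<bar>\<alpha>\<bar> \<le> pi/2" and f: "continuous_on (cball 0 1) f"
  shows "xray \<kappa> f (\<beta>, \<alpha>) = ((1 - \<kappa>\<^sup>2) / rho \<alpha>) *\<^sub>R
    integral {0..2 * cos (sct \<alpha>)} (%r. flatten f (chord \<beta> (sct \<alpha>) r))"
proof -
  define c where "c = (1 - \<kappa>\<^sup>2) / rho \<alpha>"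
  define C where "C = cos (sct \<alpha>)"
  have C0: "0 \<le> C" using cos_scat_nonneg[OF a] by (simp add: C_def)
  let ?x = "cis \<beta>" and ?v = "of_real (1 + \<kappa>) * cis (\<beta> + pi + \<alpha>)"
  from explicit_geodesic[OF a, of \<beta>, folded c_def C_def] obtain tt \<gamma>0 \<gamma>0' where t0: "tt 0 = 0" and T0: "0 \<le> tt (2 * C)"
    and dtt': "\<forall>r\<in>{0..2 * C}. (tt has_real_derivative c / (klein_root (chord \<beta> (sct \<alpha>) r))\<^sup>2) (at r)"
    and gtt': "\<forall>r\<in>{0..2 * C}. tt r \<in> {0..tt (2 * C)} \<and> \<gamma>0 (tt r) = klein_inv (chord \<beta> (sct \<alpha>) r)"
    and geo0: "geodesic_on (disk_metric \<kappa>) {0..tt (2 * C)} \<gamma>0 \<gamma>0'" and disk0: "\<gamma>0 ` {0..tt (2 * C)} \<subseteq> cball 0 1"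
    and init: "\<gamma>0 0 = ?x" "\<gamma>0' 0 = ?v"
    by (elim exE conjE) (rule that)
  note dtt = dtt'[rule_format] and gtt = gtt'[rule_format]
  let ?T = "tt (2 * C)"
  have v: "?v = (1 + \<kappa>) *\<^sub>R cis (\<beta> + pi + \<alpha>)" by (rule scaleR_conv_of_real[symmetric])
  have unit: "?v \<bullet> ?v = (conf ?x)\<^sup>2"
    unfolding v inner_scaleR_left inner_scaleR_right inner_cis conf_cis by (simp add: power2_eq_square)
  have same: "\<gamma> t = \<gamma>0 t" if "geodesic_on (disk_metric \<kappa>) {0..T} \<gamma> \<gamma>'" "\<gamma> ` {0..T} \<subseteq> cball 0 1" "\<gamma> 0 = ?x" "\<gamma>' 0 = ?v"
      "?T \<le> T" "t \<in> {0..?T}" for T \<gamma> \<gamma>' t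
  proof (rule geodesic_unique[OF _ _ geo0 disk0])
    have sub: "{0..?T} \<subseteq> {0..T}" using that by auto
    show "geodesic_on (disk_metric \<kappa>) {0..?T} \<gamma> \<gamma>'" by (rule geodesic_on_subset[OF that(1) sub])
    show "\<gamma> ` {0..?T} \<subseteq> cball 0 1" using that(2) sub by blast
  qed (use that init unit in simp_all)
  have last: "\<gamma>0 ?T = chord \<beta> (sct \<alpha>) (2 * C)"
    using gtt[of "2 * C"] C0 klein_inv_unit[OF norm_chord_end, of \<beta> "sct \<alpha>"] by (simp add: C_def)
  \<comment> \<open>A geodesic of length zero has a chord of length zero, which forces cos \<alpha>
    = 0, so its velocity is tangent to the circle.\<close>
  have tangent: "?x \<bullet> ?v = 0" if "?T = 0"
  proof -
    have "klein_inv (chord \<beta> (sct \<alpha>) 0) = chord \<beta> (sct \<alpha>) (2 * C)"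
      using gtt[of 0] C0 last that t0 by simp
    then have "C = 0" by (simp add: chord_def klein_inv_unit)
    then have "cos \<alpha> = 0" using rho_pos[of \<alpha>] kappa_gt by (simp add: C_def cos_scat)
    then show ?thesis
      unfolding v inner_scaleR_right inner_cis by (simp add: cos_add cos_diff sin_add sin_cos_squared_add3 algebra_simps)
  qed
  have "exit_time \<kappa> ?x ?v = ?T"
    unfolding exit_time_def
  proof (rule cSup_eq_maximum)
    show "?T \<in> {T. 0 \<le> T \<and> (\<exists>\<gamma>. geodesic_in_disk \<kappa> ?x ?v T \<gamma>)}"
      using T0 geo0 disk0 init unfolding geodesic_in_disk_def by blast
    fix T assume "T \<in> {T. 0 \<le> T \<and> (\<exists>\<gamma>. geodesic_in_disk \<kappa> ?x ?v T \<gamma>)}"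
    then obtain \<gamma> \<gamma>' where g: "geodesic_on (disk_metric \<kappa>) {0..T} \<gamma> \<gamma>'" "\<gamma> ` {0..T} \<subseteq> cball 0 1"
      "\<gamma> 0 = ?x" "\<gamma>' 0 = ?v" unfolding geodesic_in_disk_def by blast
    show "T \<le> ?T"
    proof (rule ccontr)
      assume "\<not> T \<le> ?T"
      then have le: "?T \<le> T" by simp
      have "\<gamma> ?T = \<gamma>0 ?T" by (rule same[OF g le]) (use T0 in auto)
      then have "norm (\<gamma> ?T) = 1" using last norm_chord_end by (simp add: C_def)
      then have "T \<le> ?T"
        using no_geodesic_beyond[OF g(1,2), of ?T] unit tangent T0 unfolding g(3,4) by simp
      then show False using \<open>\<not> T \<le> ?T\<close> by simp
    qed
  qed
  moreover define \<gamma> where "\<gamma> = (SOME \<gamma>. geodesic_in_disk \<kappa> ?x ?v ?T \<gamma>)"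
  have "geodesic_in_disk \<kappa> ?x ?v ?T \<gamma>0"
    using geo0 disk0 init unfolding geodesic_in_disk_def by blast
  then have "geodesic_in_disk \<kappa> ?x ?v ?T \<gamma>" unfolding \<gamma>_def by (rule someI[of "geodesic_in_disk \<kappa> ?x ?v ?T"])
  then obtain \<gamma>' where "geodesic_on (disk_metric \<kappa>) {0..?T} \<gamma> \<gamma>'" "\<gamma> ` {0..?T} \<subseteq> cball 0 1"
      "\<gamma> 0 = ?x" "\<gamma>' 0 = ?v" unfolding geodesic_in_disk_def by blast
  then have "\<gamma> t = \<gamma>0 t" if "t \<in> {0..?T}" for t using same[of ?T \<gamma> \<gamma>' t] that by simp
  then have "integral {0..?T} (%t. f (\<gamma> t)) = integral {0..?T} (%t. f (\<gamma>0 t))"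
    by (intro integral_cong) simp
  ultimately have "xray \<kappa> f (\<beta>, \<alpha>) = integral {0..?T} (%t. f (\<gamma>0 t))"
    by (simp add: xray_def Let_def \<gamma>_def)
  also have "\<dots> = integral {0..2 * C} (%r. (c / (klein_root (chord \<beta> (sct \<alpha>) r))\<^sup>2) *\<^sub>R f (\<gamma>0 (tt r)))"
  proof -
    have "continuous_on {0..?T} \<gamma>0"
      using geo0 unfolding geodesic_on_def by (auto intro!: continuous_on_vector_derivative)
    then have "continuous_on {0..?T} (%t. f (\<gamma>0 t))"
      by (rule continuous_on_compose2[OF f _ disk0])
    then have "((%r. (c / (klein_root (chord \<beta> (sct \<alpha>) r))\<^sup>2) *\<^sub>R f (\<gamma>0 (tt r))) has_integral
       (integral {tt 0..?T} (%t. f (\<gamma>0 t)))) {0..2 * C}"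
      using gtt C0 T0 t0 dtt
      by (intro has_integral_substitution[where c = 0 and d = ?T])
         (auto intro: has_field_derivative_at_within)
    then show ?thesis using t0 by (simp add: integral_unique)
  qed
  also have "\<dots> = integral {0..2 * C} (%r. c *\<^sub>R flatten f (chord \<beta> (sct \<alpha>) r))"
    using gtt by (intro integral_cong) (simp add: flatten_def)
  also have "\<dots> = c *\<^sub>R integral {0..2 * C} (%r. flatten f (chord \<beta> (sct \<alpha>) r))"
    by (rule integral_cmul)
  finally show ?thesis by (simp add: c_def C_def)
qed

section \<open>Chord integrals of continuous functions\<close>

definition chord_integral :: "(complex => complex) => real \<times> real => complex" where
  "chord_integral F p = ((1 - \<kappa>\<^sup>2) / rho (snd p)) *\<^sub>R
     integral {0..2 * cos (sct (snd p))} (%r. F (chord (fst p) (sct (snd p)) r))"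

lemma continuous_cos_scat: "continuous_on A (%\<alpha>. cos (sct \<alpha>))"
  unfolding cos_scat using rho_pos
  by (intro continuous_intros continuous_rho) (auto simp: less_imp_neq[THEN not_sym])

text \<open>The domain of integration varies with \<alpha> and shrinks to a point at tangential
  vectors; rescaling it to [0, 1] leaves a parameter integral of a jointly continuous
  integrand.\<close>

lemma continuous_chord_integral:
  assumes "continuous_on (cball 0 1) F"
  shows "continuous_on influx_strip (chord_integral F)"
proof -
  have eq: "chord_integral F p = ((1 - \<kappa>\<^sup>2) / rho (snd p)) *\<^sub>R (2 * cos (sct (snd p))) *\<^sub>R
      integral (cbox 0 1) (%x. F (chord (fst p) (sct (snd p)) (2 * cos (sct (snd p)) * x)))"
    if p: "p \<in> influx_strip" for p
  proof -
    define L where "L = 2 * cos (sct (snd p))"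
    have L: "L \<ge> 0" using cos_scat_nonneg[of "snd p"] p by (auto simp: influx_strip_def L_def)
    have "integral {0..L} (%r. F (chord (fst p) (sct (snd p)) r))
       = L *\<^sub>R integral {0..1} (%x. F (chord (fst p) (sct (snd p)) (L * x)))"
    proof (cases "L = 0")
      case False
      have c: "continuous_on {0..L} (%r. F (chord (fst p) (sct (snd p)) r))"
        by (rule continuous_on_compose2[OF assms])
           (use norm_chord[of _ "sct (snd p)" "fst p"] in \<open>auto simp: L_def intro!: continuous_chord\<close>)
      have "((%x. L *\<^sub>R F (chord (fst p) (sct (snd p)) (L * x))) has_integral
         (integral {L * 0..L * 1} (%r. F (chord (fst p) (sct (snd p)) r)))) {0..1}"
        using L by (intro has_integral_substitution[where c = 0 and d = L])
          (auto intro!: derivative_eq_intros c simp: mult_left_le)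
      from integral_unique[OF this] show ?thesis by (simp only: integral_cmul mult_zero_right mult_1_right)
    qed simp
    then show ?thesis by (simp add: chord_integral_def L_def)
  qed
  have "continuous_on (influx_strip \<times> cbox 0 1)
     (%(p, x). F (chord (fst p) (sct (snd p)) (2 * cos (sct (snd p)) * x)))"
  proof -
    have "continuous_on (influx_strip \<times> cbox (0::real) 1)
       (%q. chord (fst (fst q)) (sct (snd (fst q))) (2 * cos (sct (snd (fst q))) * snd q))"
      unfolding chord_def cis_mult[symmetric] cis_scat
      by (intro continuous_intros continuous_on_compose2[OF continuous_cos_scat[of UNIV]]
            continuous_on_compose2[OF continuous_rho[of UNIV]])
         (use rho_pos in \<open>auto simp: less_imp_neq[THEN not_sym]\<close>)
    moreover have "(%q. chord (fst (fst q)) (sct (snd (fst q))) (2 * cos (sct (snd (fst q))) * snd q)) ` (influx_strip \<times> cbox 0 1) \<subseteq> cball 0 1"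
    proof (intro image_subsetI)
      fix q assume q: "q \<in> influx_strip \<times> cbox (0::real) 1"
      then have "cos (sct (snd (fst q))) \<ge> 0" "0 \<le> snd q" "snd q \<le> 1"
        using cos_scat_nonneg by (auto simp: influx_strip_def mem_Times_iff)
      then have "0 \<le> 2 * cos (sct (snd (fst q))) * snd q" "2 * cos (sct (snd (fst q))) * snd q \<le> 2 * cos (sct (snd (fst q)))"
        by (auto simp: mult_left_le)
      then show "chord (fst (fst q)) (sct (snd (fst q))) (2 * cos (sct (snd (fst q))) * snd q) \<in> cball 0 1"
        using norm_chord by simp
    qed
    ultimately show ?thesis unfolding case_prod_beta by (rule continuous_on_compose2[OF assms])
  qed
  then have "continuous_on influx_strip (%p. integral (cbox 0 1) (%x. F (chord (fst p) (sct (snd p)) (2 * cos (sct (snd p)) * x))))"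
    by (rule integral_continuous_on_param)
  then have "continuous_on influx_strip (%p. ((1 - \<kappa>\<^sup>2) / rho (snd p)) *\<^sub>R (2 * cos (sct (snd p))) *\<^sub>R
      integral (cbox 0 1) (%x. F (chord (fst p) (sct (snd p)) (2 * cos (sct (snd p)) * x))))"
    by (intro continuous_intros continuous_on_compose2[OF continuous_cos_scat[of UNIV]]
            continuous_on_compose2[OF continuous_rho[of UNIV]])
       (use rho_pos in \<open>auto simp: less_imp_neq[THEN not_sym]\<close>)
  then show ?thesis using eq by (simp cong: continuous_on_cong)
qed

text \<open>The antipodal vector runs through the same chord backwards, that is r becomes 2 cos s -
  r, and \<rho> is even in \<alpha>.\<close>

lemma chord_integral_antipodal:
  assumes F: "continuous_on (cball 0 1) F" and a: "\<bar>\<alpha>\<bar> \<le> pi/2"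
  shows "chord_integral F (antipodal_scattering \<kappa> (\<beta>, \<alpha>)) = chord_integral F (\<beta>, \<alpha>)"
proof -
  let ?s = "sct \<alpha>"
  have A: "antipodal_scattering \<kappa> (\<beta>, \<alpha>) = (\<beta> + pi + 2 * (?s + pi), - \<alpha>)"
    by (simp add: antipodal_scattering_def scattering_def scat_plus_pi)
  have flip: "chord (\<beta> + pi + 2 * (?s + pi)) (- ?s) (2 * cos ?s - r) = chord \<beta> ?s r" for r
  proof -
    have p: "cis (\<beta> + pi + 2 * (?s + pi)) = - (cis \<beta> * (cis ?s * cis ?s))"
      by (simp add: cis_mult) (simp add: complex_eq_iff algebra_simps cos_add sin_add)
    have "cis (\<beta> + pi + 2 * (?s + pi) + - ?s) = cis (\<beta> + pi + 2 * (?s + pi)) * cis (- ?s)"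
      by (simp only: cis_mult)
    also have "\<dots> = - (cis \<beta> * cis ?s)"
      unfolding p by (simp add: cis_mult add.commute)
    finally have q: "cis (\<beta> + pi + 2 * (?s + pi) + - ?s) = - (cis \<beta> * cis ?s)" .
    have c: "2 * complex_of_real (cos ?s) = cis ?s + cis (- ?s)" by (simp add: complex_eq_iff)
    have "cis ?s * cis (- ?s) = 1" by (simp add: cis_mult)
    then show ?thesis
      unfolding chord_def p q scaleR_conv_of_real of_real_diff of_real_mult of_real_numeral c
        cis_mult[of \<beta> ?s, symmetric]
      by (simp add: algebra_simps)
  qed
  define L where "L = 2 * cos ?s"
  have L: "L \<ge> 0" using cos_scat_nonneg[OF a] by (simp add: L_def)
  have "integral {0..L} (%r. F (chord (\<beta> + pi + 2 * (?s + pi)) (- ?s) r)) = integral {0..L} (%r. F (chord \<beta> ?s r))"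
  proof (cases "L = 0")
    case False
    let ?f = "%r. F (chord (\<beta> + pi + 2 * (?s + pi)) (- ?s) r)"
    have c: "continuous_on {0..L} ?f"
    proof (rule continuous_on_compose2[OF F continuous_chord], rule image_subsetI)
      fix r assume "r \<in> {0..L}"
      then show "chord (\<beta> + pi + 2 * (?s + pi)) (- ?s) r \<in> cball 0 1"
        unfolding mem_cball dist_0_norm by (intro norm_chord) (simp_all add: L_def)
    qed
    have "((%x. (- 1) *\<^sub>R ?f (L - x)) has_integral (integral {L - 0..L - L} ?f - integral {L - L..L - 0} ?f)) {0..L}"
    proof (rule has_integral_substitution_general[where s = "{}" and c = 0 and d = L])
      show "continuous_on {0..L} ?f" by (rule c)
    qed (use L in \<open>auto intro!: derivative_eq_intros continuous_intros\<close>)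
    from has_integral_neg[OF this] have "((%x. ?f (L - x)) has_integral (integral {0..L} ?f)) {0..L}"
      using False L by simp
    then have "integral {0..L} ?f = integral {0..L} (%x. ?f (L - x))" by (rule integral_unique[symmetric])
    then show ?thesis unfolding L_def flip by simp
  qed simp
  then show ?thesis
    unfolding A chord_integral_def by (simp add: rho_minus scat_minus L_def)
qed

end

section \<open>Square-integrable functions\<close>

lemma square_integrable_measurable: "square_integrable M u ==> u \<in> borel_measurable M"
  by (simp add: square_integrable_def)

lemma norm_mult_cnj_le: "norm (z * cnj w) \<le> (norm z)\<^sup>2 + (norm w)\<^sup>2"
proof -
  have "2 * (norm z * norm w) \<le> (norm z)\<^sup>2 + (norm w)\<^sup>2"
    using sum_squares_bound[of "norm z" "norm w"] by simp
  moreover have "0 \<le> norm z * norm w" by simp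
  ultimately have "norm z * norm w \<le> (norm z)\<^sup>2 + (norm w)\<^sup>2" by linarith
  then show ?thesis by (simp add: norm_mult)
qed

lemma square_integrable_inner:
  assumes "square_integrable M u" "square_integrable M w"
  shows "integrable M (%x. u x * cnj (w x))"
proof (rule Bochner_Integration.integrable_bound[where f = "%x. (norm (u x))\<^sup>2 + (norm (w x))\<^sup>2"])
  show "integrable M (%x. (norm (u x))\<^sup>2 + (norm (w x))\<^sup>2)"
    using assms by (auto simp: square_integrable_def)
  show "(%x. u x * cnj (w x)) \<in> borel_measurable M"
    using assms unfolding square_integrable_def
    by (intro borel_measurable_times borel_measurable_continuous_on[OF continuous_on_cnj[OF continuous_on_id]]) auto
  show "AE x in M. norm (u x * cnj (w x)) \<le> norm ((norm (u x))\<^sup>2 + (norm (w x))\<^sup>2)"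
    using norm_mult_cnj_le by (auto simp del: norm_mult complex_mod_cnj)
qed

lemma square_integrable_cmult:
  assumes "square_integrable M u" shows "square_integrable M (%x. c * u x)"
  using assms by (auto simp: square_integrable_def norm_mult power_mult_distrib)

lemma square_integrable_add:
  assumes "square_integrable M u" "square_integrable M w"
  shows "square_integrable M (%x. u x + w x)"
  unfolding square_integrable_def
proof
  show m: "(%x. u x + w x) \<in> borel_measurable M"
    using assms by (auto simp: square_integrable_def)
  show "integrable M (%x. (norm (u x + w x))\<^sup>2)"
  proof (rule Bochner_Integration.integrable_bound[where f = "%x. 2 * (norm (u x))\<^sup>2 + 2 * (norm (w x))\<^sup>2"])
    show "integrable M (%x. 2 * (norm (u x))\<^sup>2 + 2 * (norm (w x))\<^sup>2)"
      using assms by (auto simp: square_integrable_def)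
    show "(%x. (norm (u x + w x))\<^sup>2) \<in> borel_measurable M" using m by measurable
    have "(norm (a + b))\<^sup>2 \<le> 2 * (norm a)\<^sup>2 + 2 * (norm b)\<^sup>2" for a b :: complex
    proof -
      have "(norm (a + b))\<^sup>2 \<le> (norm a + norm b)\<^sup>2" by (intro power_mono norm_triangle_ineq) simp
      also have "\<dots> \<le> 2 * (norm a)\<^sup>2 + 2 * (norm b)\<^sup>2"
        using sum_squares_bound[of "norm a" "norm b"] by (simp add: power2_sum)
      finally show ?thesis .
    qed
    then show "AE x in M. norm ((norm (u x + w x))\<^sup>2) \<le> norm (2 * (norm (u x))\<^sup>2 + 2 * (norm (w x))\<^sup>2)"
      by auto
  qed
qed

lemma square_integrable_diff:
  assumes "square_integrable M u" "square_integrable M w"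
  shows "square_integrable M (%x. u x - w x)"
  using square_integrable_add[OF assms(1) square_integrable_cmult[OF assms(2), of "-1"]] by simp

lemma square_integrable_zero: "square_integrable M (%x. 0)"
  by (simp add: square_integrable_def)

lemma square_integrable_sum:
  "(!!i. i \<in> I ==> square_integrable M (g i)) ==> square_integrable M (%x. \<Sum>i\<in>I. g i x)"
  by (induction I rule: infinite_finite_induct)
     (simp_all add: square_integrable_zero square_integrable_add)

lemma square_integrable_bounded:
  assumes "finite_measure M" "u \<in> borel_measurable M" "!!x. x \<in> space M ==> norm (u x) \<le> B"
  shows "square_integrable M u"
  unfolding square_integrable_def
proof (intro conjI assms(2) finite_measure.integrable_const_bound[OF assms(1), where B = "B\<^sup>2"])
  show "AE x in M. norm ((norm (u x))\<^sup>2) \<le> B\<^sup>2"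
    using assms(3) by (auto intro!: AE_I2 power_mono)
  show "(%x. (norm (u x))\<^sup>2) \<in> borel_measurable M" using assms(2) by measurable
qed

lemma square_integrable_AE_cong:
  assumes "square_integrable M u" "w \<in> borel_measurable M" "AE x in M. u x = w x"
  shows "square_integrable M w"
proof -
  have "integrable M (%x. (norm (w x))\<^sup>2) \<longleftrightarrow> integrable M (%x. (norm (u x))\<^sup>2)"
    using assms by (intro integrable_cong_AE) (auto simp: square_integrable_def)
  then show ?thesis using assms by (simp add: square_integrable_def)
qed

lemma square_integrable_integrable:
  assumes "finite_measure M" "square_integrable M u"
  shows "integrable M u"
  using square_integrable_inner[OF assms(2) square_integrable_bounded[OF assms(1), of "%x. 1" 1]] by simp

lemma L2_norm_nonneg: "L2_norm M u \<ge> 0"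
  by (simp add: L2_norm_def)

lemma L2_norm_square: "(L2_norm M u)\<^sup>2 = integral\<^sup>L M (%x. (norm (u x))\<^sup>2)"
  by (simp add: L2_norm_def)

lemma L2_inner_self: "L2_inner M u u = of_real ((L2_norm M u)\<^sup>2)"
  unfolding L2_norm_square L2_inner_def complex_norm_square[symmetric]
  by (simp only: integral_complex_of_real[symmetric] of_real_power)

lemma L2_norm_cong_AE:
  assumes "AE x in M. u x = w x" "u \<in> borel_measurable M" "w \<in> borel_measurable M"
  shows "L2_norm M u = L2_norm M w"
  unfolding L2_norm_def using assms by (intro arg_cong[where f = sqrt] integral_cong_AE) auto

lemma L2_norm_cmult: "L2_norm M (%x. c * u x) = norm c * L2_norm M u"
  by (simp add: L2_norm_def norm_mult power_mult_distrib real_sqrt_mult)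

lemma L2_norm_minus_commute: "L2_norm M (%x. u x - w x) = L2_norm M (%x. w x - u x)"
  by (simp add: L2_norm_def norm_minus_commute)

lemma L2_norm_bounded:
  assumes "finite_measure M" "!!x. x \<in> space M ==> norm (u x) \<le> B" "0 \<le> B" "u \<in> borel_measurable M"
  shows "L2_norm M u \<le> B * sqrt (measure M (space M))"
proof -
  interpret finite_measure M by fact
  have sq: "square_integrable M u" by (rule square_integrable_bounded) fact+
  have "(L2_norm M u)\<^sup>2 \<le> integral\<^sup>L M (%x. B\<^sup>2)"
    unfolding L2_norm_square
  proof (rule integral_mono)
    show "integrable M (%x. (norm (u x))\<^sup>2)" using sq by (simp add: square_integrable_def)
    show "integrable M (%x. B\<^sup>2)" by simp
    show "(norm (u x))\<^sup>2 \<le> B\<^sup>2" if "x \<in> space M" for x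
      by (rule power_mono[OF assms(2)[OF that] norm_ge_zero])
  qed
  also have "\<dots> = B\<^sup>2 * measure M (space M)" by simp
  also have "\<dots> = (B * sqrt (measure M (space M)))\<^sup>2"
    by (simp only: power_mult_distrib real_sqrt_pow2[OF measure_nonneg])
  finally show ?thesis
    by (rule power2_le_imp_le) (simp add: assms(3))
qed

lemma L2_inner_commute: "L2_inner M w u = cnj (L2_inner M u w)"
proof -
  have "cnj (L2_inner M u w) = integral\<^sup>L M (%x. cnj (u x * cnj (w x)))"
    unfolding L2_inner_def by (rule Bochner_Integration.integral_cnj[symmetric])
  then show ?thesis by (simp add: L2_inner_def mult.commute)
qed

lemma L2_inner_add_left:
  assumes "square_integrable M u" "square_integrable M v" "square_integrable M w"
  shows "L2_inner M (%x. u x + v x) w = L2_inner M u w + L2_inner M v w"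
  unfolding L2_inner_def distrib_right
  by (rule Bochner_Integration.integral_add[OF square_integrable_inner square_integrable_inner]) fact+

lemma L2_inner_diff_left:
  assumes "square_integrable M u" "square_integrable M v" "square_integrable M w"
  shows "L2_inner M (%x. u x - v x) w = L2_inner M u w - L2_inner M v w"
  unfolding L2_inner_def left_diff_distrib
  by (rule Bochner_Integration.integral_diff[OF square_integrable_inner square_integrable_inner]) fact+

lemma L2_inner_cmult_left: "L2_inner M (%x. c * u x) w = c * L2_inner M u w"
  unfolding L2_inner_def mult.assoc by simp

lemma L2_inner_cmult_right: "L2_inner M u (%x. c * w x) = cnj c * L2_inner M u w"
  unfolding L2_inner_def by (simp add: mult.left_commute[of _ "cnj c"])

lemma L2_inner_diff_right:
  assumes "square_integrable M u" "square_integrable M v" "square_integrable M w"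
  shows "L2_inner M w (%x. u x - v x) = L2_inner M w u - L2_inner M w v"
  using L2_inner_diff_left[OF assms] by (metis L2_inner_commute complex_cnj_diff)

lemma L2_inner_sum_left:
  assumes "!!i. i \<in> I ==> square_integrable M (g i)" "square_integrable M w"
  shows "L2_inner M (%x. \<Sum>i\<in>I. g i x) w = (\<Sum>i\<in>I. L2_inner M (g i) w)"
  using assms
proof (induction I rule: infinite_finite_induct)
  case (insert i I)
  have "L2_inner M (%x. g i x + (\<Sum>i\<in>I. g i x)) w = L2_inner M (g i) w + L2_inner M (%x. \<Sum>i\<in>I. g i x) w"
    using insert by (intro L2_inner_add_left square_integrable_sum) auto
  then show ?case using insert by simp
qed (simp_all add: L2_inner_def)

lemma L2_inner_sum_right:
  assumes "!!i. i \<in> I ==> square_integrable M (g i)" "square_integrable M w"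
  shows "L2_inner M w (%x. \<Sum>i\<in>I. g i x) = (\<Sum>i\<in>I. L2_inner M w (g i))"
proof -
  have "L2_inner M w (%x. \<Sum>i\<in>I. g i x) = cnj (\<Sum>i\<in>I. L2_inner M (g i) w)"
    by (subst L2_inner_commute) (simp only: L2_inner_sum_left[OF assms])
  also have "\<dots> = (\<Sum>i\<in>I. L2_inner M w (g i))"
    by (simp add: cnj_sum L2_inner_commute[symmetric])
  finally show ?thesis .
qed

lemma L2_norm_diff_square:
  assumes u: "square_integrable M u" and w: "square_integrable M w"
  shows "(L2_norm M (%x. u x - w x))\<^sup>2 = (L2_norm M u)\<^sup>2 - 2 * Re (L2_inner M u w) + (L2_norm M w)\<^sup>2"
proof -
  note d = square_integrable_diff[OF u w]
  have "L2_inner M (%x. u x - w x) (%x. u x - w x)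
    = L2_inner M u u - L2_inner M u w - (L2_inner M w u - L2_inner M w w)"
    by (simp add: L2_inner_diff_left[OF u w d] L2_inner_diff_right[OF u w u] L2_inner_diff_right[OF u w w])
  from arg_cong[OF this, of Re] show ?thesis
    unfolding L2_inner_self L2_inner_commute[of M w u] by (simp del: of_real_power)
qed

lemma L2_cauchy_schwarz:
  assumes u: "square_integrable M u" and w: "square_integrable M w"
  shows "norm (L2_inner M u w) \<le> L2_norm M u * L2_norm M w"
proof (cases "L2_inner M u w = 0")
  case True then show ?thesis by (simp add: L2_norm_nonneg)
next
  case False
  define z where "z = L2_inner M u w"
  define a where "a = L2_norm M u"
  define b where "b = L2_norm M w"
  have z: "norm z > 0" using False by (simp add: z_def)
  \<comment> \<open>Expansion of the squared norm of u - t z w with z the inner product of u and w;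
    the factor z makes the cross term real, so a real parameter t suffices.\<close>
  have key: "0 \<le> a\<^sup>2 - 2 * t * (norm z)\<^sup>2 + t\<^sup>2 * (norm z)\<^sup>2 * b\<^sup>2" for t :: real
  proof -
    have "0 \<le> (L2_norm M (%x. u x - (of_real t * z) * w x))\<^sup>2" by simp
    also have "\<dots> = a\<^sup>2 - 2 * Re (L2_inner M u (%x. (of_real t * z) * w x)) + (norm (of_real t * z) * b)\<^sup>2"
      unfolding L2_norm_diff_square[OF u square_integrable_cmult[OF w]] L2_norm_cmult a_def b_def ..
    also have "L2_inner M u (%x. (of_real t * z) * w x) = of_real (t * (norm z)\<^sup>2)"
    proof -
      have "cnj (of_real t * z) * z = of_real t * (z * cnj z)" by simp
      then show ?thesis unfolding L2_inner_cmult_right z_def[symmetric] complex_norm_square[symmetric] by simp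
    qed
    also have "(norm (of_real t * z) * b)\<^sup>2 = t\<^sup>2 * (norm z)\<^sup>2 * b\<^sup>2"
      by (simp add: norm_mult power_mult_distrib)
    finally show ?thesis by (simp only: Re_complex_of_real mult.assoc)
  qed
  have "norm z \<le> a * b"
  proof (cases "b = 0")
    case True
    \<comment> \<open>For b = 0 the quadratic in t degenerates to a decreasing affine function; this
      t drives it to -a^2 - 2.\<close>
    have "0 \<le> a\<^sup>2 - 2 * ((a\<^sup>2 + 1) / (norm z)\<^sup>2) * (norm z)\<^sup>2" using key[of "(a\<^sup>2 + 1) / (norm z)\<^sup>2"] True by simp
    also have "\<dots> = - a\<^sup>2 - 2" using z by simp
    finally have False using zero_le_power2[of a] by linarith
    then show ?thesis ..
  next
    case False
    then have b: "b > 0" using L2_norm_nonneg[of M w] by (simp add: b_def)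
    have "0 \<le> a\<^sup>2 - 2 * (1 / b\<^sup>2) * (norm z)\<^sup>2 + (1 / b\<^sup>2)\<^sup>2 * (norm z)\<^sup>2 * b\<^sup>2" by (rule key)
    also have "(1 / b\<^sup>2)\<^sup>2 * (norm z)\<^sup>2 * b\<^sup>2 = (1 / b\<^sup>2) * (norm z)\<^sup>2"
      using b by (simp add: power2_eq_square)
    finally have "(1 / b\<^sup>2) * (norm z)\<^sup>2 \<le> a\<^sup>2" by simp
    then have "(norm z)\<^sup>2 \<le> (a * b)\<^sup>2" using b by (simp add: power_mult_distrib pos_divide_le_eq)
    then show ?thesis using L2_norm_nonneg[of M u] b by - (erule power2_le_imp_le, simp add: a_def)
  qed
  then show ?thesis by (simp add: z_def a_def b_def)
qed

lemma L2_triangle: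
  assumes u: "square_integrable M u" and w: "square_integrable M w"
  shows "L2_norm M (%x. u x - w x) \<le> L2_norm M u + L2_norm M w"
proof (rule power2_le_imp_le)
  have "\<bar>Re (L2_inner M u w)\<bar> \<le> L2_norm M u * L2_norm M w"
    using L2_cauchy_schwarz[OF u w] abs_Re_le_cmod order_trans by blast
  then show "(L2_norm M (%x. u x - w x))\<^sup>2 \<le> (L2_norm M u + L2_norm M w)\<^sup>2"
    unfolding L2_norm_diff_square[OF u w] by (simp add: power2_sum abs_le_iff)
qed (simp add: L2_norm_nonneg)

lemma L2_triangle3:
  assumes "square_integrable M u" "square_integrable M v" "square_integrable M w"
  shows "L2_norm M (%x. u x - w x) \<le> L2_norm M (%x. u x - v x) + L2_norm M (%x. v x - w x)"
proof -
  have "L2_norm M (%x. (u x - v x) - (w x - v x)) \<le> L2_norm M (%x. u x - v x) + L2_norm M (%x. w x - v x)"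
    by (rule L2_triangle[OF square_integrable_diff[OF assms(1,2)] square_integrable_diff[OF assms(3,2)]])
  then show ?thesis unfolding L2_norm_minus_commute[of M w v] by simp
qed

lemma L2_norm_zero_AE:
  assumes "square_integrable M u" "L2_norm M u = 0"
  shows "AE x in M. u x = 0"
proof -
  have "integral\<^sup>L M (%x. (norm (u x))\<^sup>2) = 0" using assms(2) L2_norm_square[of M u] by simp
  then have "AE x in M. (norm (u x))\<^sup>2 = 0"
    using assms(1) by (subst (asm) integral_nonneg_eq_0_iff_AE) (auto simp: square_integrable_def)
  then show ?thesis by simp
qed

lemma L2_limit_inner:
  assumes "!!n. square_integrable M (f n)" "square_integrable M g" "square_integrable M w"
    and "(%n. L2_norm M (%x. g x - f n x)) \<longlonglongrightarrow> 0"
  shows "(%n. L2_inner M (f n) w) \<longlonglongrightarrow> L2_inner M g w"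
proof -
  have "(%n. L2_inner M g w - L2_inner M (f n) w) \<longlonglongrightarrow> 0"
  proof (rule Lim_null_comparison)
    show "\<forall>\<^sub>F n in sequentially. norm (L2_inner M g w - L2_inner M (f n) w)
       \<le> L2_norm M (%x. g x - f n x) * L2_norm M w"
      using L2_cauchy_schwarz[OF square_integrable_diff[OF assms(2,1)] assms(3)]
      by (simp add: L2_inner_diff_left[OF assms(2,1,3)])
    show "(%n. L2_norm M (%x. g x - f n x) * L2_norm M w) \<longlonglongrightarrow> 0"
      using tendsto_mult_right[OF assms(4), of "L2_norm M w"] by simp
  qed
  from tendsto_diff[OF tendsto_const[of "L2_inner M g w"] this] show ?thesis by simp
qed

lemma L2_limit_unique:
  assumes "!!n. square_integrable M (f n)" "square_integrable M g" "square_integrable M h"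
    and "(%n. L2_norm M (%x. g x - f n x)) \<longlonglongrightarrow> 0" "(%n. L2_norm M (%x. h x - f n x)) \<longlonglongrightarrow> 0"
  shows "AE x in M. g x = h x"
proof -
  have "L2_norm M (%x. g x - h x) \<le> L2_norm M (%x. g x - f n x) + L2_norm M (%x. h x - f n x)" for n
    using L2_triangle3[OF assms(2,1,3), of n] L2_norm_minus_commute[of M h "f n"] by simp
  moreover have "(%n. L2_norm M (%x. g x - f n x) + L2_norm M (%x. h x - f n x)) \<longlonglongrightarrow> 0"
    using tendsto_add[OF assms(4,5)] by simp
  ultimately have "L2_norm M (%x. g x - h x) \<le> 0"
    by (intro LIMSEQ_le_const) auto
  then have "L2_norm M (%x. g x - h x) = 0" using L2_norm_nonneg by (intro order_antisym)
  from L2_norm_zero_AE[OF square_integrable_diff[OF assms(2,3)] this] show ?thesis by simp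
qed

text \<open>Riesz--Fischer: a fast subsequence converges almost everywhere, because the weighted sum of
  squares of its increments has finite integral; Fatou's lemma identifies the limit.\<close>

lemma summable_sqrt_geometric: "summable (%k. c * (1 / sqrt 2) ^ k)" for c :: real
  by (intro summable_mult summable_geometric) simp

lemma L2_complete:
  fixes f :: "nat => 'a => complex"
  assumes f: "!!n. square_integrable M (f n)"
    and cauchy: "!!e. e > 0 ==> \<exists>N. \<forall>m\<ge>N. \<forall>n\<ge>N. L2_norm M (%x. f m x - f n x) < e"
  shows "\<exists>g. square_integrable M g \<and> (%n. L2_norm M (%x. g x - f n x)) \<longlonglongrightarrow> 0"
proof -
  have meas [measurable]: "f n \<in> borel_measurable M" for n using f by (simp add: square_integrable_def)
  have "\<exists>N. \<forall>k. \<forall>m\<ge>N k. \<forall>n\<ge>N k. L2_norm M (%x. f m x - f n x) < (1/2) ^ k"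
    by (rule choice, rule allI, rule cauchy) simp
  then obtain N where N: "!!k m n. m \<ge> N k ==> n \<ge> N k ==> L2_norm M (%x. f m x - f n x) < (1/2) ^ k"
    by blast
  \<comment> \<open>Summing all thresholds, plus k, makes r strictly increasing and keeps it above
    each N k.\<close>
  define r where "r k = (\<Sum>j\<le>k. N j) + k" for k
  have rN: "r k \<ge> N k" for k unfolding r_def by (simp add: trans_le_add1 member_le_sum)
  have r_mono: "r k < r (Suc k)" for k by (simp add: r_def)
  have rk: "r k \<ge> k" for k by (simp add: r_def)
  have rN': "r (Suc k) \<ge> N k" for k using rN[of k] r_mono[of k] by linarith
  define d where "d k x = f (r (Suc k)) x - f (r k) x" for k x
  have [measurable]: "d k \<in> borel_measurable M" for k unfolding d_def by measurable
  have nn: "(\<integral>\<^sup>+ x. ennreal ((norm (u x))\<^sup>2) \<partial>M) = ennreal ((L2_norm M u)\<^sup>2)" if "square_integrable M u" for u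
    unfolding L2_norm_square using that by (intro nn_integral_eq_integral) (auto simp: square_integrable_def)
  have sqd: "square_integrable M (%x. f m x - f n x)" for m n by (rule square_integrable_diff[OF f f])
  \<comment> \<open>The rate 4^{-k} leaves room for the weight 2^k: the weighted sum still converges
    like a geometric series, and pointwise finiteness of that sum forces increments of size
    2^{-k/2}.\<close>
  have dsmall: "(\<integral>\<^sup>+ x. ennreal ((norm (d k x))\<^sup>2) \<partial>M) \<le> ennreal ((1/4) ^ k)" for k
  proof -
    have "(L2_norm M (d k))\<^sup>2 \<le> ((1/2) ^ k)\<^sup>2"
      using N[OF rN'[of k] rN[of k]] unfolding d_def by (intro power_mono L2_norm_nonneg) simp
    also have "((1/2) ^ k)\<^sup>2 = (1/4 :: real) ^ k" by (simp add: power_divide power2_eq_square flip: power_mult_distrib)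
    finally show ?thesis
      using nn[OF sqd[of "r (Suc k)" "r k"]] unfolding d_def by (simp add: ennreal_leI)
  qed
  have "(\<integral>\<^sup>+ x. (\<Sum>k. ennreal (2 ^ k * (norm (d k x))\<^sup>2)) \<partial>M) = (\<Sum>k. \<integral>\<^sup>+ x. ennreal (2 ^ k * (norm (d k x))\<^sup>2) \<partial>M)"
    by (intro nn_integral_suminf) measurable
  also have "\<dots> \<le> (\<Sum>k. ennreal ((1/2) ^ k))"
  proof (intro suminf_le summableI)
    fix k
    have "(\<integral>\<^sup>+ x. ennreal (2 ^ k * (norm (d k x))\<^sup>2) \<partial>M) = ennreal (2 ^ k) * (\<integral>\<^sup>+ x. ennreal ((norm (d k x))\<^sup>2) \<partial>M)"
      by (simp add: ennreal_mult nn_integral_cmult)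
    also have "\<dots> \<le> ennreal (2 ^ k) * ennreal ((1/4) ^ k)" by (intro mult_left_mono dsmall) simp
    also have "\<dots> = ennreal ((1/2) ^ k)"
      by (simp add: ennreal_mult[symmetric] power_mult_distrib[symmetric])
    finally show "(\<integral>\<^sup>+ x. ennreal (2 ^ k * (norm (d k x))\<^sup>2) \<partial>M) \<le> ennreal ((1/2) ^ k)" .
  qed
  also have "(\<Sum>k. ennreal ((1/2) ^ k)) = ennreal (\<Sum>k. (1/2) ^ k)"
    by (rule suminf_ennreal2) (simp_all add: summable_geometric)
  also have "\<dots> < \<infinity>" by simp
  finally have fin: "(\<integral>\<^sup>+ x. (\<Sum>k. ennreal (2 ^ k * (norm (d k x))\<^sup>2)) \<partial>M) < \<infinity>" .
  have "AE x in M. (\<Sum>k. ennreal (2 ^ k * (norm (d k x))\<^sup>2)) ~= \<infinity>"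
  proof (rule nn_integral_PInf_AE)
    have "(%x. ennreal (2 ^ k * (norm (d k x))\<^sup>2)) \<in> borel_measurable M" for k by measurable
    then show "(%x. \<Sum>k. ennreal (2 ^ k * (norm (d k x))\<^sup>2)) \<in> borel_measurable M"
      by (rule borel_measurable_suminf_order)
    show "(\<integral>\<^sup>+ x. (\<Sum>k. ennreal (2 ^ k * (norm (d k x))\<^sup>2)) \<partial>M) ~= \<infinity>"
      using fin by (rule less_imp_neq)
  qed
  then have "AE x in M. convergent (%k. f (r k) x)"
  proof eventually_elim
    fix x assume fx: "(\<Sum>k. ennreal (2 ^ k * (norm (d k x))\<^sup>2)) ~= \<infinity>"
    define S where "S = enn2real (\<Sum>k. ennreal (2 ^ k * (norm (d k x))\<^sup>2))"
    have S0: "0 \<le> S" unfolding S_def by (rule enn2real_nonneg)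
    have S: "(\<Sum>k. ennreal (2 ^ k * (norm (d k x))\<^sup>2)) = ennreal S"
      unfolding S_def
      by (rule ennreal_enn2real[symmetric], rule less_top[THEN iffD1], rule fx[unfolded infinity_ennreal_def])
    have bound: "norm (d k x) \<le> sqrt S * (1 / sqrt 2) ^ k" for k
    proof -
      have "ennreal (2 ^ k * (norm (d k x))\<^sup>2) \<le> (\<Sum>k. ennreal (2 ^ k * (norm (d k x))\<^sup>2))"
        (is "?F k \<le> suminf ?F")
      proof -
        have "sum ?F {k} \<le> suminf ?F" by (rule sum_le_suminf[OF summableI]) (rule finite.intros, rule finite.intros, rule zero_le)
        moreover have "sum ?F {k} = ?F k" by (subst sum.insert) (rule finite.intros, simp_all only: empty_iff not_False_eq_True sum.empty add_0_right)
        ultimately show ?thesis by (simp only:)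
      qed
      then have "2 ^ k * (norm (d k x))\<^sup>2 \<le> S" unfolding S ennreal_le_iff[OF S0] .
      then have "(norm (d k x))\<^sup>2 \<le> S / 2 ^ k" by (simp add: pos_le_divide_eq mult.commute)
      then have "sqrt ((norm (d k x))\<^sup>2) \<le> sqrt (S / 2 ^ k)" by (rule real_sqrt_le_mono)
      then show ?thesis by (simp add: real_sqrt_divide real_sqrt_power power_divide)
    qed
    have "summable (%k. d k x)"
      by (rule summable_comparison_test'[OF summable_sqrt_geometric[of "sqrt S"], of 0]) (use bound in simp)
    then have "convergent (%n. \<Sum>k<n. d k x)" by (simp add: summable_iff_convergent)
    moreover have "(%n. \<Sum>k<n. d k x) = (%n. f (r n) x - f (r 0) x)"
      unfolding d_def by (rule ext) (rule sum_lessThan_telescope[where f = "%k. f (r k) x"])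
    ultimately have "convergent (%n. (f (r n) x - f (r 0) x) + f (r 0) x)"
      by (intro convergent_add convergent_const) simp
    then show "convergent (%k. f (r k) x)" by simp
  qed
  then have ae: "AE x in M. (%k. f (r k) x) \<longlonglongrightarrow> lim (%k. f (r k) x)"
    by eventually_elim (rule iffD1[OF convergent_LIMSEQ_iff])
  define g where "g x = lim (%k. f (r k) x)" for x
  have g [measurable]: "g \<in> borel_measurable M" unfolding g_def by measurable
  have fatou: "(\<integral>\<^sup>+ x. ennreal ((norm (g x - f n x))\<^sup>2) \<partial>M) \<le> ennreal (((1/2) ^ j)\<^sup>2)" if n: "n \<ge> N j" for n j
  proof -
    have "(\<integral>\<^sup>+ x. ennreal ((norm (g x - f n x))\<^sup>2) \<partial>M) = (\<integral>\<^sup>+ x. liminf (%k. ennreal ((norm (f (r k) x - f n x))\<^sup>2)) \<partial>M)"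
    proof (intro nn_integral_cong_AE)
      show "AE x in M. ennreal ((norm (g x - f n x))\<^sup>2) = liminf (%k. ennreal ((norm (f (r k) x - f n x))\<^sup>2))"
        using ae
      proof eventually_elim
        fix x assume "(%k. f (r k) x) \<longlonglongrightarrow> lim (%k. f (r k) x)"
        then have "(%k. ennreal ((norm (f (r k) x - f n x))\<^sup>2)) \<longlonglongrightarrow> ennreal ((norm (g x - f n x))\<^sup>2)"
          unfolding g_def by (intro tendsto_ennrealI tendsto_power tendsto_norm tendsto_diff tendsto_const)
        then show "ennreal ((norm (g x - f n x))\<^sup>2) = liminf (%k. ennreal ((norm (f (r k) x - f n x))\<^sup>2))"
          by (intro lim_imp_Liminf[symmetric]) (rule trivial_limit_sequentially)
      qed
    qed
    also have "\<dots> \<le> liminf (%k. \<integral>\<^sup>+ x. ennreal ((norm (f (r k) x - f n x))\<^sup>2) \<partial>M)"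
      by (intro nn_integral_liminf) measurable
    also have "\<dots> \<le> ennreal (((1/2) ^ j)\<^sup>2)"
    proof (rule Liminf_le)
      show "\<forall>\<^sub>F k in sequentially. (\<integral>\<^sup>+ x. ennreal ((norm (f (r k) x - f n x))\<^sup>2) \<partial>M) \<le> ennreal (((1/2) ^ j)\<^sup>2)"
        using eventually_ge_at_top[of "N j"]
      proof eventually_elim
        fix k assume "N j \<le> k"
        then have "N j \<le> r k" using rk[of k] by linarith
        then have "L2_norm M (%x. f (r k) x - f n x) < (1/2) ^ j" using N n by blast
        then have "(L2_norm M (%x. f (r k) x - f n x))\<^sup>2 \<le> ((1/2) ^ j)\<^sup>2"
          by (intro power_mono L2_norm_nonneg) simp
        then show "(\<integral>\<^sup>+ x. ennreal ((norm (f (r k) x - f n x))\<^sup>2) \<partial>M) \<le> ennreal (((1/2) ^ j)\<^sup>2)"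
          unfolding nn[OF sqd] by (rule ennreal_leI)
      qed
    qed simp
    finally show ?thesis .
  qed
  have gf: "square_integrable M (%x. g x - f n x) \<and> L2_norm M (%x. g x - f n x) \<le> (1/2) ^ j" if n: "n \<ge> N j" for n j
  proof -
    have int: "integrable M (%x. (norm (g x - f n x))\<^sup>2)"
    proof (rule integrableI_nonneg)
      show "(%x. (norm (g x - f n x))\<^sup>2) \<in> borel_measurable M" by measurable
      show "(\<integral>\<^sup>+ x. ennreal ((norm (g x - f n x))\<^sup>2) \<partial>M) < \<infinity>"
        by (rule le_less_trans[OF fatou[OF n]]) simp
    qed simp
    then have sq: "square_integrable M (%x. g x - f n x)" by (simp add: square_integrable_def)
    have "(L2_norm M (%x. g x - f n x))\<^sup>2 \<le> ((1/2) ^ j)\<^sup>2"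
      using fatou[OF n] unfolding nn[OF sq] by (simp add: ennreal_le_iff)
    then show ?thesis using sq by - (rule conjI, assumption, erule power2_le_imp_le, simp)
  qed
  have "square_integrable M g"
    using square_integrable_add[OF conjunct1[OF gf[OF order_refl]] f, of 0 "N 0"] by simp
  moreover have "(%n. L2_norm M (%x. g x - f n x)) \<longlonglongrightarrow> 0"
  proof (rule LIMSEQ_I)
    fix e :: real assume "0 < e"
    then obtain j where j: "(1/2 :: real) ^ j < e" using real_arch_pow_inv[of e "1/2"] by auto
    show "\<exists>no. \<forall>n\<ge>no. norm (L2_norm M (%x. g x - f n x) - 0) < e"
    proof (intro exI[of _ "N j"] allI impI)
      fix n assume "N j \<le> n"
      then show "norm (L2_norm M (%x. g x - f n x) - 0) < e"
        using conjunct2[OF gf[of j n]] j L2_norm_nonneg[of M "%x. g x - f n x"] by simp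
    qed
  qed
  ultimately show ?thesis by blast
qed

lemma L2_norm_orthogonal_sum:
  assumes "finite I" "!!i. i \<in> I ==> square_integrable M (g i)"
    and "!!i j. i \<in> I ==> j \<in> I ==> i ~= j ==> L2_inner M (g i) (g j) = 0"
  shows "(L2_norm M (%x. \<Sum>i\<in>I. g i x))\<^sup>2 = (\<Sum>i\<in>I. (L2_norm M (g i))\<^sup>2)"
proof -
  have "L2_inner M (%x. \<Sum>i\<in>I. g i x) (%x. \<Sum>j\<in>I. g j x) = (\<Sum>i\<in>I. \<Sum>j\<in>I. L2_inner M (g i) (g j))"
    using assms(2) by (simp add: L2_inner_sum_left L2_inner_sum_right square_integrable_sum)
  also have "\<dots> = (\<Sum>i\<in>I. L2_inner M (g i) (g i))"
  proof (intro sum.cong refl)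
    fix i assume i: "i \<in> I"
    have "(\<Sum>j\<in>I. L2_inner M (g i) (g j)) = (\<Sum>j\<in>I. if j = i then L2_inner M (g i) (g i) else 0)"
      using assms(3) i by (intro sum.cong) auto
    then show "(\<Sum>j\<in>I. L2_inner M (g i) (g j)) = L2_inner M (g i) (g i)" using assms(1) i by simp
  qed
  also have "\<dots> = of_real (\<Sum>i\<in>I. (L2_norm M (g i))\<^sup>2)" by (simp only: L2_inner_self of_real_sum)
  finally show ?thesis unfolding L2_inner_self by (simp only: of_real_eq_iff)
qed

lemma L2_bessel:
  assumes "finite I" "!!i. i \<in> I ==> square_integrable M (g i)" and w: "square_integrable M w"
    and orth: "!!i j. i \<in> I ==> j \<in> I ==> i ~= j ==> L2_inner M (g i) (g j) = 0"
    and proj: "!!i. i \<in> I ==> L2_inner M w (g i) = of_real ((L2_norm M (g i))\<^sup>2)"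
  shows "(\<Sum>i\<in>I. (L2_norm M (g i))\<^sup>2) \<le> (L2_norm M w)\<^sup>2"
proof -
  let ?s = "\<Sum>i\<in>I. (L2_norm M (g i))\<^sup>2"
  have sq: "square_integrable M (%x. \<Sum>i\<in>I. g i x)" using assms(2) by (rule square_integrable_sum)
  have i: "L2_inner M w (%x. \<Sum>i\<in>I. g i x) = of_real ?s"
    unfolding of_real_sum using L2_inner_sum_right[of I M g w] assms(2) w proj by simp
  have n: "(L2_norm M (%x. \<Sum>i\<in>I. g i x))\<^sup>2 = ?s"
    by (rule L2_norm_orthogonal_sum[OF assms(1,2) orth])
  have "0 \<le> (L2_norm M (%x. w x - (\<Sum>i\<in>I. g i x)))\<^sup>2" by simp
  then show ?thesis
    unfolding L2_norm_diff_square[OF w sq] i n Re_complex_of_real by linarith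
qed

text \<open>The squared norms of the partial sums increase and are bounded, hence form a Cauchy
  sequence, and by orthogonality they measure the distance between partial sums. Exhausting finite
  sets replace an enumeration so that modes and pairs of frequencies can both serve as
  indices.\<close>

lemma L2_orthogonal_series:
  fixes F :: "nat => 'i set"
  assumes fin: "!!N. finite (F N)" and mono: "!!N N'. N \<le> N' ==> F N \<subseteq> F N'"
    and g: "!!i. square_integrable M (g i)"
    and orth: "!!i j. i ~= j ==> L2_inner M (g i) (g j) = 0"
    and bound: "!!N. (\<Sum>i\<in>F N. (L2_norm M (g i))\<^sup>2) \<le> B"
  shows "\<exists>h. square_integrable M h \<and> (%N. L2_norm M (%x. h x - (\<Sum>i\<in>F N. g i x))) \<longlonglongrightarrow> 0"
proof (rule L2_complete)
  show "square_integrable M (%x. \<Sum>i\<in>F n. g i x)" for n using g by (rule square_integrable_sum)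
  define s where "s N = (\<Sum>i\<in>F N. (L2_norm M (g i))\<^sup>2)" for N
  have smono: "s m \<le> s n" if "m \<le> n" for m n
    unfolding s_def using fin mono[OF that] by (intro sum_mono2) auto
  have diff: "(L2_norm M (%x. (\<Sum>i\<in>F n. g i x) - (\<Sum>i\<in>F m. g i x)))\<^sup>2 = s n - s m" if "m \<le> n" for m n
  proof -
    have "(\<Sum>i\<in>F n. g i x) - (\<Sum>i\<in>F m. g i x) = (\<Sum>i\<in>F n - F m. g i x)" for x
      using fin mono[OF that] by (simp add: sum_diff)
    then have "(L2_norm M (%x. (\<Sum>i\<in>F n. g i x) - (\<Sum>i\<in>F m. g i x)))\<^sup>2 = (\<Sum>i\<in>F n - F m. (L2_norm M (g i))\<^sup>2)"
      using fin g orth by (simp add: L2_norm_orthogonal_sum)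
    then show ?thesis unfolding s_def using fin mono[OF that] by (simp add: sum_diff)
  qed
  have "Bseq s" by (intro BseqI'[of _ "B"]) (use bound in \<open>auto simp: s_def sum_nonneg\<close>)
  then have "convergent s" by (rule Bseq_mono_convergent) (use smono in auto)
  then have cau: "Cauchy s" by (rule convergent_Cauchy)
  fix e :: real assume e: "0 < e"
  then have "0 < e\<^sup>2" by simp
  then obtain N where N: "!!m n. m \<ge> N ==> n \<ge> N ==> dist (s m) (s n) < e\<^sup>2"
    using cau unfolding Cauchy_def by blast
  have lt: "L2_norm M (%x. (\<Sum>i\<in>F n. g i x) - (\<Sum>i\<in>F m. g i x)) < e" if "N \<le> m" "m \<le> n" for m n
  proof -
    have "(L2_norm M (%x. (\<Sum>i\<in>F n. g i x) - (\<Sum>i\<in>F m. g i x)))\<^sup>2 < e\<^sup>2"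
      unfolding diff[OF that(2)] using N[of m n] that by (simp add: dist_real_def)
    then show ?thesis using e by (simp add: power_less_imp_less_base)
  qed
  show "\<exists>N. \<forall>m\<ge>N. \<forall>n\<ge>N. L2_norm M (%x. (\<Sum>i\<in>F m. g i x) - (\<Sum>i\<in>F n. g i x)) < e"
  proof (intro exI[of _ N] allI impI)
    fix m n assume "N \<le> m" "N \<le> n"
    then show "L2_norm M (%x. (\<Sum>i\<in>F m. g i x) - (\<Sum>i\<in>F n. g i x)) < e"
      using lt[of m n] lt[of n m] L2_norm_minus_commute[of M "%x. \<Sum>i\<in>F m. g i x"]
      by (cases "m \<le> n") auto
  qed
qed

section \<open>The boundary measure\<close>

lemma nn_integral_periodic_shift_aux:
  fixes f :: "real => ennreal"
  assumes f [measurable]: "f \<in> borel_measurable borel" and T: "T > 0" and per: "!!x. f (x + T) = f x"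
    and c: "0 \<le> c" "c < T"
  shows "(\<integral>\<^sup>+ x. f (x + c) * indicator {a..<a + T} x \<partial>lborel) = (\<integral>\<^sup>+ x. f x * indicator {a..<a + T} x \<partial>lborel)"
proof -
  have shift: "(\<integral>\<^sup>+ x. g (x + t) \<partial>lborel) = (\<integral>\<^sup>+ x. g x \<partial>lborel)" if "g \<in> borel_measurable borel" for g :: "real => ennreal" and t
    using nn_integral_real_affine[of g 1 t] that by (simp add: add.commute)
  have "(\<integral>\<^sup>+ x. f (x + c) * indicator {a..<a + T} x \<partial>lborel)
      = (\<integral>\<^sup>+ x. (%y. f y * indicator {a + c..<a + c + T} y) (x + c) \<partial>lborel)"
    by (intro nn_integral_cong) (auto split: split_indicator)
  also have "\<dots> = (\<integral>\<^sup>+ y. f y * indicator {a + c..<a + c + T} y \<partial>lborel)"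
    by (rule shift) measurable
  also have "\<dots> = (\<integral>\<^sup>+ y. f y * indicator {a + c..<a + T} y + f y * indicator {a + T..<a + c + T} y \<partial>lborel)"
    using c by (intro nn_integral_cong) (auto split: split_indicator)
  also have "\<dots> = (\<integral>\<^sup>+ y. f y * indicator {a + c..<a + T} y \<partial>lborel) + (\<integral>\<^sup>+ y. f y * indicator {a + T..<a + c + T} y \<partial>lborel)"
    by (rule nn_integral_add) measurable
  also have "(\<integral>\<^sup>+ y. f y * indicator {a + T..<a + c + T} y \<partial>lborel)
      = (\<integral>\<^sup>+ y. (%y. f y * indicator {a + T..<a + c + T} y) (y + T) \<partial>lborel)"
    by (rule shift[symmetric]) measurable
  also have "\<dots> = (\<integral>\<^sup>+ y. f y * indicator {a..<a + c} y \<partial>lborel)"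
    by (intro nn_integral_cong) (auto simp: per split: split_indicator)
  also have "(\<integral>\<^sup>+ y. f y * indicator {a + c..<a + T} y \<partial>lborel) + (\<integral>\<^sup>+ y. f y * indicator {a..<a + c} y \<partial>lborel)
      = (\<integral>\<^sup>+ y. f y * indicator {a + c..<a + T} y + f y * indicator {a..<a + c} y \<partial>lborel)"
    by (rule nn_integral_add[symmetric]) measurable
  also have "\<dots> = (\<integral>\<^sup>+ y. f y * indicator {a..<a + T} y \<partial>lborel)"
    using c by (intro nn_integral_cong) (auto split: split_indicator)
  finally show ?thesis .
qed

lemma periodic_int_mult:
  assumes "!!x :: real. f (x + T) = f x"
  shows "f (x + of_int n * T) = f x"
proof (induction n rule: int_induct[where k=0])
  case (step1 i)
  have "f (x + of_int (i + 1) * T) = f ((x + of_int i * T) + T)" by (simp add: algebra_simps)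
  then show ?case using step1 by (simp only: assms)
next
  case (step2 i)
  have "f (x + of_int i * T) = f ((x + of_int (i - 1) * T) + T)" by (simp add: algebra_simps)
  then show ?case using step2 by (simp only: assms)
qed simp

lemma nn_integral_periodic_shift:
  fixes f :: "real => ennreal"
  assumes f: "f \<in> borel_measurable borel" and T: "T > 0" and per: "!!x. f (x + T) = f x"
  shows "(\<integral>\<^sup>+ x. f (x + c) * indicator {a..<a + T} x \<partial>lborel) = (\<integral>\<^sup>+ x. f x * indicator {a..<a + T} x \<partial>lborel)"
proof -
  define n where "n = \<lfloor>c / T\<rfloor>"
  define c' where "c' = c - of_int n * T"
  have "of_int n \<le> c / T" "c / T < of_int n + 1" unfolding n_def by linarith+
  then have c': "0 \<le> c'" "c' < T" using T by (simp_all add: c'_def field_simps)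
  have "f (x + c) = f (x + c')" for x
    using periodic_int_mult[of f T "x + c'" n, OF per] by (simp add: c'_def algebra_simps)
  then show ?thesis using nn_integral_periodic_shift_aux[OF f T per c', of a] by simp
qed

lemma nn_integral_periodic_affine:
  fixes f :: "real => ennreal"
  assumes f [measurable]: "f \<in> borel_measurable borel" and T: "T > 0" and per: "!!x. f (x + T) = f x"
    and s: "s = 1 \<or> s = -1"
  shows "(\<integral>\<^sup>+ x. f (s * x + c) * indicator {a..<a + T} x \<partial>lborel) = (\<integral>\<^sup>+ x. f x * indicator {a..<a + T} x \<partial>lborel)"
  using s
proof
  assume "s = 1" then show ?thesis using nn_integral_periodic_shift[OF f T per] by simp
next
  assume s: "s = -1"
  let ?g = "%x. f (- x)"
  have per': "?g (x + T) = ?g x" for x using per[of "- x - T"] by simp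
  have "(\<integral>\<^sup>+ x. f (s * x + c) * indicator {a..<a + T} x \<partial>lborel) = (\<integral>\<^sup>+ x. ?g (x + - c) * indicator {a..<a + T} x \<partial>lborel)"
    unfolding s by (intro nn_integral_cong) (simp add: algebra_simps)
  also have "\<dots> = (\<integral>\<^sup>+ x. ?g x * indicator {a..<a + T} x \<partial>lborel)"
    by (rule nn_integral_periodic_shift[of ?g, OF _ T per']) measurable
  also have "\<dots> = (\<integral>\<^sup>+ x. f x * indicator {a..<a + T} (- x) \<partial>lborel)"
    using nn_integral_real_affine[of "%x. f (- x) * indicator {a..<a + T} x" "-1" 0] by simp
  also have "\<dots> = (\<integral>\<^sup>+ x. f x * indicator {- a - T..<- a} x \<partial>lborel)"
  proof (rule nn_integral_cong_AE)
    have "AE x in lborel. x ~= - a \<and> x ~= - a - T"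
      by (intro AE_conjI AE_lborel_singleton)
    then show "AE x in lborel. f x * indicator {a..<a + T} (- x) = f x * indicator {- a - T..<- a} x"
      by eventually_elim (auto split: split_indicator)
  qed
  also have "\<dots> = (\<integral>\<^sup>+ x. f (x + (2 * a + T)) * indicator {- a - T..<(- a - T) + T} x \<partial>lborel)"
    using nn_integral_periodic_shift[OF f T per, of "2 * a + T" "- a - T"] by simp
  also have "\<dots> = (\<integral>\<^sup>+ x. (%y. f y * indicator {a..<a + T} y) (x + (2 * a + T)) \<partial>lborel)"
    by (intro nn_integral_cong) (auto split: split_indicator)
  also have "\<dots> = (\<integral>\<^sup>+ y. f y * indicator {a..<a + T} y \<partial>lborel)"
    using nn_integral_real_affine[of "%y. f y * indicator {a..<a + T} y" 1 "2 * a + T"] by (simp add: add.commute)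
  finally show ?thesis .
qed

section \<open>Fundamental domain and invariance of the measure\<close>

definition fund :: "(real \<times> real) set" where
  "fund = {0..<2 * pi} \<times> {- (pi/2)..<3 * pi/2}"

definition reduce :: "real \<times> real => real \<times> real" where
  "reduce = (%(\<beta>, \<alpha>). (\<beta> - 2 * pi * of_int \<lfloor>\<beta> / (2 * pi)\<rfloor>, \<alpha> - 2 * pi * of_int \<lfloor>(\<alpha> + pi/2) / (2 * pi)\<rfloor>))"

lemma floor_reduction: "0 \<le> x - 2 * pi * of_int \<lfloor>x / (2 * pi)\<rfloor>" "x - 2 * pi * of_int \<lfloor>x / (2 * pi)\<rfloor> < 2 * pi"
proof -
  define n where "n = \<lfloor>x / (2 * pi)\<rfloor>"
  have "of_int n \<le> x / (2 * pi)" "x / (2 * pi) < of_int n + 1" unfolding n_def by linarith+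
  then have "0 \<le> x - 2 * pi * of_int n" "x - 2 * pi * of_int n < 2 * pi"
    by (simp_all add: pos_le_divide_eq pos_divide_less_eq algebra_simps)
  then show "0 \<le> x - 2 * pi * of_int \<lfloor>x / (2 * pi)\<rfloor>" "x - 2 * pi * of_int \<lfloor>x / (2 * pi)\<rfloor> < 2 * pi"
    unfolding n_def .
qed

lemma reduce_in_fund: "reduce p \<in> fund"
  using floor_reduction[of "fst p"] floor_reduction[of "snd p + pi/2"]
  by (auto simp: reduce_def fund_def split: prod.split)

lemma reduce_fund: assumes "p \<in> fund" shows "reduce p = p"
proof -
  have "\<lfloor>fst p / (2 * pi)\<rfloor> = 0" "\<lfloor>(snd p + pi/2) / (2 * pi)\<rfloor> = 0"
    using assms by (auto simp: fund_def mem_Times_iff intro!: floor_unique)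
  then show ?thesis by (cases p) (simp add: reduce_def)
qed

lemma measurable_reduce [measurable]: "reduce \<in> borel_measurable borel"
  unfolding reduce_def borel_prod[symmetric] by measurable

lemma fund_sets [measurable]: "fund \<in> sets borel"
  unfolding fund_def borel_prod[symmetric] by measurable

lemma periodic_bdry_reduce:
  assumes "periodic_bdry w" shows "w (reduce p) = w p"
proof -
  obtain \<beta> \<alpha> where p: "p = (\<beta>, \<alpha>)" by (cases p)
  define m where "m = \<lfloor>\<beta> / (2 * pi)\<rfloor>"
  define n where "n = \<lfloor>(\<alpha> + pi/2) / (2 * pi)\<rfloor>"
  have 1: "w (b + of_int k * (2 * pi), a) = w (b, a)" for b a k
    using assms by (intro periodic_int_mult[of "%b. w (b, a)"]) (simp add: periodic_bdry_def)
  have 2: "w (b, a + of_int k * (2 * pi)) = w (b, a)" for b a k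
    using assms by (intro periodic_int_mult[of "%a. w (b, a)"]) (simp add: periodic_bdry_def)
  have "w (reduce p) = w (\<beta> + of_int (- m) * (2 * pi), \<alpha> + of_int (- n) * (2 * pi))"
    by (simp add: p reduce_def m_def n_def algebra_simps)
  also have "\<dots> = w p" unfolding 1 2 p ..
  finally show ?thesis .
qed

lemma periodic_bdry_reduceI: "periodic_bdry (%p. w (reduce p))"
proof -
  have f: "\<lfloor>(x + 2 * pi) / (2 * pi)\<rfloor> = \<lfloor>x / (2 * pi)\<rfloor> + 1" for x :: real
    by (simp add: add_divide_distrib)
  have g: "\<lfloor>(x + 2 * pi + pi/2) / (2 * pi)\<rfloor> = \<lfloor>(x + pi/2) / (2 * pi)\<rfloor> + 1" for x :: real
    using f[of "x + pi/2"] by (simp add: algebra_simps)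
  show ?thesis
    unfolding periodic_bdry_def reduce_def case_prod_conv f g by (simp add: algebra_simps)
qed

text \<open>The maps \<open>(\<beta>, \<alpha>) \<mapsto> (\<beta> + c(\<alpha>), \<plusminus>\<alpha> + d)\<close> cover both the scattering relation and the
  antipodal map.\<close>

lemma nn_integral_skew:
  fixes \<phi> :: "real \<times> real => ennreal"
  assumes phi [measurable]: "\<phi> \<in> borel_measurable borel" and per: "periodic_bdry \<phi>"
    and c [measurable]: "c \<in> borel_measurable borel" and s: "s = 1 \<or> s = -1"
  shows "(\<integral>\<^sup>+ p. \<phi> (fst p + c (snd p), s * snd p + d) * indicator fund p \<partial>lborel)
    = (\<integral>\<^sup>+ p. \<phi> p * indicator fund p \<partial>lborel)"
proof -
  have phi' [measurable]: "\<phi> \<in> borel_measurable (borel \<Otimes>\<^sub>M borel)" by (simp add: borel_prod)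
  have p1: "\<phi> (b + 2 * pi, a) = \<phi> (b, a)" and p2: "\<phi> (b, a + 2 * pi) = \<phi> (b, a)" for a b
    using per by (auto simp: periodic_bdry_def)
  have ind: "indicator fund (b, a) = (indicator {0..<0 + 2 * pi} b * indicator {- (pi/2)..<- (pi/2) + 2 * pi} a :: ennreal)" for b a
    by (simp add: fund_def indicator_times)
  define J where "J a = (\<integral>\<^sup>+ b. \<phi> (b, a) * indicator {0..<0 + 2 * pi} b \<partial>lborel)" for a
  have J [measurable]: "J \<in> borel_measurable borel" unfolding J_def by measurable
  have Jper: "J (a + 2 * pi) = J a" for a by (simp add: J_def p2)
  \<comment> \<open>The variable \<beta> is integrated first: for fixed \<alpha> a skew map is
    merely a translation in \<beta>.\<close>
  have swap: "(\<integral>\<^sup>+ p. g p \<partial>lborel) = (\<integral>\<^sup>+ a. \<integral>\<^sup>+ b. g (b, a) \<partial>lborel \<partial>lborel)"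
    if [measurable]: "g \<in> borel_measurable (borel \<Otimes>\<^sub>M borel)" for g :: "real \<times> real => ennreal"
    unfolding lborel_prod[symmetric]
    by (rule lborel_pair.nn_integral_snd[symmetric]) measurable
  have [measurable]: "fund \<in> sets (borel \<Otimes>\<^sub>M borel)" unfolding borel_prod by (rule fund_sets)
  have m1: "(%p. \<phi> (fst p + c (snd p), s * snd p + d) * indicator fund p) \<in> borel_measurable (borel \<Otimes>\<^sub>M borel)"
    and m2: "(%p. \<phi> p * indicator fund p) \<in> borel_measurable (borel \<Otimes>\<^sub>M borel)"
    by measurable
  have "(\<integral>\<^sup>+ p. \<phi> (fst p + c (snd p), s * snd p + d) * indicator fund p \<partial>lborel)
      = (\<integral>\<^sup>+ a. \<integral>\<^sup>+ b. \<phi> (b + c a, s * a + d) * indicator {0..<0 + 2 * pi} b * indicator {- (pi/2)..<- (pi/2) + 2 * pi} a \<partial>lborel \<partial>lborel)"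
    unfolding swap[OF m1] by (simp add: ind mult.assoc)
  also have "\<dots> = (\<integral>\<^sup>+ a. J (s * a + d) * indicator {- (pi/2)..<- (pi/2) + 2 * pi} a \<partial>lborel)"
  proof (intro nn_integral_cong)
    fix a
    have "(\<integral>\<^sup>+ b. \<phi> (b + c a, s * a + d) * indicator {0..<0 + 2 * pi} b \<partial>lborel) = J (s * a + d)"
      unfolding J_def using p1 by (intro nn_integral_periodic_shift) auto
    then show "(\<integral>\<^sup>+ b. \<phi> (b + c a, s * a + d) * indicator {0..<0 + 2 * pi} b * indicator {- (pi/2)..<- (pi/2) + 2 * pi} a \<partial>lborel)
       = J (s * a + d) * indicator {- (pi/2)..<- (pi/2) + 2 * pi} a"
      by (simp add: nn_integral_multc)
  qed
  also have "\<dots> = (\<integral>\<^sup>+ a. J a * indicator {- (pi/2)..<- (pi/2) + 2 * pi} a \<partial>lborel)"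
    using Jper s by (intro nn_integral_periodic_affine) auto
  also have "\<dots> = (\<integral>\<^sup>+ a. \<integral>\<^sup>+ b. \<phi> (b, a) * indicator {0..<0 + 2 * pi} b * indicator {- (pi/2)..<- (pi/2) + 2 * pi} a \<partial>lborel \<partial>lborel)"
    unfolding J_def by (intro nn_integral_cong) (simp add: nn_integral_multc)
  also have "\<dots> = (\<integral>\<^sup>+ p. \<phi> p * indicator fund p \<partial>lborel)"
    unfolding swap[OF m2] by (simp add: ind mult.assoc)
  finally show ?thesis .
qed

lemma AE_fst_neq: "AE p in (lborel :: (real \<times> real) measure). fst p ~= c"
  using AE_lborel_inner_neq[of "(1, 0) :: real \<times> real" c] by (simp add: Basis_prod_def inner_prod_def)

lemma AE_snd_neq: "AE p in (lborel :: (real \<times> real) measure). snd p ~= c"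
  using AE_lborel_inner_neq[of "(0, 1) :: real \<times> real" c] by (simp add: Basis_prod_def inner_prod_def)

context curved_disk
begin

abbreviation bm :: "(real \<times> real) measure" where "bm \<equiv> bdry_measure \<kappa>"
abbreviation im :: "(real \<times> real) measure" where "im \<equiv> influx_measure \<kappa>"
abbreviation S :: "real \<times> real => real \<times> real" where "S \<equiv> scattering \<kappa>"

lemma kappa_const: "1 / (1 + \<kappa>) > 0" using kappa_gt by simp

lemma sets_boxes [measurable]:
  "{0..2*pi} \<times> {- (pi/2)..3*pi/2} \<in> sets (borel :: (real \<times> real) measure)"
  "{0..2*pi} \<times> {- (pi/2)..pi/2} \<in> sets (borel :: (real \<times> real) measure)"
  by (auto intro!: borel_closed closed_Times)

lemma nn_integral_bm:
  assumes [measurable]: "\<phi> \<in> borel_measurable borel"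
  shows "(\<integral>\<^sup>+ p. \<phi> p \<partial>bm) = ennreal (1 / (1 + \<kappa>)) * (\<integral>\<^sup>+ p. \<phi> p * indicator fund p \<partial>lborel)"
proof -
  have m: "\<phi> \<in> borel_measurable (restrict_space lborel ({0..2*pi} \<times> {- (pi/2)..3*pi/2}))"
    by (intro measurable_restrict_space1) simp
  have "(\<integral>\<^sup>+ p. \<phi> p \<partial>bm) = (\<integral>\<^sup>+ p. ennreal (1 / (1 + \<kappa>)) * \<phi> p \<partial>restrict_space lborel ({0..2*pi} \<times> {- (pi/2)..3*pi/2}))"
    unfolding bdry_measure_def using m by (intro nn_integral_density) auto
  also have "\<dots> = ennreal (1 / (1 + \<kappa>)) * (\<integral>\<^sup>+ p. \<phi> p \<partial>restrict_space lborel ({0..2*pi} \<times> {- (pi/2)..3*pi/2}))"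
    by (rule nn_integral_cmult[OF m])
  also have "(\<integral>\<^sup>+ p. \<phi> p \<partial>restrict_space lborel ({0..2*pi} \<times> {- (pi/2)..3*pi/2}))
      = (\<integral>\<^sup>+ p. \<phi> p * indicator ({0..2*pi} \<times> {- (pi/2)..3*pi/2}) p \<partial>lborel)"
    by (rule nn_integral_restrict_space) simp
  also have "\<dots> = (\<integral>\<^sup>+ p. \<phi> p * indicator fund p \<partial>lborel)"
  proof (rule nn_integral_cong_AE)
    show "AE p in lborel. \<phi> p * indicator ({0..2*pi} \<times> {- (pi/2)..3*pi/2}) p = \<phi> p * indicator fund p"
      using AE_fst_neq[of "2 * pi"] AE_snd_neq[of "3 * pi/2"]
      by eventually_elim (auto simp: fund_def indicator_def)
  qed
  finally show ?thesis .
qed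

text \<open>Up to null sets the inward half is the region cos \<alpha> > 0. This description is
  stable under reduction modulo 2\<pi> and is exchanged with its complement by scattering, which the
  strip of the definition is not.\<close>

lemma nn_integral_im:
  assumes [measurable]: "\<phi> \<in> borel_measurable borel"
  shows "(\<integral>\<^sup>+ p. \<phi> p \<partial>im) = (\<integral>\<^sup>+ p. \<phi> p * indicator {p. cos (snd p) > 0} p \<partial>bm)"
proof -
  have m: "\<phi> \<in> borel_measurable (restrict_space lborel ({0..2*pi} \<times> {- (pi/2)..pi/2}))"
    by (intro measurable_restrict_space1) simp
  have c [measurable]: "{p :: real \<times> real. cos (snd p) > 0} \<in> sets borel"
    by (intro borel_open open_Collect_less continuous_intros)
  have "(\<integral>\<^sup>+ p. \<phi> p \<partial>im) = (\<integral>\<^sup>+ p. ennreal (1 / (1 + \<kappa>)) * \<phi> p \<partial>restrict_space lborel ({0..2*pi} \<times> {- (pi/2)..pi/2}))"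
    unfolding influx_measure_def using m by (intro nn_integral_density) auto
  also have "\<dots> = ennreal (1 / (1 + \<kappa>)) * (\<integral>\<^sup>+ p. \<phi> p \<partial>restrict_space lborel ({0..2*pi} \<times> {- (pi/2)..pi/2}))"
    by (rule nn_integral_cmult[OF m])
  also have "(\<integral>\<^sup>+ p. \<phi> p \<partial>restrict_space lborel ({0..2*pi} \<times> {- (pi/2)..pi/2}))
      = (\<integral>\<^sup>+ p. \<phi> p * indicator ({0..2*pi} \<times> {- (pi/2)..pi/2}) p \<partial>lborel)"
    by (rule nn_integral_restrict_space) simp
  also have "\<dots> = (\<integral>\<^sup>+ p. \<phi> p * indicator {p. cos (snd p) > 0} p * indicator fund p \<partial>lborel)"
  proof (rule nn_integral_cong_AE)
    show "AE p in lborel. \<phi> p * indicator ({0..2*pi} \<times> {- (pi/2)..pi/2}) p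
        = \<phi> p * indicator {p. cos (snd p) > 0} p * indicator fund p"
      using AE_fst_neq[of "2 * pi"] AE_snd_neq[of "pi/2"] AE_snd_neq[of "- (pi/2)"]
    proof eventually_elim
      fix p :: "real \<times> real" assume ne: "fst p ~= 2 * pi" "snd p ~= pi/2" "snd p ~= - (pi/2)"
      have "cos (snd p) > 0" if "- (pi/2) \<le> snd p" "snd p \<le> pi/2"
        using that ne by (intro cos_gt_zero_pi) auto
      moreover have "\<not> cos (snd p) > 0" if "pi/2 < snd p" "snd p < 3 * pi/2"
        using cos_ge_zero[of "snd p - pi"] that by (simp add: cos_diff)
      ultimately show "\<phi> p * indicator ({0..2*pi} \<times> {- (pi/2)..pi/2}) p
        = \<phi> p * indicator {p. cos (snd p) > 0} p * indicator fund p"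
        using ne by (cases p) (auto simp: fund_def indicator_def)
    qed
  qed
  finally show ?thesis by (simp add: nn_integral_bm)
qed

lemma space_bm: "space bm = {0..2*pi} \<times> {- (pi/2)..3*pi/2}"
  and space_im: "space im = {0..2*pi} \<times> {- (pi/2)..pi/2}"
  by (simp_all add: bdry_measure_def influx_measure_def space_restrict_space)

lemma emeasure_fund_finite: "emeasure lborel fund < \<infinity>"
proof -
  have "emeasure lborel fund \<le> emeasure lborel (cbox (0, - (pi/2)) (2*pi, 3*pi/2))"
    by (intro emeasure_mono) (auto simp: fund_def cbox_Pair_eq)
  also have "\<dots> < \<infinity>" by (rule emeasure_lborel_cbox_finite)
  finally show ?thesis .
qed

lemma finite_bm: "finite_measure bm" and finite_im: "finite_measure im"
proof -
  have "emeasure bm (space bm) = (\<integral>\<^sup>+ p. 1 \<partial>bm)" by simp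
  also have "\<dots> = ennreal (1 / (1 + \<kappa>)) * (\<integral>\<^sup>+ p. 1 * indicator fund p \<partial>lborel)"
    by (rule nn_integral_bm) simp
  also have "\<dots> = ennreal (1 / (1 + \<kappa>)) * emeasure lborel fund" by simp
  also have "\<dots> < \<infinity>"
    using emeasure_fund_finite by (auto simp: ennreal_mult_less_top)
  finally have b: "emeasure bm (space bm) < \<infinity>" .
  then show "finite_measure bm" by (intro finite_measureI) (simp add: less_top[symmetric])
  have "emeasure im (space im) = (\<integral>\<^sup>+ p. 1 \<partial>im)" by simp
  also have "\<dots> = (\<integral>\<^sup>+ p. 1 * indicator {p. cos (snd p) > 0} p \<partial>bm)"
    by (rule nn_integral_im) simp
  also have "\<dots> \<le> (\<integral>\<^sup>+ p. 1 \<partial>bm)"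
    by (intro nn_integral_mono) (auto simp: indicator_def)
  also have "\<dots> < \<infinity>" using b by simp
  finally show "finite_measure im" by (intro finite_measureI) (simp add: less_top[symmetric])
qed

lemma borel_measurable_bmI: "f \<in> borel_measurable borel ==> f \<in> borel_measurable bm"
  and borel_measurable_imI: "f \<in> borel_measurable borel ==> f \<in> borel_measurable im"
  unfolding bdry_measure_def influx_measure_def
  by (simp_all add: measurable_restrict_space1)

lemma bdry_borel_measurable:
  fixes w :: "real \<times> real => complex"
  assumes "periodic_bdry w" "w \<in> borel_measurable bm"
  shows "w \<in> borel_measurable borel"
proof -
  have "w \<in> borel_measurable (restrict_space lborel ({0..2*pi} \<times> {- (pi/2)..3*pi/2}))"
    using assms(2) by (simp add: bdry_measure_def)
  then have [measurable]: "(%p. indicator ({0..2*pi} \<times> {- (pi/2)..3*pi/2}) p *\<^sub>R w p) \<in> borel_measurable borel"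
    by (subst (asm) borel_measurable_restrict_space_iff) simp_all
  have "(%p. indicator ({0..2*pi} \<times> {- (pi/2)..3*pi/2}) (reduce p) *\<^sub>R w (reduce p)) \<in> borel_measurable borel"
    by (rule measurable_compose[OF measurable_reduce]) measurable
  moreover have "reduce p \<in> {0..2*pi} \<times> {- (pi/2)..3*pi/2}" for p
    using reduce_in_fund[of p] by (auto simp: fund_def)
  ultimately show ?thesis by (simp add: periodic_bdry_reduce[OF assms(1)])
qed

lemma L2_bdry_measurable: "w \<in> L2_bdry \<kappa> ==> w \<in> borel_measurable borel"
  unfolding L2_bdry_def using bdry_borel_measurable by (auto simp: square_integrable_def)

lemma L2_bdryI:
  assumes "periodic_bdry w" "w \<in> borel_measurable borel" "!!p. norm (w p) \<le> B"
  shows "w \<in> L2_bdry \<kappa>"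
  unfolding L2_bdry_def using assms
  by (auto intro!: square_integrable_bounded[OF finite_bm, where B = B] borel_measurable_bmI)

definition skew :: "(real => real) => real => real => real \<times> real => real \<times> real" where
  "skew c s d p = (fst p + c (snd p), s * snd p + d)"

lemma measurable_skew [measurable]:
  assumes [measurable]: "c \<in> borel_measurable borel"
  shows "skew c s d \<in> borel_measurable borel"
  unfolding skew_def borel_prod[symmetric] by measurable

text \<open>An indicator composed with \<open>reduce\<close> is periodic, so invariance of
  nonnegative integrals applies to it. Stated for image measures, the invariance passes at once to
  integrability and to integrals of vector-valued functions.\<close>

lemma distr_skew:
  assumes c: "c \<in> borel_measurable borel" and s: "s = 1 \<or> s = -1"
  shows "distr bm borel (%p. reduce (skew c s d p)) = distr bm borel reduce"
proof (rule measure_eqI)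
  note [measurable] = measurable_skew[OF c, of s d]
  fix A assume "A \<in> sets (distr bm borel (%p. reduce (skew c s d p)))"
  then have A [measurable]: "A \<in> sets borel" by simp
  have m1: "reduce \<in> measurable bm borel" "(%p. reduce (skew c s d p)) \<in> measurable bm borel"
    unfolding bdry_measure_def by (simp_all add: measurable_restrict_space1)
  have per: "periodic_bdry (%p. indicator A (reduce p) :: ennreal)" by (rule periodic_bdry_reduceI)
  have "emeasure (distr bm borel (%p. reduce (skew c s d p))) A = (\<integral>\<^sup>+ x. indicator A x \<partial>distr bm borel (%p. reduce (skew c s d p)))"
    by simp
  also have "\<dots> = (\<integral>\<^sup>+ p. indicator A (reduce (skew c s d p)) \<partial>bm)"
    using m1 by (intro nn_integral_distr) auto
  also have "\<dots> = (\<integral>\<^sup>+ p. indicator A (reduce p) \<partial>bm)"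
  proof -
    have "(\<integral>\<^sup>+ p. indicator A (reduce (skew c s d p)) \<partial>bm)
        = ennreal (1 / (1 + \<kappa>)) * (\<integral>\<^sup>+ p. indicator A (reduce (skew c s d p)) * indicator fund p \<partial>lborel)"
      by (rule nn_integral_bm) measurable
    also have "(\<integral>\<^sup>+ p. indicator A (reduce (skew c s d p)) * indicator fund p \<partial>lborel)
        = (\<integral>\<^sup>+ p. indicator A (reduce p) * indicator fund p \<partial>lborel)"
      unfolding skew_def by (rule nn_integral_skew[OF _ per c s]) measurable
    also have "ennreal (1 / (1 + \<kappa>)) * \<dots> = (\<integral>\<^sup>+ p. indicator A (reduce p) \<partial>bm)"
      by (rule nn_integral_bm[symmetric]) measurable
    finally show ?thesis .
  qed
  also have "\<dots> = (\<integral>\<^sup>+ x. indicator A x \<partial>distr bm borel reduce)"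
    using m1 by (intro nn_integral_distr[symmetric]) auto
  finally show "emeasure (distr bm borel (%p. reduce (skew c s d p))) A = emeasure (distr bm borel reduce) A"
    by simp
qed simp

lemma measurable_bm_reduce: "reduce \<in> measurable bm borel"
  unfolding bdry_measure_def by (simp add: measurable_restrict_space1)

lemma measurable_bm_reduce_skew:
  assumes "c \<in> borel_measurable borel" shows "(%p. reduce (skew c s d p)) \<in> measurable bm borel"
proof -
  note [measurable] = measurable_skew[OF assms, of s d]
  show ?thesis unfolding bdry_measure_def by (simp add: measurable_restrict_space1)
qed

lemma
  fixes g :: "real \<times> real => 'b::{banach, second_countable_topology}"
  assumes c: "c \<in> borel_measurable borel" and s: "s = 1 \<or> s = -1"
    and g: "g \<in> borel_measurable borel" and per: "periodic_bdry g"
  shows integral_skew: "integral\<^sup>L bm (%p. g (skew c s d p)) = integral\<^sup>L bm g"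
    and integrable_skew: "integrable bm (%p. g (skew c s d p)) \<longleftrightarrow> integrable bm g"
proof -
  have r: "g (reduce p) = g p" for p by (rule periodic_bdry_reduce[OF per])
  have "integral\<^sup>L bm (%p. g (reduce (skew c s d p))) = integral\<^sup>L bm (%p. g (reduce p))"
    using integral_distr[OF measurable_bm_reduce_skew[OF c] g, of s d]
      integral_distr[OF measurable_bm_reduce g] distr_skew[OF c s, of d] by simp
  then show "integral\<^sup>L bm (%p. g (skew c s d p)) = integral\<^sup>L bm g" by (simp only: r)
  have "integrable bm (%p. g (reduce (skew c s d p))) \<longleftrightarrow> integrable bm (%p. g (reduce p))"
    using integrable_distr_eq[OF measurable_bm_reduce_skew[OF c] g, of s d]
      integrable_distr_eq[OF measurable_bm_reduce g] distr_skew[OF c s, of d] by simp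
  then show "integrable bm (%p. g (skew c s d p)) \<longleftrightarrow> integrable bm g" by (simp only: r)
qed

lemma scattering_skew: "S p = skew (%\<alpha>. pi + 2 * sct \<alpha>) (-1) pi p"
  by (cases p) (simp add: scattering_def skew_def)

lemma measurable_scattering [measurable]: "S \<in> borel_measurable borel"
proof -
  have "skew (%\<alpha>. pi + 2 * sct \<alpha>) (-1) pi \<in> borel_measurable borel" by (rule measurable_skew) measurable
  then show ?thesis unfolding scattering_skew[abs_def] by simp
qed

lemmas integral_scattering = integral_skew[where c = "%\<alpha>. pi + 2 * sct \<alpha>" and s = "-1" and d = pi,
    folded scattering_skew, simplified]
lemmas integrable_scattering = integrable_skew[where c = "%\<alpha>. pi + 2 * sct \<alpha>" and s = "-1" and d = pi,
    folded scattering_skew, simplified]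

lemma periodic_int_shift:
  assumes "periodic_bdry w"
  shows "w (\<beta> + of_int m * (2 * pi), \<alpha> + of_int n * (2 * pi)) = w (\<beta>, \<alpha>)"
proof -
  have "w (\<beta> + of_int m * (2 * pi), a) = w (\<beta>, a)" for a
    using assms by (intro periodic_int_mult[of "%b. w (b, a)"]) (simp add: periodic_bdry_def)
  moreover have "w (\<beta>, \<alpha> + of_int n * (2 * pi)) = w (\<beta>, \<alpha>)"
    using assms by (intro periodic_int_mult[of "%a. w (\<beta>, a)"]) (simp add: periodic_bdry_def)
  ultimately show ?thesis by simp
qed

lemma periodic_scattering:
  assumes "periodic_bdry w" shows "periodic_bdry (%p. w (S p))"
  unfolding periodic_bdry_def
proof (intro allI conjI)
  fix \<beta> \<alpha>
  show "w (S (\<beta> + 2 * pi, \<alpha>)) = w (S (\<beta>, \<alpha>))"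
    using periodic_int_shift[OF assms, of "\<beta> + pi + 2 * sct \<alpha>" 1 "pi - \<alpha>" 0]
    by (simp add: scattering_def algebra_simps)
  show "w (S (\<beta>, \<alpha> + 2 * pi)) = w (S (\<beta>, \<alpha>))"
    using periodic_int_shift[OF assms, of "\<beta> + pi + 2 * sct \<alpha>" 2 "pi - \<alpha>" "-1"]
    unfolding scattering_def case_prod_conv scat_plus_2pi by (simp add: algebra_simps)
qed

lemma scattering_involution: "S (S (\<beta>, \<alpha>)) = (\<beta> + 4 * pi, \<alpha>)"
  by (simp add: scattering_def scat_pi_minus)

lemma periodic_scattering_twice:
  assumes "periodic_bdry w" shows "w (S (S p)) = w p"
  using periodic_int_shift[OF assms, of "fst p" 2 "snd p" 0]
  by (cases p) (simp add: scattering_involution algebra_simps)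

lemma periodic_influx_int:
  assumes "periodic_influx u" "\<bar>a\<bar> \<le> pi/2"
  shows "u (\<beta> + of_int m * (2 * pi), a) = u (\<beta>, a)"
  using assms by (intro periodic_int_mult[of "%b. u (b, a)"]) (simp add: periodic_influx_def)

lemma A_minus_inner: "\<bar>a\<bar> \<le> pi/2 ==> A_minus \<kappa> u (\<beta>, a) = u (\<beta>, a)"
proof -
  assume "\<bar>a\<bar> \<le> pi/2"
  then have "- (pi/2) \<le> a" "a \<le> pi/2" unfolding abs_le_iff by linarith+
  moreover from this pi_gt_zero have "a < 3 * pi/2" by linarith
  ultimately have "\<lfloor>(a + pi/2) / (2*pi)\<rfloor> = 0" by (intro floor_unique) (auto simp: field_simps)
  then show ?thesis using \<open>a \<le> pi/2\<close> by (simp add: A_minus_def)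
qed

lemma A_minus_outer:
  assumes "pi/2 < a" "a < 3*pi/2"
  shows "A_minus \<kappa> u (\<beta>, a) = - u (S (\<beta>, a))"
proof -
  have "\<lfloor>(a + pi/2) / (2*pi)\<rfloor> = 0" using assms by (intro floor_unique) auto
  then show ?thesis using assms by (simp add: A_minus_def)
qed

lemma periodic_A_minus:
  assumes "periodic_influx u" shows "periodic_bdry (A_minus \<kappa> u)"
  unfolding periodic_bdry_def
proof (intro allI conjI)
  fix \<beta> \<alpha> :: real
  define a where "a = \<alpha> - 2 * pi * of_int \<lfloor>(\<alpha> + pi/2) / (2*pi)\<rfloor>"
  have a: "- (pi/2) \<le> a" "a < 3*pi/2"
    using floor_reduction[of "\<alpha> + pi/2"] by (simp_all add: a_def)
  show "A_minus \<kappa> u (\<beta> + 2*pi, \<alpha>) = A_minus \<kappa> u (\<beta>, \<alpha>)"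
  proof (cases "a \<le> pi/2")
    case True
    then show ?thesis using a periodic_influx_int[OF assms, of a \<beta> 1]
      unfolding A_minus_def case_prod_conv Let_def a_def[symmetric] by (simp add: abs_le_iff)
  next
    case False
    then have "\<bar>pi - a\<bar> \<le> pi/2" using a by arith
    then show ?thesis using False periodic_influx_int[OF assms, of "pi - a" "\<beta> + pi + 2 * sct a" 1]
      unfolding A_minus_def case_prod_conv Let_def a_def[symmetric]
      by (simp add: scattering_def algebra_simps)
  qed
  have "\<lfloor>(\<alpha> + 2 * pi + pi/2) / (2 * pi)\<rfloor> = \<lfloor>(\<alpha> + pi/2) / (2 * pi) + of_int 1\<rfloor>"
    by (simp add: add_divide_distrib)
  then have "\<lfloor>(\<alpha> + 2 * pi + pi/2) / (2 * pi)\<rfloor> = \<lfloor>(\<alpha> + pi/2) / (2 * pi)\<rfloor> + 1" by (simp only: floor_add_int)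
  then have "(\<alpha> + 2*pi) - 2 * pi * of_int \<lfloor>(\<alpha> + 2*pi + pi/2) / (2*pi)\<rfloor> = a" by (simp add: a_def algebra_simps)
  then show "A_minus \<kappa> u (\<beta>, \<alpha> + 2*pi) = A_minus \<kappa> u (\<beta>, \<alpha>)"
    unfolding A_minus_def case_prod_conv Let_def a_def[symmetric] by simp
qed

lemma periodic_eqI:
  assumes "periodic_bdry f" "periodic_bdry g" "!!p. p \<in> fund ==> f p = g p"
  shows "f p = g p"
  using assms(3)[OF reduce_in_fund, of p] periodic_bdry_reduce[OF assms(1), of p] periodic_bdry_reduce[OF assms(2), of p]
  by simp

text \<open>Tangential vectors are excluded because both such a vector and its image lie in the
  closed inward strip, where \<open>A_minus\<close> takes the values of u without a sign.\<close>

lemma A_minus_anti: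
  assumes u: "periodic_influx u" and c: "cos (snd p) ~= 0"
  shows "A_minus \<kappa> u (S p) = - A_minus \<kappa> u p"
proof -
  let ?w = "A_minus \<kappa> u"
  note per = periodic_A_minus[OF u]
  have red: "?w (S (reduce p)) = - ?w (reduce p)"
  proof -
    obtain \<beta> a where r: "reduce p = (\<beta>, a)" by (cases "reduce p")
    have "cos a = cos (snd p)"
    proof -
      have "a = snd p + of_int (- \<lfloor>(snd p + pi/2) / (2 * pi)\<rfloor>) * (2 * pi)"
        using r by (auto simp: reduce_def split: prod.splits)
      then show ?thesis
        using periodic_int_mult[of cos "2 * pi" "snd p" "- \<lfloor>(snd p + pi/2) / (2 * pi)\<rfloor>"] by simp
    qed
    then have ca: "cos a ~= 0" using c by simp
    have "(\<beta>, a) \<in> fund" using reduce_in_fund[of p] r by simp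
    then have "- (pi/2) \<le> a" "a < 3*pi/2" by (auto simp: fund_def)
    moreover have "a ~= - (pi/2)" using ca cos_pi_half cos_minus[of "pi/2"] by metis
    moreover have "a ~= pi/2" using ca cos_pi_half by metis
    ultimately consider "- (pi/2) < a" "a < pi/2" | "pi/2 < a" "a < 3*pi/2" by linarith
    then have "?w (S (\<beta>, a)) = - ?w (\<beta>, a)"
    proof cases
      case 1
      have "?w (S (\<beta>, a)) = - u (S (S (\<beta>, a)))"
        using 1 A_minus_outer[of "pi - a" u "\<beta> + pi + 2 * sct a"] by (simp add: scattering_def)
      also have "\<dots> = - u (\<beta>, a)"
        using periodic_influx_int[OF u, of a \<beta> 2] 1 by (simp add: scattering_involution abs_le_iff algebra_simps)
      finally show ?thesis using 1 A_minus_inner[of a u \<beta>] by (simp add: abs_le_iff)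
    next
      case 2
      then have "\<bar>pi - a\<bar> \<le> pi/2" by arith
      then show ?thesis
        using 2 A_minus_outer[of a u \<beta>] A_minus_inner[of "pi - a" u "\<beta> + pi + 2 * sct a"]
        by (simp add: scattering_def)
    qed
    then show ?thesis by (simp add: r)
  qed
  then show ?thesis
    using periodic_bdry_reduce[OF per, of p] periodic_bdry_reduce[OF periodic_scattering[OF per], of p] by simp
qed

text \<open>The function h - h \<circ> S changes sign under scattering everywhere, S \<circ> S being
  a translation by periods; extending its restriction antisymmetrically therefore gives it back.
  Thanks to this, \<open>C_minus\<close> can be iterated without returning to the inward
  half.\<close>

lemma A_minus_of_adj:
  assumes h: "periodic_bdry h"
  shows "A_minus \<kappa> (%p. 1/2 * (h p - h (S p))) p = 1/2 * (h p - h (S p))"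
proof (rule periodic_eqI[where f = "A_minus \<kappa> (%p. 1/2 * (h p - h (S p)))" and g = "%p. 1/2 * (h p - h (S p))"])
  let ?u = "%p. 1/2 * (h p - h (S p))"
  have per: "periodic_bdry ?u"
    using h periodic_scattering[OF h] unfolding periodic_bdry_def by simp
  then show "periodic_bdry ?u" .
  show "periodic_bdry (A_minus \<kappa> ?u)"
    using per by (intro periodic_A_minus) (simp add: periodic_bdry_def periodic_influx_def)
  fix p assume "p \<in> fund"
  then obtain \<beta> a where p: "p = (\<beta>, a)" "- (pi/2) \<le> a" "a < 3*pi/2" by (auto simp: fund_def)
  show "A_minus \<kappa> ?u p = ?u p"
  proof (cases "a \<le> pi/2")
    case True
    then show ?thesis using A_minus_inner[of a ?u \<beta>] p by (simp add: abs_le_iff)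
  next
    case False
    then have "A_minus \<kappa> ?u p = - ?u (S p)" using A_minus_outer[of a ?u \<beta>] p by simp
    also have "\<dots> = ?u p" unfolding periodic_scattering_twice[OF h] by (simp add: field_simps)
    finally show ?thesis .
  qed
qed

text \<open>Measurability of u is known on one closed rectangle only, its values elsewhere being
  arbitrary or determined by periodicity. The function is cut off to the rectangle, made periodic in
  \<beta>, and only then composed with scattering and reduction.\<close>

lemma measurable_A_minus:
  assumes u: "periodic_influx u" "u \<in> borel_measurable im"
  shows "A_minus \<kappa> u \<in> borel_measurable borel"
proof -
  let ?D = "{0..2*pi} \<times> {- (pi/2)..pi/2}"
  have "u \<in> borel_measurable (restrict_space lborel ?D)"
    using assms(2) by (simp add: influx_measure_def)
  then have U [measurable]: "(%p. indicator ?D p *\<^sub>R u p) \<in> borel_measurable borel"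
    by (subst (asm) borel_measurable_restrict_space_iff) simp_all
  define r where "r = (%p :: real \<times> real. (fst p - 2 * pi * of_int \<lfloor>fst p / (2 * pi)\<rfloor>, snd p))"
  have r [measurable]: "r \<in> borel_measurable borel"
    unfolding r_def borel_prod[symmetric] by measurable
  define v where "v p = indicator ?D (r p) *\<^sub>R u (r p)" for p
  have v [measurable]: "v \<in> borel_measurable borel"
    unfolding v_def by (rule measurable_compose[OF r]) measurable
  have vu: "v p = u p" if "\<bar>snd p\<bar> \<le> pi/2" for p
  proof -
    have "r p \<in> ?D" using that floor_reduction[of "fst p"] by (auto simp: r_def abs_le_iff)
    moreover have "u (r p) = u p"
      using periodic_influx_int[OF u(1), of "snd p" "fst p" "- \<lfloor>fst p / (2 * pi)\<rfloor>"] that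
      by (simp add: r_def algebra_simps)
    ultimately show ?thesis by (simp add: v_def)
  qed
  define w where "w p = (if snd p \<le> pi/2 then v p else - v (S p))" for p
  have w [measurable]: "w \<in> borel_measurable borel"
  proof -
    have [measurable]: "(snd :: real \<times> real => real) \<in> borel_measurable borel"
      by (simp add: borel_prod[symmetric])
    show ?thesis unfolding w_def by measurable
  qed
  have "A_minus \<kappa> u p = w (reduce p)" for p
  proof -
    obtain \<beta> a where q: "reduce p = (\<beta>, a)" by (cases "reduce p")
    then have a: "- (pi/2) \<le> a" "a < 3*pi/2" using reduce_in_fund[of p] by (auto simp: fund_def)
    have "A_minus \<kappa> u p = A_minus \<kappa> u (\<beta>, a)"
      using periodic_bdry_reduce[OF periodic_A_minus[OF u(1)], of p] q by simp
    also have "\<dots> = w (\<beta>, a)"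
    proof (cases "a \<le> pi/2")
      case True
      then show ?thesis using a A_minus_inner[of a u \<beta>] vu[of "(\<beta>, a)"] by (simp add: w_def abs_le_iff)
    next
      case False
      then have "\<bar>pi - a\<bar> \<le> pi/2" using a by arith
      then show ?thesis
        using False a A_minus_outer[of a u \<beta>] vu[of "S (\<beta>, a)"] by (simp add: w_def scattering_def)
    qed
    finally show ?thesis by (simp add: q)
  qed
  then have "A_minus \<kappa> u = (%p. w (reduce p))" by (rule ext)
  moreover have "(%p. w (reduce p)) \<in> borel_measurable borel" by measurable
  ultimately show ?thesis by (simp only:)
qed

lemma AE_bm_cos: "AE p in bm. cos (snd p) ~= 0"
proof -
  have "AE p in lborel. \<forall>n::int. snd (p :: real \<times> real) ~= of_int n * pi + pi/2"
    unfolding AE_all_countable by (intro allI AE_snd_neq)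
  then have "AE p in lborel. cos (snd (p :: real \<times> real)) ~= 0"
    by eventually_elim (auto simp: cos_zero_iff_int2)
  then have "AE p in restrict_space lborel ({0..2*pi} \<times> {- (pi/2)..3*pi/2}). cos (snd p) ~= 0"
    by (subst AE_restrict_space_iff) auto
  then show ?thesis unfolding bdry_measure_def by (subst AE_density) auto
qed

end

section \<open>Fourier expansion adapted to the scattering relation\<close>

definition parity_sign :: "int => complex" where
  "parity_sign k = (if even k then 1 else -1)"

lemma cis_int_pi: "cis (of_int k * pi) = parity_sign k"
proof (cases "even k")
  case True
  then obtain j where k: "k = 2 * j" by (elim evenE)
  have "cis (of_int k * pi) = cis (2 * pi * of_int j)" by (simp add: k mult_ac)
  then show ?thesis using True by (simp add: parity_sign_def cis_multiple_2pi)
next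
  case False
  then obtain j where k: "k = 2 * j + 1" by (elim oddE)
  have "cis (of_int k * pi) = cis (2 * pi * of_int j) * cis pi" unfolding cis_mult by (simp add: k algebra_simps)
  then show ?thesis using False by (simp add: parity_sign_def cis_multiple_2pi)
qed

lemma borel_measurable_cnj [measurable (raw)]:
  "f \<in> borel_measurable M ==> (%x. cnj (f x)) \<in> borel_measurable M"
  by (rule borel_measurable_continuous_on[OF continuous_on_cnj[OF continuous_on_id]])

lemma parity_sign_norm: "parity_sign k * parity_sign k = 1" "cnj (parity_sign k) = parity_sign k"
  by (simp_all add: parity_sign_def)

lemma closed_box_AE:
  "AE p in lborel. p \<in> {0..2*pi} \<times> {- (pi/2)..3*pi/2} \<longleftrightarrow> p \<in> {0<..<2*pi} \<times> {- (pi/2)<..<3*pi/2}"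
  using AE_fst_neq[of 0] AE_fst_neq[of "2 * pi"] AE_snd_neq[of "3 * pi/2"] AE_snd_neq[of "- (pi/2)"]
  by eventually_elim auto

context curved_disk
begin

text \<open>The e_{p,m} of the overview. As s' is a constant multiple of 1/\<rho>^2, the factor
  1/\<rho> makes these functions orthogonal for d\<beta> d\<alpha>, although they are exponentials
  in s.\<close>

definition wv :: "int => int => real \<times> real => complex" where
  "wv p m q = of_real (1 / rho (snd q)) * (cis (of_int p * fst q) * cis (of_int m * sct (snd q)))"

lemma rho_lower: "1 - \<bar>\<kappa>\<bar> \<le> rho \<alpha>"
proof (rule power2_le_imp_le)
  have 1: "(1 - \<bar>\<kappa>\<bar>)\<^sup>2 \<le> (1 + \<kappa>)\<^sup>2" "(1 - \<bar>\<kappa>\<bar>)\<^sup>2 \<le> (1 - \<kappa>)\<^sup>2"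
    using kappa_gt kappa_lt by (auto intro!: power_mono)
  have "(1 - \<bar>\<kappa>\<bar>)\<^sup>2 = (1 - \<bar>\<kappa>\<bar>)\<^sup>2 * ((cos \<alpha>)\<^sup>2 + (sin \<alpha>)\<^sup>2)" by simp
  also have "\<dots> \<le> (1 + \<kappa>)\<^sup>2 * (cos \<alpha>)\<^sup>2 + (1 - \<kappa>)\<^sup>2 * (sin \<alpha>)\<^sup>2"
    unfolding distrib_left using 1 by (intro add_mono mult_right_mono) auto
  finally show "(1 - \<bar>\<kappa>\<bar>)\<^sup>2 \<le> (rho \<alpha>)\<^sup>2" by (simp add: rho_square power_mult_distrib)
qed (use rho_pos[of \<alpha>] in simp)

lemma kappa_abs: "1 - \<bar>\<kappa>\<bar> > 0" using kappa_gt kappa_lt by auto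

lemma norm_wv: "norm (wv p m q) \<le> 1 / (1 - \<bar>\<kappa>\<bar>)"
  using rho_lower[of "snd q"] kappa_abs rho_pos[of "snd q"]
  by (simp add: wv_def norm_mult norm_divide frac_le)

lemma continuous_wv: "continuous_on A (wv p m)"
  unfolding wv_def using rho_pos
  by (intro continuous_intros continuous_on_compose2[OF continuous_rho[of UNIV]]
      continuous_on_compose2[OF continuous_cis_mult_scat[of UNIV]])
     (auto simp: less_imp_neq[THEN not_sym])

lemma measurable_wv [measurable]: "wv p m \<in> borel_measurable borel"
  by (rule borel_measurable_continuous_onI[OF continuous_wv])

lemma cis_int_2pi: "cis (of_int k * (x + 2 * pi)) = cis (of_int k * x)"
proof -
  have "cis (of_int k * (x + 2 * pi)) = cis (of_int k * x) * cis (of_int (2 * k) * pi)"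
    unfolding cis_mult by (simp add: algebra_simps)
  then show ?thesis unfolding cis_int_pi by (simp add: parity_sign_def)
qed

lemma rho_plus_2pi: "rho (\<alpha> + 2 * pi) = rho \<alpha>" by (simp add: rho_def)

lemma periodic_wv: "periodic_bdry (wv p m)"
  unfolding periodic_bdry_def wv_def fst_conv snd_conv scat_plus_2pi cis_int_2pi rho_plus_2pi by simp

lemma wv_L2: "wv p m \<in> L2_bdry \<kappa>"
  by (rule L2_bdryI[OF periodic_wv measurable_wv norm_wv])

lemma L2_bdry_sq: "w \<in> L2_bdry \<kappa> ==> square_integrable bm w"
  and L2_bdry_periodic: "w \<in> L2_bdry \<kappa> ==> periodic_bdry w"
  by (simp_all add: L2_bdry_def)

lemma wv_sq: "square_integrable bm (wv p m)" by (rule L2_bdry_sq[OF wv_L2])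

lemma wv_scattering: "wv p m (S q) = parity_sign (p + m) * wv p (2 * p - m) q"
proof -
  obtain \<beta> \<alpha> where q: "q = (\<beta>, \<alpha>)" by (cases q)
  have "cis (of_int p * (\<beta> + pi + 2 * sct \<alpha>)) * cis (of_int m * (pi - sct \<alpha>))
      = cis (of_int (p + m) * pi) * (cis (of_int p * \<beta>) * cis (of_int (2 * p - m) * sct \<alpha>))"
    unfolding cis_mult by (simp add: algebra_simps)
  then show ?thesis
    unfolding q wv_def scattering_def case_prod_conv fst_conv snd_conv scat_pi_minus rho_pi_minus cis_int_pi by simp
qed

lemma wv_shift: "wv p m (\<beta>, \<alpha> + pi) = parity_sign m * wv p m (\<beta>, \<alpha>)"
proof -
  have "cis (of_int m * (sct \<alpha> + pi)) = cis (of_int m * pi) * cis (of_int m * sct \<alpha>)"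
    unfolding cis_mult by (simp add: algebra_simps)
  then show ?thesis
    unfolding wv_def fst_conv snd_conv scat_plus_pi rho_plus_pi cis_int_pi by simp
qed

text \<open>Coefficients are left unnormalized; all basis functions have the same norm, by which a
  single division is made later.\<close>

definition cf :: "(real \<times> real => complex) => int => int => complex" where
  "cf g p m = L2_inner bm g (wv p m)"

lemma L2_bdry_scattering:
  assumes g: "g \<in> L2_bdry \<kappa>" shows "(%q. g (S q)) \<in> L2_bdry \<kappa>"
proof -
  note [measurable] = L2_bdry_measurable[OF g]
  have m: "(%q. (norm (g q))\<^sup>2) \<in> borel_measurable borel" "(%q. g (S q)) \<in> borel_measurable borel" by measurable
  have p: "periodic_bdry (%q. (norm (g q))\<^sup>2)"
    using L2_bdry_periodic[OF g] by (simp add: periodic_bdry_def)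
  have "integrable bm (%q. (norm (g q))\<^sup>2)" using L2_bdry_sq[OF g] by (simp add: square_integrable_def)
  then have "integrable bm (%q. (norm (g (S q)))\<^sup>2)" using integrable_scattering[OF m(1) p] by simp
  then show ?thesis
    using periodic_scattering[OF L2_bdry_periodic[OF g]] borel_measurable_bmI[OF m(2)]
    by (simp add: L2_bdry_def square_integrable_def)
qed

lemma cf_scattering:
  assumes g: "g \<in> L2_bdry \<kappa>"
  shows "cf (%q. g (S q)) p m = parity_sign (p + m) * cf g p (2 * p - m)"
proof -
  note [measurable] = L2_bdry_measurable[OF g]
  define f where "f q = g q * cnj (wv p (2 * p - m) q)" for q
  have per: "periodic_bdry f"
    using L2_bdry_periodic[OF g] periodic_wv[of p "2 * p - m"] by (simp add: periodic_bdry_def f_def)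
  have f: "f \<in> borel_measurable borel" unfolding f_def by measurable
  have "wv p m q = parity_sign (p + m) * wv p (2 * p - m) (S q)" for q
  proof -
    have "even (p + (2 * p - m)) = even (p + m)" by presburger
    then show ?thesis
      unfolding wv_scattering by (simp add: parity_sign_def)
  qed
  then have "cf (%q. g (S q)) p m = integral\<^sup>L bm (%q. parity_sign (p + m) * f (S q))"
    unfolding cf_def L2_inner_def f_def by (simp add: parity_sign_norm mult_ac)
  also have "\<dots> = parity_sign (p + m) * integral\<^sup>L bm (%q. f (S q))" by simp
  also have "integral\<^sup>L bm (%q. f (S q)) = integral\<^sup>L bm f"
    by (rule integral_scattering) (use f per in simp_all)
  finally show ?thesis by (simp add: cf_def L2_inner_def f_def[abs_def])
qed

lemma cf_shift:
  assumes g: "g \<in> L2_bdry \<kappa>"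
  shows "(%q. g (fst q, snd q + pi)) \<in> L2_bdry \<kappa>" "cf (%q. g (fst q, snd q + pi)) p m = parity_sign m * cf g p m"
proof -
  note [measurable] = L2_bdry_measurable[OF g]
  have sk: "skew (%_. 0) 1 pi q = (fst q, snd q + pi)" for q by (simp add: skew_def)
  have [measurable]: "(%q :: real \<times> real. (fst q, snd q + pi)) \<in> borel_measurable borel"
    using measurable_skew[of "%_. 0" 1 pi] unfolding skew_def by simp
  have m: "(%q. (norm (g q))\<^sup>2) \<in> borel_measurable borel" "(%q. g (fst q, snd q + pi)) \<in> borel_measurable borel" by measurable
  have p: "periodic_bdry (%q. (norm (g q))\<^sup>2)"
    using L2_bdry_periodic[OF g] by (simp add: periodic_bdry_def)
  have "integrable bm (%q. (norm (g q))\<^sup>2)" using L2_bdry_sq[OF g] by (simp add: square_integrable_def)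
  then have "integrable bm (%q. (norm (g (fst q, snd q + pi)))\<^sup>2)"
    using integrable_skew[of "%_. 0" 1, OF _ _ m(1) p, of pi] unfolding sk by simp
  moreover have "periodic_bdry (%q. g (fst q, snd q + pi))"
    unfolding periodic_bdry_def
  proof (intro allI conjI)
    fix \<beta> \<alpha>
    show "g (fst (\<beta> + 2 * pi, \<alpha>), snd (\<beta> + 2 * pi, \<alpha>) + pi) = g (fst (\<beta>, \<alpha>), snd (\<beta>, \<alpha>) + pi)"
      using L2_bdry_periodic[OF g] by (simp add: periodic_bdry_def)
    have "\<alpha> + 2 * pi + pi = (\<alpha> + pi) + 2 * pi" by simp
    moreover have "g (\<beta>, (\<alpha> + pi) + 2 * pi) = g (\<beta>, \<alpha> + pi)"
      using L2_bdry_periodic[OF g] unfolding periodic_bdry_def by blast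
    ultimately show "g (fst (\<beta>, \<alpha> + 2 * pi), snd (\<beta>, \<alpha> + 2 * pi) + pi) = g (fst (\<beta>, \<alpha>), snd (\<beta>, \<alpha>) + pi)"
      by (simp only: fst_conv snd_conv)
  qed
  ultimately show "(%q. g (fst q, snd q + pi)) \<in> L2_bdry \<kappa>"
    using borel_measurable_bmI[OF m(2)] by (simp add: L2_bdry_def square_integrable_def)
  define f where "f q = g q * cnj (wv p m q)" for q
  have per: "periodic_bdry f"
    using L2_bdry_periodic[OF g] periodic_wv[of p m] by (simp add: periodic_bdry_def f_def)
  have f: "f \<in> borel_measurable borel" unfolding f_def by measurable
  have e: "wv p m q = parity_sign m * wv p m (fst q, snd q + pi)" for q
    unfolding wv_shift mult.assoc[symmetric] parity_sign_norm by simp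
  have "g (fst q, snd q + pi) * cnj (wv p m q) = parity_sign m * f (skew (%_. 0) 1 pi q)" for q
    by (subst e) (simp add: f_def sk parity_sign_norm)
  then have "cf (%q. g (fst q, snd q + pi)) p m = integral\<^sup>L bm (%q. parity_sign m * f (skew (%_. 0) 1 pi q))"
    unfolding cf_def L2_inner_def by simp
  also have "\<dots> = parity_sign m * integral\<^sup>L bm (%q. f (skew (%_. 0) 1 pi q))" by simp
  also have "integral\<^sup>L bm (%q. f (skew (%_. 0) 1 pi q)) = integral\<^sup>L bm f"
    by (rule integral_skew) (use f per in simp_all)
  finally show "cf (%q. g (fst q, snd q + pi)) p m = parity_sign m * cf g p m"
    by (simp add: cf_def L2_inner_def f_def[abs_def])
qed

lemma integral_bm:
  fixes f :: "real \<times> real => complex"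
  assumes [measurable]: "f \<in> borel_measurable borel"
  shows "integral\<^sup>L bm f = (1 / (1 + \<kappa>)) *\<^sub>R integral\<^sup>L lborel (%q. indicator ({0<..<2*pi} \<times> {- (pi/2)<..<3*pi/2}) q *\<^sub>R f q)"
    and "integrable bm f \<longleftrightarrow> integrable lborel (%q. indicator ({0<..<2*pi} \<times> {- (pi/2)<..<3*pi/2}) q *\<^sub>R f q)"
proof -
  let ?D = "{0..2*pi} \<times> {- (pi/2)..3*pi/2}" and ?O = "{0<..<2*pi} \<times> {- (pi/2)<..<3*pi/2}"
  have [measurable]: "?O \<in> sets borel" by (intro borel_open open_Times) auto
  have m: "f \<in> borel_measurable (restrict_space lborel ?D)" by (intro measurable_restrict_space1) simp
  have c: "0 \<le> 1 / (1 + \<kappa>)" using kappa_const by simp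
  have ae: "AE q in lborel. indicator ?D q *\<^sub>R f q = indicator ?O q *\<^sub>R f q"
    using closed_box_AE by eventually_elim (simp add: indicator_def)
  have "integral\<^sup>L bm f = integral\<^sup>L (restrict_space lborel ?D) (%q. (1 / (1 + \<kappa>)) *\<^sub>R f q)"
    unfolding bdry_measure_def by (rule integral_density) (use m c in auto)
  also have "\<dots> = (1 / (1 + \<kappa>)) *\<^sub>R integral\<^sup>L (restrict_space lborel ?D) f" by (rule Bochner_Integration.integral_scaleR_right)
  also have "integral\<^sup>L (restrict_space lborel ?D) f = integral\<^sup>L lborel (%q. indicator ?D q *\<^sub>R f q)"
    by (rule integral_restrict_space) simp
  also have "\<dots> = integral\<^sup>L lborel (%q. indicator ?O q *\<^sub>R f q)"
    using ae by (intro integral_cong_AE) measurable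
  finally show "integral\<^sup>L bm f = (1 / (1 + \<kappa>)) *\<^sub>R integral\<^sup>L lborel (%q. indicator ?O q *\<^sub>R f q)" .
  have "integrable bm f \<longleftrightarrow> integrable (restrict_space lborel ?D) (%q. (1 / (1 + \<kappa>)) *\<^sub>R f q)"
    unfolding bdry_measure_def by (rule integrable_density) (use m c in auto)
  also have "\<dots> \<longleftrightarrow> integrable (restrict_space lborel ?D) f"
  proof
    assume "integrable (restrict_space lborel ?D) (%q. (1 / (1 + \<kappa>)) *\<^sub>R f q)"
    from integrable_scaleR_right[OF this, of "1 + \<kappa>"] show "integrable (restrict_space lborel ?D) f"
      using kappa_gt by simp
  next
    assume "integrable (restrict_space lborel ?D) f"
    then show "integrable (restrict_space lborel ?D) (%q. (1 / (1 + \<kappa>)) *\<^sub>R f q)" by (rule integrable_scaleR_right)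
  qed
  also have "\<dots> \<longleftrightarrow> integrable lborel (%q. indicator ?D q *\<^sub>R f q)"
    by (rule integrable_restrict_space) simp
  also have "\<dots> \<longleftrightarrow> integrable lborel (%q. indicator ?O q *\<^sub>R f q)"
    using ae by (intro integrable_cong_AE) measurable
  finally show "integrable bm f \<longleftrightarrow> integrable lborel (%q. indicator ?O q *\<^sub>R f q)" .
qed

section \<open>Completeness of the basis\<close>

inductive trig :: "(real \<times> real => complex) => bool" where
  mono: "trig (%q. c * (cis (of_int p * fst q) * cis (of_int m * sct (snd q))))"
| add: "trig f ==> trig g ==> trig (%q. f q + g q)"

lemma trig_mult_mono:
  "trig g ==> trig (%q. (c * (cis (of_int p * fst q) * cis (of_int m * sct (snd q)))) * g q)"
proof (induction rule: trig.induct)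
  case (mono d p' m')
  have h: "cis (of_int (k + l) * x) = cis (of_int k * x) * cis (of_int l * x)" for k l :: int and x
    by (simp add: cis_mult distrib_right)
  have "(c * (cis (of_int p * fst q) * cis (of_int m * sct (snd q)))) * (d * (cis (of_int p' * fst q) * cis (of_int m' * sct (snd q))))
     = (c * d) * (cis (of_int (p + p') * fst q) * cis (of_int (m + m') * sct (snd q)))" for q
    unfolding h by (simp only: mult_ac)
  then show ?case using trig.mono[of "c * d" "p + p'" "m + m'"] by (simp only:)
next
  case (add f g)
  then show ?case using trig.add unfolding distrib_left by blast
qed

lemma trig_mult: "trig f ==> trig g ==> trig (%q. f q * g q)"
proof (induction rule: trig.induct)
  case (mono c p m)
  then show ?case by (rule trig_mult_mono)
next
  case (add f h)
  then show ?case using trig.add unfolding distrib_right by blast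
qed

lemma trig_const: "trig (%q. c)"
  using trig.mono[of c 0 0] by simp

lemma trig_cmult: "trig f ==> trig (%q. c * f q)"
  by (rule trig_mult[OF trig_const])

lemma trig_coords:
  "trig (%q. of_real (cos (fst q)))" "trig (%q. of_real (sin (fst q)))"
  "trig (%q. of_real (cos (sct (snd q))))" "trig (%q. of_real (sin (sct (snd q))))"
proof -
  have c: "of_real (cos x) = 1/2 * cis x + 1/2 * cis (- x)" and s: "of_real (sin x) = (- \<i>/2) * cis x + (\<i>/2) * cis (- x)" for x
    by (simp_all add: complex_eq_iff)
  have 1: "trig (%q. c * cis (fst q))" "trig (%q. c * cis (- fst q))" "trig (%q. c * cis (sct (snd q)))" "trig (%q. c * cis (- sct (snd q)))" for c
    using trig.mono[of c 1 0] trig.mono[of c "-1" 0] trig.mono[of c 0 1] trig.mono[of c 0 "-1"] by simp_all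
  show "trig (%q. of_real (cos (fst q)))" unfolding c by (rule trig.add[OF 1(1) 1(2)])
  show "trig (%q. of_real (sin (fst q)))" unfolding s by (rule trig.add[OF 1(1) 1(2)])
  show "trig (%q. of_real (cos (sct (snd q))))" unfolding c by (rule trig.add[OF 1(3) 1(4)])
  show "trig (%q. of_real (sin (sct (snd q))))" unfolding s by (rule trig.add[OF 1(3) 1(4)])
qed

text \<open>Real polynomials in the real and imaginary parts of e^{i\<beta>} and e^{is} are
  trigonometric polynomials by Euler's formulas. This connects Stone-Weierstrass on a product of two
  circles with the basis.\<close>

lemma trig_polynomial:
  assumes "real_polynomial_function P"
  shows "trig (%q. of_real (P (cis (fst q), cis (sct (snd q)))))"
  using assms
proof (induction rule: real_polynomial_function.induct)
  case (linear f)
  interpret bounded_linear f by fact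
  have lin: "f (z, w) = Re z * f (1, 0) + Im z * f (\<i>, 0) + Re w * f (0, 1) + Im w * f (0, \<i>)" for z w
  proof -
    have "(z, w) = Re z *\<^sub>R (1, 0) + Im z *\<^sub>R (\<i>, 0) + Re w *\<^sub>R (0, 1) + Im w *\<^sub>R (0, \<i>)"
      by (simp add: complex_eq_iff)
    then have "f (z, w) = f (Re z *\<^sub>R (1, 0) + Im z *\<^sub>R (\<i>, 0) + Re w *\<^sub>R (0, 1) + Im w *\<^sub>R (0, \<i>))"
      by (rule arg_cong[where f = f])
    then show ?thesis by (simp only: add scaleR real_scaleR_def)
  qed
  have e: "complex_of_real (f (cis (fst q), cis (sct (snd q)))) =
     of_real (f (1, 0)) * of_real (cos (fst q)) + of_real (f (\<i>, 0)) * of_real (sin (fst q)) +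
     of_real (f (0, 1)) * of_real (cos (sct (snd q))) + of_real (f (0, \<i>)) * of_real (sin (sct (snd q)))" for q
    unfolding lin[of "cis (fst q)" "cis (sct (snd q))"] by (simp add: mult.commute)
  show ?case unfolding e by (intro trig.add trig_cmult trig_coords)
next
  case (const c)
  show ?case by (rule trig_const)
next
  case (add f g)
  then show ?case unfolding of_real_add by (intro trig.add)
next
  case (mult f g)
  then show ?case unfolding of_real_mult by (intro trig_mult)
qed

lemma trig_bounded: "trig f ==> f \<in> borel_measurable borel \<and> (\<exists>B. \<forall>q. norm (f q) \<le> B)"
proof (induction rule: trig.induct)
  case (mono c p m)
  have "continuous_on UNIV (%q. c * (cis (of_int p * fst q) * cis (of_int m * sct (snd q))))"
    by (intro continuous_intros continuous_on_compose2[OF continuous_cis_mult_scat[of UNIV]]) auto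
  then show ?case by (auto intro!: borel_measurable_continuous_onI exI[of _ "norm c"] simp: norm_mult)
next
  case (add f g)
  then obtain A B where "\<forall>q. norm (f q) \<le> A" "\<forall>q. norm (g q) \<le> B" by blast
  then have "norm (f q + g q) \<le> A + B" for q
    using norm_triangle_mono[of "f q" A "g q" B] by blast
  then show ?case using add.IH by (intro conjI borel_measurable_add exI[of _ "A + B"]) auto
qed

lemma integrable_bounded_mult:
  assumes "integrable bm G" "f \<in> borel_measurable borel" "!!q. norm (f q) \<le> B"
  shows "integrable bm (%q. G q * (f q :: complex))"
proof (rule Bochner_Integration.integrable_bound[where f = "%q. B * norm (G q)"])
  show "integrable bm (%q. B * norm (G q))" using assms(1) by auto
  show "(%q. G q * f q) \<in> borel_measurable bm"
    using assms(1) borel_measurable_bmI[OF assms(2)] by auto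
  show "AE q in bm. norm (G q * f q) \<le> norm (B * norm (G q))"
  proof (rule AE_I2)
    fix q
    have "norm (G q * f q) = norm (f q) * norm (G q)" by (simp add: norm_mult)
    also have "\<dots> \<le> B * norm (G q)" using assms(3) by (intro mult_right_mono) auto
    also have "\<dots> \<le> norm (B * norm (G q))" by (simp only: real_norm_def abs_ge_self)
    finally show "norm (G q * f q) \<le> norm (B * norm (G q))" .
  qed
qed

text \<open>Embeds the half-open fundamental domain injectively into a compact torus in C^2, on
  which approximation is carried out.\<close>

definition tor :: "real \<times> real => complex \<times> complex" where
  "tor q = (cis (fst q), cis (sct (snd q)))"

lemma continuous_tor: "continuous_on A tor"
  unfolding tor_def
  by (intro continuous_intros continuous_on_compose2[OF continuous_cis_scat[of UNIV]]) auto

lemma cis_eq_interval: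
  assumes "cis x = cis y" "a \<le> x" "x < a + 2 * pi" "a \<le> y" "y < a + 2 * pi"
  shows "x = y"
proof -
  have "sin x = sin y" "cos x = cos y" using assms(1) by (simp_all add: complex_eq_iff)
  then obtain n :: int where n: "x = y + 2 * pi * of_int n" using sin_cos_eq_iff[of x y] by auto
  have "\<bar>2 * pi * of_int n\<bar> < 2 * pi * 1" using n assms by linarith
  then have "2 * pi * \<bar>of_int n\<bar> < 2 * pi * 1" by (simp add: abs_mult)
  then have "\<bar>real_of_int n\<bar> < 1" by (simp add: mult_less_cancel_left_pos)
  then have "real_of_int \<bar>n\<bar> < 1" by (simp only: of_int_abs)
  then have "n = 0" by simp
  then show ?thesis using n by simp
qed

lemma tor_inj:
  assumes "tor p = tor q" "p \<in> fund" "q \<in> fund" shows "p = q"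
proof -
  have "cis (fst p) = cis (fst q)" and s: "cis (sct (snd p)) = cis (sct (snd q))"
    using assms(1) by (simp_all add: tor_def)
  with cis_scat_inj[OF s] show ?thesis
    using cis_eq_interval[of "fst p" "fst q" 0] cis_eq_interval[of "snd p" "snd q" "- (pi/2)"] assms(2,3)
    by (auto simp: fund_def mem_Times_iff prod_eq_iff)
qed

text \<open>Approximation is uniform on the torus, so an integrable G, paired with the error,
  contributes at most e times its L1 norm.\<close>

lemma continuous_test_zero:
  assumes G: "integrable bm G" and zero: "!!t. trig t ==> integral\<^sup>L bm (%q. G q * t q) = 0"
    and F: "continuous_on UNIV (F :: complex \<times> complex => real)"
  shows "integral\<^sup>L bm (%q. G q * of_real (F (tor q))) = 0"
proof -
  define T where "T = sphere (0::complex) 1 \<times> sphere (0::complex) 1"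
  have T: "compact T" unfolding T_def by (intro compact_Times compact_sphere)
  have tT: "tor q \<in> T" for q by (simp add: tor_def T_def)
  have cF: "continuous_on T F" using F by (rule continuous_on_subset) simp
  obtain B where B: "!!z. z \<in> T ==> \<bar>F z\<bar> \<le> B"
    using compact_imp_bounded[OF compact_continuous_image[OF cF T]] unfolding bounded_iff by auto
  have mF: "(%q. complex_of_real (F (tor q))) \<in> borel_measurable borel"
    by (intro borel_measurable_continuous_onI continuous_intros continuous_on_compose2[OF F continuous_tor]) auto
  have iF: "integrable bm (%q. G q * of_real (F (tor q)))"
    by (rule integrable_bounded_mult[OF G mF, where B = B]) (simp add: B tT)
  define I where "I = integral\<^sup>L bm (%q. norm (G q))"
  have I0: "I \<ge> 0" unfolding I_def by (intro integral_nonneg_AE) simp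
  have "norm (integral\<^sup>L bm (%q. G q * of_real (F (tor q)))) \<le> e * I" if e: "e > 0" for e
  proof -
    obtain P where P: "polynomial_function P" "!!z. z \<in> T ==> norm (F z - P z) < e"
      using Stone_Weierstrass_polynomial_function[OF T cF e] by auto
    then have rP: "real_polynomial_function P" by (simp add: real_polynomial_function_eq)
    have tr: "trig (%q. of_real (P (tor q)))" using trig_polynomial[OF rP] by (simp add: tor_def)
    then obtain C where C: "(%q. complex_of_real (P (tor q))) \<in> borel_measurable borel" "!!q. norm (complex_of_real (P (tor q))) \<le> C"
      using trig_bounded by blast
    have iP: "integrable bm (%q. G q * of_real (P (tor q)))" by (rule integrable_bounded_mult[OF G C])
    have "integral\<^sup>L bm (%q. G q * of_real (F (tor q)))
        = integral\<^sup>L bm (%q. G q * of_real (F (tor q))) - integral\<^sup>L bm (%q. G q * of_real (P (tor q)))"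
      using zero[OF tr] by simp
    also have "\<dots> = integral\<^sup>L bm (%q. G q * of_real (F (tor q)) - G q * of_real (P (tor q)))"
      by (rule Bochner_Integration.integral_diff[OF iF iP, symmetric])
    also have "norm \<dots> \<le> integral\<^sup>L bm (%q. e * norm (G q))"
    proof (rule order_trans[OF integral_norm_bound integral_mono])
      show "integrable bm (%q. norm (G q * of_real (F (tor q)) - G q * of_real (P (tor q))))"
        by (intro integrable_norm Bochner_Integration.integrable_diff iF iP)
      show "integrable bm (%q. e * norm (G q))" using G by simp
      fix q
      have "norm (G q * of_real (F (tor q)) - G q * of_real (P (tor q))) = norm (G q) * norm (F (tor q) - P (tor q))"
        unfolding right_diff_distrib[symmetric] of_real_diff[symmetric] norm_mult norm_of_real real_norm_def ..
      also have "\<dots> \<le> norm (G q) * e" using P(2)[OF tT[of q]] by (intro mult_left_mono) auto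
      finally show "norm (G q * of_real (F (tor q)) - G q * of_real (P (tor q))) \<le> e * norm (G q)" by (simp add: mult.commute)
    qed
    also have "\<dots> = e * I" by (simp add: I_def)
    finally show ?thesis .
  qed
  note est = this
  have "norm (integral\<^sup>L bm (%q. G q * of_real (F (tor q)))) \<le> 0"
  proof (rule field_le_epsilon)
    fix e :: real assume e: "0 < e"
    have "norm (integral\<^sup>L bm (%q. G q * of_real (F (tor q)))) \<le> e / (I + 1) * I"
      using e I0 by (intro est) simp
    also have "\<dots> \<le> e" using e I0 by (simp add: field_simps)
    finally show "norm (integral\<^sup>L bm (%q. G q * of_real (F (tor q)))) \<le> 0 + e" by simp
  qed
  then show ?thesis by simp
qed

abbreviation open_fund :: "(real \<times> real) set" where
  "open_fund \<equiv> {0<..<2*pi} \<times> {- (pi/2)<..<3*pi/2}"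

text \<open>The indicator of K is a bounded pointwise limit of continuous functions of the distance
  to the compact image of K in the torus. Points of the fundamental domain outside K have positive
  distance by injectivity, which is why K has to stay away from the edges that are glued.\<close>

lemma compact_test_zero:
  assumes G: "integrable bm G" and mG: "G \<in> borel_measurable borel" and zero: "!!t. trig t ==> integral\<^sup>L bm (%q. G q * t q) = 0"
    and K: "compact K" "K \<subseteq> open_fund"
  shows "integral\<^sup>L bm (%q. G q * indicator K q) = 0"
proof (cases "K = {}")
  case True then show ?thesis by simp
next
  case False
  define L where "L = tor ` K"
  have L: "compact L" "L ~= {}"
    unfolding L_def using False by (auto intro!: compact_continuous_image continuous_tor K)
  define F where "F n z = max 0 (1 - real n * infdist z L)" for n z
  have cF: "continuous_on UNIV (F n)" for n
    unfolding F_def by (intro continuous_intros continuous_on_infdist)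
  have F01: "\<bar>F n z\<bar> \<le> 1" for n z using infdist_nonneg[of z L] by (auto simp: F_def abs_le_iff)
  have lim: "(%n. F n (tor q)) \<longlonglongrightarrow> indicator K q" if q: "q \<in> fund" for q
  proof (cases "q \<in> K")
    case True
    then have "infdist (tor q) L = 0" by (intro infdist_zero) (simp add: L_def)
    then show ?thesis using True by (simp add: F_def)
  next
    case False
    have "tor q \<notin> L"
    proof
      assume "tor q \<in> L"
      then obtain p where "p \<in> K" "tor q = tor p" by (auto simp: L_def)
      then show False using tor_inj[of q p] q K(2) False by (auto simp: fund_def)
    qed
    then have d: "infdist (tor q) L > 0"
      using L infdist_pos_not_in_closed[of L "tor q"] compact_imp_closed by blast
    obtain N where N: "1 / infdist (tor q) L < real N" using reals_Archimedean2 by blast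
    have "F n (tor q) = 0" if "n \<ge> N" for n
    proof -
      have "1 / infdist (tor q) L < real n" using N that by simp
      then have "1 < real n * infdist (tor q) L" using d by (simp add: pos_divide_less_eq)
      then show ?thesis by (simp add: F_def)
    qed
    then have "\<forall>\<^sub>F n in sequentially. F n (tor q) = indicator K q"
      using False by (auto simp: eventually_sequentially)
    then show ?thesis by (rule tendsto_eventually)
  qed
  have mK: "K \<in> sets borel" using K(1) by (intro borel_closed compact_imp_closed)
  have "(%n. integral\<^sup>L bm (%q. G q * of_real (F n (tor q)))) \<longlonglongrightarrow> integral\<^sup>L bm (%q. G q * indicator K q)"
  proof (rule integral_dominated_convergence[where w = "%q. norm (G q)"])
    show "(%q. G q * indicator K q) \<in> borel_measurable bm"
      using mK mG by (intro borel_measurable_bmI borel_measurable_times borel_measurable_indicator) auto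
    show "(%q. G q * of_real (F n (tor q))) \<in> borel_measurable bm" for n
    proof (rule borel_measurable_bmI, rule borel_measurable_times[OF mG])
      show "(%q. complex_of_real (F n (tor q))) \<in> borel_measurable borel"
        by (intro borel_measurable_continuous_onI
          continuous_intros continuous_on_compose2[OF cF continuous_tor]) auto
    qed
    show "integrable bm (%q. norm (G q))" using G by simp
    show "AE q in bm. norm (G q * of_real (F n (tor q))) \<le> norm (G q)" for n
      using F01[of n] by (intro AE_I2) (simp add: norm_mult mult_left_le)
    have "AE q in bm. q \<in> fund"
    proof -
      have "AE q in lborel. q \<in> {0..2*pi} \<times> {- (pi/2)..3*pi/2} \<longrightarrow> q \<in> fund"
        using closed_box_AE by eventually_elim (auto simp: fund_def)
      then have "AE q in restrict_space lborel ({0..2*pi} \<times> {- (pi/2)..3*pi/2}). q \<in> fund"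
        by (subst AE_restrict_space_iff) auto
      then show ?thesis unfolding bdry_measure_def by (subst AE_density) auto
    qed
    then show "AE q in bm. (%n. G q * of_real (F n (tor q))) \<longlonglongrightarrow> G q * indicator K q"
    proof eventually_elim
      fix q assume q: "q \<in> fund"
      have "(%n. G q * of_real (F n (tor q))) \<longlonglongrightarrow> G q * of_real (indicator K q)"
        by (intro tendsto_mult tendsto_of_real lim[OF q] tendsto_const)
      then show "(%n. G q * of_real (F n (tor q))) \<longlonglongrightarrow> G q * indicator K q"
        by (cases "q \<in> K") simp_all
    qed
  qed
  moreover have "integral\<^sup>L bm (%q. G q * of_real (F n (tor q))) = 0" for n
    by (rule continuous_test_zero[OF G zero cF])
  ultimately show ?thesis by (simp add: LIMSEQ_const_iff)
qed

text \<open>Inner regularity passes from compact sets to arbitrary measurable sets, and an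
  integrable function whose integral over every measurable set vanishes is zero almost
  everywhere.\<close>

lemma trig_test_zero:
  assumes G: "integrable bm G" and mG [measurable]: "G \<in> borel_measurable borel"
    and zero: "!!t. trig t ==> integral\<^sup>L bm (%q. G q * t q) = 0"
  shows "AE q in bm. G q = 0"
proof -
  have O [measurable]: "open_fund \<in> sets borel" by (intro borel_open open_Times) auto
  define g where "g q = indicator open_fund q *\<^sub>R G q" for q
  have g: "integrable lborel g" using G integral_bm(2)[OF mG] by (simp add: g_def[abs_def])
  have mg [measurable]: "g \<in> borel_measurable borel" unfolding g_def by measurable
  \<comment> \<open>Regularity is applied to the finite measure with density |g| rather than to
    Lebesgue measure, so that smallness of a remainder set bounds the integral of g over it
    directly.\<close>
  define \<nu> where "\<nu> = density lborel (%q. ennreal (norm (g q)))"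
  have s\<nu>: "sets \<nu> = sets borel" by (simp add: \<nu>_def)
  have em: "emeasure \<nu> A = (\<integral>\<^sup>+ q. ennreal (norm (g q)) * indicator A q \<partial>lborel)" if "A \<in> sets borel" for A
    unfolding \<nu>_def using that by (intro emeasure_density) auto
  have fin: "emeasure \<nu> UNIV < \<infinity>"
    using g unfolding integrable_iff_bounded by (simp add: em)
  have zK: "integral\<^sup>L lborel (%q. indicator K q *\<^sub>R g q) = 0" if K: "compact K" "K \<subseteq> open_fund" for K
  proof -
    have mK: "K \<in> sets borel" using K(1) by (intro borel_closed compact_imp_closed)
    have mGK: "(%q. G q * indicator K q) \<in> borel_measurable borel"
      using mK mG by (intro borel_measurable_times borel_measurable_indicator) auto
    have "0 = integral\<^sup>L bm (%q. G q * indicator K q)" using compact_test_zero[OF G mG zero K] by simp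
    also have "\<dots> = (1 / (1 + \<kappa>)) *\<^sub>R integral\<^sup>L lborel (%q. indicator open_fund q *\<^sub>R (G q * indicator K q))"
      by (rule integral_bm(1)[OF mGK])
    also have "(%q. indicator open_fund q *\<^sub>R (G q * indicator K q)) = (%q. indicator K q *\<^sub>R g q)"
      by (auto simp: g_def indicator_def)
    finally show ?thesis using kappa_gt by simp
  qed
  have zA: "set_lebesgue_integral lborel A g = 0" if A: "A \<in> sets lborel" for A
  proof -
    have A' [measurable]: "A \<in> sets borel" using A by simp
    let ?B = "A \<inter> open_fund"
    have B [measurable]: "?B \<in> sets borel" by measurable
    have iB: "integrable lborel (%q. indicator C q *\<^sub>R g q)" if "C \<in> sets borel" for C
      using that by (intro integrable_mult_indicator g) simp
    have "norm (integral\<^sup>L lborel (%q. indicator ?B q *\<^sub>R g q)) \<le> 0"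
    proof (rule field_le_epsilon)
      fix e :: real assume e: "0 < e"
      have fB: "emeasure \<nu> ?B < \<infinity>"
        by (rule le_less_trans[OF emeasure_mono fin]) (simp_all add: s\<nu>)
      have sp: "space \<nu> = UNIV" by (simp add: \<nu>_def)
      have sup: "emeasure \<nu> ?B = (SUP K \<in> {K. K \<subseteq> ?B \<and> compact K}. emeasure \<nu> K)"
        by (rule inner_regular) (use fin in \<open>simp_all add: s\<nu> sp\<close>)
      have "{} \<in> {K. K \<subseteq> ?B \<and> compact K}" by simp
      then have "\<exists>K\<in>{K. K \<subseteq> ?B \<and> compact K}. emeasure \<nu> ?B < emeasure \<nu> K + ennreal e"
        using fB e by (intro SUP_approx_ennreal[OF _ _ sup]) auto
      then obtain K where K: "K \<subseteq> ?B" "compact K" "emeasure \<nu> ?B < emeasure \<nu> K + ennreal e" by auto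
      have mK [measurable]: "K \<in> sets borel" using K(2) by (intro borel_closed compact_imp_closed)
      have "emeasure \<nu> ?B = emeasure \<nu> K + emeasure \<nu> (?B - K)"
        using K(1) by (subst plus_emeasure) (auto simp: s\<nu> Un_absorb1)
      then have "emeasure \<nu> K + emeasure \<nu> (?B - K) < emeasure \<nu> K + ennreal e" using K(3) by (simp only:)
      then have small: "emeasure \<nu> (?B - K) \<le> ennreal e"
        unfolding ennreal_add_left_cancel_less by (simp add: less_imp_le)
      have iBK: "integrable lborel (%q. indicator (?B - K) q *\<^sub>R g q)" by (rule iB) measurable
      have split: "indicator ?B q *\<^sub>R g q = indicator K q *\<^sub>R g q + indicator (?B - K) q *\<^sub>R g q" for q
        using K(1) by (auto simp: indicator_def)
      have "integral\<^sup>L lborel (%q. indicator ?B q *\<^sub>R g q)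
          = integral\<^sup>L lborel (%q. indicator K q *\<^sub>R g q) + integral\<^sup>L lborel (%q. indicator (?B - K) q *\<^sub>R g q)"
        unfolding split by (intro Bochner_Integration.integral_add iBK iB[OF mK])
      also have "integral\<^sup>L lborel (%q. indicator K q *\<^sub>R g q) = 0" using zK[OF K(2)] K(1) by blast
      finally have "integral\<^sup>L lborel (%q. indicator ?B q *\<^sub>R g q) = integral\<^sup>L lborel (%q. indicator (?B - K) q *\<^sub>R g q)" by simp
      also have "norm \<dots> \<le> e"
      proof -
        have "ennreal (norm (integral\<^sup>L lborel (%q. indicator (?B - K) q *\<^sub>R g q)))
           \<le> (\<integral>\<^sup>+ q. ennreal (norm (indicator (?B - K) q *\<^sub>R g q)) \<partial>lborel)"
          by (rule integral_norm_bound_ennreal[OF iBK])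
        also have "\<dots> = emeasure \<nu> (?B - K)"
          by (subst em) (auto intro!: nn_integral_cong simp: indicator_def)
        also have "\<dots> \<le> ennreal e" by (rule small)
        finally show ?thesis using e by simp
      qed
      finally show "norm (integral\<^sup>L lborel (%q. indicator ?B q *\<^sub>R g q)) \<le> 0 + e" by simp
    qed
    moreover have "(%q. indicator ?B q *\<^sub>R g q) = (%q. indicator A q *\<^sub>R g q)"
      by (auto simp: g_def indicator_def)
    ultimately show ?thesis by (simp add: set_lebesgue_integral_def)
  qed
  have "AE q in lborel. g q = 0" by (rule sigma_finite_measure.density_zero[OF sigma_finite_lborel g zA])
  then have "AE q in lborel. q \<in> {0..2*pi} \<times> {- (pi/2)..3*pi/2} \<longrightarrow> G q = 0"
    using closed_box_AE by eventually_elim (auto simp: g_def)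
  then have "AE q in restrict_space lborel ({0..2*pi} \<times> {- (pi/2)..3*pi/2}). G q = 0"
    by (subst AE_restrict_space_iff) auto
  then show ?thesis unfolding bdry_measure_def by (subst AE_density) auto
qed

text \<open>The factor 1/\<rho> is bounded and nowhere zero, so it can be moved from the basis
  function to g; the frequencies change sign because the inner product conjugates its second
  argument.\<close>

lemma cf_unique_zero:
  assumes g: "g \<in> L2_bdry \<kappa>" and zero: "!!p m. cf g p m = 0"
  shows "AE q in bm. g q = 0"
proof -
  note [measurable] = L2_bdry_measurable[OF g]
  have [measurable]: "(%q :: real \<times> real. rho (snd q)) \<in> borel_measurable borel"
    by (intro borel_measurable_continuous_onI continuous_on_compose2[OF continuous_rho[of UNIV]] continuous_intros) auto
  define r where "r q = complex_of_real (1 / rho (snd q))" for q :: "real \<times> real"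
  have r: "r \<in> borel_measurable borel" unfolding r_def by measurable
  have rb: "norm (r q) \<le> 1 / (1 - \<bar>\<kappa>\<bar>)" for q
    using rho_lower[of "snd q"] kappa_abs rho_pos[of "snd q"] by (simp add: r_def norm_divide frac_le)
  define G where "G q = g q * r q" for q
  have ig: "integrable bm g" by (rule square_integrable_integrable[OF finite_bm L2_bdry_sq[OF g]])
  have iG: "integrable bm G" unfolding G_def by (rule integrable_bounded_mult[OF ig r rb])
  have mG: "G \<in> borel_measurable borel" unfolding G_def using r by measurable
  have "AE q in bm. G q = 0"
  proof (rule trig_test_zero[OF iG mG])
    fix t assume "trig t"
    then show "integral\<^sup>L bm (%q. G q * t q) = 0"
    proof (induction rule: trig.induct)
      case (mono c p m)
      have "wv (- p) (- m) q = r q * (cis (- (of_int p * fst q)) * cis (- (of_int m * sct (snd q))))" for q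
        by (simp add: wv_def r_def)
      then have e: "G q * (c * (cis (of_int p * fst q) * cis (of_int m * sct (snd q)))) = c * (g q * cnj (wv (- p) (- m) q))" for q
        by (simp add: G_def r_def cis_cnj mult_ac)
      show ?case unfolding e using zero[of "- p" "- m"] by (simp add: cf_def L2_inner_def)
    next
      case (add f h)
      have "integrable bm (%q. G q * f q)" "integrable bm (%q. G q * h q)"
        using trig_bounded[OF add.hyps(1)] trig_bounded[OF add.hyps(2)]
        by (elim conjE exE, blast intro: integrable_bounded_mult[OF iG])+
      then show ?case unfolding distrib_left using add.IH by simp
    qed
  qed
  then show ?thesis
  proof eventually_elim
    fix q assume "G q = 0"
    moreover have "r q ~= 0" using rho_pos[of "snd q"] by (simp add: r_def)
    ultimately show "g q = 0" by (simp add: G_def)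
  qed
qed

lemma cf_unique:
  assumes f: "f \<in> L2_bdry \<kappa>" and g: "g \<in> L2_bdry \<kappa>" and eq: "!!p m. cf f p m = cf g p m"
  shows "AE q in bm. f q = g q"
proof -
  have d: "(%q. f q - g q) \<in> L2_bdry \<kappa>"
    using square_integrable_diff[OF L2_bdry_sq[OF f] L2_bdry_sq[OF g]] L2_bdry_periodic[OF f] L2_bdry_periodic[OF g]
    by (simp add: L2_bdry_def periodic_bdry_def)
  have "cf (%q. f q - g q) p m = 0" for p m
    unfolding cf_def using L2_inner_diff_left[OF L2_bdry_sq[OF f] L2_bdry_sq[OF g] wv_sq] eq by (simp add: cf_def)
  from cf_unique_zero[OF d this] show ?thesis by simp
qed

end

section \<open>The Hilbert transform\<close>

lemma measurable_cis_mult [measurable]: "(%x::real. cis (c * x)) \<in> borel_measurable borel"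
  "(%x::real. cis (- (c * x))) \<in> borel_measurable borel"
  by (intro borel_measurable_continuous_onI continuous_intros)+

abbreviation fib :: "real set" where "fib \<equiv> {- (pi/2)..3*pi/2}"

context curved_disk
begin

lemma integral_cis_fib:
  "integral\<^sup>L lborel (%\<alpha>. indicator fib \<alpha> *\<^sub>R cis (of_int n * \<alpha>)) = (if n = 0 then of_real (2 * pi) else 0)"
proof (cases "n = 0")
  case True
  have "integral\<^sup>L lborel (%\<alpha>. indicator fib \<alpha> *\<^sub>R (1::complex)) = complex_of_real (3*pi/2) - complex_of_real (- (pi/2))"
    by (rule integral_FTC_atLeastAtMost) (auto intro!: derivative_eq_intros)
  then show ?thesis using True by simp
next
  case False
  let ?F = "%\<alpha>. (- \<i> / of_int n) * cis (of_int n * \<alpha>)"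
  have "integral\<^sup>L lborel (%\<alpha>. indicator fib \<alpha> *\<^sub>R cis (of_int n * \<alpha>)) = ?F (3*pi/2) - ?F (- (pi/2))"
  proof (rule integral_FTC_atLeastAtMost)
    have "((%\<alpha>. cis (of_int n * \<alpha>)) has_vector_derivative (of_int n * \<i>) * cis (of_int n * x)) (at x within fib)" for x
    proof -
      have "((%\<alpha>. exp (\<alpha> *\<^sub>R (\<i> * of_int n))) has_vector_derivative exp (x *\<^sub>R (\<i> * of_int n)) * (\<i> * of_int n)) (at x within fib)"
        by (rule exp_scaleR_has_vector_derivative_right)
      moreover have "exp (\<alpha> *\<^sub>R (\<i> * of_int n)) = cis (of_int n * \<alpha>)" for \<alpha>
        by (simp add: cis_conv_exp scaleR_conv_of_real mult_ac)
      ultimately show ?thesis by (simp add: mult_ac)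
    qed
    from has_vector_derivative_mult_right[OF this, of "- \<i> / of_int n"]
    show "(?F has_vector_derivative cis (of_int n * x)) (at x within fib)" for x
      using False by simp
    show "continuous_on fib (%\<alpha>. cis (of_int n * \<alpha>))" by (intro continuous_intros)
  qed simp
  moreover have "cis (of_int n * (3*pi/2)) = cis (of_int n * (- (pi/2)))"
    using cis_int_2pi[of n "- (pi/2)"] by (simp add: algebra_simps)
  ultimately show ?thesis using False by simp
qed

definition mode :: "(real \<times> real => complex) => int => real \<times> real => complex" where
  "mode w k q = fiber_coeff w k (fst q) * cis (of_int k * snd q)"

lemma fiber_coeff_eq:
  "fiber_coeff w k \<beta> = of_real (1 / (2*pi)) * integral\<^sup>L lborel (%\<alpha>. indicator fib \<alpha> *\<^sub>R (w (\<beta>, \<alpha>) * cis (- (of_int k * \<alpha>))))"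
  by (simp add: fiber_coeff_def set_lebesgue_integral_def)

lemma borel_pair: "f \<in> borel_measurable (borel :: (real \<times> real) measure) ==> f \<in> borel_measurable (borel \<Otimes>\<^sub>M borel)"
  by (simp add: borel_prod)

lemma measurable_section:
  assumes "f \<in> borel_measurable (borel :: (real \<times> real) measure)"
  shows "(%\<alpha>. f (\<beta>, \<alpha>)) \<in> borel_measurable borel"
  by (rule measurable_compose[OF _ borel_pair[OF assms]]) simp

lemma measurable_fiber_coeff:
  assumes "w \<in> borel_measurable borel"
  shows "fiber_coeff w k \<in> borel_measurable borel"
proof -
  note [measurable] = borel_pair[OF assms]
  show ?thesis unfolding fiber_coeff_eq by measurable
qed

lemma integral_bm_fubini:
  assumes f: "f \<in> borel_measurable borel" and i: "integrable bm f"
  shows "integral\<^sup>L bm f = (1 / (1 + \<kappa>)) *\<^sub>R integral\<^sup>L lborel (%\<beta>. indicator {0..2*pi} \<beta> *\<^sub>R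
     integral\<^sup>L lborel (%\<alpha>. indicator fib \<alpha> *\<^sub>R (f (\<beta>, \<alpha>) :: complex)))"
proof -
  let ?D = "{0..2*pi} \<times> fib"
  have O [measurable]: "open_fund \<in> sets borel" by (intro borel_open open_Times) auto
  note [measurable] = f
  have ae: "AE q in lborel. indicator open_fund q *\<^sub>R f q = indicator ?D q *\<^sub>R f q"
    using closed_box_AE by eventually_elim (simp add: indicator_def)
  have iD: "integrable lborel (%q. indicator ?D q *\<^sub>R f q)"
    using i unfolding integral_bm(2)[OF f] by (subst (asm) integrable_cong_AE[OF _ _ ae]) measurable
  have "integral\<^sup>L lborel (%q. indicator open_fund q *\<^sub>R f q) = integral\<^sup>L lborel (%q. indicator ?D q *\<^sub>R f q)"
    using ae by (intro integral_cong_AE) measurable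
  also have "\<dots> = integral\<^sup>L lborel (%\<beta>. integral\<^sup>L lborel (%\<alpha>. indicator ?D (\<beta>, \<alpha>) *\<^sub>R f (\<beta>, \<alpha>)))"
    using lborel_pair.integral_fst'[of "%q. indicator ?D q *\<^sub>R f q"] iD
    by (simp add: lborel_prod)
  also have "\<dots> = integral\<^sup>L lborel (%\<beta>. indicator {0..2*pi} \<beta> *\<^sub>R integral\<^sup>L lborel (%\<alpha>. indicator fib \<alpha> *\<^sub>R f (\<beta>, \<alpha>)))"
    by (simp add: indicator_times scaleR_scaleR[symmetric] del: scaleR_scaleR)
  finally show ?thesis unfolding integral_bm(1)[OF f] by simp
qed

text \<open>Cauchy-Schwarz on one fibre. The estimate is made in extended reals so that it holds for
  every \<beta>: on fibres where w is not square integrable the right-hand side is infinite.\<close>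

lemma fiber_coeff_bound:
  assumes w: "w \<in> borel_measurable borel"
  shows "ennreal ((norm (fiber_coeff w k \<beta>))\<^sup>2) \<le> ennreal (1 / (2*pi)) * (\<integral>\<^sup>+ \<alpha>. ennreal ((norm (w (\<beta>, \<alpha>)))\<^sup>2) * indicator fib \<alpha> \<partial>lborel)"
proof -
  let ?M = "restrict_space lborel fib"
  note [measurable] = measurable_section[OF w, of \<beta>]
  have mM: "(%\<alpha>. w (\<beta>, \<alpha>)) \<in> borel_measurable ?M" by (intro measurable_restrict_space1) simp
  have finM: "finite_measure ?M"
    by (intro finite_measureI) (simp add: space_restrict_space emeasure_restrict_space)
  have nn: "(\<integral>\<^sup>+ \<alpha>. ennreal ((norm (w (\<beta>, \<alpha>)))\<^sup>2) * indicator fib \<alpha> \<partial>lborel) = (\<integral>\<^sup>+ \<alpha>. ennreal ((norm (w (\<beta>, \<alpha>)))\<^sup>2) \<partial>?M)"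
    by (rule nn_integral_restrict_space[symmetric]) simp
  show ?thesis
  proof (cases "square_integrable ?M (%\<alpha>. w (\<beta>, \<alpha>))")
    case True
    let ?e = "%\<alpha>. cis (of_int k * \<alpha>)"
    have me: "?e \<in> borel_measurable ?M" by (intro measurable_restrict_space1) measurable
    have e: "square_integrable ?M ?e"
      by (rule square_integrable_bounded[OF finM me, of 1]) simp
    have ne: "(L2_norm ?M ?e)\<^sup>2 = 2 * pi"
      unfolding L2_norm_square by (simp add: measure_restrict_space space_restrict_space)
    have "fiber_coeff w k \<beta> = of_real (1 / (2*pi)) * L2_inner ?M (%\<alpha>. w (\<beta>, \<alpha>)) ?e"
      unfolding fiber_coeff_eq L2_inner_def by (subst integral_restrict_space) (simp_all add: cis_cnj)
    then have "norm (fiber_coeff w k \<beta>) = 1 / (2*pi) * norm (L2_inner ?M (%\<alpha>. w (\<beta>, \<alpha>)) ?e)"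
      by (simp only: norm_mult norm_of_real) simp
    also have "\<dots> \<le> 1 / (2*pi) * (L2_norm ?M (%\<alpha>. w (\<beta>, \<alpha>)) * L2_norm ?M ?e)"
      by (rule mult_left_mono[OF L2_cauchy_schwarz[OF True e]]) simp
    finally have "norm (fiber_coeff w k \<beta>) \<le> 1 / (2*pi) * (L2_norm ?M (%\<alpha>. w (\<beta>, \<alpha>)) * L2_norm ?M ?e)" .
    then have "(norm (fiber_coeff w k \<beta>))\<^sup>2 \<le> (1 / (2*pi) * (L2_norm ?M (%\<alpha>. w (\<beta>, \<alpha>)) * L2_norm ?M ?e))\<^sup>2"
      by (rule power_mono) (rule norm_ge_zero)
    also have "\<dots> = (1 / (2*pi))\<^sup>2 * (2 * pi) * (L2_norm ?M (%\<alpha>. w (\<beta>, \<alpha>)))\<^sup>2"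
      unfolding power_mult_distrib ne by (simp only: mult_ac)
    also have "(1 / (2*pi))\<^sup>2 * (2 * pi) = 1 / (2 * pi)" by (simp add: power2_eq_square)
    finally have b: "(norm (fiber_coeff w k \<beta>))\<^sup>2 \<le> 1 / (2*pi) * (L2_norm ?M (%\<alpha>. w (\<beta>, \<alpha>)))\<^sup>2" .
    have "(\<integral>\<^sup>+ \<alpha>. ennreal ((norm (w (\<beta>, \<alpha>)))\<^sup>2) \<partial>?M) = ennreal ((L2_norm ?M (%\<alpha>. w (\<beta>, \<alpha>)))\<^sup>2)"
      unfolding L2_norm_square using True by (intro nn_integral_eq_integral) (auto simp: square_integrable_def)
    then show ?thesis unfolding nn using b by (simp add: ennreal_mult[symmetric] ennreal_leI)
  next
    case False
    then have "\<not> integrable ?M (%\<alpha>. (norm (w (\<beta>, \<alpha>)))\<^sup>2)" using mM by (simp add: square_integrable_def)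
    moreover have m2: "(%\<alpha>. (norm (w (\<beta>, \<alpha>)))\<^sup>2) \<in> borel_measurable ?M" using mM by measurable
    moreover have "integrable ?M (%\<alpha>. (norm (w (\<beta>, \<alpha>)))\<^sup>2)"
      if lt: "(\<integral>\<^sup>+ \<alpha>. ennreal ((norm (w (\<beta>, \<alpha>)))\<^sup>2) \<partial>?M) < \<infinity>"
      by (rule integrableI_nonneg[OF m2 AE_I2[OF zero_le_power2] lt])
    ultimately have "\<not> (\<integral>\<^sup>+ \<alpha>. ennreal ((norm (w (\<beta>, \<alpha>)))\<^sup>2) \<partial>?M) < \<infinity>" by blast
    then have "(\<integral>\<^sup>+ \<alpha>. ennreal ((norm (w (\<beta>, \<alpha>)))\<^sup>2) \<partial>?M) = top"
      unfolding infinity_ennreal_def less_top[symmetric] by blast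
    then show ?thesis unfolding nn by (simp add: ennreal_mult_top)
  qed
qed

lemma periodic_mode:
  assumes "periodic_bdry w" shows "periodic_bdry (mode w k)"
  using assms cis_int_2pi[of k]
  unfolding periodic_bdry_def mode_def fiber_coeff_eq by simp

lemma measurable_mode:
  assumes "w \<in> borel_measurable borel" shows "mode w k \<in> borel_measurable borel"
proof -
  note [measurable] = measurable_fiber_coeff[OF assms]
  show ?thesis unfolding mode_def borel_prod[symmetric] by measurable
qed

lemma mode_L2:
  assumes w: "w \<in> L2_bdry \<kappa>" shows "mode w k \<in> L2_bdry \<kappa>"
proof -
  note wm = L2_bdry_measurable[OF w]
  note [measurable] = borel_pair[OF wm] measurable_fiber_coeff[OF wm]
  note mm = measurable_mode[OF wm, of k]
  have ind: "indicator fund (b, a) \<le> (indicator fib a :: ennreal)" for b a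
    by (auto simp: fund_def indicator_def)
  have f1: "(%q. ennreal ((norm (mode w k q))\<^sup>2) * indicator fund q) \<in> borel_measurable (borel \<Otimes>\<^sub>M borel)"
    and f2: "(%q. ennreal ((norm (w q))\<^sup>2) * indicator ({0..2*pi} \<times> fib) q) \<in> borel_measurable (borel \<Otimes>\<^sub>M borel)"
    using mm wm fund_sets sets_boxes(1) unfolding borel_prod by measurable
  have "(\<integral>\<^sup>+ q. ennreal ((norm (mode w k q))\<^sup>2) * indicator fund q \<partial>lborel)
      = (\<integral>\<^sup>+ b. \<integral>\<^sup>+ a. ennreal ((norm (mode w k (b, a)))\<^sup>2) * indicator fund (b, a) \<partial>lborel \<partial>lborel)"
    unfolding lborel_prod[symmetric]
    by (rule lborel.nn_integral_fst[of "%q. ennreal ((norm (mode w k q))\<^sup>2) * indicator fund q" lborel, symmetric])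
       (use f1 in simp)
  also have "\<dots> \<le> (\<integral>\<^sup>+ b. \<integral>\<^sup>+ a. ennreal ((norm (w (b, a)))\<^sup>2) * indicator ({0..2*pi} \<times> fib) (b, a) \<partial>lborel \<partial>lborel)"
  proof (rule nn_integral_mono)
    fix b
    show "(\<integral>\<^sup>+ a. ennreal ((norm (mode w k (b, a)))\<^sup>2) * indicator fund (b, a) \<partial>lborel)
       \<le> (\<integral>\<^sup>+ a. ennreal ((norm (w (b, a)))\<^sup>2) * indicator ({0..2*pi} \<times> fib) (b, a) \<partial>lborel)"
    proof (cases "b \<in> {0..2*pi}")
      case False
      then have "indicator fund (b, a) = (0 :: ennreal)" for a by (auto simp: fund_def indicator_def)
      then show ?thesis by simp
    next
      case True
      have "(\<integral>\<^sup>+ a. ennreal ((norm (mode w k (b, a)))\<^sup>2) * indicator fund (b, a) \<partial>lborel)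
          \<le> (\<integral>\<^sup>+ a. ennreal ((norm (fiber_coeff w k b))\<^sup>2) * indicator fib a \<partial>lborel)"
        using ind by (intro nn_integral_mono mult_mono) (auto simp: mode_def norm_mult)
      also have "\<dots> = ennreal ((norm (fiber_coeff w k b))\<^sup>2) * ennreal (2 * pi)"
        by (subst nn_integral_cmult_indicator) simp_all
      also have "\<dots> \<le> ennreal (1 / (2*pi)) * (\<integral>\<^sup>+ \<alpha>. ennreal ((norm (w (b, \<alpha>)))\<^sup>2) * indicator fib \<alpha> \<partial>lborel) * ennreal (2 * pi)"
        by (intro mult_right_mono fiber_coeff_bound[OF wm]) simp
      also have "\<dots> = (ennreal (1 / (2*pi)) * ennreal (2 * pi)) * (\<integral>\<^sup>+ \<alpha>. ennreal ((norm (w (b, \<alpha>)))\<^sup>2) * indicator fib \<alpha> \<partial>lborel)"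
        by (simp only: mult_ac)
      also have "ennreal (1 / (2*pi)) * ennreal (2 * pi) = 1" by (simp add: ennreal_mult[symmetric])
      also have "1 * (\<integral>\<^sup>+ \<alpha>. ennreal ((norm (w (b, \<alpha>)))\<^sup>2) * indicator fib \<alpha> \<partial>lborel)
         = (\<integral>\<^sup>+ a. ennreal ((norm (w (b, a)))\<^sup>2) * indicator ({0..2*pi} \<times> fib) (b, a) \<partial>lborel)"
        using True by (simp add: indicator_times)
      finally show ?thesis .
    qed
  qed
  also have "\<dots> = (\<integral>\<^sup>+ q. ennreal ((norm (w q))\<^sup>2) * indicator ({0..2*pi} \<times> fib) q \<partial>lborel)"
    unfolding lborel_prod[symmetric]
    by (rule lborel.nn_integral_fst[of "%q. ennreal ((norm (w q))\<^sup>2) * indicator ({0..2*pi} \<times> fib) q" lborel])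
       (use f2 in simp)
  also have "\<dots> = (\<integral>\<^sup>+ q. ennreal ((norm (w q))\<^sup>2) * indicator fund q \<partial>lborel)"
  proof (rule nn_integral_cong_AE)
    show "AE q in lborel. ennreal ((norm (w q))\<^sup>2) * indicator ({0..2*pi} \<times> fib) q = ennreal ((norm (w q))\<^sup>2) * indicator fund q"
      using AE_fst_neq[of "2 * pi"] AE_snd_neq[of "3 * pi/2"]
      by eventually_elim (auto simp: fund_def indicator_def)
  qed
  finally have le: "(\<integral>\<^sup>+ q. ennreal ((norm (mode w k q))\<^sup>2) \<partial>bm) \<le> (\<integral>\<^sup>+ q. ennreal ((norm (w q))\<^sup>2) \<partial>bm)"
    using mm wm by (simp add: nn_integral_bm mult_left_mono)
  also have "\<dots> < \<infinity>"
    using L2_bdry_sq[OF w] unfolding square_integrable_def integrable_iff_bounded by simp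
  finally have fin: "(\<integral>\<^sup>+ q. ennreal ((norm (mode w k q))\<^sup>2) \<partial>bm) < \<infinity>" .
  have "integrable bm (%q. (norm (mode w k q))\<^sup>2)"
  proof (rule integrableI_nonneg[OF _ AE_I2[OF zero_le_power2] fin])
    show "(%q. (norm (mode w k q))\<^sup>2) \<in> borel_measurable bm" using borel_measurable_bmI[OF mm] by measurable
  qed
  then show ?thesis
    using periodic_mode[OF L2_bdry_periodic[OF w]] borel_measurable_bmI[OF mm]
    by (simp add: L2_bdry_def square_integrable_def)
qed

lemma mode_inner_eq:
  assumes w: "w \<in> L2_bdry \<kappa>" and g: "g \<in> L2_bdry \<kappa>"
  shows "L2_inner bm (mode w k) g = (1 / (1 + \<kappa>)) *\<^sub>R integral\<^sup>L lborel (%\<beta>. indicator {0..2*pi} \<beta> *\<^sub>R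
     (of_real (2 * pi) * (fiber_coeff w k \<beta> * cnj (fiber_coeff g k \<beta>))))"
proof -
  note [measurable] = L2_bdry_measurable[OF g] L2_bdry_measurable[OF mode_L2[OF w, of k]]
  have m: "(%q. mode w k q * cnj (g q)) \<in> borel_measurable borel" by measurable
  have i: "integrable bm (%q. mode w k q * cnj (g q))"
    by (rule square_integrable_inner[OF L2_bdry_sq[OF mode_L2[OF w]] L2_bdry_sq[OF g]])
  have "integral\<^sup>L lborel (%\<alpha>. indicator fib \<alpha> *\<^sub>R (mode w k (\<beta>, \<alpha>) * cnj (g (\<beta>, \<alpha>))))
      = of_real (2 * pi) * (fiber_coeff w k \<beta> * cnj (fiber_coeff g k \<beta>))" for \<beta>
  proof -
    have "integral\<^sup>L lborel (%\<alpha>. indicator fib \<alpha> *\<^sub>R (mode w k (\<beta>, \<alpha>) * cnj (g (\<beta>, \<alpha>))))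
      = integral\<^sup>L lborel (%\<alpha>. fiber_coeff w k \<beta> * cnj (indicator fib \<alpha> *\<^sub>R (g (\<beta>, \<alpha>) * cis (- (of_int k * \<alpha>)))))"
      by (intro Bochner_Integration.integral_cong refl) (simp add: mode_def cis_cnj mult_ac)
    also have "\<dots> = fiber_coeff w k \<beta> * cnj (integral\<^sup>L lborel (%\<alpha>. indicator fib \<alpha> *\<^sub>R (g (\<beta>, \<alpha>) * cis (- (of_int k * \<alpha>)))))"
      by (simp only: integral_mult_right_zero Bochner_Integration.integral_cnj)
    also have "\<dots> = of_real (2 * pi) * (fiber_coeff w k \<beta> * cnj (fiber_coeff g k \<beta>))"
      unfolding fiber_coeff_eq[of g] by simp
    finally show ?thesis .
  qed
  then show ?thesis unfolding L2_inner_def integral_bm_fubini[OF m i] by simp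
qed

text \<open>Moves the projection onto a Fourier mode from an arbitrary w to an explicit test
  function, where it can be computed.\<close>

lemma mode_selfadjoint:
  assumes w: "w \<in> L2_bdry \<kappa>" and g: "g \<in> L2_bdry \<kappa>"
  shows "L2_inner bm (mode w k) g = L2_inner bm w (mode g k)"
proof -
  have "L2_inner bm w (mode g k) = cnj (L2_inner bm (mode g k) w)" by (rule L2_inner_commute)
  also have "\<dots> = L2_inner bm (mode w k) g"
    unfolding mode_inner_eq[OF w g] mode_inner_eq[OF g w] complex_cnj_scaleR Bochner_Integration.integral_cnj[symmetric]
    by (simp add: mult_ac)
  finally show ?thesis ..
qed

lemma mode_product:
  assumes "!!\<beta> \<alpha>. g (\<beta>, \<alpha>) = c \<beta> * cis (of_int j * \<alpha>)"
  shows "mode g k q = (if k = j then g q else 0)"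
proof -
  have "fiber_coeff g k \<beta> = (if k = j then c \<beta> else 0)" for \<beta>
  proof -
    have "integral\<^sup>L lborel (%\<alpha>. indicator fib \<alpha> *\<^sub>R (g (\<beta>, \<alpha>) * cis (- (of_int k * \<alpha>))))
       = integral\<^sup>L lborel (%\<alpha>. c \<beta> * (indicator fib \<alpha> *\<^sub>R cis (of_int (j - k) * \<alpha>)))"
      unfolding assms by (intro Bochner_Integration.integral_cong refl) (simp add: cis_mult algebra_simps)
    also have "\<dots> = c \<beta> * (if j - k = 0 then of_real (2 * pi) else 0)"
      by (simp only: integral_mult_right_zero integral_cis_fib)
    finally show ?thesis unfolding fiber_coeff_eq by auto
  qed
  then show ?thesis using assms[of "fst q" "snd q"] by (simp add: mode_def)
qed

lemma mode_mode: "mode (mode w j) k q = (if k = j then mode w j q else 0)"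
  by (rule mode_product) (simp add: mode_def)

lemma mode_orthogonal:
  assumes w: "w \<in> L2_bdry \<kappa>"
  shows "L2_inner bm (mode w k) (mode w j) = (if k = j then L2_inner bm w (mode w k) else 0)"
proof -
  have "L2_inner bm (mode w k) (mode w j) = L2_inner bm w (mode (mode w j) k)"
    by (rule mode_selfadjoint[OF w mode_L2[OF w]])
  then show ?thesis by (auto simp: mode_mode[abs_def] L2_inner_def)
qed

text \<open>Limits in L2 are functions on the closed rectangle, determined up to null sets;
  composition with \<open>reduce\<close> supplies a periodic representative.\<close>

lemma L2_bdry_representative:
  assumes h: "square_integrable bm h"
  shows "\<exists>g\<in>L2_bdry \<kappa>. AE q in bm. h q = g q"
proof (rule bexI[of _ "%q. h (reduce q)"])
  let ?D = "{0..2*pi} \<times> {- (pi/2)..3*pi/2}"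
  have "h \<in> borel_measurable (restrict_space lborel ?D)"
    using h by (simp add: bdry_measure_def square_integrable_def)
  then have [measurable]: "(%p. indicator ?D p *\<^sub>R h p) \<in> borel_measurable borel"
    by (subst (asm) borel_measurable_restrict_space_iff) simp_all
  have "(%p. indicator ?D (reduce p) *\<^sub>R h (reduce p)) \<in> borel_measurable borel"
    by (rule measurable_compose[OF measurable_reduce]) measurable
  moreover have "reduce p \<in> ?D" for p
    using reduce_in_fund[of p] by (auto simp: fund_def)
  ultimately have m: "(%q. h (reduce q)) \<in> borel_measurable borel" by simp
  have "AE q in lborel. q \<in> ?D \<longrightarrow> h q = h (reduce q)"
    using closed_box_AE
  proof eventually_elim
    fix q assume "q \<in> ?D \<longleftrightarrow> q \<in> open_fund"
    then have "q \<in> ?D ==> q \<in> fund" by (auto simp: fund_def)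
    then show "q \<in> ?D \<longrightarrow> h q = h (reduce q)" by (simp add: reduce_fund)
  qed
  then have "AE q in restrict_space lborel ?D. h q = h (reduce q)"
    by (subst AE_restrict_space_iff) auto
  then show ae: "AE q in bm. h q = h (reduce q)" unfolding bdry_measure_def by (subst AE_density) auto
  show "(%q. h (reduce q)) \<in> L2_bdry \<kappa>"
    using square_integrable_AE_cong[OF h borel_measurable_bmI[OF m] ae] periodic_bdry_reduceI[of h]
    by (simp add: L2_bdry_def)
qed

lemma hilbert_partial_sum_mode:
  "hilbert_partial_sum K N w = (%q. \<Sum>k\<in>K \<inter> {- int N..int N}. (- \<i> * of_int (sgn k)) * mode w k q)"
  by (auto simp: hilbert_partial_sum_def mode_def mult.assoc)

text \<open>The Hilbert transform is specified by a choice, which means nothing until a limit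
  exists. The multipliers have modulus at most 1, so Bessel's inequality for the modes of w bounds
  the orthogonal series.\<close>

lemma fiber_hilbert_exists:
  assumes w: "w \<in> L2_bdry \<kappa>"
  shows "\<exists>h. h \<in> L2_bdry \<kappa> \<and> (%N. L2_norm bm (%p. h p - hilbert_partial_sum K N w p)) \<longlonglongrightarrow> 0"
proof -
  define g where "g k q = (- \<i> * of_int (sgn k)) * mode w k q" for k q
  define F where "F N = K \<inter> {- int N..int N}" for N
  have msq: "square_integrable bm (mode w k)" for k by (rule L2_bdry_sq[OF mode_L2[OF w]])
  have gsq: "square_integrable bm (g k)" for k unfolding g_def[abs_def] by (rule square_integrable_cmult[OF msq])
  have ng: "L2_norm bm (g k) \<le> L2_norm bm (mode w k)" for k
    unfolding g_def[abs_def] L2_norm_cmult using L2_norm_nonneg[of bm "mode w k"] by (auto simp: norm_mult sgn_if)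
  have "\<exists>h. square_integrable bm h \<and> (%N. L2_norm bm (%x. h x - (\<Sum>i\<in>F N. g i x))) \<longlonglongrightarrow> 0"
  proof (rule L2_orthogonal_series[where B = "(L2_norm bm w)\<^sup>2"])
    show "finite (F N)" for N by (simp add: F_def)
    show "F N \<subseteq> F N'" if "N \<le> N'" for N N' using that by (auto simp: F_def)
    show "square_integrable bm (g i)" for i by (rule gsq)
    show "L2_inner bm (g i) (g j) = 0" if "i ~= j" for i j
      unfolding g_def[abs_def] L2_inner_cmult_left L2_inner_cmult_right mode_orthogonal[OF w] using that by simp
    show "(\<Sum>i\<in>F N. (L2_norm bm (g i))\<^sup>2) \<le> (L2_norm bm w)\<^sup>2" for N
    proof -
      have "(\<Sum>i\<in>F N. (L2_norm bm (g i))\<^sup>2) \<le> (\<Sum>i\<in>F N. (L2_norm bm (mode w i))\<^sup>2)"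
        by (intro sum_mono power_mono ng L2_norm_nonneg)
      also have "\<dots> \<le> (L2_norm bm w)\<^sup>2"
      proof (rule L2_bessel)
        show "L2_inner bm (mode w i) (mode w j) = 0" if "i ~= j" for i j using that mode_orthogonal[OF w] by simp
        show "L2_inner bm w (mode w i) = complex_of_real ((L2_norm bm (mode w i))\<^sup>2)" for i
          unfolding L2_inner_self[symmetric] using mode_orthogonal[OF w, of i i] by simp
      qed (simp_all add: F_def msq L2_bdry_sq[OF w])
      finally show ?thesis .
    qed
  qed
  then obtain h0 where h0: "square_integrable bm h0" "(%N. L2_norm bm (%x. h0 x - (\<Sum>i\<in>F N. g i x))) \<longlonglongrightarrow> 0" by blast
  obtain h where h: "h \<in> L2_bdry \<kappa>" "AE q in bm. h0 q = h q" using L2_bdry_representative[OF h0(1)] by blast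
  have "L2_norm bm (%x. h0 x - (\<Sum>i\<in>F N. g i x)) = L2_norm bm (%p. h p - hilbert_partial_sum K N w p)" for N
  proof -
    have "L2_norm bm (%x. h0 x - (\<Sum>i\<in>F N. g i x)) = L2_norm bm (%x. h x - (\<Sum>i\<in>F N. g i x))"
      using h(2) square_integrable_measurable[OF h0(1)] square_integrable_measurable[OF L2_bdry_sq[OF h(1)]]
        square_integrable_measurable[OF square_integrable_sum[of "F N" bm g, OF gsq]]
      by (intro L2_norm_cong_AE) auto
    then show ?thesis unfolding hilbert_partial_sum_mode F_def g_def .
  qed
  then show ?thesis using h(1) h0(2) by (intro exI[of _ h]) simp
qed

lemma H_minus_spec:
  assumes w: "w \<in> L2_bdry \<kappa>"
  shows "H_minus \<kappa> w \<in> L2_bdry \<kappa>"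
    and "(%N. L2_norm bm (%p. H_minus \<kappa> w p - hilbert_partial_sum {k. odd k} N w p)) \<longlonglongrightarrow> 0"
proof -
  have "H_minus \<kappa> w \<in> L2_bdry \<kappa> \<and> (%N. L2_norm bm (%p. H_minus \<kappa> w p - hilbert_partial_sum {k. odd k} N w p)) \<longlonglongrightarrow> 0"
    unfolding H_minus_def fiber_hilbert_def by (rule someI_ex[OF fiber_hilbert_exists[OF w]])
  then show "H_minus \<kappa> w \<in> L2_bdry \<kappa>"
    and "(%N. L2_norm bm (%p. H_minus \<kappa> w p - hilbert_partial_sum {k. odd k} N w p)) \<longlonglongrightarrow> 0" by blast+
qed

text \<open>Pairing with a fixed G turns convergence in L2 into convergence of numbers in which the
  unknown transform no longer occurs and only modes of G remain.\<close>

lemma H_minus_inner_limit: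
  assumes w: "w \<in> L2_bdry \<kappa>" and G: "G \<in> L2_bdry \<kappa>"
  shows "(%N. \<Sum>k\<in>{k. odd k} \<inter> {- int N..int N}. (- \<i> * of_int (sgn k)) * L2_inner bm w (mode G k))
    \<longlonglongrightarrow> L2_inner bm (H_minus \<kappa> w) G"
proof -
  have msq: "square_integrable bm (%q. (- \<i> * of_int (sgn k)) * mode w k q)" for k
    by (rule square_integrable_cmult[OF L2_bdry_sq[OF mode_L2[OF w]]])
  have sq: "square_integrable bm (hilbert_partial_sum {k. odd k} N w)" for N
    unfolding hilbert_partial_sum_mode by (rule square_integrable_sum[OF msq])
  have "(%N. L2_inner bm (hilbert_partial_sum {k. odd k} N w) G) \<longlonglongrightarrow> L2_inner bm (H_minus \<kappa> w) G"
    by (rule L2_limit_inner[OF sq L2_bdry_sq[OF H_minus_spec(1)[OF w]] L2_bdry_sq[OF G] H_minus_spec(2)[OF w]])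
  moreover have "L2_inner bm (hilbert_partial_sum {k. odd k} N w) G
     = (\<Sum>k\<in>{k. odd k} \<inter> {- int N..int N}. (- \<i> * of_int (sgn k)) * L2_inner bm w (mode G k))" for N
    unfolding hilbert_partial_sum_mode L2_inner_sum_left[OF msq L2_bdry_sq[OF G]] L2_inner_cmult_left
      mode_selfadjoint[OF w G] ..
  ultimately show ?thesis by simp
qed

end

section \<open>One-sided Fourier series of the basis functions\<close>

definition abs_power_series :: "(complex => complex) => bool" where
  "abs_power_series g \<longleftrightarrow> (\<exists>a. summable (%j. norm (a j)) \<and> (\<forall>z. norm z = 1 \<longrightarrow> (%j. a j * z ^ j) sums g z))"

text \<open>Absolute summability is stable under Cauchy products, so the algebra of absolutely
  convergent power series on the circle contains all products of linear factors and geometric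
  series, in particular those occurring in the basis functions.\<close>

lemma abs_power_series_mult:
  assumes "abs_power_series f" "abs_power_series g"
  shows "abs_power_series (%z. f z * g z)"
proof -
  obtain a where a: "summable (%j. norm (a j))" "!!z. norm z = 1 ==> (%j. a j * z ^ j) sums f z"
    using assms(1) unfolding abs_power_series_def by blast
  obtain b where b: "summable (%j. norm (b j))" "!!z. norm z = 1 ==> (%j. b j * z ^ j) sums g z"
    using assms(2) unfolding abs_power_series_def by blast
  define c where "c k = (\<Sum>i\<le>k. a i * b (k - i))" for k
  have s1: "summable (%k. \<Sum>i\<le>k. norm (a i) * norm (b (k - i)))"
    by (rule summable_Cauchy_product) (simp_all only: real_norm_def abs_norm_cancel a(1) b(1))
  have b1: "norm (norm (c k)) \<le> (\<Sum>i\<le>k. norm (a i) * norm (b (k - i)))" for k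
    unfolding c_def real_norm_def abs_norm_cancel norm_mult[symmetric] by (rule norm_sum)
  have "summable (%k. norm (c k))"
    by (rule summable_comparison_test'[OF s1, of 0]) (rule b1)
  moreover have "(%k. c k * z ^ k) sums (f z * g z)" if z: "norm z = 1" for z
  proof -
    have "(%k. \<Sum>i\<le>k. (a i * z ^ i) * (b (k - i) * z ^ (k - i))) sums ((\<Sum>k. a k * z ^ k) * (\<Sum>k. b k * z ^ k))"
      by (rule Cauchy_product_sums) (simp_all add: norm_mult norm_power z a(1) b(1))
    moreover have "(\<Sum>i\<le>k. (a i * z ^ i) * (b (k - i) * z ^ (k - i))) = c k * z ^ k" for k
      unfolding c_def sum_distrib_right
      by (intro sum.cong refl) (simp add: power_add[symmetric] mult_ac)
    ultimately show ?thesis using a(2)[OF z] b(2)[OF z] by (simp add: sums_iff)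
  qed
  ultimately show ?thesis unfolding abs_power_series_def by blast
qed

lemma abs_power_series_linear: "abs_power_series (%z. z + c)"
proof -
  have "summable (%j. norm (if j = 0 then c else if j = 1 then 1 else 0))"
    by (rule summable_finite[of "{0, 1}"]) auto
  moreover have "(%j. (if j = 0 then c else if j = 1 then 1 else 0) * z ^ j) sums (z + c)" for z
    using sums_finite[of "{0, 1}" "%j. (if j = 0 then c else if j = 1 then 1 else 0) * z ^ j"]
    by (simp add: add.commute)
  ultimately show ?thesis unfolding abs_power_series_def
    by (intro exI[of _ "%j. if j = 0 then c else if j = 1 then 1 else 0"] conjI allI impI)
qed

lemma abs_power_series_geometric:
  assumes "norm c < 1" shows "abs_power_series (%z. 1 / (1 + c * z))"
proof -
  have "summable (%j. norm ((- c) ^ j))" using assms by (simp add: norm_power)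
  moreover have "(%j. (- c) ^ j * z ^ j) sums (1 / (1 + c * z))" if "norm z = 1" for z
    using geometric_sums[of "- c * z"] assms that by (simp add: norm_mult power_mult_distrib[symmetric])
  ultimately show ?thesis unfolding abs_power_series_def by blast
qed

lemma abs_power_series_power: "abs_power_series f ==> abs_power_series (%z. f z ^ n)"
proof (induction n)
  case 0
  have "summable (%j. norm (if j = 0 then 1 else (0::complex)))" by (rule summable_finite[of "{0}"]) auto
  moreover have "(%j. (if j = 0 then 1 else 0) * z ^ j) sums (1::complex)" for z
    using sums_finite[of "{0}" "%j. (if j = 0 then 1 else 0) * z ^ j"] by simp
  ultimately show ?case unfolding abs_power_series_def by force
next
  case (Suc n)
  then show ?case using abs_power_series_mult by simp
qed

context curved_disk
begin

text \<open>With \<open>z = e\<^sup>2\<^sup>i\<^sup>\<alpha>\<close> one has \<open>e\<^sup>2\<^sup>i\<^sup>s = (z + \<kappa>)/(1 + \<kappa>z)\<close> and \<open>e\<^sup>i\<^sup>s/\<rho> = e\<^sup>i\<^sup>\<alpha>/(1 + \<kappa>z)\<close>, so for odd \<open>m\<close>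
  the Fourier modes in \<open>\<alpha>\<close> of a mode in \<open>s\<close> all have the sign of \<open>m\<close>.\<close>

lemma wv_Blaschke:
  "wv p (2 * int l + 1) (\<beta>, \<alpha>) = cis (of_int p * \<beta>) * cis \<alpha> *
     ((cis (2 * \<alpha>) + of_real \<kappa>) ^ l * (1 / (1 + of_real \<kappa> * cis (2 * \<alpha>))) ^ Suc l)"
proof -
  let ?n = "cis \<alpha> + of_real \<kappa> * cis (- \<alpha>)" and ?d = "cis (- \<alpha>) + of_real \<kappa> * cis \<alpha>" and ?r = "complex_of_real (rho \<alpha>)"
  have r0: "?r ~= 0" using rho_pos[of \<alpha>] by simp
  have nd: "?n * ?d = ?r\<^sup>2"
  proof -
    have "?d = cnj ?n" by (simp add: cis_cnj)
    then have "?n * ?d = of_real ((norm ?n)\<^sup>2)"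
      by (simp only: complex_norm_square)
    also have "(norm ?n)\<^sup>2 = (rho \<alpha>)\<^sup>2"
      unfolding cmod_power2 rho_square by (simp add: algebra_simps)
    finally show ?thesis by simp
  qed
  then have n0: "?n ~= 0" and d0: "?d ~= 0" using r0 by auto
  have 1: "cis (sct \<alpha>) / ?r = 1 / ?d"
    unfolding cis_scat using r0 d0 nd by (simp add: field_simps power2_eq_square)
  have 2: "(cis (sct \<alpha>))\<^sup>2 = ?n / ?d"
    unfolding cis_scat power_divide nd[symmetric] using n0 d0 by (simp add: power2_eq_square)
  have da: "?d = cis (- \<alpha>) * (1 + of_real \<kappa> * cis (2 * \<alpha>))"
    by (simp add: distrib_left cis_mult mult.left_commute)
  have na: "?n = cis (- \<alpha>) * (cis (2 * \<alpha>) + of_real \<kappa>)"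
    by (simp add: distrib_left cis_mult mult.commute)
  have "cis (of_int (2 * int l + 1) * sct \<alpha>) = (cis (sct \<alpha>))\<^sup>2 ^ l * cis (sct \<alpha>)"
    unfolding power_mult[symmetric] Complex.DeMoivre cis_mult by (simp add: algebra_simps)
  then have "wv p (2 * int l + 1) (\<beta>, \<alpha>) = cis (of_int p * \<beta>) * ((cis (sct \<alpha>))\<^sup>2 ^ l * (cis (sct \<alpha>) / ?r))"
    by (simp add: wv_def)
  also have "(cis (sct \<alpha>))\<^sup>2 = (cis (2 * \<alpha>) + of_real \<kappa>) / (1 + of_real \<kappa> * cis (2 * \<alpha>))"
    unfolding 2 da na by simp
  also have "cis (sct \<alpha>) / ?r = cis \<alpha> / (1 + of_real \<kappa> * cis (2 * \<alpha>))"
    unfolding 1 da by (simp add: divide_inverse cis_inverse mult.commute)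
  finally show ?thesis by (simp add: power_divide mult_ac)
qed

definition ex :: "int => int => real \<times> real => complex" where
  "ex p k q = cis (of_int p * fst q) * cis (of_int k * snd q)"

lemma ex_L2: "ex p k \<in> L2_bdry \<kappa>"
proof (rule L2_bdryI)
  show "periodic_bdry (ex p k)" unfolding periodic_bdry_def ex_def fst_conv snd_conv cis_int_2pi by simp
  show "ex p k \<in> borel_measurable borel"
    unfolding ex_def by (intro borel_measurable_continuous_onI continuous_intros)
  show "norm (ex p k q) \<le> 1" for q by (simp add: ex_def norm_mult)
qed

text \<open>For positive m this is the power series in e^{2i\<alpha>} times e^{i\<alpha>}; for
  negative m it is the complex conjugate of the case of opposite frequencies. Summability of the
  coefficients makes the convergence uniform in both variables.\<close>

lemma wv_expansion:
  assumes "odd m"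
  shows "\<exists>a. summable (%j. norm (a j)) \<and> (\<forall>q. (%j. a j * ex p (sgn m * (2 * int j + 1)) q) sums wv p m q)"
proof -
  have pos: "\<exists>a. summable (%j. norm (a j)) \<and> (\<forall>q. (%j. a j * ex p (2 * int j + 1) q) sums wv p (2 * int l + 1) q)" for p l
  proof -
    have "abs_power_series (%z. (z + of_real \<kappa>) ^ l * (1 / (1 + of_real \<kappa> * z)) ^ Suc l)"
      using kappa_gt kappa_lt
      by (intro abs_power_series_mult abs_power_series_power abs_power_series_linear abs_power_series_geometric) (simp add: abs_less_iff)
    then obtain a where a: "summable (%j. norm (a j))"
      "!!z :: complex. norm z = 1 ==> (%j. a j * z ^ j) sums ((z + of_real \<kappa>) ^ l * (1 / (1 + of_real \<kappa> * z)) ^ Suc l)"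
      unfolding abs_power_series_def by blast
    have "(%j. a j * ex p (2 * int j + 1) q) sums wv p (2 * int l + 1) q" for q
    proof -
      obtain \<beta> \<alpha> where q: "q = (\<beta>, \<alpha>)" by (cases q)
      have "(%j. cis (of_int p * \<beta>) * cis \<alpha> * (a j * cis (2 * \<alpha>) ^ j)) sums wv p (2 * int l + 1) q"
        unfolding q wv_Blaschke by (intro sums_mult a(2)) simp
      moreover have "cis (of_int p * \<beta>) * cis \<alpha> * (a j * cis (2 * \<alpha>) ^ j) = a j * ex p (2 * int j + 1) q" for j
      proof -
        have "cis (of_int (2 * int j + 1) * \<alpha>) = cis \<alpha> * cis (2 * \<alpha>) ^ j"
          unfolding Complex.DeMoivre cis_mult by (simp add: algebra_simps)
        then show ?thesis by (simp add: ex_def q)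
      qed
      ultimately show ?thesis by simp
    qed
    then show ?thesis using a(1) by blast
  qed
  show ?thesis
  proof (cases "m > 0")
    case True
    obtain j where j: "m = 2 * j + 1" using assms by (elim oddE)
    define l where "l = nat j"
    have "m = 2 * int l + 1" using j True unfolding l_def by simp
    then show ?thesis using pos[of p l] True by simp
  next
    case False
    obtain j where j: "m = 2 * j + 1" using assms by (elim oddE)
    define l where "l = nat (- j - 1)"
    have l: "m = - (2 * int l + 1)" using j False unfolding l_def by simp
    obtain a where a: "summable (%j. norm (a j))" "!!q. (%j. a j * ex (- p) (2 * int j + 1) q) sums wv (- p) (2 * int l + 1) q"
      using pos[of "- p" l] by blast
    have "(%j. cnj (a j) * ex p (sgn m * (2 * int j + 1)) q) sums wv p m q" for q
    proof -
      have e1: "cnj (wv (- p) (2 * int l + 1) q) = wv p m q" by (simp add: wv_def l cis_cnj algebra_simps)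
      have e2: "cnj (a j * ex (- p) (2 * int j + 1) q) = cnj (a j) * ex p (sgn m * (2 * int j + 1)) q" for j
        using l by (simp add: ex_def cis_cnj sgn_if algebra_simps)
      from a(2)[of q, THEN sums_cnj[THEN iffD2]] show ?thesis unfolding e1 e2 .
    qed
    then show ?thesis using a(1) by (intro exI[of _ "%j. cnj (a j)"]) simp
  qed
qed

lemma H_minus_ex:
  assumes w: "w \<in> L2_bdry \<kappa>" and k: "odd k"
  shows "L2_inner bm (H_minus \<kappa> w) (ex p k) = - \<i> * of_int (sgn k) * L2_inner bm w (ex p k)"
proof -
  have m: "mode (ex p k) j = (if j = k then ex p k else (%_. 0))" for j
    using mode_product[of "ex p k" "%\<beta>. cis (of_int p * \<beta>)" k j] by (auto simp: ex_def)
  have z: "L2_inner bm w (%_. 0) = 0" by (simp add: L2_inner_def)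
  have "(\<Sum>j\<in>{k. odd k} \<inter> {- int N..int N}. (- \<i> * of_int (sgn j)) * L2_inner bm w (mode (ex p k) j))
      = - \<i> * of_int (sgn k) * L2_inner bm w (ex p k)" if "N \<ge> nat \<bar>k\<bar>" for N
  proof -
    have "(\<Sum>j\<in>{k. odd k} \<inter> {- int N..int N}. (- \<i> * of_int (sgn j)) * L2_inner bm w (mode (ex p k) j))
      = (\<Sum>j\<in>{k. odd k} \<inter> {- int N..int N}. if j = k then - \<i> * of_int (sgn k) * L2_inner bm w (ex p k) else 0)"
      by (intro sum.cong refl) (simp add: m z)
    also have "\<dots> = - \<i> * of_int (sgn k) * L2_inner bm w (ex p k)"
      using that k by (subst sum.delta) auto
    finally show ?thesis .
  qed
  then have "(%N. \<Sum>j\<in>{k. odd k} \<inter> {- int N..int N}. (- \<i> * of_int (sgn j)) * L2_inner bm w (mode (ex p k) j))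
      \<longlonglongrightarrow> - \<i> * of_int (sgn k) * L2_inner bm w (ex p k)"
    by (intro tendsto_eventually eventually_sequentiallyI[of "nat \<bar>k\<bar>"])
  from LIMSEQ_unique[OF H_minus_inner_limit[OF w ex_L2] this] show ?thesis .
qed

text \<open>Every exponential in the expansion has the sign of m, so pairing with a partial sum W J
  multiplies by one and the same scalar. The partial sums converge to the basis function in L2, and
  both inner products converge with them; continuity of the transform itself does not enter.\<close>

lemma cf_H_minus_odd:
  assumes w: "w \<in> L2_bdry \<kappa>" and m: "odd m"
  shows "cf (H_minus \<kappa> w) p m = - \<i> * of_int (sgn m) * cf w p m"
proof -
  obtain a where a: "summable (%j. norm (a j))" "!!q. (%j. a j * ex p (sgn m * (2 * int j + 1)) q) sums wv p m q"
    using wv_expansion[OF m, of p] by blast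
  define W where "W J q = (\<Sum>j<J. a j * ex p (sgn m * (2 * int j + 1)) q)" for J q
  have exsq: "square_integrable bm (%q. a j * ex p (sgn m * (2 * int j + 1)) q)" for j
    by (rule square_integrable_cmult[OF L2_bdry_sq[OF ex_L2]])
  have Wsq: "square_integrable bm (W J)" for J
    unfolding W_def[abs_def] by (rule square_integrable_sum[OF exsq])
  define t where "t J = (\<Sum>j. norm (a (j + J)))" for J
  have tail: "norm (wv p m q - W J q) \<le> t J" for J q
  proof -
    have s: "summable (%j. a j * ex p (sgn m * (2 * int j + 1)) q)" using a(2)[of q] by (rule sums_summable)
    have n: "norm (ex p k q) = 1" for k by (simp add: ex_def norm_mult)
    have "wv p m q - W J q = (\<Sum>j. a (j + J) * ex p (sgn m * (2 * int (j + J) + 1)) q)"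
      using suminf_minus_initial_segment[OF s, of J] sums_unique[OF a(2)[of q]] by (simp add: W_def)
    also have "norm \<dots> \<le> (\<Sum>j. norm (a (j + J) * ex p (sgn m * (2 * int (j + J) + 1)) q))"
      by (rule summable_norm) (simp only: norm_mult n mult_1_right summable_ignore_initial_segment[OF a(1)])
    also have "\<dots> = t J" unfolding t_def by (simp only: norm_mult n mult_1_right)
    finally show ?thesis .
  qed
  have t0: "t \<longlonglongrightarrow> 0" unfolding t_def[abs_def] by (rule suminf_exist_split2[OF a(1)])
  have tn: "t J \<ge> 0" for J unfolding t_def by (intro suminf_nonneg summable_ignore_initial_segment a(1)) simp
  have lim: "(%J. L2_norm bm (%q. wv p m q - W J q)) \<longlonglongrightarrow> 0"
  proof (rule Lim_null_comparison)
    show "\<forall>\<^sub>F J in sequentially. norm (L2_norm bm (%q. wv p m q - W J q)) \<le> t J * sqrt (measure bm (space bm))"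
      using L2_norm_bounded[OF finite_bm tail tn square_integrable_measurable[OF square_integrable_diff[OF wv_sq Wsq]]]
      by (simp add: L2_norm_nonneg)
    show "(%J. t J * sqrt (measure bm (space bm))) \<longlonglongrightarrow> 0"
      using tendsto_mult_right[OF t0, of "sqrt (measure bm (space bm))"] by simp
  qed
  have conv: "(%J. L2_inner bm g (W J)) \<longlonglongrightarrow> cf g p m" if g: "g \<in> L2_bdry \<kappa>" for g
  proof -
    have "(%J. cnj (L2_inner bm (W J) g)) \<longlonglongrightarrow> cnj (L2_inner bm (wv p m) g)"
      by (intro tendsto_cnj L2_limit_inner[OF Wsq wv_sq L2_bdry_sq[OF g] lim])
    then show ?thesis unfolding cf_def L2_inner_commute[of bm "wv p m" g] L2_inner_commute[of bm "W _" g] by simp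
  qed
  have "L2_inner bm (H_minus \<kappa> w) (W J) = - \<i> * of_int (sgn m) * L2_inner bm w (W J)" for J
  proof -
    have e: "L2_inner bm g (W J) = (\<Sum>j<J. cnj (a j) * L2_inner bm g (ex p (sgn m * (2 * int j + 1))))"
      if g: "g \<in> L2_bdry \<kappa>" for g
      unfolding W_def[abs_def] L2_inner_sum_right[OF exsq L2_bdry_sq[OF g]] L2_inner_cmult_right ..
    have k: "odd (sgn m * (2 * int j + 1))" "sgn (sgn m * (2 * int j + 1)) = sgn m" for j
      using m by (auto simp: sgn_if)
    show ?thesis
      unfolding e[OF H_minus_spec(1)[OF w]] e[OF w] H_minus_ex[OF w k(1)] k(2) sum_distrib_left
      by (intro sum.cong refl) (simp add: mult_ac)
  qed
  then have "(%J. L2_inner bm (H_minus \<kappa> w) (W J)) \<longlonglongrightarrow> - \<i> * of_int (sgn m) * cf w p m"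
    using tendsto_mult_left[OF conv[OF w], of "- \<i> * of_int (sgn m)"] by simp
  from LIMSEQ_unique[OF conv[OF H_minus_spec(1)[OF w]] this] show ?thesis .
qed

text \<open>Under the shift by \<pi> the basis function is even and the exponential is odd, so the
  two halves of the fibre cancel.\<close>

lemma fiber_coeff_even_wv:
  assumes "even m" "odd k" shows "L2_inner bm w (mode (wv p m) k) = 0"
proof -
  have "fiber_coeff (wv p m) k \<beta> = 0" for \<beta>
  proof -
    define f where "f \<alpha> = wv p m (\<beta>, \<alpha>) * cis (- (of_int k * \<alpha>))" for \<alpha>
    have fs: "f (\<alpha> + pi) = - f \<alpha>" for \<alpha>
    proof -
      have "cis (- (of_int k * (\<alpha> + pi))) = cis (of_int (- k) * pi) * cis (- (of_int k * \<alpha>))"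
        unfolding cis_mult by (simp add: algebra_simps)
      then show ?thesis using assms by (simp add: f_def wv_shift cis_int_pi parity_sign_def del: of_int_minus)
    qed
    have mf: "f \<in> borel_measurable borel"
      unfolding f_def using measurable_section[OF measurable_wv, of p m \<beta>] by measurable
    have fb: "norm (f \<alpha>) \<le> 1 / (1 - \<bar>\<kappa>\<bar>)" for \<alpha> using norm_wv[of p m "(\<beta>, \<alpha>)"] by (simp add: f_def norm_mult)
    have ii: "integrable lborel (%\<alpha>. indicator {a..b} \<alpha> *\<^sub>R f \<alpha>)" for a b
    proof (rule integrableI_bounded_set_indicator[where B = "1 / (1 - \<bar>\<kappa>\<bar>)"])
      show "emeasure lborel {a..b} < \<infinity>"
        using emeasure_lborel_cbox_finite[of a b] by (simp only: cbox_interval infinity_ennreal_def)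
    qed (use mf fb in auto)
    have "integral\<^sup>L lborel (%\<alpha>. indicator fib \<alpha> *\<^sub>R f \<alpha>)
       = integral\<^sup>L lborel (%\<alpha>. indicator {- (pi/2)..pi/2} \<alpha> *\<^sub>R f \<alpha> + indicator {pi/2..3*pi/2} \<alpha> *\<^sub>R f \<alpha>)"
    proof (rule integral_cong_AE)
      have "AE \<alpha> in lborel. \<alpha> ~= pi/2" by (rule AE_lborel_singleton)
      then show "AE \<alpha> in lborel. indicator fib \<alpha> *\<^sub>R f \<alpha> = indicator {- (pi/2)..pi/2} \<alpha> *\<^sub>R f \<alpha> + indicator {pi/2..3*pi/2} \<alpha> *\<^sub>R f \<alpha>"
        by eventually_elim (auto simp: indicator_def)
    qed (use mf in measurable)
    also have "\<dots> = integral\<^sup>L lborel (%\<alpha>. indicator {- (pi/2)..pi/2} \<alpha> *\<^sub>R f \<alpha>) + integral\<^sup>L lborel (%\<alpha>. indicator {pi/2..3*pi/2} \<alpha> *\<^sub>R f \<alpha>)"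
      by (rule Bochner_Integration.integral_add[OF ii ii])
    also have "integral\<^sup>L lborel (%\<alpha>. indicator {pi/2..3*pi/2} \<alpha> *\<^sub>R f \<alpha>)
       = integral\<^sup>L lborel (%\<alpha>. indicator {pi/2..3*pi/2} (pi + 1 * \<alpha>) *\<^sub>R f (pi + 1 * \<alpha>))"
      using lborel_integral_real_affine[of 1 "%\<alpha>. indicator {pi/2..3*pi/2} \<alpha> *\<^sub>R f \<alpha>" pi] by simp
    also have "\<dots> = integral\<^sup>L lborel (%\<alpha>. - (indicator {- (pi/2)..pi/2} \<alpha> *\<^sub>R f \<alpha>))"
      by (intro Bochner_Integration.integral_cong refl) (auto simp: indicator_def add.commute[of pi] fs)
    finally show ?thesis unfolding fiber_coeff_eq f_def[symmetric] by simp
  qed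
  then show ?thesis by (simp add: mode_def[abs_def] L2_inner_def)
qed

lemma cf_H_minus_even:
  assumes w: "w \<in> L2_bdry \<kappa>" and m: "even m"
  shows "cf (H_minus \<kappa> w) p m = 0"
proof -
  have "(%N. \<Sum>k\<in>{k. odd k} \<inter> {- int N..int N}. (- \<i> * of_int (sgn k)) * L2_inner bm w (mode (wv p m) k))
    \<longlonglongrightarrow> cf (H_minus \<kappa> w) p m"
    unfolding cf_def by (rule H_minus_inner_limit[OF w wv_L2])
  moreover have "(\<Sum>k\<in>{k. odd k} \<inter> {- int N..int N}. (- \<i> * of_int (sgn k)) * L2_inner bm w (mode (wv p m) k)) = 0" for N
    by (intro sum.neutral) (simp add: fiber_coeff_even_wv[OF m])
  ultimately show ?thesis by (simp add: LIMSEQ_const_iff)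
qed

section \<open>Diagonalization of C_- on the whole boundary\<close>

definition Bop :: "(real \<times> real => complex) => real \<times> real => complex" where
  "Bop w = (%q. 1/2 * (H_minus \<kappa> w q - H_minus \<kappa> w (S q)))"

lemma L2_bdry_add: "f \<in> L2_bdry \<kappa> ==> g \<in> L2_bdry \<kappa> ==> (%q. f q + g q) \<in> L2_bdry \<kappa>"
  by (simp add: L2_bdry_def square_integrable_add periodic_bdry_def)

lemma L2_bdry_diff: "f \<in> L2_bdry \<kappa> ==> g \<in> L2_bdry \<kappa> ==> (%q. f q - g q) \<in> L2_bdry \<kappa>"
  by (simp add: L2_bdry_def square_integrable_diff periodic_bdry_def)

lemma L2_bdry_cmult: "f \<in> L2_bdry \<kappa> ==> (%q. c * f q) \<in> L2_bdry \<kappa>"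
  by (simp add: L2_bdry_def square_integrable_cmult periodic_bdry_def)

lemma cf_add: "f \<in> L2_bdry \<kappa> ==> g \<in> L2_bdry \<kappa> ==> cf (%q. f q + g q) p m = cf f p m + cf g p m"
  unfolding cf_def by (intro L2_inner_add_left L2_bdry_sq wv_sq)

lemma cf_diff: "f \<in> L2_bdry \<kappa> ==> g \<in> L2_bdry \<kappa> ==> cf (%q. f q - g q) p m = cf f p m - cf g p m"
  unfolding cf_def by (intro L2_inner_diff_left L2_bdry_sq wv_sq)

lemma cf_cmult: "cf (%q. c * f q) p m = c * cf f p m"
  unfolding cf_def by (rule L2_inner_cmult_left)

lemma cf_cong_AE:
  assumes "f \<in> L2_bdry \<kappa>" "g \<in> L2_bdry \<kappa>" "AE q in bm. f q = g q"
  shows "cf f p m = cf g p m"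
proof -
  note [measurable] = borel_measurable_bmI[OF L2_bdry_measurable[OF assms(1)]]
    borel_measurable_bmI[OF L2_bdry_measurable[OF assms(2)]] borel_measurable_bmI[OF measurable_wv]
  show ?thesis unfolding cf_def L2_inner_def
    using assms(3) by (intro integral_cong_AE) auto
qed

text \<open>This and \<open>anti_cf\<close> are the traces, on the coefficients, of oddness under
  \<alpha> \<mapsto> \<alpha> + \<pi> and of antisymmetry under scattering; almost-everywhere
  symmetries become algebra of coefficients.\<close>

definition odd_cf :: "(real \<times> real => complex) => bool" where
  "odd_cf w \<longleftrightarrow> (\<forall>p m. even m \<longrightarrow> cf w p m = 0)"

definition anti_cf :: "(real \<times> real => complex) => bool" where
  "anti_cf w \<longleftrightarrow> (\<forall>p m. parity_sign (p + m) * cf w p (2 * p - m) = - cf w p m)"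

lemma anti_cfI:
  assumes w: "w \<in> L2_bdry \<kappa>" and a: "AE q in bm. w (S q) = - w q"
  shows "anti_cf w"
  unfolding anti_cf_def
proof (intro allI)
  fix p m
  have "parity_sign (p + m) * cf w p (2 * p - m) = cf (%q. w (S q)) p m" by (rule cf_scattering[OF w, symmetric])
  also have "\<dots> = cf (%q. (-1) * w q) p m"
    using a by (intro cf_cong_AE L2_bdry_scattering L2_bdry_cmult w) simp
  also have "\<dots> = - cf w p m" unfolding cf_cmult by simp
  finally show "parity_sign (p + m) * cf w p (2 * p - m) = - cf w p m" .
qed

lemma Bop_L2: "w \<in> L2_bdry \<kappa> ==> Bop w \<in> L2_bdry \<kappa>"
  unfolding Bop_def by (intro L2_bdry_cmult L2_bdry_diff L2_bdry_scattering H_minus_spec(1))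

lemma Bop_scattering:
  assumes w: "w \<in> L2_bdry \<kappa>" shows "Bop w (S q) = - Bop w q"
  using periodic_scattering_twice[OF L2_bdry_periodic[OF H_minus_spec(1)[OF w]], of q]
  by (simp add: Bop_def algebra_simps)

lemma Bop_anti: "w \<in> L2_bdry \<kappa> ==> anti_cf (Bop w)"
  by (rule anti_cfI) (simp_all add: Bop_L2 Bop_scattering)

lemma cf_Bop_expand:
  assumes w: "w \<in> L2_bdry \<kappa>"
  shows "cf (Bop w) p m = 1/2 * (cf (H_minus \<kappa> w) p m - parity_sign (p + m) * cf (H_minus \<kappa> w) p (2 * p - m))"
  unfolding Bop_def cf_cmult cf_diff[OF H_minus_spec(1)[OF w] L2_bdry_scattering[OF H_minus_spec(1)[OF w]]]
    cf_scattering[OF H_minus_spec(1)[OF w]] ..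

lemma Bop_odd: "w \<in> L2_bdry \<kappa> ==> odd_cf (Bop w)"
  unfolding odd_cf_def by (simp add: cf_Bop_expand cf_H_minus_even)

text \<open>The scattered term carries the coefficient at 2p - m; antisymmetry replaces it by minus
  the coefficient at m, which turns the difference of the two Hilbert multipliers into their
  sum.\<close>

lemma cf_Bop:
  assumes w: "w \<in> L2_bdry \<kappa>" and a: "anti_cf w" and m: "odd m"
  shows "cf (Bop w) p m = - \<i> / 2 * of_int (sgn m + sgn (2 * p - m)) * cf w p m"
proof -
  have m': "odd (2 * p - m)" using m by simp
  have "cf (Bop w) p m = 1/2 * (- \<i> * of_int (sgn m) * cf w p m - (- \<i> * of_int (sgn (2 * p - m))) * (parity_sign (p + m) * cf w p (2 * p - m)))"
    unfolding cf_Bop_expand[OF w] cf_H_minus_odd[OF w m] cf_H_minus_odd[OF w m'] by (simp add: mult_ac)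
  also have "parity_sign (p + m) * cf w p (2 * p - m) = - cf w p m" using a by (simp add: anti_cf_def)
  finally show ?thesis by (simp add: algebra_simps)
qed

text \<open>For odd m neither m nor 2p - m is zero, so the eigenvalue is 0 or of modulus 1 and
  imaginary; adding its square to 1 leaves 1 or 0. A sum of two signs, rather than one, is what
  makes the result a projection.\<close>

lemma cf_id_plus_Bop_square:
  assumes w: "w \<in> L2_bdry \<kappa>" and a: "anti_cf w" and o: "odd_cf w"
  shows "cf (%q. w q + Bop (Bop w) q) p m = (if odd m \<and> sgn m ~= sgn (2 * p - m) then cf w p m else 0)"
proof -
  note B = Bop_L2[OF w] and BB = Bop_L2[OF Bop_L2[OF w]]
  have e: "cf (%q. w q + Bop (Bop w) q) p m = cf w p m + cf (Bop (Bop w)) p m" by (rule cf_add[OF w BB])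
  show ?thesis
  proof (cases "odd m")
    case False
    then show ?thesis unfolding e using o Bop_odd[OF B] by (simp add: odd_cf_def)
  next
    case True
    then have nz: "m ~= 0" "2 * p - m ~= 0" by auto
    have "cf (Bop (Bop w)) p m = (- \<i> / 2 * of_int (sgn m + sgn (2 * p - m))) * ((- \<i> / 2 * of_int (sgn m + sgn (2 * p - m))) * cf w p m)"
      unfolding cf_Bop[OF B Bop_anti[OF w] True] cf_Bop[OF w a True] ..
    moreover define s where "s = (of_int (sgn m + sgn (2 * p - m)) :: complex)"
    have a: "sgn m = 1 \<or> sgn m = -1" "sgn (2 * p - m) = 1 \<or> sgn (2 * p - m) = -1" using nz by (simp_all add: sgn_if)
    have ss: "s * s = (if sgn m = sgn (2 * p - m) then 4 else 0)"
      using a by (elim disjE) (simp_all add: s_def)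
    have sq: "- \<i> / 2 * s * (- \<i> / 2 * s * c) = - (s * s / 4 * c)" for c
      by (simp add: mult.assoc mult.left_commute[of s "\<i>"])
    ultimately have "cf (Bop (Bop w)) p m = - (s * s / 4 * cf w p m)" by (simp only: s_def[symmetric] sq)
    then have "cf (Bop (Bop w)) p m = (if sgn m = sgn (2 * p - m) then - cf w p m else 0)"
      unfolding ss by (simp split: if_split)
    then show ?thesis unfolding e using True by (simp split: if_split)
  qed
qed

section \<open>Passage between the inward half and the whole boundary\<close>

lemma indicator_cos_measurable [measurable]: "{q :: real \<times> real. cos (snd q) > 0} \<in> sets borel"
  by (intro borel_open open_Collect_less continuous_intros)

lemma integral_im:
  fixes f :: "real \<times> real => complex"
  assumes [measurable]: "f \<in> borel_measurable borel"
  shows "integral\<^sup>L im f = integral\<^sup>L bm (%q. indicator {q. cos (snd q) > 0} q *\<^sub>R f q)"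
proof -
  let ?D = "{0..2*pi} \<times> {- (pi/2)..pi/2}" and ?P = "{q :: real \<times> real. cos (snd q) > 0}"
  have O [measurable]: "open_fund \<in> sets borel" by (intro borel_open open_Times) auto
  have m: "f \<in> borel_measurable (restrict_space lborel ?D)" by (intro measurable_restrict_space1) simp
  have c: "0 \<le> 1 / (1 + \<kappa>)" using kappa_const by simp
  have ae: "AE q in lborel. indicator ?D q *\<^sub>R f q = indicator open_fund q *\<^sub>R (indicator ?P q *\<^sub>R f q)"
    using AE_fst_neq[of 0] AE_fst_neq[of "2 * pi"] AE_snd_neq[of "pi/2"] AE_snd_neq[of "- (pi/2)"]
  proof eventually_elim
    fix q :: "real \<times> real" assume ne: "fst q ~= 0" "fst q ~= 2 * pi" "snd q ~= pi/2" "snd q ~= - (pi/2)"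
    have "cos (snd q) > 0" if "- (pi/2) \<le> snd q" "snd q \<le> pi/2"
      using that ne by (intro cos_gt_zero_pi) auto
    moreover have "\<not> cos (snd q) > 0" if "pi/2 < snd q" "snd q < 3 * pi/2"
      using cos_ge_zero[of "snd q - pi"] that by (simp add: cos_diff)
    ultimately show "indicator ?D q *\<^sub>R f q = indicator open_fund q *\<^sub>R (indicator ?P q *\<^sub>R f q)"
      using ne by (cases q) (auto simp: indicator_def)
  qed
  have "integral\<^sup>L im f = integral\<^sup>L (restrict_space lborel ?D) (%q. (1 / (1 + \<kappa>)) *\<^sub>R f q)"
    unfolding influx_measure_def by (rule integral_density) (use m c in auto)
  also have "\<dots> = (1 / (1 + \<kappa>)) *\<^sub>R integral\<^sup>L (restrict_space lborel ?D) f" by (rule Bochner_Integration.integral_scaleR_right)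
  also have "integral\<^sup>L (restrict_space lborel ?D) f = integral\<^sup>L lborel (%q. indicator ?D q *\<^sub>R f q)"
    by (rule integral_restrict_space) simp
  also have "\<dots> = integral\<^sup>L lborel (%q. indicator open_fund q *\<^sub>R (indicator ?P q *\<^sub>R f q))"
    using ae by (intro integral_cong_AE) measurable
  also have "(1 / (1 + \<kappa>)) *\<^sub>R \<dots> = integral\<^sup>L bm (%q. indicator ?P q *\<^sub>R f q)"
    by (rule integral_bm(1)[symmetric]) measurable
  finally show ?thesis .
qed

lemma nn_integral_bm_skew:
  fixes \<phi> :: "real \<times> real => ennreal"
  assumes [measurable]: "\<phi> \<in> borel_measurable borel" and per: "periodic_bdry \<phi>"
    and c [measurable]: "c \<in> borel_measurable borel" and s: "s = 1 \<or> s = -1"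
  shows "(\<integral>\<^sup>+ q. \<phi> (skew c s d q) \<partial>bm) = (\<integral>\<^sup>+ q. \<phi> q \<partial>bm)"
proof -
  note [measurable] = measurable_skew[OF c, of s d]
  have m: "(%q. \<phi> (skew c s d q)) \<in> borel_measurable borel" by measurable
  show ?thesis unfolding nn_integral_bm[OF m] nn_integral_bm[OF assms(1)]
    using nn_integral_skew[OF assms(1) per c s, of d] by (simp only: skew_def)
qed

text \<open>Scattering preserves the measure and exchanges the half cos \<alpha> > 0 with the half
  cos \<alpha> < 0, while the rest is null. This transfers square integrability from u to its
  antisymmetric extension.\<close>

lemma nn_integral_bm_double:
  assumes [measurable]: "\<phi> \<in> borel_measurable borel" and per: "periodic_bdry \<phi>"
    and inv: "!!q. cos (snd q) ~= 0 ==> \<phi> (S q) = \<phi> q"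
  shows "(\<integral>\<^sup>+ q. \<phi> q \<partial>bm) = 2 * (\<integral>\<^sup>+ q. \<phi> q \<partial>im)"
proof -
  let ?P = "{q :: real \<times> real. cos (snd q) > 0}" and ?N = "{q :: real \<times> real. cos (snd q) < 0}"
  have [measurable]: "?N \<in> sets borel" by (intro borel_open open_Collect_less continuous_intros)
  have pN: "periodic_bdry (%q. \<phi> q * indicator ?N q)"
    using per by (simp add: periodic_bdry_def indicator_def)
  have sc: "cos (snd (S q)) = - cos (snd q)" for q by (cases q) (simp add: scattering_def)
  have "(\<integral>\<^sup>+ q. \<phi> q \<partial>bm) = (\<integral>\<^sup>+ q. \<phi> q * indicator ?P q + \<phi> q * indicator ?N q \<partial>bm)"
    using AE_bm_cos by (intro nn_integral_cong_AE, eventually_elim) (auto simp: indicator_def)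
  also have "\<dots> = (\<integral>\<^sup>+ q. \<phi> q * indicator ?P q \<partial>bm) + (\<integral>\<^sup>+ q. \<phi> q * indicator ?N q \<partial>bm)"
    by (rule nn_integral_add) (intro borel_measurable_bmI, measurable)+
  also have "(\<integral>\<^sup>+ q. \<phi> q * indicator ?N q \<partial>bm) = (\<integral>\<^sup>+ q. \<phi> (S q) * indicator ?N (S q) \<partial>bm)"
    unfolding scattering_skew
    by (rule nn_integral_bm_skew[where \<phi> = "%q. \<phi> q * indicator ?N q", symmetric]) (use pN in measurable)
  also have "\<dots> = (\<integral>\<^sup>+ q. \<phi> q * indicator ?P q \<partial>bm)"
    using AE_bm_cos by (intro nn_integral_cong_AE, eventually_elim) (auto simp: indicator_def inv sc)
  finally show ?thesis unfolding nn_integral_im[OF assms(1)] by (simp add: mult_2)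
qed

lemma integral_bm_double:
  fixes f :: "real \<times> real => complex"
  assumes f [measurable]: "f \<in> borel_measurable borel" and per: "periodic_bdry f" and i: "integrable bm f"
    and inv: "!!q. cos (snd q) ~= 0 ==> f (S q) = f q"
  shows "integral\<^sup>L bm f = 2 * integral\<^sup>L im f"
proof -
  let ?P = "{q :: real \<times> real. cos (snd q) > 0}" and ?N = "{q :: real \<times> real. cos (snd q) < 0}"
  have [measurable]: "?N \<in> sets borel" by (intro borel_open open_Collect_less continuous_intros)
  have pN: "periodic_bdry (%q. indicator ?N q *\<^sub>R f q)"
    using per by (simp add: periodic_bdry_def indicator_def)
  have sc: "cos (snd (S q)) = - cos (snd q)" for q by (cases q) (simp add: scattering_def)
  have sb: "sets bm = sets (restrict_space lborel ({0..2*pi} \<times> {- (pi/2)..3*pi/2}))" by (simp add: bdry_measure_def)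
  have mb: "f \<in> borel_measurable bm" "indicator ?P \<in> borel_measurable bm" "indicator ?N \<in> borel_measurable bm"
    "(%q. indicator ?P q *\<^sub>R f q) \<in> borel_measurable bm" "(%q. indicator ?N q *\<^sub>R f q) \<in> borel_measurable bm"
    "(%q. indicator ?N (S q) *\<^sub>R f (S q)) \<in> borel_measurable bm"
    by (rule borel_measurable_bmI, measurable)+
  have iP: "integrable bm (%q. indicator ?P q *\<^sub>R f q)" "integrable bm (%q. indicator ?N q *\<^sub>R f q)"
    by (rule Bochner_Integration.integrable_bound[OF i mb(4)], simp add: indicator_def,
        rule Bochner_Integration.integrable_bound[OF i mb(5)], simp add: indicator_def)
  have "integral\<^sup>L bm f = integral\<^sup>L bm (%q. indicator ?P q *\<^sub>R f q + indicator ?N q *\<^sub>R f q)"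
  proof (rule integral_cong_AE)
    show "AE q in bm. f q = indicator ?P q *\<^sub>R f q + indicator ?N q *\<^sub>R f q"
      using AE_bm_cos by eventually_elim (auto simp: indicator_def)
  qed (use mb in auto)
  also have "\<dots> = integral\<^sup>L bm (%q. indicator ?P q *\<^sub>R f q) + integral\<^sup>L bm (%q. indicator ?N q *\<^sub>R f q)"
    by (rule Bochner_Integration.integral_add[OF iP])
  also have "integral\<^sup>L bm (%q. indicator ?N q *\<^sub>R f q) = integral\<^sup>L bm (%q. indicator ?N (S q) *\<^sub>R f (S q))"
    by (rule integral_scattering[where g = "%q. indicator ?N q *\<^sub>R f q", symmetric]) (use pN in measurable)
  also have "\<dots> = integral\<^sup>L bm (%q. indicator ?P q *\<^sub>R f q)"
  proof (rule integral_cong_AE)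
    show "AE q in bm. indicator ?N (S q) *\<^sub>R f (S q) = indicator ?P q *\<^sub>R f q"
      using AE_bm_cos by eventually_elim (auto simp: indicator_def inv sc)
  qed (use mb in auto)
  finally show ?thesis unfolding integral_im[OF f] by simp
qed

lemma space_im_inner: "q \<in> space im ==> \<bar>snd q\<bar> \<le> pi/2"
  by (auto simp: space_im abs_le_iff)

lemma A_minus_eq_im: "q \<in> space im ==> A_minus \<kappa> u q = u q"
  using A_minus_inner[of "snd q" u "fst q"] space_im_inner[of q] by simp

lemma A_minus_L2:
  assumes u: "u \<in> L2_influx \<kappa>" shows "A_minus \<kappa> u \<in> L2_bdry \<kappa>"
proof -
  have pu: "periodic_influx u" and sq: "square_integrable im u" using u by (auto simp: L2_influx_def)
  have m [measurable]: "A_minus \<kappa> u \<in> borel_measurable borel"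
    by (rule measurable_A_minus[OF pu square_integrable_measurable[OF sq]])
  let ?\<phi> = "%q. ennreal ((norm (A_minus \<kappa> u q))\<^sup>2)"
  have "(\<integral>\<^sup>+ q. ?\<phi> q \<partial>bm) = 2 * (\<integral>\<^sup>+ q. ?\<phi> q \<partial>im)"
  proof (rule nn_integral_bm_double)
    show "periodic_bdry ?\<phi>" using periodic_A_minus[OF pu] by (simp add: periodic_bdry_def)
  qed (measurable, simp add: A_minus_anti[OF pu])
  also have "(\<integral>\<^sup>+ q. ?\<phi> q \<partial>im) = (\<integral>\<^sup>+ q. ennreal ((norm (u q))\<^sup>2) \<partial>im)"
    by (intro nn_integral_cong) (simp add: A_minus_eq_im)
  also have "2 * \<dots> < \<infinity>"
    using sq unfolding square_integrable_def integrable_iff_bounded by (simp add: ennreal_mult_less_top)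
  finally have fin: "(\<integral>\<^sup>+ q. ?\<phi> q \<partial>bm) < \<infinity>" .
  have "integrable bm (%q. (norm (A_minus \<kappa> u q))\<^sup>2)"
  proof (rule integrableI_nonneg[OF _ AE_I2[OF zero_le_power2] fin])
    show "(%q. (norm (A_minus \<kappa> u q))\<^sup>2) \<in> borel_measurable bm" using borel_measurable_bmI[OF m] by measurable
  qed
  then show ?thesis using periodic_A_minus[OF pu] borel_measurable_bmI[OF m]
    by (simp add: L2_bdry_def square_integrable_def)
qed

lemma im_norm_le:
  assumes g: "g \<in> L2_bdry \<kappa>"
  shows "square_integrable im g" "L2_norm im g \<le> L2_norm bm g"
proof -
  note [measurable] = L2_bdry_measurable[OF g]
  have nb: "(\<integral>\<^sup>+ q. ennreal ((norm (g q))\<^sup>2) \<partial>bm) = ennreal ((L2_norm bm g)\<^sup>2)"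
    unfolding L2_norm_square using L2_bdry_sq[OF g] by (intro nn_integral_eq_integral) (auto simp: square_integrable_def)
  have "(\<integral>\<^sup>+ q. ennreal ((norm (g q))\<^sup>2) \<partial>im) = (\<integral>\<^sup>+ q. ennreal ((norm (g q))\<^sup>2) * indicator {q. cos (snd q) > 0} q \<partial>bm)"
    by (rule nn_integral_im) measurable
  also have "\<dots> \<le> (\<integral>\<^sup>+ q. ennreal ((norm (g q))\<^sup>2) \<partial>bm)"
    by (intro nn_integral_mono) (auto simp: indicator_def)
  finally have le: "(\<integral>\<^sup>+ q. ennreal ((norm (g q))\<^sup>2) \<partial>im) \<le> ennreal ((L2_norm bm g)\<^sup>2)" unfolding nb .
  have "integrable im (%q. (norm (g q))\<^sup>2)"
  proof (rule integrableI_nonneg[OF _ AE_I2[OF zero_le_power2]])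
    show "(%q. (norm (g q))\<^sup>2) \<in> borel_measurable im" by (rule borel_measurable_imI) measurable
    show "(\<integral>\<^sup>+ q. ennreal ((norm (g q))\<^sup>2) \<partial>im) < \<infinity>" by (rule le_less_trans[OF le]) simp
  qed
  then show sq: "square_integrable im g"
    using borel_measurable_imI[OF L2_bdry_measurable[OF g]] by (simp add: square_integrable_def)
  have "(\<integral>\<^sup>+ q. ennreal ((norm (g q))\<^sup>2) \<partial>im) = ennreal ((L2_norm im g)\<^sup>2)"
    unfolding L2_norm_square using sq by (intro nn_integral_eq_integral) (auto simp: square_integrable_def)
  then have "(L2_norm im g)\<^sup>2 \<le> (L2_norm bm g)\<^sup>2" using le by (simp add: ennreal_le_iff)
  then show "L2_norm im g \<le> L2_norm bm g" by (rule power2_le_imp_le) (rule L2_norm_nonneg)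
qed

lemma L2_bdry_influx: assumes "g \<in> L2_bdry \<kappa>" shows "g \<in> L2_influx \<kappa>"
  using im_norm_le(1)[OF assms] L2_bdry_periodic[OF assms]
  by (simp add: L2_influx_def periodic_influx_def periodic_bdry_def)

lemma C_minus_Bop: "C_minus \<kappa> u = Bop (A_minus \<kappa> u)"
  by (simp add: C_minus_def A_minus_adj_def Bop_def)

lemma A_minus_Bop: "w \<in> L2_bdry \<kappa> ==> A_minus \<kappa> (Bop w) = Bop w"
  unfolding Bop_def using A_minus_of_adj[OF L2_bdry_periodic[OF H_minus_spec(1)]] by (intro ext) blast

lemma id_plus_C_minus_sq_eq:
  assumes u: "u \<in> L2_influx \<kappa>"
  shows "id_plus_C_minus_sq \<kappa> u = (%q. u q + Bop (Bop (A_minus \<kappa> u)) q)"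
  by (simp add: id_plus_C_minus_sq_def C_minus_Bop A_minus_Bop[OF A_minus_L2[OF u]])

lemma A_minus_add: "A_minus \<kappa> (%q. u q + v q) q = A_minus \<kappa> u q + A_minus \<kappa> v q"
  by (cases q) (simp add: A_minus_def Let_def)

lemma A_minus_id_plus_C_minus_sq:
  assumes u: "u \<in> L2_influx \<kappa>"
  shows "A_minus \<kappa> (id_plus_C_minus_sq \<kappa> u) = (%q. A_minus \<kappa> u q + Bop (Bop (A_minus \<kappa> u)) q)"
  unfolding id_plus_C_minus_sq_eq[OF u] A_minus_add[abs_def] A_minus_Bop[OF Bop_L2[OF A_minus_L2[OF u]]] ..

lemma id_plus_C_minus_sq_L2:
  assumes u: "u \<in> L2_influx \<kappa>" shows "id_plus_C_minus_sq \<kappa> u \<in> L2_influx \<kappa>"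
proof -
  have B: "Bop (Bop (A_minus \<kappa> u)) \<in> L2_influx \<kappa>"
    by (intro L2_bdry_influx Bop_L2 A_minus_L2 u)
  show ?thesis unfolding id_plus_C_minus_sq_eq[OF u] using u B
    by (simp add: L2_influx_def periodic_influx_def square_integrable_add)
qed

lemma AE_im_iff:
  assumes N [measurable]: "N \<in> sets borel"
  shows "(AE q in im. q \<notin> N) \<longleftrightarrow> (AE q in bm. cos (snd q) > 0 \<longrightarrow> q \<notin> N)"
proof -
  have a: "(AE q in im. q \<notin> N) \<longleftrightarrow> (\<integral>\<^sup>+ q. indicator N q \<partial>im) = 0"
    by (subst nn_integral_0_iff_AE) (auto intro!: borel_measurable_imI simp: indicator_def)
  have b: "(AE q in bm. cos (snd q) > 0 \<longrightarrow> q \<notin> N) \<longleftrightarrow> (\<integral>\<^sup>+ q. indicator N q * indicator {q. cos (snd q) > 0} q \<partial>bm) = 0"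
    by (subst nn_integral_0_iff_AE[OF borel_measurable_bmI]) (measurable, auto simp: indicator_def)
  show ?thesis unfolding a b by (subst nn_integral_im) auto
qed

text \<open>The antipodal map is the shift of \<alpha> by \<pi> followed by scattering, under which
  \<open>A_minus\<close> changes sign. Invariance of u thus becomes oddness of its extension under
  the shift, a property that the coefficients detect: those with even m vanish.\<close>

lemma unoriented_iff:
  assumes u: "u \<in> L2_influx \<kappa>"
  shows "unoriented \<kappa> u \<longleftrightarrow> (AE q in bm. A_minus \<kappa> u (fst q, snd q + pi) = - A_minus \<kappa> u q)"
proof -
  let ?w = "A_minus \<kappa> u"
  have pu: "periodic_influx u" using u by (simp add: L2_influx_def)
  note per = periodic_A_minus[OF pu]
  note [measurable] = L2_bdry_measurable[OF A_minus_L2[OF u]]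
  have sk: "skew (%_. 0) 1 pi q = (fst q, snd q + pi)" for q by (simp add: skew_def)
  have [measurable]: "(%q :: real \<times> real. (fst q, snd q + pi)) \<in> borel_measurable borel"
    using measurable_skew[of "%_. 0" 1 pi] unfolding skew_def by simp
  define N where "N = {q. ?w (fst q, snd q + pi) ~= - ?w q}"
  have N [measurable]: "N \<in> sets borel" unfolding N_def by measurable
  have ap: "antipodal_scattering \<kappa> q = S (fst q, snd q + pi)" for q
    by (cases q) (simp add: antipodal_scattering_def)
  have cosAE: "AE q in im. cos (snd q) ~= 0"
  proof -
    have "{q :: real \<times> real. cos (snd q) = 0} \<in> sets borel"
      by (intro borel_closed closed_Collect_eq continuous_intros)
    from AE_im_iff[OF this] AE_bm_cos show ?thesis by simp
  qed
  have eq: "u (antipodal_scattering \<kappa> q) = u q \<longleftrightarrow> q \<notin> N" if q: "q \<in> space im" and c: "cos (snd q) ~= 0" for q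
  proof -
    have "snd (antipodal_scattering \<kappa> q) = - snd q" by (simp add: ap scattering_def)
    then have "\<bar>snd (antipodal_scattering \<kappa> q)\<bar> \<le> pi/2" using space_im_inner[OF q] by simp
    from A_minus_inner[OF this, of u "fst (antipodal_scattering \<kappa> q)"]
    have "u (antipodal_scattering \<kappa> q) = ?w (antipodal_scattering \<kappa> q)" by (simp only: prod.collapse)
    also have "\<dots> = - ?w (fst q, snd q + pi)"
      unfolding ap using c by (intro A_minus_anti[OF pu]) simp
    finally show ?thesis using A_minus_eq_im[OF q, of u] unfolding N_def mem_Collect_eq by (metis minus_minus)
  qed
  have "unoriented \<kappa> u \<longleftrightarrow> (AE q in im. q \<notin> N)"
    unfolding unoriented_def
  proof
    assume "AE q in im. u (antipodal_scattering \<kappa> q) = u q"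
    with cosAE AE_space[of im] show "AE q in im. q \<notin> N" by eventually_elim (use eq in blast)
  next
    assume "AE q in im. q \<notin> N"
    with cosAE AE_space[of im] show "AE q in im. u (antipodal_scattering \<kappa> q) = u q" by eventually_elim (use eq in blast)
  qed
  also have "\<dots> \<longleftrightarrow> (AE q in bm. cos (snd q) > 0 \<longrightarrow> q \<notin> N)" by (rule AE_im_iff[OF N])
  also have "\<dots> \<longleftrightarrow> (AE q in bm. q \<notin> N)"
  proof
    \<comment> \<open>The exceptional set is invariant under the shift by \<pi>, since 2\<pi> is a
      period. The shift preserves the measure and carries the outward part of the set to its inward
      part, which is null.\<close>
    assume a: "AE q in bm. cos (snd q) > 0 \<longrightarrow> q \<notin> N"
    let ?M = "{q :: real \<times> real. cos (snd q) < 0}"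
    have [measurable]: "?M \<in> sets borel" by (intro borel_open open_Collect_less continuous_intros)
    define \<phi> where "\<phi> q = (indicator (N \<inter> ?M) q :: ennreal)" for q
    have m\<phi> [measurable]: "\<phi> \<in> borel_measurable borel" unfolding \<phi>_def by measurable
    have p\<phi>: "periodic_bdry \<phi>"
      unfolding periodic_bdry_def
    proof (intro allI conjI)
      fix \<beta> \<alpha>
      have p1: "?w (\<beta> + 2 * pi, x) = ?w (\<beta>, x)" and p2: "?w (\<beta>, x + 2 * pi) = ?w (\<beta>, x)" for x
        using per by (auto simp: periodic_bdry_def)
      have x: "\<alpha> + 2 * pi + pi = (\<alpha> + pi) + 2 * pi" by simp
      show "\<phi> (\<beta> + 2 * pi, \<alpha>) = \<phi> (\<beta>, \<alpha>)" by (simp add: \<phi>_def indicator_def N_def p1)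
      show "\<phi> (\<beta>, \<alpha> + 2 * pi) = \<phi> (\<beta>, \<alpha>)"
        using p2[of "\<alpha> + pi"] unfolding x[symmetric]
        by (simp only: \<phi>_def indicator_def N_def mem_Collect_eq Int_iff fst_conv snd_conv p2 cos_periodic)
    qed
    have "(\<integral>\<^sup>+ q. \<phi> q \<partial>bm) = (\<integral>\<^sup>+ q. \<phi> (skew (%_. 0) 1 pi q) \<partial>bm)"
      by (rule nn_integral_bm_skew[OF m\<phi> p\<phi>, symmetric]) auto
    also have "\<dots> = 0"
    proof (subst nn_integral_0_iff_AE)
      show "(%q. \<phi> (skew (%_. 0) 1 pi q)) \<in> borel_measurable bm" unfolding sk by (rule borel_measurable_bmI) measurable
      show "AE q in bm. \<phi> (skew (%_. 0) 1 pi q) = 0"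
        using a
      proof eventually_elim
        fix q assume q: "cos (snd q) > 0 \<longrightarrow> q \<notin> N"
        have "?w (fst q, snd q + pi + pi) = ?w q"
          using per unfolding periodic_bdry_def by (cases q) (simp add: add.assoc mult_2[symmetric])
        then show "\<phi> (skew (%_. 0) 1 pi q) = 0" unfolding sk using q by (auto simp: \<phi>_def N_def)
      qed
    qed
    finally have "AE q in bm. \<phi> q = 0"
      by (subst (asm) nn_integral_0_iff_AE) (auto intro: borel_measurable_bmI)
    with a AE_bm_cos show "AE q in bm. q \<notin> N" by eventually_elim (auto simp: \<phi>_def indicator_def)
  qed auto
  finally show ?thesis by (simp add: N_def)
qed

lemma odd_cf_iff:
  assumes w: "w \<in> L2_bdry \<kappa>"
  shows "odd_cf w \<longleftrightarrow> (AE q in bm. w (fst q, snd q + pi) = - w q)"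
proof
  assume o: "odd_cf w"
  have "AE q in bm. w (fst q, snd q + pi) = (-1) * w q"
  proof (rule cf_unique[OF cf_shift(1)[OF w] L2_bdry_cmult[OF w]])
    show "cf (%q. w (fst q, snd q + pi)) p m = cf (%q. (-1) * w q) p m" for p m
      unfolding cf_shift(2)[OF w] cf_cmult using o by (auto simp: odd_cf_def parity_sign_def)
  qed
  then show "AE q in bm. w (fst q, snd q + pi) = - w q" by simp
next
  assume a: "AE q in bm. w (fst q, snd q + pi) = - w q"
  show "odd_cf w" unfolding odd_cf_def
  proof (intro allI impI)
    fix p m :: int assume m: "even m"
    have "cf w p m = cf (%q. w (fst q, snd q + pi)) p m" unfolding cf_shift(2)[OF w] using m by (simp add: parity_sign_def)
    also have "\<dots> = cf (%q. (-1) * w q) p m"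
      using a by (intro cf_cong_AE cf_shift(1) L2_bdry_cmult w) simp
    also have "\<dots> = - cf w p m" unfolding cf_cmult by simp
    finally show "cf w p m = 0" by simp
  qed
qed

lemma A_minus_anti_cf: assumes u: "u \<in> L2_influx \<kappa>" shows "anti_cf (A_minus \<kappa> u)"
proof (rule anti_cfI[OF A_minus_L2[OF u]])
  have pu: "periodic_influx u" using u by (simp add: L2_influx_def)
  show "AE q in bm. A_minus \<kappa> u (S q) = - A_minus \<kappa> u q"
    using AE_bm_cos by eventually_elim (rule A_minus_anti[OF pu])
qed

lemma cf_id_plus_C_minus_sq:
  assumes u: "u \<in> L2_influx \<kappa>" "unoriented \<kappa> u"
  shows "cf (A_minus \<kappa> (id_plus_C_minus_sq \<kappa> u)) p m = (if odd m \<and> sgn m ~= sgn (2 * p - m) then cf (A_minus \<kappa> u) p m else 0)"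
  unfolding A_minus_id_plus_C_minus_sq[OF u(1)]
  using u unoriented_iff[OF u(1)] odd_cf_iff[OF A_minus_L2[OF u(1)]]
  by (intro cf_id_plus_Bop_square A_minus_L2 A_minus_anti_cf) auto

lemma id_plus_C_minus_sq_unoriented:
  assumes u: "u \<in> L2_influx \<kappa>" "unoriented \<kappa> u"
  shows "unoriented \<kappa> (id_plus_C_minus_sq \<kappa> u)"
proof -
  note P = id_plus_C_minus_sq_L2[OF u(1)]
  have "odd_cf (A_minus \<kappa> (id_plus_C_minus_sq \<kappa> u))"
    unfolding odd_cf_def using cf_id_plus_C_minus_sq[OF u] by simp
  then show ?thesis using unoriented_iff[OF P] odd_cf_iff[OF A_minus_L2[OF P]] by simp
qed

lemma integral_cis_period:
  assumes "k ~= 0"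
  shows "integral\<^sup>L lborel (%x. indicator {0..2*pi} x *\<^sub>R cis (of_int k * x)) = 0"
proof -
  have d: "((%x. cis (of_int k * x) / (\<i> * of_int k)) has_vector_derivative cis (of_int k * x)) (at x within {0..2*pi})" for x
  proof -
    have "((%x. cis (of_int k * x)) has_vector_derivative (\<i> * of_int k * cis (of_int k * x))) (at x)"
      using exp_scaleR_has_vector_derivative_right[of "\<i> * of_int k" x UNIV]
      by (simp add: cis_conv_exp scaleR_conv_of_real mult_ac)
    then have "((%x. cis (of_int k * x) / (\<i> * of_int k)) has_vector_derivative (\<i> * of_int k * cis (of_int k * x)) / (\<i> * of_int k)) (at x)"
      by (rule bounded_linear.has_vector_derivative[OF bounded_linear_divide])
    then show ?thesis using assms by (auto intro: has_vector_derivative_at_within)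
  qed
  have "integral\<^sup>L lborel (%x. indicator {0..2*pi} x *\<^sub>R cis (of_int k * x))
      = cis (of_int k * (2*pi)) / (\<i> * of_int k) - cis (of_int k * 0) / (\<i> * of_int k)"
    by (rule integral_FTC_Icc[OF _ d]) (auto intro!: continuous_intros)
  also have "cis (of_int k * (2*pi)) = 1" using cis_int_2pi[of k 0] by (simp only: add_0_left mult_zero_right cis_zero)
  finally show ?thesis by simp
qed

text \<open>The factor 1/\<rho>^2 is s' up to a constant, so the integrand is an exact derivative of
  a multiple of e^{iks}, and s grows by 2\<pi> over one fibre.\<close>

lemma integral_cis_scat_period:
  assumes "k ~= 0"
  shows "integral\<^sup>L lborel (%x. indicator {- (pi/2)..3*pi/2} x *\<^sub>R (of_real (1 / (rho x)\<^sup>2) * cis (of_int k * sct x))) = 0"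
proof -
  let ?c = "\<i> * of_int k * of_real (1 - \<kappa>\<^sup>2) :: complex"
  have "1 - \<kappa>\<^sup>2 ~= 0" using abs_square_less_1[of \<kappa>] kappa_gt kappa_lt by auto
  then have c: "?c ~= 0" using assms by (simp del: of_real_diff of_real_power)
  have d: "((%x. cis (of_int k * sct x) / ?c) has_vector_derivative (of_real (1 / (rho x)\<^sup>2) * cis (of_int k * sct x)))
     (at x within {- (pi/2)..3*pi/2})" for x
  proof -
    have "((%x. cis (of_int k * sct x) / ?c) has_vector_derivative
      (\<i> * of_int k * of_real ((1 - \<kappa>\<^sup>2) / (rho x)\<^sup>2) * cis (of_int k * sct x)) / ?c) (at x)"
      by (rule bounded_linear.has_vector_derivative[OF bounded_linear_divide has_vector_derivative_cis_mult_scat])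
    moreover have "(\<i> * of_int k * of_real ((1 - \<kappa>\<^sup>2) / (rho x)\<^sup>2) * cis (of_int k * sct x)) / ?c = of_real (1 / (rho x)\<^sup>2) * cis (of_int k * sct x)"
      using c rho_pos[of x] by (simp add: divide_simps)
    ultimately show ?thesis by (simp only: has_vector_derivative_at_within)
  qed
  have "integral\<^sup>L lborel (%x. indicator {- (pi/2)..3*pi/2} x *\<^sub>R (of_real (1 / (rho x)\<^sup>2) * cis (of_int k * sct x)))
      = cis (of_int k * sct (3*pi/2)) / ?c - cis (of_int k * sct (- (pi/2))) / ?c"
    by (rule integral_FTC_Icc[OF _ d])
       (use rho_pos in \<open>auto intro!: continuous_intros continuous_cis_mult_scat continuous_rho simp: less_imp_neq[symmetric]\<close>)
  also have "sct (3*pi/2) = sct (- (pi/2)) + 2 * pi" using scat_plus_2pi[of "- (pi/2)"] by simp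
  also have "cis (of_int k * (sct (- (pi/2)) + 2 * pi)) = cis (of_int k * sct (- (pi/2)))"
    by (rule cis_int_2pi)
  finally show ?thesis by simp
qed

lemma wv_orthogonal:
  assumes "(p, m) ~= (p', m')" shows "L2_inner bm (wv p m) (wv p' m') = 0"
proof -
  let ?f = "%q. wv p m q * cnj (wv p' m' q)"
  define X where "X \<alpha> = of_real (1 / (rho \<alpha>)\<^sup>2) * cis (of_int (m - m') * sct \<alpha>)" for \<alpha>
  have f: "?f (\<beta>, \<alpha>) = cis (of_int (p - p') * \<beta>) * X \<alpha>" for \<beta> \<alpha>
  proof -
    have "cis (of_int p * \<beta>) * cnj (cis (of_int p' * \<beta>)) = cis (of_int (p - p') * \<beta>)"
      unfolding cis_cnj cis_mult by (simp add: algebra_simps)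
    moreover have "cis (of_int m * sct \<alpha>) * cnj (cis (of_int m' * sct \<alpha>)) = cis (of_int (m - m') * sct \<alpha>)"
      unfolding cis_cnj cis_mult by (simp add: algebra_simps)
    ultimately show ?thesis unfolding wv_def fst_conv snd_conv X_def
      by (simp add: power2_eq_square mult_ac)
  qed
  have inner: "integral\<^sup>L lborel (%\<alpha>. indicator {- (pi/2)..3*pi/2} \<alpha> *\<^sub>R ?f (\<beta>, \<alpha>))
      = cis (of_int (p - p') * \<beta>) * integral\<^sup>L lborel (%\<alpha>. indicator {- (pi/2)..3*pi/2} \<alpha> *\<^sub>R X \<alpha>)" for \<beta>
    by (simp only: f mult_scaleR_right[symmetric] Bochner_Integration.integral_mult_right_zero)
  have m: "?f \<in> borel_measurable borel"
    using measurable_wv[of p m] measurable_wv[of p' m'] by measurable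
  have i: "integrable bm ?f" by (rule square_integrable_inner[OF wv_sq wv_sq])
  have "L2_inner bm (wv p m) (wv p' m') = (1 / (1 + \<kappa>)) *\<^sub>R integral\<^sup>L lborel (%\<beta>. indicator {0..2*pi} \<beta> *\<^sub>R
     integral\<^sup>L lborel (%\<alpha>. indicator {- (pi/2)..3*pi/2} \<alpha> *\<^sub>R ?f (\<beta>, \<alpha>)))"
    unfolding L2_inner_def by (rule integral_bm_fubini[OF m i])
  also have "\<dots> = (1 / (1 + \<kappa>)) *\<^sub>R (integral\<^sup>L lborel (%\<beta>. indicator {0..2*pi} \<beta> *\<^sub>R cis (of_int (p - p') * \<beta>))
     * integral\<^sup>L lborel (%\<alpha>. indicator {- (pi/2)..3*pi/2} \<alpha> *\<^sub>R X \<alpha>))"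
    unfolding inner unfolding mult_scaleR_left[symmetric] Bochner_Integration.integral_mult_left_zero ..
  also have "\<dots> = 0" using assms integral_cis_period[of "p - p'"] integral_cis_scat_period[of "m - m'", folded X_def] by auto
  finally show ?thesis .
qed

section \<open>Expansion in the retained frequencies\<close>

definition n0 :: real where "n0 = L2_norm bm (wv 0 0)"

lemma norm_wv_eq: "norm (wv p m q) = 1 / rho (snd q)"
  using rho_pos[of "snd q"] by (simp add: wv_def norm_mult norm_divide)

lemma L2_norm_wv: "L2_norm bm (wv p m) = n0"
  unfolding n0_def L2_norm_def norm_wv_eq ..

lemma n0_pos: "n0 > 0"
proof (rule ccontr)
  assume "\<not> n0 > 0"
  then have "L2_norm bm (wv 0 0) = 0" using L2_norm_nonneg[of bm "wv 0 0"] unfolding n0_def by simp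
  then have "AE q in bm. wv 0 0 q = 0" by (rule L2_norm_zero_AE[OF wv_sq])
  then have "AE q in bm. False"
  proof eventually_elim
    fix q assume "wv 0 0 q = 0"
    then show False using norm_wv_eq[of 0 0 q] rho_pos[of "snd q"] by simp
  qed
  then have "(\<integral>\<^sup>+ q. 1 \<partial>bm) = (\<integral>\<^sup>+ q. 0 \<partial>bm)" by (intro nn_integral_cong_AE) auto
  then have "(\<integral>\<^sup>+ q. 1 * indicator fund q \<partial>lborel) = 0"
    using kappa_const unfolding nn_integral_bm[OF borel_measurable_const] by (simp add: ennreal_zero_less_divide)
  then have z: "emeasure lborel fund = 0" by simp
  have "{0..1} \<times> {0..1} \<subseteq> fund" using pi_gt3 by (auto simp: fund_def)
  then have "emeasure lborel ({0..1::real} \<times> {0..1::real}) \<le> emeasure lborel fund"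
    by (intro emeasure_mono) (simp_all add: fund_sets)
  moreover have "emeasure lborel ({0..1::real} \<times> {0..1::real}) = 1"
    unfolding lborel_prod[symmetric] by (subst lborel.emeasure_pair_measure_Times) auto
  ultimately show False unfolding z by simp
qed

text \<open>The series converges by orthogonality and Bessel's inequality, and its sum has the
  coefficients of v, hence equals v by completeness. The index sets have to exhaust only the support
  of the coefficients, which permits summation by polynomial degree later.\<close>

lemma wv_series:
  fixes F :: "nat => (int \<times> int) set"
  assumes v: "v \<in> L2_bdry \<kappa>" and fin: "!!N. finite (F N)" and mono: "!!N N'. N \<le> N' ==> F N \<subseteq> F N'"
    and cov: "!!p m. cf v p m ~= 0 ==> \<exists>N. (p, m) \<in> F N"
  shows "(%N. L2_norm bm (%q. v q - (\<Sum>i\<in>F N. cf v (fst i) (snd i) / of_real (n0\<^sup>2) * wv (fst i) (snd i) q))) \<longlonglongrightarrow> 0"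
proof -
  define c where "c i = cf v (fst i) (snd i) / of_real (n0\<^sup>2)" for i
  define g where "g i q = c i * wv (fst i) (snd i) q" for i q
  have sq: "square_integrable bm (g i)" for i unfolding g_def by (intro square_integrable_cmult wv_sq)
  have ng: "(L2_norm bm (g i))\<^sup>2 = (norm (cf v (fst i) (snd i)))\<^sup>2 / n0\<^sup>2" for i
  proof -
    have "norm (c i) = norm (cf v (fst i) (snd i)) / n0\<^sup>2"
      unfolding c_def norm_divide norm_of_real by simp
    then show ?thesis
      using n0_pos unfolding g_def L2_norm_cmult L2_norm_wv by (simp add: field_simps power2_eq_square)
  qed
  have orth: "L2_inner bm (g i) (g j) = 0" if "i ~= j" for i j
    using wv_orthogonal[of "fst i" "snd i" "fst j" "snd j"] that unfolding g_def L2_inner_cmult_left L2_inner_cmult_right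
    by (simp add: prod_eq_iff)
  have proj: "L2_inner bm v (g i) = of_real ((L2_norm bm (g i))\<^sup>2)" for i
    unfolding ng g_def L2_inner_cmult_right cf_def[symmetric] c_def
    by (simp add: complex_norm_square[symmetric] mult.commute del: of_real_power)
  have sqv: "square_integrable bm v" by (rule L2_bdry_sq[OF v])
  have "\<exists>h. square_integrable bm h \<and> (%N. L2_norm bm (%x. h x - (\<Sum>i\<in>F N. g i x))) \<longlonglongrightarrow> 0"
    by (rule L2_orthogonal_series[where B = "(L2_norm bm v)\<^sup>2", OF fin mono sq orth]) (auto intro: L2_bessel fin sq sqv orth proj)
  then obtain h where h: "square_integrable bm h" "(%N. L2_norm bm (%x. h x - (\<Sum>i\<in>F N. g i x))) \<longlonglongrightarrow> 0" by blast
  from L2_bdry_representative[OF h(1)] obtain h0 where h0: "h0 \<in> L2_bdry \<kappa>" and hh: "AE q in bm. h q = h0 q" by (rule bexE)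
  have sqs: "square_integrable bm (%x. \<Sum>i\<in>F N. g i x)" for N using sq by (rule square_integrable_sum)
  have ms: "h \<in> borel_measurable bm" "h0 \<in> borel_measurable bm" "v \<in> borel_measurable bm" "(%x. \<Sum>i\<in>F N. g i x) \<in> borel_measurable bm" for N
    using h(1) L2_bdry_sq[OF h0] sqv sqs by (simp_all add: square_integrable_measurable)
  have "L2_norm bm (%x. h0 x - (\<Sum>i\<in>F N. g i x)) = L2_norm bm (%x. h x - (\<Sum>i\<in>F N. g i x))" for N
    using hh ms by (intro L2_norm_cong_AE borel_measurable_diff) auto
  then have l0: "(%N. L2_norm bm (%x. h0 x - (\<Sum>i\<in>F N. g i x))) \<longlonglongrightarrow> 0" using h(2) by simp
  have "AE q in bm. v q = h0 q"
  proof (rule cf_unique[OF v h0])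
    fix p m
    have l1: "(%N. L2_inner bm (%x. \<Sum>i\<in>F N. g i x) (wv p m)) \<longlonglongrightarrow> cf h0 p m"
      unfolding cf_def by (rule L2_limit_inner[OF sqs L2_bdry_sq[OF h0] wv_sq l0])
    have val: "L2_inner bm (%x. \<Sum>i\<in>F N. g i x) (wv p m) = (if (p, m) \<in> F N then cf v p m else 0)" for N
    proof -
      have "L2_inner bm (%x. \<Sum>i\<in>F N. g i x) (wv p m) = (\<Sum>i\<in>F N. L2_inner bm (g i) (wv p m))"
        by (rule L2_inner_sum_left[OF sq wv_sq])
      also have "\<dots> = (\<Sum>i\<in>F N. if i = (p, m) then cf v p m else 0)"
      proof (rule sum.cong[OF refl])
        fix i
        show "L2_inner bm (g i) (wv p m) = (if i = (p, m) then cf v p m else 0)"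
          using n0_pos wv_orthogonal[of "fst i" "snd i" p m] unfolding g_def L2_inner_cmult_left c_def
          by (auto simp: L2_inner_self L2_norm_wv prod_eq_iff)
      qed
      also have "\<dots> = (if (p, m) \<in> F N then cf v p m else 0)" using fin by simp
      finally show ?thesis .
    qed
    have l2: "(%N. if (p, m) \<in> F N then cf v p m else 0) \<longlonglongrightarrow> cf v p m"
    proof (cases "cf v p m = 0")
      case False
      then obtain N where N: "(p, m) \<in> F N" using cov by blast
      show ?thesis
        by (rule tendsto_eventually, rule eventually_sequentiallyI[of N]) (use N mono in auto)
    qed (simp cong: if_cong)
    show "cf v p m = cf h0 p m" by (rule LIMSEQ_unique[OF l2 l1[unfolded val]])
  qed
  then have "L2_norm bm (%x. v x - (\<Sum>i\<in>F N. g i x)) = L2_norm bm (%x. h0 x - (\<Sum>i\<in>F N. g i x))" for N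
    using ms by (intro L2_norm_cong_AE borel_measurable_diff) auto
  then show ?thesis using l0 by (simp add: g_def c_def)
qed

text \<open>The pair of frequencies \<open>(p, m)\<close> and \<open>(p, 2p - m)\<close> with \<open>m > 0 > 2p - m\<close>, odd, combined so as to
  be antisymmetric under scattering; here \<open>p = 2a - n\<close> and \<open>m = 2a + 1\<close> with \<open>0 \<le> a \<le> n\<close>.\<close>

definition pz :: "nat => nat => real \<times> real => complex" where
  "pz n a q = wv (2 * int a - int n) (2 * int a + 1) q
     - parity_sign (int n + 1) * wv (2 * int a - int n) (2 * int a - 2 * int n - 1) q"

lemma parity_sign_cong: "even x = even y ==> parity_sign x = parity_sign y"
  by (simp add: parity_sign_def)

lemma parity_sign_square: "parity_sign x * parity_sign x = 1"
  by (simp add: parity_sign_def)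

lemma pz_L2: "pz n a \<in> L2_bdry \<kappa>"
  unfolding pz_def[abs_def] by (intro L2_bdry_diff L2_bdry_cmult wv_L2)

lemma pz_scattering: "pz n a (S q) = - pz n a q"
proof -
  let ?p = "2 * int a - int n" and ?m = "2 * int a + 1" and ?k = "2 * int a - 2 * int n - 1"
  have s: "2 * ?p - ?m = ?k" "2 * ?p - ?k = ?m" by simp_all
  have e: "parity_sign (?p + ?m) = parity_sign (int n + 1)" "parity_sign (?p + ?k) = parity_sign (int n + 1)"
    by (rule parity_sign_cong, simp)+
  show ?thesis unfolding pz_def wv_scattering s e
    by (simp add: algebra_simps parity_sign_square flip: mult.assoc)
qed

definition supp_cf :: "(real \<times> real => complex) => bool" where
  "supp_cf v \<longleftrightarrow> (\<forall>p m. cf v p m ~= 0 \<longrightarrow> odd m \<and> sgn m ~= sgn (2 * p - m))"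

definition dco :: "(real \<times> real => complex) => nat => nat => complex" where
  "dco v n a = cf v (2 * int a - int n) (2 * int a + 1) / of_real (n0\<^sup>2)"

lemma anti_cf_pair:
  assumes "anti_cf v"
  shows "cf v (2 * int a - int n) (2 * int a - 2 * int n - 1)
    = - parity_sign (int n + 1) * cf v (2 * int a - int n) (2 * int a + 1)"
proof -
  let ?p = "2 * int a - int n" and ?m = "2 * int a + 1" and ?k = "2 * int a - 2 * int n - 1"
  have "parity_sign (?p + ?k) * cf v ?p (2 * ?p - ?k) = - cf v ?p ?k" using assms unfolding anti_cf_def by blast
  moreover have "2 * ?p - ?k = ?m" by simp
  moreover have "parity_sign (?p + ?k) = parity_sign (int n + 1)" by (rule parity_sign_cong) simp
  ultimately show ?thesis by simp
qed

text \<open>For m > 0 the equations m = 2a + 1 and p = 2a - n are solved for a and n; for m < 0 the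
  same is done with 2p - m in place of m. Opposite signs of m and 2p - m amount to 0 \<le> a \<le>
  n.\<close>

lemma supp_cf_cover:
  assumes "odd m" "sgn m ~= sgn (2 * p - m)"
  shows "\<exists>n a. a \<le> n \<and> p = 2 * int a - int n \<and> (m = 2 * int a + 1 \<or> m = 2 * int a - 2 * int n - 1)"
proof -
  obtain j where j: "m = 2 * j + 1" using assms(1) by (rule oddE)
  show ?thesis
  proof (cases "m > 0")
    case True
    then have "2 * p - m \<le> 0" using assms(2) by (auto simp: sgn_if split: if_splits)
    then have "p \<le> j" "0 \<le> j" using True j by auto
    then show ?thesis using j by (intro exI[of _ "nat (2 * j - p)"] exI[of _ "nat j"]) auto
  next
    case False
    then have "m < 0" using j by presburger
    then have "2 * p - m \<ge> 0" using assms(2) by (auto simp: sgn_if split: if_splits)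
    then have "p - j - 1 \<ge> 0" "- 1 - j \<ge> 0" using \<open>m < 0\<close> j by auto
    then show ?thesis using j by (intro exI[of _ "nat (p - j - 1 + (- 1 - j))"] exI[of _ "nat (p - j - 1)"]) auto
  qed
qed

text \<open>Each pair (n, a) accounts for two basis frequencies whose coefficients are tied together
  by antisymmetry; the maps e1 and e2 enumerate the two members of the pair, with disjoint images
  because one has m > 0 and the other m < 0.\<close>

lemma pz_series:
  assumes v: "v \<in> L2_bdry \<kappa>" and a: "anti_cf v" and s: "supp_cf v"
  shows "(%N. L2_norm bm (%q. v q - (\<Sum>n\<le>N. \<Sum>a\<le>n. dco v n a * pz n a q))) \<longlonglongrightarrow> 0"
proof -
  define T :: "nat => (nat \<times> nat) set" where "T N = (SIGMA n:{..N}. {..n})" for N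
  define e1 where "e1 i = (2 * int (snd i) - int (fst i), 2 * int (snd i) + 1)" for i :: "nat \<times> nat"
  define e2 where "e2 i = (2 * int (snd i) - int (fst i), 2 * int (snd i) - 2 * int (fst i) - 1)" for i :: "nat \<times> nat"
  define F where "F N = e1 ` T N \<union> e2 ` T N" for N
  have finT: "finite (T N)" for N by (simp add: T_def)
  have i1: "inj_on e1 (T N)" and i2: "inj_on e2 (T N)" for N
    by (auto simp: inj_on_def e1_def e2_def prod_eq_iff)
  have dj: "e1 ` T N \<inter> e2 ` T N = {}" for N
    by (auto simp: T_def e1_def e2_def)
  have "(%N. L2_norm bm (%q. v q - (\<Sum>i\<in>F N. cf v (fst i) (snd i) / of_real (n0\<^sup>2) * wv (fst i) (snd i) q))) \<longlonglongrightarrow> 0"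
  proof (rule wv_series[OF v])
    show "finite (F N)" for N using finT by (simp add: F_def)
    have "T N \<subseteq> T N'" if "N \<le> N'" for N N' using that by (auto simp: T_def)
    then show "F N \<subseteq> F N'" if "N \<le> N'" for N N' unfolding F_def using that by blast
    fix p m assume "cf v p m ~= 0"
    then have "odd m" "sgn m ~= sgn (2 * p - m)" using s by (auto simp: supp_cf_def)
    then obtain n a where na: "a \<le> n" "p = 2 * int a - int n" "m = 2 * int a + 1 \<or> m = 2 * int a - 2 * int n - 1"
      using supp_cf_cover by blast
    then have "(n, a) \<in> T n" "(p, m) = e1 (n, a) \<or> (p, m) = e2 (n, a)" by (auto simp: T_def e1_def e2_def)
    then show "\<exists>N. (p, m) \<in> F N" unfolding F_def by blast
  qed
  moreover have "(\<Sum>i\<in>F N. cf v (fst i) (snd i) / of_real (n0\<^sup>2) * wv (fst i) (snd i) q) = (\<Sum>n\<le>N. \<Sum>a\<le>n. dco v n a * pz n a q)" for N q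
  proof -
    let ?t = "%i. cf v (fst i) (snd i) / of_real (n0\<^sup>2) * wv (fst i) (snd i) q"
    have "sum ?t (F N) = sum ?t (e1 ` T N) + sum ?t (e2 ` T N)"
      unfolding F_def using finT dj by (intro sum.union_disjoint) auto
    also have "\<dots> = (\<Sum>i\<in>T N. ?t (e1 i) + ?t (e2 i))"
      unfolding sum.reindex[OF i1] sum.reindex[OF i2] sum.distrib by simp
    also have "\<dots> = (\<Sum>i\<in>T N. dco v (fst i) (snd i) * pz (fst i) (snd i) q)"
      unfolding e1_def e2_def fst_conv snd_conv anti_cf_pair[OF a] dco_def pz_def
      by (intro sum.cong refl) (simp add: add_divide_distrib diff_divide_distrib algebra_simps)
    also have "\<dots> = (\<Sum>n\<le>N. \<Sum>a\<le>n. dco v n a * pz n a q)"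
      unfolding T_def by (subst sum.Sigma) (auto simp: split_beta)
    finally show ?thesis .
  qed
  ultimately show ?thesis by simp
qed

text \<open>Both factors change sign under scattering, so their product is invariant and its
  integral over the inward half is one half of the full integral.\<close>

lemma L2_inner_im_pz:
  assumes w: "w \<in> L2_influx \<kappa>"
  shows "L2_inner im w (pz n a) = 1/2 * (cf (A_minus \<kappa> w) (2 * int a - int n) (2 * int a + 1)
     - parity_sign (int n + 1) * cf (A_minus \<kappa> w) (2 * int a - int n) (2 * int a - 2 * int n - 1))"
proof -
  have pw: "periodic_influx w" using w by (simp add: L2_influx_def)
  note A = A_minus_L2[OF w]
  let ?f = "%q. A_minus \<kappa> w q * cnj (pz n a q)"
  note [measurable] = L2_bdry_measurable[OF A] L2_bdry_measurable[OF pz_L2[of n a]]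
  have m: "?f \<in> borel_measurable borel" by measurable
  have "integral\<^sup>L bm ?f = 2 * integral\<^sup>L im ?f"
  proof (rule integral_bm_double[OF m])
    show "periodic_bdry ?f" using L2_bdry_periodic[OF A] L2_bdry_periodic[OF pz_L2[of n a]] by (simp add: periodic_bdry_def)
    show "integrable bm ?f" by (rule square_integrable_inner[OF L2_bdry_sq[OF A] L2_bdry_sq[OF pz_L2]])
    show "?f (S q) = ?f q" if "cos (snd q) ~= 0" for q using A_minus_anti[OF pw that] by (simp add: pz_scattering)
  qed
  moreover have "integral\<^sup>L im ?f = L2_inner im w (pz n a)"
    unfolding L2_inner_def by (intro Bochner_Integration.integral_cong refl) (simp add: A_minus_eq_im)
  moreover have "integral\<^sup>L bm ?f = cf (A_minus \<kappa> w) (2 * int a - int n) (2 * int a + 1)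
     - parity_sign (int n + 1) * cf (A_minus \<kappa> w) (2 * int a - int n) (2 * int a - 2 * int n - 1)"
    unfolding L2_inner_def[symmetric] pz_def[abs_def] cf_def
    by (subst L2_inner_diff_right[OF wv_sq square_integrable_cmult[OF wv_sq] L2_bdry_sq[OF A]])
       (simp add: L2_inner_cmult_right parity_sign_def)
  ultimately show ?thesis by simp
qed

end

section \<open>Ridge functions and Zernike polynomials\<close>

text \<open>Chebyshev polynomials U_n of the second kind.\<close>

fun chebU :: "nat => real poly" where
  "chebU 0 = 1"
| "chebU (Suc 0) = [:0, 2:]"
| "chebU (Suc (Suc n)) = [:0, 2:] * chebU (Suc n) - chebU n"

lemma chebU_cos_sin: "poly (chebU n) (cos a) * sin a = sin (real (n + 1) * a)"
proof (induction n rule: chebU.induct)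
  case 2
  then show ?case using sin_double[of a] by simp
next
  case (3 n)
  have e: "real (Suc (Suc n) + 1) * a = real (Suc n + 1) * a + a" "real (n + 1) * a = real (Suc n + 1) * a - a"
    by (simp_all add: algebra_simps)
  have "poly (chebU (Suc (Suc n))) (cos a) * sin a
      = 2 * cos a * (poly (chebU (Suc n)) (cos a) * sin a) - poly (chebU n) (cos a) * sin a"
    by (simp add: algebra_simps)
  also have "\<dots> = 2 * cos a * sin (real (Suc n + 1) * a) - sin (real (n + 1) * a)" unfolding 3 ..
  also have "\<dots> = sin (real (Suc (Suc n) + 1) * a)" unfolding e sin_add sin_diff by simp
  finally show ?case .
qed simp

text \<open>The quotient sin((n + 1) a) / sin a as a geometric sum, valid also where sin a = 0. Its
  exponentials separate the two angles when a is a difference of angles. The recurrence follows from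
  splitting off either the last or the first term.\<close>

lemma chebU_cis: "complex_of_real (poly (chebU n) (cos a)) = (\<Sum>l\<le>n. cis ((real n - 2 * real l) * a))"
proof (induction n rule: chebU.induct)
  case 2
  then show ?case by (simp add: complex_eq_iff)
next
  case (3 n)
  define E where "E m = (\<Sum>l\<le>m. cis ((real m - 2 * real l) * a))" for m
  have E1: "E (Suc m) = cis a * E m + cis (- (real (Suc m) * a))" for m
    unfolding E_def sum.atMost_Suc sum_distrib_left cis_mult
    by (simp add: algebra_simps)
  have E2: "E (Suc m) = cis (- a) * E m + cis (real (Suc m) * a)" for m
    unfolding E_def sum.atMost_Suc_shift sum_distrib_left cis_mult
    by (simp add: algebra_simps)
  have "E (Suc (Suc n)) = cis a * E (Suc n) + cis (- (real (Suc (Suc n)) * a))" by (rule E1)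
  also have "cis (- (real (Suc (Suc n)) * a)) = cis (- a) * cis (- (real (Suc n) * a))"
    unfolding cis_mult by (rule arg_cong[where f = cis]) (simp add: algebra_simps)
  also have "cis (- (real (Suc n) * a)) = E (Suc n) - cis a * E n" unfolding E1[of n] by simp
  also have "cis a * E (Suc n) + cis (- a) * (E (Suc n) - cis a * E n) = (cis a + cis (- a)) * E (Suc n) - cis (- a) * cis a * E n"
    by (simp add: algebra_simps)
  also have "cis a + cis (- a) = of_real (2 * cos a)" by (simp add: complex_eq_iff)
  also have "cis (- a) * cis a = 1" by (simp add: cis_mult)
  finally show ?case using 3 unfolding E_def[symmetric] by (simp add: mult_ac)
qed simp

text \<open>The antiderivative of \<open>U\<^sub>n\<close> is \<open>T\<^sub>n\<^sub>+\<^sub>1 / (n + 1)\<close>, and \<open>2 T\<^sub>n\<^sub>+\<^sub>1 = U\<^sub>n\<^sub>+\<^sub>1 - U\<^sub>n\<^sub>-\<^sub>1\<close>.\<close>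

definition chebT :: "nat => real poly" where
  "chebT n = smult (1/2) (chebU (Suc n) - (if n = 0 then 0 else chebU (n - 1)))"

text \<open>With m = n + 2 this is the rule T_m' = m U_{m-1} for 2 T_m = U_m - U_{m-2}. Strong
  induction along the recurrence keeps the argument inside the polynomial ring, without division by
  sines.\<close>

lemma pderiv_chebU: "pderiv (chebU (Suc (Suc n))) = pderiv (chebU n) + smult (2 * real (n + 2)) (chebU (Suc n))"
proof (induction n rule: less_induct)
  case (less n)
  have b: "pderiv [:0, 2:] = [:2::real:]" by (simp add: pderiv_pCons)
  have alg: "X * (A + smult c D) + [:2:] * G - (B + smult (c - 2) E)
      = (X * A + [:2:] * E - B) + smult c (X * D - E) + smult 2 G" for X A B D E G :: "real poly" and c
    by (simp add: smult_diff_left smult_diff_right smult_add_right algebra_simps)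
  consider "n = 0" | "n = 1" | m where "n = Suc (Suc m)" by (metis One_nat_def chebU.cases)
  then show ?case
  proof cases
    case 1 then show ?thesis by (simp add: pderiv_diff pderiv_mult b pderiv_pCons)
  next
    case 2 then show ?thesis by (simp add: pderiv_diff pderiv_mult b pderiv_pCons pderiv_smult one_pCons numeral_poly)
  next
    case (3 m)
    let ?x = "[:0, 2:] :: real poly"
    have i1: "pderiv (chebU (Suc (Suc (Suc m)))) = pderiv (chebU (Suc m)) + smult (2 * real (Suc m + 2)) (chebU (Suc (Suc m)))"
      using less.IH[of "Suc m"] 3 by simp
    have i0: "pderiv (chebU (Suc (Suc m))) = pderiv (chebU m) + smult (2 * real (m + 2)) (chebU (Suc m))"
      using less.IH[of m] 3 by simp
    have "pderiv (chebU (Suc (Suc n))) = ?x * pderiv (chebU (Suc n)) + [:2:] * chebU (Suc n) - pderiv (chebU n)"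
      by (simp only: chebU.simps(3) pderiv_diff pderiv_mult b add.commute mult.commute)
    also have "\<dots> = ?x * (pderiv (chebU (Suc m)) + smult (2 * real (Suc m + 2)) (chebU (Suc (Suc m)))) + [:2:] * chebU (Suc n)
        - (pderiv (chebU m) + smult (2 * real (m + 2)) (chebU (Suc m)))"
      unfolding 3 i1 i0 ..
    also have "\<dots> = (?x * pderiv (chebU (Suc m)) + [:2:] * chebU (Suc m) - pderiv (chebU m))
        + smult (2 * real (Suc m + 2)) (?x * chebU (Suc (Suc m)) - chebU (Suc m)) + smult 2 (chebU (Suc n))"
      using alg[of ?x "pderiv (chebU (Suc m))" "2 * real (Suc m + 2)" "chebU (Suc (Suc m))" "chebU (Suc n)" "pderiv (chebU m)" "chebU (Suc m)"]
      by simp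
    also have "?x * chebU (Suc (Suc m)) - chebU (Suc m) = chebU (Suc n)" unfolding 3 by simp
    also have "?x * pderiv (chebU (Suc m)) + [:2:] * chebU (Suc m) - pderiv (chebU m) = pderiv (chebU n)"
      unfolding 3 by (simp only: chebU.simps(3) pderiv_diff pderiv_mult b add.commute mult.commute)
    finally show ?thesis unfolding 3 by (simp add: algebra_simps flip: smult_add_left)
  qed
qed

lemma pderiv_chebT: "pderiv (chebT n) = smult (real (n + 1)) (chebU n)"
proof (cases n)
  case 0
  then show ?thesis by (simp add: chebT_def pderiv_smult pderiv_diff pderiv_mult pderiv_pCons)
next
  case (Suc m)
  show ?thesis unfolding chebT_def Suc
    by (simp only: pderiv_smult pderiv_diff pderiv_chebU nat.distinct if_False diff_Suc_1) (simp add: algebra_simps)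
qed

lemma poly_chebT: "poly (chebT n) (cos a) = cos (real (n + 1) * a)"
proof (cases n)
  case 0
  then show ?thesis by (simp add: chebT_def algebra_simps)
next
  case (Suc m)
  have "complex_of_real (poly (chebU (Suc (Suc m))) (cos a)) - of_real (poly (chebU m) (cos a))
      = cis (real (m + 2) * a) + cis (- (real (m + 2) * a))"
  proof -
    have "(\<Sum>l\<le>Suc (Suc m). cis ((real (Suc (Suc m)) - 2 * real l) * a))
        = cis (real (m + 2) * a) + ((\<Sum>l\<le>m. cis ((real m - 2 * real l) * a)) + cis (- (real (m + 2) * a)))"
      unfolding sum.atMost_Suc_shift[of _ "Suc m"] by (simp add: algebra_simps)
    then show ?thesis unfolding chebU_cis by simp
  qed
  also have "\<dots> = of_real (2 * cos (real (m + 2) * a))" by (simp add: complex_eq_iff)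
  finally have "poly (chebU (Suc (Suc m))) (cos a) - poly (chebU m) (cos a) = 2 * cos (real (m + 2) * a)"
    by (simp only: of_real_diff[symmetric] of_real_eq_iff)
  then show ?thesis unfolding Suc chebT_def by simp
qed

text \<open>Parity of U_n, as e is 1 or -1. It serves the degenerate case in which a ridge function
  is constant along the chord.\<close>

lemma chebU_sign:
  assumes "e * e = (1 :: real)"
  shows "poly (chebU n) (e * y) = e ^ n * poly (chebU n) y"
proof (induction n rule: chebU.induct)
  case (3 n)
  have "poly (chebU (Suc (Suc n))) (e * y) = e * e ^ n * e * (2 * y * poly (chebU (Suc n)) y) - 1 * e ^ n * poly (chebU n) y"
    using 3 by (simp add: algebra_simps)
  also have "\<dots> = e * e ^ n * e * (2 * y * poly (chebU (Suc n)) y) - (e * e) * e ^ n * poly (chebU n) y"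
    unfolding assms ..
  also have "\<dots> = e ^ Suc (Suc n) * poly (chebU (Suc (Suc n))) y" by (simp add: algebra_simps)
  finally show ?case .
qed simp_all

lemma chebU_one: "poly (chebU n) 1 = real (n + 1)"
  by (induction n rule: chebU.induct) simp_all

text \<open>Along the chord the argument of U_n moves affinely from cos(\<delta> + c) to
  cos(\<delta> - c), so the antiderivative T_{n+1} yields a difference of cosines and hence a
  product of sines. If sin \<delta> = 0 the argument does not move, and the integral is length times
  value.\<close>

lemma chebU_integral:
  assumes c: "0 \<le> sin c"
  shows "((%r. poly (chebU n) (cos (\<delta> + c) + r * sin \<delta>)) has_integral
     2 / real (n + 1) * sin (real (n + 1) * c) * poly (chebU n) (cos \<delta>)) {0..2 * sin c}"
proof (cases "sin \<delta> = 0")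
  case True
  define e where "e = cos \<delta>"
  have ee: "e * e = 1" using sin_cos_squared_add[of \<delta>] True by (simp add: e_def power2_eq_square)
  have u: "poly (chebU n) (cos \<delta>) = e ^ n * real (n + 1)"
    using chebU_sign[OF ee, of n 1] by (simp add: chebU_one e_def)
  have v: "poly (chebU n) (cos (\<delta> + c)) = e ^ n * poly (chebU n) (cos c)"
    unfolding cos_add True using chebU_sign[OF ee, of n "cos c"] by (simp add: e_def)
  have i: "((%r. poly (chebU n) (cos (\<delta> + c))) has_integral (2 * sin c - 0) *\<^sub>R poly (chebU n) (cos (\<delta> + c))) {0..2 * sin c}"
    using c by (intro has_integral_const_real[THEN has_integral_eq_rhs]) (simp add: content_real)
  have "(2 * sin c - 0) *\<^sub>R poly (chebU n) (cos (\<delta> + c)) = 2 * e ^ n * (poly (chebU n) (cos c) * sin c)"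
    unfolding v by simp
  also have "\<dots> = 2 / real (n + 1) * sin (real (n + 1) * c) * poly (chebU n) (cos \<delta>)"
    unfolding chebU_cos_sin u by simp
  finally show ?thesis using i unfolding True by simp
next
  case False
  let ?F = "%r. poly (chebT n) (cos (\<delta> + c) + r * sin \<delta>) / (real (n + 1) * sin \<delta>)"
  have "(?F has_vector_derivative poly (chebU n) (cos (\<delta> + c) + r * sin \<delta>)) (at r within {0..2 * sin c})" for r
  proof -
    have "((%r. poly (chebT n) (cos (\<delta> + c) + r * sin \<delta>)) has_real_derivative
       poly (pderiv (chebT n)) (cos (\<delta> + c) + r * sin \<delta>) * sin \<delta>) (at r)"
      by (rule DERIV_chain2[OF poly_DERIV]) (auto intro!: derivative_eq_intros)
    then have "(?F has_real_derivative poly (pderiv (chebT n)) (cos (\<delta> + c) + r * sin \<delta>) * sin \<delta> / (real (n + 1) * sin \<delta>)) (at r)"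
      by (rule DERIV_cdivide)
    then show ?thesis using False
      by (simp add: pderiv_chebT has_real_derivative_iff_has_vector_derivative[symmetric] has_field_derivative_at_within)
  qed
  then have i: "((%r. poly (chebU n) (cos (\<delta> + c) + r * sin \<delta>)) has_integral ?F (2 * sin c) - ?F 0) {0..2 * sin c}"
    using c by (intro fundamental_theorem_of_calculus) auto
  have e: "cos (\<delta> + c) + 2 * sin c * sin \<delta> = cos (\<delta> - c)" by (simp add: cos_add cos_diff)
  have "?F (2 * sin c) - ?F 0 = (cos (real (n + 1) * (\<delta> - c)) - cos (real (n + 1) * (\<delta> + c))) / (real (n + 1) * sin \<delta>)"
    unfolding e poly_chebT[symmetric] by (simp add: diff_divide_distrib)
  also have "cos (real (n + 1) * (\<delta> - c)) - cos (real (n + 1) * (\<delta> + c)) = 2 * sin (real (n + 1) * \<delta>) * sin (real (n + 1) * c)"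
    unfolding right_diff_distrib distrib_left cos_diff cos_add by simp
  also have "sin (real (n + 1) * \<delta>) = poly (chebU n) (cos \<delta>) * sin \<delta>" by (rule chebU_cos_sin[symmetric])
  finally show ?thesis using i False by (simp add: mult_ac)
qed

lemma chebU_cis': "complex_of_real (poly (chebU n) (cos a)) = (\<Sum>l\<le>n. cis ((2 * real l - real n) * a))"
proof -
  have "complex_of_real (poly (chebU n) (cos a)) = cnj (complex_of_real (poly (chebU n) (cos a)))" by simp
  also have "\<dots> = (\<Sum>l\<le>n. cnj (cis ((real n - 2 * real l) * a)))" unfolding chebU_cis by (rule cnj_sum)
  also have "\<dots> = (\<Sum>l\<le>n. cis ((2 * real l - real n) * a))"
    unfolding cis_cnj by (intro sum.cong refl arg_cong[where f = cis]) (simp add: algebra_simps)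
  finally show ?thesis .
qed

text \<open>Orthogonality of characters of the cyclic group of order n + 1. Both indices lie in
  {0..n}, so their difference is a multiple of n + 1 only if it is zero.\<close>

lemma sum_cis_roots:
  assumes "a \<le> n" "b \<le> n"
  shows "(\<Sum>j\<le>n. cis (2 * (real a - real b) * (pi * real j / real (n + 1)))) = (if a = b then of_nat (n + 1) else 0)"
proof (cases "a = b")
  case False
  let ?k = "int a - int b" and ?z = "cis (2 * (real a - real b) * (pi / real (n + 1)))"
  have s: "(\<Sum>j\<le>n. cis (2 * (real a - real b) * (pi * real j / real (n + 1)))) = (\<Sum>j\<le>n. ?z ^ j)"
    unfolding Complex.DeMoivre by (intro sum.cong refl arg_cong[where f = cis]) (simp add: field_simps)
  have "?z ^ (n + 1) = cis (2 * pi * of_int ?k)" unfolding Complex.DeMoivre by (rule arg_cong[where f = cis]) (simp add: field_simps)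
  also have "\<dots> = 1" by (rule cis_multiple_2pi) simp
  finally have 1: "?z ^ (n + 1) = 1" .
  have "?z ~= 1"
  proof
    assume "?z = 1"
    then have "cos (2 * (real a - real b) * (pi / real (n + 1))) = 1" by (simp add: complex_eq_iff)
    then obtain m :: int where "2 * (real a - real b) * (pi / real (n + 1)) = of_int m * 2 * pi"
      unfolding cos_one_2pi_int by blast
    then have "pi * (real a - real b) = pi * (of_int m * real (n + 1))" by (simp add: field_simps)
    then have "real a - real b = of_int m * real (n + 1)" by (simp only: mult_cancel_left pi_neq_zero simp_thms)
    then have "of_int ?k = (of_int (m * (int n + 1)) :: real)" by simp
    then have k: "?k = m * (int n + 1)" by (simp only: of_int_eq_iff)
    have "\<bar>?k\<bar> \<le> int n" "?k ~= 0" using assms False by auto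
    then have m: "m ~= 0" and h1: "\<bar>m\<bar> * (int n + 1) \<le> int n" using k by (auto simp: abs_mult)
    have h2: "1 * (int n + 1) \<le> \<bar>m\<bar> * (int n + 1)" using m by (intro mult_right_mono) auto
    from order_trans[OF h2 h1] show False by simp
  qed
  then have "(\<Sum>j\<le>n. ?z ^ j) = (?z ^ (n + 1) - 1) / (?z - 1)" using geometric_sum[of ?z "n + 1"] by (simp add: lessThan_Suc_atMost)
  then show ?thesis unfolding s 1 using False by simp
qed simp

definition ridge :: "nat => real => complex => complex" where
  "ridge n \<phi> x = of_real (poly (chebU n) (x \<bullet> cis \<phi>))"

lemma continuous_ridge: "continuous_on A (ridge n \<phi>)"
  unfolding ridge_def[abs_def] by (intro continuous_intros)

context curved_disk
begin

lemma chord_integrable: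
  fixes F :: "complex => complex"
  assumes F: "continuous_on (cball 0 1) F" and a: "\<bar>\<alpha>\<bar> \<le> pi/2"
  shows "(%r. F (chord \<beta> (sct \<alpha>) r)) integrable_on {0..2 * cos (sct \<alpha>)}"
  by (intro integrable_continuous_real continuous_on_compose2[OF F continuous_chord])
     (auto simp: norm_chord)

lemma chord_integral_sum:
  fixes F :: "'i => complex => complex"
  assumes fin: "finite I" and F: "!!i. i \<in> I ==> continuous_on (cball 0 1) (F i)" and a: "\<bar>snd p\<bar> \<le> pi/2"
  shows "chord_integral (%x. \<Sum>i\<in>I. c i * F i x) p = (\<Sum>i\<in>I. c i * chord_integral (F i) p)"
proof -
  have "integral {0..2 * cos (sct (snd p))} (%r. \<Sum>i\<in>I. c i * F i (chord (fst p) (sct (snd p)) r))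
      = (\<Sum>i\<in>I. c i * integral {0..2 * cos (sct (snd p))} (%r. F i (chord (fst p) (sct (snd p)) r)))"
  proof (subst integral_sum[OF fin])
    fix i assume "i \<in> I"
    show "(%r. c i * F i (chord (fst p) (sct (snd p)) r)) integrable_on {0..2 * cos (sct (snd p))}"
      by (rule integrable_on_mult_right, rule chord_integrable[OF F[OF \<open>i \<in> I\<close>] a])
  qed (simp only: integral_mult_right)
  then show ?thesis unfolding chord_integral_def mult_scaleR_right scaleR_sum_right[symmetric] by (rule arg_cong)
qed

text \<open>Chords have length at most 2, and \<rho> \<ge> 1 - \<bar>\<kappa>\<bar> bounds the
  weight; the transform is therefore continuous for uniform norms.\<close>

lemma chord_integral_close:
  assumes F: "continuous_on (cball 0 1) F" and G: "continuous_on (cball 0 1) G" and a: "\<bar>snd p\<bar> \<le> pi/2"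
    and e: "!!x. x \<in> cball 0 1 ==> norm (F x - G x) \<le> e"
  shows "norm (chord_integral F p - chord_integral G p) \<le> (1 - \<kappa>\<^sup>2) / (1 - \<bar>\<kappa>\<bar>) * (2 * e)"
proof -
  let ?s = "sct (snd p)" and ?\<beta> = "fst p"
  have e0: "0 \<le> e" using order_trans[OF norm_ge_zero e[of 0]] by simp
  have k: "0 \<le> 1 - \<kappa>\<^sup>2" using abs_square_le_1[of \<kappa>] kappa_abs by simp
  have k1: "0 < 1 - \<bar>\<kappa>\<bar>" using kappa_abs by simp
  have eq: "chord_integral F p - chord_integral G p
      = ((1 - \<kappa>\<^sup>2) / rho (snd p)) *\<^sub>R integral {0..2 * cos ?s} (%r. F (chord ?\<beta> ?s r) - G (chord ?\<beta> ?s r))"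
    unfolding chord_integral_def scaleR_diff_right[symmetric]
    by (subst Henstock_Kurzweil_Integration.integral_diff[OF chord_integrable[OF F a] chord_integrable[OF G a]]) (rule refl)
  have n1: "norm (integral {0..2 * cos ?s} (%r. F (chord ?\<beta> ?s r) - G (chord ?\<beta> ?s r))) \<le> e * (2 * cos ?s - 0)"
  proof (rule integral_bound)
    show "0 \<le> 2 * cos ?s" using cos_scat_nonneg[OF a] by simp
    show "continuous_on {0..2 * cos ?s} (%r. F (chord ?\<beta> ?s r) - G (chord ?\<beta> ?s r))"
      by (intro continuous_on_diff continuous_on_compose2[OF F continuous_chord] continuous_on_compose2[OF G continuous_chord])
         (auto simp: norm_chord)
    show "norm (F (chord ?\<beta> ?s r) - G (chord ?\<beta> ?s r)) \<le> e" if "r \<in> {0..2 * cos ?s}" for r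
      using that by (intro e) (auto simp: norm_chord)
  qed
  have n2: "e * (2 * cos ?s - 0) \<le> 2 * e" using e0 cos_le_one[of ?s] by (simp add: mult_left_le)
  have n3: "(1 - \<kappa>\<^sup>2) / rho (snd p) \<le> (1 - \<kappa>\<^sup>2) / (1 - \<bar>\<kappa>\<bar>)"
    using k k1 rho_lower[of "snd p"] by (intro divide_left_mono mult_pos_pos rho_pos) auto
  have "0 \<le> (1 - \<kappa>\<^sup>2) / rho (snd p)" using k rho_pos[of "snd p"] by simp
  then have "norm (chord_integral F p - chord_integral G p) = (1 - \<kappa>\<^sup>2) / rho (snd p)
      * norm (integral {0..2 * cos ?s} (%r. F (chord ?\<beta> ?s r) - G (chord ?\<beta> ?s r)))"
    unfolding eq norm_scaleR by (simp only: abs_of_nonneg)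
  also have "\<dots> \<le> (1 - \<kappa>\<^sup>2) / (1 - \<bar>\<kappa>\<bar>) * (2 * e)"
    by (rule mult_mono[OF n3 order_trans[OF n1 n2]]) (use k k1 in simp_all)
  finally show ?thesis .
qed

text \<open>With \<theta> = \<beta> + s - \<pi>/2 and c = \<pi>/2 - s the midpoint of the chord is
  cos(c) e^{i\<theta>}. In these normal coordinates the two frequencies share one exponential in
  \<theta> and combine to a sine in c, the same separated form as the integral of a ridge
  function.\<close>

lemma pz_eq:
  "pz n a (\<beta>, \<alpha>) = of_real (2 / rho \<alpha>) * (-1) ^ a * of_real (sin (real (n + 1) * (pi/2 - sct \<alpha>)))
     * cis ((2 * real a - real n) * (\<beta> + sct \<alpha> - pi/2))"
proof -
  define c \<theta> where "c = pi/2 - sct \<alpha>" and "\<theta> = \<beta> + sct \<alpha> - pi/2"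
  let ?P = "2 * real a - real n" and ?N = "real (n + 1)"
  have s: "sct \<alpha> = pi/2 - c" "\<beta> = \<theta> + c" by (simp_all add: c_def \<theta>_def)
  have 1: "cis (of_int (2 * int a - int n) * \<beta>) * cis (of_int (2 * int a + 1) * sct \<alpha>)
      = cis (real a * pi) * cis (?P * \<theta>) * (\<i> * cis (- (?N * c)))"
  proof -
    have "\<i> = cis (pi/2)" by simp
    show ?thesis unfolding \<open>\<i> = cis (pi/2)\<close> cis_mult s by (rule arg_cong[where f = cis]) (simp add: field_simps)
  qed
  have 2: "parity_sign (int n + 1) * (cis (of_int (2 * int a - int n) * \<beta>) * cis (of_int (2 * int a - 2 * int n - 1) * sct \<alpha>))
      = cis (real a * pi) * cis (?P * \<theta>) * (\<i> * cis (?N * c))"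
  proof -
    have "\<i> = cis (pi/2)" by simp
    have "cis (of_int (int n + 1) * pi) * (cis (of_int (2 * int a - int n) * \<beta>) * cis (of_int (2 * int a - 2 * int n - 1) * sct \<alpha>))
      = cis (real a * pi) * cis (?P * \<theta>) * (cis (pi/2) * cis (?N * c))"
      unfolding cis_mult s by (rule arg_cong[where f = cis]) (simp add: field_simps)
    then show ?thesis unfolding cis_int_pi \<open>\<i> = cis (pi/2)\<close> .
  qed
  have 3: "cis (real a * pi) = (-1) ^ a" by (simp add: Complex.DeMoivre[symmetric])
  have 4: "\<i> * cis (- (?N * c)) - \<i> * cis (?N * c) = of_real (2 * sin (?N * c))" by (simp add: complex_eq_iff)
  have "pz n a (\<beta>, \<alpha>) = of_real (1 / rho \<alpha>) * (cis (of_int (2 * int a - int n) * \<beta>) * cis (of_int (2 * int a + 1) * sct \<alpha>)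
     - parity_sign (int n + 1) * (cis (of_int (2 * int a - int n) * \<beta>) * cis (of_int (2 * int a - 2 * int n - 1) * sct \<alpha>)))"
    unfolding pz_def wv_def fst_conv snd_conv by (simp only: right_diff_distrib mult.left_commute)
  also have "\<dots> = of_real (1 / rho \<alpha>) * ((-1) ^ a * cis (?P * \<theta>) * (\<i> * cis (- (?N * c)) - \<i> * cis (?N * c)))"
    unfolding 1 2 3 by (simp only: right_diff_distrib)
  also have "\<dots> = of_real (2 / rho \<alpha>) * (-1) ^ a * of_real (sin (?N * c)) * cis (?P * \<theta>)"
    unfolding 4 by (simp add: mult_ac)
  finally show ?thesis unfolding c_def \<theta>_def .
qed

text \<open>The chord integral contains U_n at cos(\<theta> - \<phi>), and the exponential form of
  U_n splits it into products of a function of \<phi> and a function of \<theta>, one for each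
  a.\<close>

lemma chord_integral_ridge:
  assumes a: "\<bar>snd p\<bar> \<le> pi/2"
  shows "chord_integral (ridge n \<phi>) p
    = (\<Sum>a\<le>n. of_real ((1 - \<kappa>\<^sup>2) / real (n + 1)) * (-1) ^ a * cis (- ((2 * real a - real n) * \<phi>)) * pz n a p)"
proof -
  obtain \<beta> \<alpha> where p: "p = (\<beta>, \<alpha>)" by (cases p)
  define c \<theta> where "c = pi/2 - sct \<alpha>" and "\<theta> = \<beta> + sct \<alpha> - pi/2"
  have sc: "sin c = cos (sct \<alpha>)" by (simp add: c_def sin_diff)
  have dot: "chord \<beta> (sct \<alpha>) r \<bullet> cis \<phi> = cos (\<theta> - \<phi> + c) + r * sin (\<theta> - \<phi>)" for r
  proof -
    have e: "\<beta> - \<phi> = \<theta> - \<phi> + c" "\<beta> + sct \<alpha> - \<phi> = \<theta> - \<phi> + pi/2" by (simp_all add: c_def \<theta>_def)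
    show ?thesis unfolding chord_def inner_diff_left inner_scaleR_left inner_cis e
      by (simp add: cos_add[of _ "pi/2"])
  qed
  have "0 \<le> sin c" unfolding sc using a cos_scat_nonneg[of \<alpha>] by (simp add: p)
  from has_integral_linear[OF chebU_integral[OF this, of n "\<theta> - \<phi>"] bounded_linear_of_real[where 'a = complex]]
  have "((%r. ridge n \<phi> (chord \<beta> (sct \<alpha>) r)) has_integral
      of_real (2 / real (n + 1) * sin (real (n + 1) * c) * poly (chebU n) (cos (\<theta> - \<phi>)))) {0..2 * cos (sct \<alpha>)}"
    unfolding o_def ridge_def dot sc .
  then have "chord_integral (ridge n \<phi>) p = ((1 - \<kappa>\<^sup>2) / rho \<alpha>) *\<^sub>R
      (of_real (2 / real (n + 1) * sin (real (n + 1) * c)) * of_real (poly (chebU n) (cos (\<theta> - \<phi>))))"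
    unfolding chord_integral_def p fst_conv snd_conv by (simp add: integral_unique)
  also have "\<dots> = (\<Sum>a\<le>n. ((1 - \<kappa>\<^sup>2) / rho \<alpha>) *\<^sub>R
      (of_real (2 / real (n + 1) * sin (real (n + 1) * c)) * cis ((2 * real a - real n) * (\<theta> - \<phi>))))"
    unfolding chebU_cis' by (simp only: sum_distrib_left scaleR_sum_right)
  also have "\<dots> = (\<Sum>a\<le>n. of_real ((1 - \<kappa>\<^sup>2) / real (n + 1)) * (-1) ^ a * cis (- ((2 * real a - real n) * \<phi>)) * pz n a p)"
  proof (rule sum.cong[OF refl])
    fix a
    have 1: "cis ((2 * real a - real n) * (\<theta> - \<phi>)) = cis (- ((2 * real a - real n) * \<phi>)) * cis ((2 * real a - real n) * \<theta>)"
      unfolding cis_mult by (rule arg_cong[where f = cis]) (simp add: algebra_simps)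
    have 2: "(-1) ^ a * (-1) ^ a = (1 :: complex)" by (simp add: power_mult_distrib[symmetric])
    have "of_real ((1 - \<kappa>\<^sup>2) / real (n + 1)) * (-1) ^ a * cis (- ((2 * real a - real n) * \<phi>)) * pz n a p
      = ((-1) ^ a * (-1) ^ a) * (of_real ((1 - \<kappa>\<^sup>2) / real (n + 1)) * of_real (2 / rho \<alpha>) * of_real (sin (real (n + 1) * c)))
        * (cis (- ((2 * real a - real n) * \<phi>)) * cis ((2 * real a - real n) * \<theta>))"
      unfolding p pz_eq c_def \<theta>_def by (simp only: mult_ac)
    also have "\<dots> = (of_real ((1 - \<kappa>\<^sup>2) / rho \<alpha>) * of_real (2 / real (n + 1) * sin (real (n + 1) * c)))
        * (cis (- ((2 * real a - real n) * \<phi>)) * cis ((2 * real a - real n) * \<theta>))"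
      unfolding 2 of_real_mult[symmetric] mult_1_left by (simp only: times_divide_times_eq times_divide_eq_left times_divide_eq_right mult_ac)
    finally show "((1 - \<kappa>\<^sup>2) / rho \<alpha>) *\<^sub>R (of_real (2 / real (n + 1) * sin (real (n + 1) * c)) * cis ((2 * real a - real n) * (\<theta> - \<phi>)))
      = of_real ((1 - \<kappa>\<^sup>2) / real (n + 1)) * (-1) ^ a * cis (- ((2 * real a - real n) * \<phi>)) * pz n a p"
      unfolding 1 scaleR_conv_of_real by (simp only: mult_ac)
  qed
  finally show ?thesis .
qed

text \<open>The Zernike polynomials of the disk, as averages of ridge functions.\<close>

definition zern :: "nat => nat => complex => complex" where
  "zern n a x = (\<Sum>j\<le>n. of_real (1 / real (n + 1)) * cis ((2 * real a - real n) * (pi * real j / real (n + 1)))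
      * ridge n (pi * real j / real (n + 1)) x)"

text \<open>A discrete Fourier transform in the ridge direction isolates a single a. The frequencies
  2a - n all have the parity of n, so their differences are even and n + 1 directions equally spaced
  in a half circle suffice.\<close>

lemma chord_integral_zern:
  assumes p: "\<bar>snd p\<bar> \<le> pi/2" and a: "a \<le> n"
  shows "chord_integral (zern n a) p = of_real ((1 - \<kappa>\<^sup>2) / real (n + 1)) * (-1) ^ a * pz n a p"
proof -
  let ?f = "%j. pi * real j / real (n + 1)" and ?K = "of_real ((1 - \<kappa>\<^sup>2) / real (n + 1)) :: complex"
  have "chord_integral (zern n a) p = (\<Sum>j\<le>n. of_real (1 / real (n + 1)) * cis ((2 * real a - real n) * ?f j) * chord_integral (ridge n (?f j)) p)"
    unfolding zern_def[abs_def] by (rule chord_integral_sum[OF _ continuous_ridge p]) simp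
  also have "\<dots> = (\<Sum>j\<le>n. \<Sum>b\<le>n. of_real (1 / real (n + 1)) * ?K * (-1) ^ b * pz n b p * cis (2 * (real a - real b) * ?f j))"
    unfolding chord_integral_ridge[OF p] sum_distrib_left
  proof (intro sum.cong refl)
    fix j b
    have e: "cis (2 * (real a - real b) * t) = cis ((2 * real a - real n) * t) * cis (- ((2 * real b - real n) * t))" for t
      unfolding cis_mult by (rule arg_cong[where f = cis]) (simp add: algebra_simps)
    show "of_real (1 / real (n + 1)) * cis ((2 * real a - real n) * ?f j) * (?K * (-1) ^ b * cis (- ((2 * real b - real n) * ?f j)) * pz n b p)
      = of_real (1 / real (n + 1)) * ?K * (-1) ^ b * pz n b p * cis (2 * (real a - real b) * ?f j)"
      unfolding e by (simp only: mult_ac)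
  qed
  also have "\<dots> = (\<Sum>b\<le>n. of_real (1 / real (n + 1)) * ?K * (-1) ^ b * pz n b p * (\<Sum>j\<le>n. cis (2 * (real a - real b) * ?f j)))"
    by (subst sum.swap) (simp only: sum_distrib_left)
  also have "\<dots> = (\<Sum>b\<le>n. if a = b then of_real (1 / real (n + 1)) * ?K * (-1) ^ b * pz n b p * of_nat (n + 1) else 0)"
  proof (intro sum.cong refl)
    fix b assume "b \<in> {..n}"
    then have "b \<le> n" by simp
    show "of_real (1 / real (n + 1)) * ?K * (-1) ^ b * pz n b p * (\<Sum>j\<le>n. cis (2 * (real a - real b) * ?f j))
      = (if a = b then of_real (1 / real (n + 1)) * ?K * (-1) ^ b * pz n b p * of_nat (n + 1) else 0)"
      unfolding sum_cis_roots[OF a \<open>b \<le> n\<close>] by (cases "a = b") (simp_all only: if_True if_False simp_thms mult_zero_right)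
  qed
  also have "\<dots> = of_real (1 / real (n + 1)) * ?K * (-1) ^ a * pz n a p * of_nat (n + 1)"
    using a by (simp only: sum.delta' finite_atMost atMost_iff if_True)
  also have "\<dots> = (of_real (1 / real (n + 1)) * of_nat (n + 1)) * (?K * (-1) ^ a * pz n a p)" by (simp only: mult_ac)
  also have "of_real (1 / real (n + 1)) * of_nat (n + 1) = (1 :: complex)"
    using of_nat_neq_0[of n, where 'a = complex] by (simp add: field_simps)
  finally show ?thesis by (simp only: mult_1_left)
qed

end

section \<open>Orthogonality to the range\<close>

inductive chebspan :: "real poly => bool" where
  zero: "chebspan 0"
| step: "chebspan q ==> chebspan (q + smult c (chebU n))"

lemma chebspan_add: "chebspan r ==> chebspan q ==> chebspan (q + r)"
proof (induction r rule: chebspan.induct)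
  case (step r c n)
  then show ?case using chebspan.step[of "q + r" c n] by (simp add: add.assoc)
qed simp

lemma chebspan_chebU: "chebspan (smult c (chebU n))"
  using chebspan.step[OF chebspan.zero, of c n] by simp

text \<open>The recurrence read as multiplication by x: twice x U_n is U_{n+1} + U_{n-1}, and only
  U_1 for n = 0.\<close>

lemma chebspan_shift: "chebspan q ==> chebspan (pCons 0 q)"
proof (induction q rule: chebspan.induct)
  case (step q c n)
  have "chebspan (pCons 0 (smult c (chebU n)))"
  proof (cases n)
    case 0
    then have "pCons 0 (smult c (chebU n)) = smult (c / 2) (chebU 1)" by (simp add: one_pCons)
    then show ?thesis by (simp only: chebspan_chebU)
  next
    case (Suc m)
    have "pCons 0 (smult c (chebU n)) = smult (c / 2) (chebU (Suc (Suc m))) + smult (c / 2) (chebU m)"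
      by (simp add: Suc smult_diff_right)
    then show ?thesis by (simp only: chebspan_chebU chebspan_add)
  qed
  then show ?case using chebspan_add[of "pCons 0 (smult c (chebU n))" "pCons 0 q"] step.IH by simp
qed (simp add: chebspan.zero)

lemma chebspan_all: "chebspan q"
proof (induction q)
  case (pCons a q)
  have "pCons a q = pCons 0 q + smult a (chebU 0)" by simp
  then show ?case using chebspan.step[OF chebspan_shift[OF pCons.IH], of a 0] by (simp only:)
qed (rule chebspan.zero)

text \<open>Real exponentials bridge two requirements: each is a ridge function, being a function of
  one linear coordinate, and their sums are closed under products, as Stone-Weierstrass demands.
  Ridge functions by themselves lack the second property.\<close>

inductive expsum :: "(complex => real) => bool" where
  base: "expsum (%x. c * exp (x \<bullet> \<xi>))"
| add: "expsum f ==> expsum g ==> expsum (%x. f x + g x)"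

lemma expsum_mult_exp: "expsum g ==> expsum (%x. (c * exp (x \<bullet> \<xi>)) * g x)"
proof (induction g rule: expsum.induct)
  case (base d \<eta>)
  have "(%x. (c * exp (x \<bullet> \<xi>)) * (d * exp (x \<bullet> \<eta>))) = (%x. (c * d) * exp (x \<bullet> (\<xi> + \<eta>)))"
    by (simp add: inner_add_right exp_add mult_ac)
  then show ?case by (simp only: expsum.base)
next
  case (add f g)
  then show ?case using expsum.add[OF add.IH] by (simp only: distrib_left)
qed

lemma expsum_mult: "expsum f ==> expsum g ==> expsum (%x. f x * g x)"
proof (induction f rule: expsum.induct)
  case (base c \<xi>) then show ?case by (rule expsum_mult_exp)
next
  case (add f h)
  then show ?case using expsum.add[of "%x. f x * g x" "%x. h x * g x"] by (simp add: distrib_right)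
qed

lemma expsum_continuous: "expsum f ==> continuous_on A f"
  by (induction f rule: expsum.induct) (intro continuous_intros | assumption)+

lemma expsum_approx:
  fixes f :: "complex => real"
  assumes "continuous_on (cball 0 1) f" "0 < e"
  shows "\<exists>g. expsum g \<and> (\<forall>x\<in>cball 0 1. \<bar>f x - g x\<bar> < e)"
proof (rule Stone_Weierstrass_HOL[OF compact_cball _ _ _ _ _ assms])
  show "expsum (%x. c)" for c using expsum.base[of c 0] by simp
  show "\<exists>f. expsum f \<and> f x ~= f y" if "x \<in> cball 0 1 \<and> y \<in> cball 0 1 \<and> x ~= y" for x y
  \<comment> \<open>The direction x - y separates x from y, because the two exponents differ by |x -
    y|^2.\<close>
  proof (intro exI[of _ "%z. 1 * exp (z \<bullet> (x - y))"] conjI expsum.base)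
    have "(x - y) \<bullet> (x - y) ~= 0" using that by simp
    then show "1 * exp (x \<bullet> (x - y)) ~= 1 * exp (y \<bullet> (x - y))" by (simp add: inner_diff_left)
  qed
qed (auto intro: expsum.add expsum_mult expsum_continuous)

context curved_disk
begin

lemma influx_L2:
  assumes c: "continuous_on influx_strip (g :: real \<times> real => complex)" and p: "periodic_influx g"
  shows "g \<in> L2_influx \<kappa>"
proof -
  let ?D = "{0..2*pi} \<times> {- (pi/2)..pi/2}"
  have c': "continuous_on ?D g" by (rule continuous_on_subset[OF c]) (auto simp: influx_strip_def)
  have "g \<in> borel_measurable (restrict_space borel ?D)" by (rule borel_measurable_continuous_on_restrict[OF c'])
  also have "borel_measurable (restrict_space borel ?D) = borel_measurable im"
    by (rule measurable_cong_sets) (simp_all add: influx_measure_def sets_restrict_space)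
  finally have m: "g \<in> borel_measurable im" .
  have "bounded (g ` ?D)" by (intro compact_imp_bounded compact_continuous_image c' compact_Times compact_Icc)
  then obtain B where B: "!!x. x \<in> ?D ==> norm (g x) \<le> B" unfolding bounded_iff by blast
  have "square_integrable im g" by (rule square_integrable_bounded[OF finite_im m, of B]) (use B in \<open>simp only: space_im\<close>)
  then show ?thesis using p by (simp add: L2_influx_def)
qed

lemma chord_integral_periodic: "periodic_influx (chord_integral F)"
proof -
  have "cis (\<beta> + 2 * pi) = cis \<beta>" "cis (\<beta> + 2 * pi + s) = cis (\<beta> + s)" for \<beta> s
    by (simp_all add: cis_mult[symmetric] del: cis_mult)
  then show ?thesis by (simp add: periodic_influx_def chord_integral_def chord_def)
qed

lemma chord_integral_L2: "continuous_on (cball 0 1) F ==> chord_integral F \<in> L2_influx \<kappa>"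
  by (intro influx_L2 continuous_chord_integral chord_integral_periodic)

lemma chord_integral_sq: "continuous_on (cball 0 1) F ==> square_integrable im (chord_integral F)"
  using chord_integral_L2 by (simp add: L2_influx_def)

definition orth :: "(real \<times> real => complex) => (complex => complex) => bool" where
  "orth d F \<longleftrightarrow> continuous_on (cball 0 1) F \<and> L2_inner im d (chord_integral F) = 0"

lemma L2_inner_cong_space: "(!!x. x \<in> space M ==> w x = w' x) ==> L2_inner M d w = L2_inner M d w'"
  unfolding L2_inner_def by (intro Bochner_Integration.integral_cong) auto

lemma chord_integral_lin:
  assumes F: "continuous_on (cball 0 1) F" and G: "continuous_on (cball 0 1) G" and p: "\<bar>snd p\<bar> \<le> pi/2"
  shows "chord_integral (%x. a * F x + b * G x) p = a * chord_integral F p + b * chord_integral G p"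
  using chord_integral_sum[of "UNIV :: bool set" "%t. if t then F else G" p "%t. if t then a else b"] F G p
  by (simp add: UNIV_bool add.commute)

lemma orth_lin:
  assumes d: "square_integrable im d" and F: "orth d F" and G: "orth d G"
  shows "orth d (%x. a * F x + b * G x)"
proof -
  have c: "continuous_on (cball 0 1) F" "continuous_on (cball 0 1) G" using F G by (simp_all add: orth_def)
  note s = chord_integral_sq[OF c(1)] chord_integral_sq[OF c(2)]
  have "L2_inner im d (chord_integral (%x. a * F x + b * G x)) = L2_inner im d (%p. a * chord_integral F p - (- b) * chord_integral G p)"
    by (rule L2_inner_cong_space) (simp add: chord_integral_lin[OF c space_im_inner])
  also have "\<dots> = 0"
    unfolding L2_inner_diff_right[OF square_integrable_cmult[OF s(1)] square_integrable_cmult[OF s(2)] d] L2_inner_cmult_right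
    using F G by (simp add: orth_def)
  finally show ?thesis using c by (simp add: orth_def continuous_on_add continuous_on_mult_left)
qed

lemma orth_limit:
  assumes d: "square_integrable im d" and F: "continuous_on (cball 0 1) F"
    and ap: "!!e. 0 < e ==> \<exists>G. orth d G \<and> (\<forall>x\<in>cball 0 1. norm (F x - G x) \<le> e)"
  shows "orth d F"
proof -
  define K where "K = (1 - \<kappa>\<^sup>2) / (1 - \<bar>\<kappa>\<bar>) * 2"
  have K: "0 \<le> K" using kappa_abs abs_square_le_1[of \<kappa>] by (simp add: K_def)
  define L where "L = L2_norm im d * (K * sqrt (measure im (space im)))"
  have L0: "0 \<le> L" using K by (simp add: L_def L2_norm_nonneg)
  have bd: "norm (L2_inner im d (chord_integral F)) \<le> L * e" if e: "0 < e" for e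
  proof -
    from ap[OF e] obtain G where G: "orth d G" and FG: "!!x. x \<in> cball 0 1 ==> norm (F x - G x) \<le> e" by (elim exE conjE bspec) blast
    have cG: "continuous_on (cball 0 1) G" using G by (simp add: orth_def)
    note s = chord_integral_sq[OF F] chord_integral_sq[OF cG]
    have "L2_inner im d (%p. chord_integral F p - chord_integral G p) = L2_inner im d (chord_integral F)"
      using G by (simp add: L2_inner_diff_right[OF s d] orth_def)
    moreover have "norm (L2_inner im d (%p. chord_integral F p - chord_integral G p))
        \<le> L2_norm im d * L2_norm im (%p. chord_integral F p - chord_integral G p)"
      by (rule L2_cauchy_schwarz[OF d square_integrable_diff[OF s]])
    moreover have "L2_norm im (%p. chord_integral F p - chord_integral G p) \<le> (K * e) * sqrt (measure im (space im))"
    proof (rule L2_norm_bounded[OF finite_im])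
      show "norm (chord_integral F p - chord_integral G p) \<le> K * e" if "p \<in> space im" for p
        using chord_integral_close[OF F cG space_im_inner[OF that] FG] by (simp only: K_def mult.assoc)
      show "0 \<le> K * e" using K e by simp
    qed (rule square_integrable_measurable[OF square_integrable_diff[OF s]])
    then have "L2_norm im d * L2_norm im (%p. chord_integral F p - chord_integral G p) \<le> L2_norm im d * ((K * e) * sqrt (measure im (space im)))"
      by (rule mult_left_mono) (rule L2_norm_nonneg)
    ultimately show ?thesis by (simp add: L_def mult_ac)
  qed
  have "norm (L2_inner im d (chord_integral F)) \<le> 0"
  proof (rule field_le_epsilon)
    fix e :: real assume e: "0 < e"
    have "norm (L2_inner im d (chord_integral F)) \<le> L * (e / (L + 1))" using e L0 by (intro bd) simp
    also have "\<dots> \<le> e" using e L0 by (simp add: field_simps)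
    finally show "norm (L2_inner im d (chord_integral F)) \<le> 0 + e" by simp
  qed
  then show ?thesis using F by (simp add: orth_def)
qed

text \<open>The chord integral of a ridge function is a finite combination of the
  \<open>pz n a\<close> with a \<le> n, and pairing d with these sees only frequencies at which the
  coefficients of its extension vanish.\<close>

lemma orth_ridge:
  assumes d: "d \<in> L2_influx \<kappa>" and z: "!!p m. odd m ==> sgn m ~= sgn (2 * p - m) ==> cf (A_minus \<kappa> d) p m = 0"
  shows "orth d (ridge n \<phi>)"
proof -
  have sd: "square_integrable im d" using d by (simp add: L2_influx_def)
  have pz0: "L2_inner im d (pz n a) = 0" if a: "a \<le> n" for a
  proof -
    have "cf (A_minus \<kappa> d) (2 * int a - int n) (2 * int a + 1) = 0" by (rule z) (use a in \<open>auto simp: sgn_if\<close>)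
    moreover have "cf (A_minus \<kappa> d) (2 * int a - int n) (2 * int a - 2 * int n - 1) = 0" by (rule z) (use a in \<open>auto simp: sgn_if\<close>)
    ultimately show ?thesis unfolding L2_inner_im_pz[OF d] by simp
  qed
  have sp: "square_integrable im (pz n a)" for a by (rule im_norm_le(1)[OF pz_L2])
  define c where "c a = of_real ((1 - \<kappa>\<^sup>2) / real (n + 1)) * (-1) ^ a * cis (- ((2 * real a - real n) * \<phi>))" for a
  have "L2_inner im d (chord_integral (ridge n \<phi>)) = L2_inner im d (%p. \<Sum>a\<le>n. c a * pz n a p)"
    unfolding c_def by (rule L2_inner_cong_space) (rule chord_integral_ridge[OF space_im_inner])
  also have "\<dots> = (\<Sum>a\<le>n. L2_inner im d (%p. c a * pz n a p))"
    by (rule L2_inner_sum_right[OF square_integrable_cmult[OF sp] sd])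
  also have "\<dots> = 0" unfolding L2_inner_cmult_right using pz0 by simp
  finally show ?thesis by (simp add: orth_def continuous_ridge)
qed

text \<open>Orthogonality is carried from Chebyshev ridges to polynomial ridges by linearity, to
  exponentials by one-variable approximation, to continuous real functions by Stone-Weierstrass, and
  to complex ones by linearity again. Each uniform limit is harmless because the chord integral is
  continuous in the uniform norm.\<close>

lemma orth_all:
  assumes d: "d \<in> L2_influx \<kappa>" and z: "!!p m. odd m ==> sgn m ~= sgn (2 * p - m) ==> cf (A_minus \<kappa> d) p m = 0"
    and F: "continuous_on (cball 0 1) F"
  shows "L2_inner im d (chord_integral F) = 0"
proof -
  have sd: "square_integrable im d" using d by (simp add: L2_influx_def)
  note lin = orth_lin[OF sd]
  have pol: "orth d (%x. of_real (poly q (x \<bullet> cis \<phi>)))" for q \<phi>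
    using chebspan_all[of q]
  proof (induction q rule: chebspan.induct)
    case zero
    show ?case using lin[OF orth_ridge[OF d z] orth_ridge[OF d z], where a = 0 and b = 0] by simp
  next
    case (step q c n)
    show ?case using lin[OF step.IH orth_ridge[OF d z, of n \<phi>], of 1 "of_real c"] by (simp add: ridge_def)
  qed
  \<comment> \<open>The exponential depends on x only through its component along the direction Arg
    \<xi>, which ranges over [-1, 1], so approximation by polynomials in one variable
    suffices.\<close>
  have exps: "orth d (%x. of_real (exp (x \<bullet> \<xi>)))" for \<xi>
  proof (rule orth_limit[OF sd])
    fix e :: real assume e: "0 < e"
    have ce: "continuous_on {-1..1} (%t. exp (norm \<xi> * t))" by (intro continuous_intros)
    from Stone_Weierstrass_real_polynomial_function[OF compact_Icc ce e]
    obtain g where g: "real_polynomial_function g" and ge: "!!t. t \<in> {-1..1} ==> \<bar>exp (norm \<xi> * t) - g t\<bar> < e" by blast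
    from g obtain a N where gs: "g = (%t. \<Sum>i\<le>N. a i * t ^ i)" unfolding real_polynomial_function_iff_sum by blast
    define q where "q = (\<Sum>i\<le>N. monom (a i) i)"
    have gq: "g t = poly q t" for t by (simp add: gs q_def poly_sum poly_monom)
    have xi: "x \<bullet> \<xi> = norm \<xi> * (x \<bullet> cis (Arg \<xi>))" for x
    proof -
      have "\<xi> = norm \<xi> *\<^sub>R cis (Arg \<xi>)" using rcis_cmod_Arg[of \<xi>] by (simp add: rcis_def scaleR_conv_of_real)
      then show ?thesis by (metis inner_scaleR_right)
    qed
    show "\<exists>G. orth d G \<and> (\<forall>x\<in>cball 0 1. norm (of_real (exp (x \<bullet> \<xi>)) - G x) \<le> e)"
    proof (intro exI[of _ "%x. of_real (poly q (x \<bullet> cis (Arg \<xi>)))"] conjI pol ballI)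
      fix x :: complex assume "x \<in> cball 0 1"
      then have "\<bar>x \<bullet> cis (Arg \<xi>)\<bar> \<le> 1" using Cauchy_Schwarz_ineq2[of x "cis (Arg \<xi>)"] by simp
      then have "\<bar>exp (x \<bullet> \<xi>) - poly q (x \<bullet> cis (Arg \<xi>))\<bar> < e"
        unfolding xi gq[symmetric] by (intro ge) auto
      then show "norm (complex_of_real (exp (x \<bullet> \<xi>)) - of_real (poly q (x \<bullet> cis (Arg \<xi>)))) \<le> e"
        unfolding of_real_diff[symmetric] norm_of_real by simp
    qed
  qed (intro continuous_intros)
  have es: "orth d (%x. of_real (g x))" if "expsum g" for g
    using that
  proof (induction g rule: expsum.induct)
    case (base c \<xi>)
    show ?case using lin[OF exps exps, of "of_real c" \<xi> 0 \<xi>] by simp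
  next
    case (add f g)
    show ?case using lin[OF add.IH, of 1 1] by simp
  qed
  have re: "orth d (%x. of_real (f x))" if f: "continuous_on (cball 0 1) f" for f
  proof (rule orth_limit[OF sd])
    show "continuous_on (cball 0 1) (%x. complex_of_real (f x))" by (intro continuous_on_of_real f)
    fix e :: real assume e: "0 < e"
    from expsum_approx[OF f e] obtain g where g: "expsum g" "\<forall>x\<in>cball 0 1. \<bar>f x - g x\<bar> < e" by (elim exE conjE)
    show "\<exists>G. orth d G \<and> (\<forall>x\<in>cball 0 1. norm (of_real (f x) - G x) \<le> e)"
    proof (intro exI[of _ "%x. of_real (g x)"] conjI es g(1) ballI)
      fix x :: complex assume "x \<in> cball 0 1"
      then show "norm (complex_of_real (f x) - of_real (g x)) \<le> e"
        unfolding of_real_diff[symmetric] norm_of_real using g(2) by (simp add: less_imp_le)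
    qed
  qed
  have "orth d (%x. 1 * of_real (Re (F x)) + \<i> * of_real (Im (F x)))"
    by (intro lin re continuous_intros F)
  moreover have "(%x. 1 * of_real (Re (F x)) + \<i> * of_real (Im (F x))) = F" by (simp add: fun_eq_iff complex_eq_iff)
  ultimately show ?thesis by (simp add: orth_def)
qed

end

section \<open>Density of the range\<close>

lemma smooth_on_sum: "(!!i. i \<in> I ==> smooth_on S (f i)) ==> smooth_on S (%x. \<Sum>i\<in>I. f i x :: complex)"
  by (induction I rule: infinite_finite_induct) (auto intro: smooth_on_const smooth_on_add)

lemma smooth_ridge: "smooth_on S (ridge n \<phi>)"
proof -
  have b: "smooth_on S (%x. of_real (x \<bullet> cis \<phi>) :: complex)"
    by (intro smooth_on_bounded_linear bounded_linear_compose[OF bounded_linear_of_real bounded_linear_inner_left])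
  have "smooth_on S (%x. of_real (poly q (x \<bullet> cis \<phi>)) :: complex)" for q
  proof (induction q)
    case (pCons a q)
    have "smooth_on S (%x. of_real a + of_real (x \<bullet> cis \<phi>) * of_real (poly q (x \<bullet> cis \<phi>)) :: complex)"
      by (rule smooth_on_add[OF smooth_on_const smooth_on_mult[OF b pCons.IH]])
    then show ?case by simp
  qed (simp add: smooth_on_const)
  then show ?thesis unfolding ridge_def[abs_def] .
qed

context curved_disk
begin

lemma smooth_zern: "smooth_on X (zern n a)"
  unfolding zern_def[abs_def] by (rule smooth_on_sum, rule smooth_on_mult[OF smooth_on_const smooth_ridge])

section \<open>Undoing the projective change of variables\<close>

definition lift_den :: "complex => complex" where "lift_den z = 1 - of_real \<kappa> * (z * cnj z)"
definition lift_pt :: "complex => complex" where "lift_pt z = of_real (1 - \<kappa>) * (z * inverse (lift_den z))"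
text \<open>This is \<open>klein_root\<close> evaluated at \<open>lift_pt z\<close>, written as a
  rational function of z and its conjugate: no square root remains, and smoothness up to the
  boundary follows from the nonvanishing of \<open>lift_den\<close> alone.\<close>

definition lift_wt :: "complex => complex" where
  "lift_wt z = of_real (1 - \<kappa>) * ((1 + of_real \<kappa> * (z * cnj z)) * inverse (lift_den z))"
definition lift :: "(complex => complex) => complex => complex" where
  "lift F z = (lift_wt z * lift_wt z) * F (lift_pt z)"

lemma lift_den_eq: "lift_den z = of_real (1 - \<kappa> * (norm z)\<^sup>2)"
  by (simp add: lift_den_def complex_norm_square[symmetric])

lemma lift_den_pos: "norm z \<le> 1 ==> 0 < 1 - \<kappa> * (norm z)\<^sup>2"
proof -
  assume "norm z \<le> 1"
  then have n: "(norm z)\<^sup>2 \<le> 1" by (simp add: power_le_one)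
  have "\<kappa> * (norm z)\<^sup>2 \<le> \<bar>\<kappa>\<bar> * 1" using n by (intro mult_mono) auto
  then show ?thesis using kappa_abs by simp
qed

lemma norm_lift_pt: assumes z: "norm z \<le> 1" shows "norm (lift_pt z) \<le> 1"
proof -
  let ?n = "norm z"
  have "0 \<le> (1 - ?n) * (1 + \<kappa> * ?n)"
  proof (rule mult_nonneg_nonneg)
    have "- (\<kappa> * ?n) \<le> \<bar>\<kappa>\<bar> * 1" using z mult_mono[of "\<bar>\<kappa>\<bar>" "\<bar>\<kappa>\<bar>" ?n 1] abs_ge_minus_self[of "\<kappa> * ?n"] by (simp add: abs_mult)
    then show "0 \<le> 1 + \<kappa> * ?n" using kappa_abs by simp
  qed (use z in simp)
  then have "(1 - \<kappa>) * ?n \<le> 1 - \<kappa> * ?n\<^sup>2" by (simp add: algebra_simps power2_eq_square)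
  moreover have "norm (lift_pt z) = (1 - \<kappa>) * ?n / (1 - \<kappa> * ?n\<^sup>2)"
    unfolding lift_pt_def lift_den_eq norm_mult norm_inverse norm_of_real
    using lift_den_pos[OF z] kappa_lt by (simp add: divide_inverse)
  ultimately show ?thesis using lift_den_pos[OF z] by simp
qed

lemma lift_klein_inv:
  assumes y: "norm y \<le> 1"
  shows "lift_pt (klein_inv y) = y" "lift_wt (klein_inv y) = of_real (klein_root y)"
proof -
  let ?R = "klein_root y" and ?k = "1 - \<kappa>" and ?w = "klein_inv y"
  have R: "?R > 0" "?R\<^sup>2 = ?k\<^sup>2 + 4 * \<kappa> * (norm y)\<^sup>2"
    using klein_root_pos[OF y] klein_root_square[OF y] by (simp_all add: power2_norm_eq_inner)
  have k: "?k > 0" using kappa_lt by simp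
  define s where "s = ?k + ?R"
  have s: "s > 0" using R k by (simp add: s_def)
  have w2: "(norm ?w)\<^sup>2 = 4 * (norm y)\<^sup>2 / s\<^sup>2"
    using s by (simp add: klein_inv_def s_def power_divide power_mult_distrib)
  have kw: "\<kappa> * (norm ?w)\<^sup>2 = (?R\<^sup>2 - ?k\<^sup>2) / s\<^sup>2" unfolding w2 R(2) by simp
  \<comment> \<open>This factorization cancels one factor s and yields \<kappa> |w|^2 without
    dividing by \<kappa>, which may be zero.\<close>
  have "?R\<^sup>2 - ?k\<^sup>2 = s * (?R - ?k)" by (simp add: s_def power2_eq_square algebra_simps)
  then have kw': "\<kappa> * (norm ?w)\<^sup>2 = (?R - ?k) / s" unfolding kw using s by (simp add: power2_eq_square)
  have d: "1 - \<kappa> * (norm ?w)\<^sup>2 = 2 * ?k / s" unfolding kw' using s by (simp add: field_simps s_def)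
  have n: "1 + \<kappa> * (norm ?w)\<^sup>2 = 2 * ?R / s" unfolding kw' using s by (simp add: field_simps s_def)
  have w: "?w = of_real (2 / s) * y" by (simp add: klein_inv_def s_def scaleR_conv_of_real)
  have den: "lift_den ?w = of_real (2 * ?k / s)" unfolding lift_den_eq d ..
  have num: "1 + of_real \<kappa> * (?w * cnj ?w) = complex_of_real (2 * ?R / s)"
    unfolding n[symmetric] complex_norm_square[symmetric] by simp
  have "lift_pt ?w = of_real (?k * (2 / s) * inverse (2 * ?k / s)) * y"
    unfolding lift_pt_def den unfolding w by (simp only: of_real_mult of_real_inverse mult_ac)
  also have "?k * (2 / s) * inverse (2 * ?k / s) = 1" using s k by (simp add: field_simps)
  finally show "lift_pt ?w = y" by simp
  have "lift_wt ?w = of_real (?k * ((2 * ?R / s) * inverse (2 * ?k / s)))"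
    unfolding lift_wt_def num den by (simp only: of_real_mult of_real_inverse)
  also have "?k * ((2 * ?R / s) * inverse (2 * ?k / s)) = ?R" using s k by (simp add: field_simps)
  finally show "lift_wt ?w = of_real ?R" .
qed

lemma flatten_lift: assumes y: "norm y \<le> 1" shows "flatten (lift F) y = F y"
  unfolding flatten_def lift_def lift_klein_inv[OF y] using klein_root_pos[OF y]
  by (simp add: scaleR_conv_of_real power2_eq_square)

lemma lift_smooth:
  assumes F: "smooth_on (cball 0 1) F" shows "lift F \<in> C_inf_disk"
proof -
  let ?S = "cball 0 1 :: complex set"
  have i: "smooth_on ?S (%z. z)" by (rule smooth_on_bounded_linear) (rule bounded_linear_ident)
  have zz: "smooth_on ?S (%z. z * cnj z)" by (rule smooth_on_mult[OF i smooth_on_linear_comp[OF i bounded_linear_cnj]])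
  have kz: "smooth_on ?S (%z. c + k * (z * cnj z))" for c k
    by (rule smooth_on_add[OF smooth_on_const smooth_on_mult[OF smooth_on_const zz]])
  have den: "smooth_on ?S (%z. inverse (lift_den z))"
  proof (rule smooth_on_inverse)
    show "smooth_on ?S lift_den" using kz[of 1 "- of_real \<kappa>"] unfolding lift_den_def[abs_def] by simp
    show "lift_den z ~= 0" if "z \<in> ?S" for z
      using lift_den_pos[of z] that unfolding lift_den_eq by (simp only: of_real_eq_0_iff) simp
  qed
  have pt: "smooth_on ?S lift_pt" unfolding lift_pt_def[abs_def]
    by (rule smooth_on_mult[OF smooth_on_const smooth_on_mult[OF i den]])
  have wt: "smooth_on ?S lift_wt" unfolding lift_wt_def[abs_def]
    by (rule smooth_on_mult[OF smooth_on_const smooth_on_mult[OF kz den]])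
  have "smooth_on ?S (lift F)" unfolding lift_def[abs_def]
    by (rule smooth_on_mult[OF smooth_on_mult[OF wt wt] smooth_on_compose[OF pt _ F]]) (auto simp: norm_lift_pt)
  then show ?thesis by (simp add: C_inf_disk_def)
qed

lemma C_inf_disk_continuous: "f \<in> C_inf_disk ==> continuous_on (cball 0 1) f"
  by (simp add: C_inf_disk_def smooth_on_continuous)

lemma xray_chord: "f \<in> C_inf_disk ==> \<bar>snd p\<bar> \<le> pi/2 ==> xray \<kappa> f p = chord_integral (flatten f) p"
  using xray_formula[of "snd p" f "fst p"] C_inf_disk_continuous by (simp add: chord_integral_def)

lemma chord_integral_cong:
  assumes "!!y. norm y \<le> 1 ==> F y = G y" "\<bar>snd p\<bar> \<le> pi/2"
  shows "chord_integral F p = chord_integral G p"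
  unfolding chord_integral_def
  by (intro arg_cong[where f = "%x. _ *\<^sub>R x"] Henstock_Kurzweil_Integration.integral_cong assms(1) norm_chord) auto

lemma xray_lift:
  assumes "smooth_on (cball 0 1) F" "\<bar>snd p\<bar> \<le> pi/2"
  shows "xray \<kappa> (lift F) p = chord_integral F p"
  unfolding xray_chord[OF lift_smooth[OF assms(1)] assms(2)] by (rule chord_integral_cong[OF flatten_lift assms(2)])

lemma L2_influx_cong:
  assumes "w \<in> L2_influx \<kappa>" "!!p. \<bar>snd p\<bar> \<le> pi/2 ==> w' p = w p"
  shows "w' \<in> L2_influx \<kappa>"
proof -
  have sp: "w' p = w p" if "p \<in> space im" for p using assms(2) space_im_inner[OF that] .
  have "square_integrable im w' \<longleftrightarrow> square_integrable im w"
    unfolding square_integrable_def using sp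
    by (intro conj_cong measurable_cong Bochner_Integration.integrable_cong) auto
  then show ?thesis using assms by (simp add: L2_influx_def periodic_influx_def)
qed

lemma xray_unoriented:
  assumes f: "f \<in> C_inf_disk" shows "xray \<kappa> f \<in> L2_unoriented \<kappa>"
proof -
  have c: "continuous_on (cball 0 1) (flatten f)" by (rule continuous_flatten[OF C_inf_disk_continuous[OF f]])
  have "xray \<kappa> f \<in> L2_influx \<kappa>" by (rule L2_influx_cong[OF chord_integral_L2[OF c] xray_chord[OF f]])
  moreover have "unoriented \<kappa> (xray \<kappa> f)"
    unfolding unoriented_def
  proof (rule AE_I2)
    fix p assume "p \<in> space im"
    note p = space_im_inner[OF this]
    have "snd (antipodal_scattering \<kappa> p) = - snd p" by (cases p) (simp add: antipodal_scattering_def scattering_def)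
    then have p': "\<bar>snd (antipodal_scattering \<kappa> p)\<bar> \<le> pi/2" using p by simp
    then show "xray \<kappa> f (antipodal_scattering \<kappa> p) = xray \<kappa> f p"
      unfolding xray_chord[OF f p] xray_chord[OF f p'] using chord_integral_antipodal[OF c p, of "fst p"] by simp
  qed
  ultimately show ?thesis by (simp add: L2_unoriented_def)
qed

text \<open>The scalars invert those in the chord integrals of the Zernike polynomials, so that d
  becomes the coefficient family of the \<open>pz n a\<close>.\<close>

definition zsum :: "(nat => nat => complex) => nat => complex => complex" where
  "zsum d n x = (\<Sum>a\<le>n. (d n a * of_real (real (n + 1) / (1 - \<kappa>\<^sup>2)) * (-1) ^ a) * zern n a x)"

lemma smooth_zsum: "smooth_on X (zsum d n)"
  unfolding zsum_def[abs_def] by (rule smooth_on_sum, rule smooth_on_mult[OF smooth_on_const smooth_zern])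

lemma one_minus_kappa_sq: "1 - \<kappa>\<^sup>2 > 0"
  using abs_square_less_1[of \<kappa>] kappa_gt kappa_lt by auto

lemma chord_integral_zsum:
  assumes p: "\<bar>snd p\<bar> \<le> pi/2"
  shows "chord_integral (%x. \<Sum>n\<in>I. 1 * zsum d n x) p = (\<Sum>n\<in>I. \<Sum>a\<le>n. d n a * pz n a p)"
proof (cases "finite I")
  case True
  have "chord_integral (zsum d n) p = (\<Sum>a\<le>n. d n a * pz n a p)" for n
  proof -
    have "chord_integral (zsum d n) p = (\<Sum>a\<le>n. (d n a * of_real (real (n + 1) / (1 - \<kappa>\<^sup>2)) * (-1) ^ a) * chord_integral (zern n a) p)"
      unfolding zsum_def[abs_def] by (rule chord_integral_sum[OF _ smooth_on_continuous[OF smooth_zern] p]) simp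
    also have "\<dots> = (\<Sum>a\<le>n. d n a * pz n a p)"
    proof (rule sum.cong[OF refl])
      fix a assume "a \<in> {..n}"
      then have a: "a \<le> n" by simp
      have 1: "(-1) ^ a * (-1) ^ a = (1 :: complex)" by (simp add: power_mult_distrib[symmetric])
      have "real (n + 1) / (1 - \<kappa>\<^sup>2) * ((1 - \<kappa>\<^sup>2) / real (n + 1)) = 1" using one_minus_kappa_sq by simp
      then have 2: "of_real (real (n + 1) / (1 - \<kappa>\<^sup>2)) * of_real ((1 - \<kappa>\<^sup>2) / real (n + 1)) = (1 :: complex)"
        unfolding of_real_mult[symmetric] by simp
      have "(d n a * of_real (real (n + 1) / (1 - \<kappa>\<^sup>2)) * (-1) ^ a) * chord_integral (zern n a) p
        = (of_real (real (n + 1) / (1 - \<kappa>\<^sup>2)) * of_real ((1 - \<kappa>\<^sup>2) / real (n + 1))) * ((-1) ^ a * (-1) ^ a) * (d n a * pz n a p)"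
        unfolding chord_integral_zern[OF p a] by (simp only: mult_ac)
      then show "(d n a * of_real (real (n + 1) / (1 - \<kappa>\<^sup>2)) * (-1) ^ a) * chord_integral (zern n a) p = d n a * pz n a p"
        unfolding 1 2 by simp
    qed
    finally show ?thesis .
  qed
  then show ?thesis
    by (subst chord_integral_sum[OF True smooth_on_continuous[OF smooth_zsum] p]) simp
next
  case False
  then show ?thesis by (simp add: chord_integral_def)
qed

lemma A_minus_diff: "A_minus \<kappa> (%q. u q - v q) q = A_minus \<kappa> u q - A_minus \<kappa> v q"
  by (cases q) (simp add: A_minus_def Let_def)

lemma projection_coeffs:
  assumes u: "u \<in> L2_unoriented \<kappa>"
  defines "v \<equiv> A_minus \<kappa> (id_plus_C_minus_sq \<kappa> u)"
  shows "v \<in> L2_bdry \<kappa>" "anti_cf v" "supp_cf v"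
proof -
  have u': "u \<in> L2_influx \<kappa>" "unoriented \<kappa> u" using u by (simp_all add: L2_unoriented_def)
  note P = id_plus_C_minus_sq_L2[OF u'(1)]
  show "v \<in> L2_bdry \<kappa>" unfolding v_def by (rule A_minus_L2[OF P])
  show "anti_cf v" unfolding v_def by (rule A_minus_anti_cf[OF P])
  show "supp_cf v" unfolding supp_cf_def v_def cf_id_plus_C_minus_sq[OF u'] by simp
qed

lemma pz_sum_L2: "(%q. \<Sum>n\<le>N. \<Sum>a\<le>n. d n a * pz n a q) \<in> L2_bdry \<kappa>"
proof -
  have zero: "(%q. 0) \<in> L2_bdry \<kappa>" by (rule L2_bdryI[of _ 0]) (simp_all add: periodic_bdry_def)
  have sum: "(%q. \<Sum>i\<in>I. f i q) \<in> L2_bdry \<kappa>" if "!!i. f i \<in> L2_bdry \<kappa>" for I :: "nat set" and f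
    by (induction I rule: infinite_finite_induct) (simp_all add: zero L2_bdry_add that)
  show ?thesis by (intro sum L2_bdry_cmult pz_L2)
qed

text \<open>For merely square-integrable u the Zernike series need not converge to a function smooth
  on the disk; its finite partial sums are smooth and place the projection in the closure. In the
  other direction, u minus its projection has no coefficient at the frequencies carried by chord
  integrals.\<close>

lemma part1:
  "L2_orthogonal_projection_onto im (L2_unoriented \<kappa>) (id_plus_C_minus_sq \<kappa>) (xray \<kappa> ` C_inf_disk)"
  unfolding L2_orthogonal_projection_onto_def
proof (intro conjI ballI)
  show "xray \<kappa> ` C_inf_disk \<subseteq> L2_unoriented \<kappa>" using xray_unoriented by blast
next
  fix u assume u: "u \<in> L2_unoriented \<kappa>"
  let ?P = "id_plus_C_minus_sq \<kappa> u"
  define v where "v = A_minus \<kappa> ?P"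
  note v = projection_coeffs[OF u, folded v_def]
  have u': "u \<in> L2_influx \<kappa>" "unoriented \<kappa> u" using u by (simp_all add: L2_unoriented_def)
  have Pu: "?P \<in> L2_unoriented \<kappa>"
    using id_plus_C_minus_sq_L2[OF u'(1)] id_plus_C_minus_sq_unoriented[OF u'] by (simp add: L2_unoriented_def)
  show "?P \<in> L2_closure im (L2_unoriented \<kappa>) (xray \<kappa> ` C_inf_disk)"
    unfolding L2_closure_def
  proof (intro CollectI conjI Pu allI impI)
    fix e :: real assume "0 < e"
    define w where "w N q = (\<Sum>n\<le>N. \<Sum>a\<le>n. dco v n a * pz n a q)" for N q
    have "(%N. L2_norm bm (%q. v q - w N q)) \<longlonglongrightarrow> 0" unfolding w_def by (rule pz_series[OF v])
    then have "eventually (%N. L2_norm bm (%q. v q - w N q) < e) sequentially" by (rule order_tendstoD) fact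
    then obtain N where N: "L2_norm bm (%q. v q - w N q) < e" unfolding eventually_sequentially by blast
    define F where "F x = (\<Sum>n\<le>N. 1 * zsum (dco v) n x)" for x
    have F: "smooth_on (cball 0 1) F" unfolding F_def[abs_def]
      by (rule smooth_on_sum, rule smooth_on_mult[OF smooth_on_const smooth_zsum])
    have wL: "w N \<in> L2_bdry \<kappa>" unfolding w_def[abs_def] by (rule pz_sum_L2)
    have "L2_norm im (%p. ?P p - xray \<kappa> (lift F) p) = L2_norm im (%p. v p - w N p)"
    proof -
      have "?P p - xray \<kappa> (lift F) p = v p - w N p" if "p \<in> space im" for p
        using xray_lift[OF F space_im_inner[OF that]] chord_integral_zsum[OF space_im_inner[OF that], where d = "dco v" and I = "{..N}", folded F_def[abs_def]]
        by (simp add: v_def A_minus_eq_im[OF that] w_def)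
      then show ?thesis unfolding L2_norm_def by (intro arg_cong[where f = sqrt] Bochner_Integration.integral_cong) auto
    qed
    also have "\<dots> \<le> L2_norm bm (%q. v q - w N q)" by (rule im_norm_le(2)[OF L2_bdry_diff[OF v(1) wL]])
    finally show "\<exists>r\<in>xray \<kappa> ` C_inf_disk. L2_norm im (%p. ?P p - r p) < e"
      using N lift_smooth[OF F] by (intro bexI[of _ "xray \<kappa> (lift F)"]) auto
  qed
  fix r assume "r \<in> xray \<kappa> ` C_inf_disk"
  then obtain f where r: "r = xray \<kappa> f" and f: "f \<in> C_inf_disk" by (rule imageE)
  define d where "d q = u q - ?P q" for q
  have PL: "?P \<in> L2_influx \<kappa>" by (rule id_plus_C_minus_sq_L2[OF u'(1)])
  have d: "d \<in> L2_influx \<kappa>" unfolding d_def[abs_def] using u'(1) PL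
    by (simp add: L2_influx_def periodic_influx_def square_integrable_diff)
  have z: "cf (A_minus \<kappa> d) p m = 0" if "odd m" "sgn m ~= sgn (2 * p - m)" for p m
    unfolding d_def[abs_def] A_minus_diff[abs_def] cf_diff[OF A_minus_L2[OF u'(1)] A_minus_L2[OF PL]]
      cf_id_plus_C_minus_sq[OF u'] using that by simp
  have "L2_inner im d r = L2_inner im d (chord_integral (flatten f))"
    unfolding r by (rule L2_inner_cong_space) (rule xray_chord[OF f space_im_inner])
  also have "\<dots> = 0" by (rule orth_all[OF d z continuous_flatten[OF C_inf_disk_continuous[OF f]]])
  finally show "L2_inner im (%x. u x - ?P x) r = 0" by (simp add: d_def[abs_def])
qed

end

section \<open>Smoothness of the preimage\<close>

lemma chebU_bound: assumes "\<bar>t\<bar> \<le> 1" shows "\<bar>poly (chebU n) t\<bar> \<le> real (n + 1)"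
proof -
  have t: "t = cos (arccos t)" using assms by (simp add: cos_arccos_abs)
  have "\<bar>poly (chebU n) t\<bar> = norm (complex_of_real (poly (chebU n) (cos (arccos t))))" unfolding t[symmetric] by simp
  also have "\<dots> \<le> (\<Sum>l\<le>n. norm (cis ((real n - 2 * real l) * arccos t)))" unfolding chebU_cis by (rule norm_sum)
  finally show ?thesis by simp
qed

text \<open>Each derivative costs two powers of n + 1, as in Markov's inequality. The induction is
  double: the derivative recurrence lowers n by two at the same order i + 1 and brings in a term of
  order i.\<close>

lemma pderiv_chebU_bound:
  assumes t: "\<bar>t\<bar> \<le> 1"
  shows "\<bar>poly ((pderiv ^^ i) (chebU n)) t\<bar> \<le> real (n + 1) ^ (2 * i + 1)"
proof (induction i arbitrary: n)
  case 0
  show ?case using chebU_bound[OF t, of n] by simp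
next
  case (Suc i)
  have zero: "(pderiv ^^ i) 0 = (0 :: real poly)" for i by (induction i) simp_all
  have add: "(pderiv ^^ i) (p + q) = (pderiv ^^ i) p + (pderiv ^^ i) (q :: real poly)" for i p q by (induction i) (simp_all add: pderiv_add)
  have smu: "(pderiv ^^ i) (smult c p) = smult c ((pderiv ^^ i) (p :: real poly))" for i c p by (induction i) (simp_all add: pderiv_smult)
  show ?case
  proof (induction n rule: less_induct)
    case (less n)
    consider "n = 0" | "n = 1" | m where "n = Suc (Suc m)" by (metis One_nat_def chebU.cases)
    then show ?case
    proof cases
      case 1 then show ?thesis by (simp add: funpow_Suc_right zero del: funpow.simps)
    next
      case 2
      have "(pderiv ^^ Suc i) (chebU n) = (pderiv ^^ i) [:2:]" unfolding 2 by (simp add: funpow_Suc_right pderiv_pCons del: funpow.simps)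
      also have "\<bar>poly \<dots> t\<bar> \<le> 2" by (cases i) (simp_all add: funpow_Suc_right pderiv_pCons zero del: funpow.simps)
      also have "(2 :: real) \<le> 2 ^ (2 * Suc i + 1)" using power_increasing[of 1 "2 * Suc i + 1" "2 :: real"] by simp
      finally show ?thesis using 2 by simp
    next
      case (3 m)
      have "(pderiv ^^ Suc i) (chebU n) = (pderiv ^^ Suc i) (chebU m) + smult (2 * real (m + 2)) ((pderiv ^^ i) (chebU (Suc m)))"
        unfolding 3 funpow_Suc_right o_def pderiv_chebU add smu ..
      then have "\<bar>poly ((pderiv ^^ Suc i) (chebU n)) t\<bar>
          \<le> \<bar>poly ((pderiv ^^ Suc i) (chebU m)) t\<bar> + 2 * real (m + 2) * \<bar>poly ((pderiv ^^ i) (chebU (Suc m))) t\<bar>"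
        using abs_triangle_ineq[of "poly ((pderiv ^^ Suc i) (chebU m)) t" "2 * real (m + 2) * poly ((pderiv ^^ i) (chebU (Suc m))) t"]
        by (simp add: abs_mult)
      also have "\<dots> \<le> real (m + 1) ^ (2 * i + 3) + 4 * real (m + 2) * real (m + 2) ^ (2 * i + 1)"
      proof (rule add_mono)
        show "\<bar>poly ((pderiv ^^ Suc i) (chebU m)) t\<bar> \<le> real (m + 1) ^ (2 * i + 3)"
          using less.IH[of m] 3 by (simp add: numeral_3_eq_3)
        have "2 * real (m + 2) * \<bar>poly ((pderiv ^^ i) (chebU (Suc m))) t\<bar> \<le> 4 * real (m + 2) * real (m + 2) ^ (2 * i + 1)"
          using Suc.IH[of "Suc m"] by (intro mult_mono) auto
        then show "2 * real (m + 2) * \<bar>poly ((pderiv ^^ i) (chebU (Suc m))) t\<bar> \<le> 4 * real (m + 2) * real (m + 2) ^ (2 * i + 1)" .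
      qed
      also have "\<dots> \<le> (real (m + 3) ^ (2 * i + 1)) * (real (m + 1))\<^sup>2 + (4 * real (m + 2)) * real (m + 3) ^ (2 * i + 1)"
      proof (rule add_mono)
        have "real (m + 1) ^ (2 * i + 3) = real (m + 1) ^ (2 * i + 1) * (real (m + 1))\<^sup>2"
          unfolding power_add[symmetric] by (rule arg_cong[where f = "%k. _ ^ k"]) simp
        also have "\<dots> \<le> real (m + 3) ^ (2 * i + 1) * (real (m + 1))\<^sup>2"
          by (intro mult_right_mono power_mono) auto
        finally show "real (m + 1) ^ (2 * i + 3) \<le> real (m + 3) ^ (2 * i + 1) * (real (m + 1))\<^sup>2" .
        show "4 * real (m + 2) * real (m + 2) ^ (2 * i + 1) \<le> (4 * real (m + 2)) * real (m + 3) ^ (2 * i + 1)"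
          by (intro mult_left_mono power_mono) auto
      qed
      \<comment> \<open>The constants were arranged for the identity (m + 1)^2 + 4 (m + 2) = (m +
        3)^2.\<close>
      also have "\<dots> = real (m + 3) ^ (2 * i + 1) * (real (m + 3))\<^sup>2"
        by (simp add: power2_eq_square algebra_simps del: power_Suc power_add)
      also have "\<dots> = real (n + 1) ^ (2 * Suc i + 1)"
        unfolding 3 power_add[symmetric] by (rule arg_cong2[where f = power]) simp_all
      finally show ?thesis .
    qed
  qed
qed

definition rapid :: "(nat => nat => complex) => bool" where
  "rapid C \<longleftrightarrow> (\<forall>k. \<exists>B. \<forall>n j. j \<le> n \<longrightarrow> norm (C n j) * real (n + 1) ^ k \<le> B)"

text \<open>The order i is a parameter and the coefficients are arbitrary because differentiation
  raises i by one and only rescales coefficients; the resulting class of series is closed under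
  derivatives.\<close>

definition rterm :: "nat => (nat => nat => complex) => nat => complex => complex" where
  "rterm i C n x = (\<Sum>j\<le>n. C n j * of_real (poly ((pderiv ^^ i) (chebU n)) (x \<bullet> cis (pi * real j / real (n + 1)))))"

definition rseries :: "nat => (nat => nat => complex) => complex => complex" where
  "rseries i C x = (\<Sum>n. rterm i C n x)"

definition tail2 :: "nat => real" where "tail2 n = 1 / (real (n + 1))\<^sup>2"

lemma summable_tail2: "summable tail2"
proof -
  have "summable (%n. inverse (real n ^ 2))" by (rule inverse_power_summable) simp
  then have "summable (%n. inverse (real (Suc n) ^ 2))" by (subst summable_Suc_iff)
  then show ?thesis by (simp add: tail2_def[abs_def] inverse_eq_divide)
qed

text \<open>The coefficients D may differ from C, and the bound is linear in their ratio c. With c =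
  |h| this gives estimates uniform in the direction h, as differentiation of a series in several
  variables requires.\<close>

lemma rterm_bound:
  assumes "rapid C"
  obtains B where "0 \<le> B" "!!n x D c. norm x \<le> 1 ==> 0 \<le> c ==> (!!j. norm (D n j) \<le> c * norm (C n j)) ==>
    norm (rterm i D n x) \<le> c * (B * tail2 n)"
proof -
  \<comment> \<open>Of the exponent, 2i + 1 pays for the derivative of U_n, one for the n + 1
    summands, and two leave a summable tail.\<close>
  from assms obtain B where B: "!!n j. j \<le> n ==> norm (C n j) * real (n + 1) ^ (2 * i + 4) \<le> B" unfolding rapid_def by blast
  have B0: "0 \<le> B" using order_trans[OF _ B[of 0 0]] by simp
  have "norm (rterm i D n x) \<le> c * (B * tail2 n)"
    if x: "norm x \<le> 1" and c: "0 \<le> c" and D: "!!j. norm (D n j) \<le> c * norm (C n j)" for n x D c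
  proof -
    let ?N = "real (n + 1)"
    have one: "norm (D n j * of_real (poly ((pderiv ^^ i) (chebU n)) (x \<bullet> cis \<phi>))) \<le> c * B / ?N ^ 3" if "j \<le> n" for j \<phi>
    proof -
      have t: "\<bar>x \<bullet> cis \<phi>\<bar> \<le> 1" using Cauchy_Schwarz_ineq2[of x "cis \<phi>"] x by simp
      have "norm (D n j * of_real (poly ((pderiv ^^ i) (chebU n)) (x \<bullet> cis \<phi>))) \<le> (c * norm (C n j)) * ?N ^ (2 * i + 1)"
        unfolding norm_mult norm_of_real by (intro mult_mono D pderiv_chebU_bound[OF t]) (use c in auto)
      also have "\<dots> = c * (norm (C n j) * ?N ^ (2 * i + 4)) / ?N ^ 3"
      proof -
        have "?N ^ (2 * i + 4) = ?N ^ (2 * i + 1) * ?N ^ 3"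
          unfolding power_add[symmetric] by (rule arg_cong[where f = "%k. _ ^ k"]) simp
        then show ?thesis by simp
      qed
      also have "\<dots> \<le> c * B / ?N ^ 3" using B[OF that] c by (intro divide_right_mono mult_left_mono) auto
      finally show ?thesis .
    qed
    have "norm (rterm i D n x) \<le> (\<Sum>j\<le>n. c * B / ?N ^ 3)"
      unfolding rterm_def by (rule sum_norm_le) (rule one, simp)
    also have "\<dots> = ?N * (c * B / ?N ^ 3)" by simp
    also have "\<dots> = c * (B * tail2 n)" unfolding tail2_def by (simp add: power3_eq_cube power2_eq_square del: of_nat_Suc of_nat_add)
    finally show ?thesis .
  qed
  with B0 show ?thesis by (rule that)
qed

lemma tail_bound:
  fixes f :: "nat => complex"
  assumes "!!n. norm (f n) \<le> c * (B * tail2 n)"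
  shows "summable f" "norm ((\<Sum>i<n. f i) - suminf f) \<le> c * (B * (\<Sum>i. tail2 (i + n)))"
proof -
  have s: "summable (%n. c * (B * tail2 n))" by (intro summable_mult summable_tail2)
  show sf: "summable f" by (rule summable_comparison_test'[OF s, of 0]) (rule assms)
  have st: "summable (%i. tail2 (i + n))" by (rule summable_ignore_initial_segment[OF summable_tail2])
  have sc: "summable (%i. c * (B * tail2 (i + n)))" by (intro summable_mult st)
  have sn: "summable (%i. norm (f (i + n)))" by (rule summable_comparison_test'[OF sc, of 0]) (simp add: assms)
  have "(\<Sum>i<n. f i) - suminf f = - (\<Sum>i. f (i + n))" using suminf_split_initial_segment[OF sf, of n] by simp
  then have "norm ((\<Sum>i<n. f i) - suminf f) = norm (\<Sum>i. f (i + n))" by simp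
  also have "\<dots> \<le> (\<Sum>i. norm (f (i + n)))" by (rule summable_norm[OF sn])
  also have "\<dots> \<le> (\<Sum>i. c * (B * tail2 (i + n)))" by (rule suminf_le[OF assms sn sc])
  also have "\<dots> = c * (B * (\<Sum>i. tail2 (i + n)))" using st by (simp add: suminf_mult summable_mult)
  finally show "norm ((\<Sum>i<n. f i) - suminf f) \<le> c * (B * (\<Sum>i. tail2 (i + n)))" .
qed

lemma tail2_lim: "(%n. \<Sum>i. tail2 (i + n)) \<longlonglongrightarrow> 0"
proof -
  have "(%n. suminf tail2 - (\<Sum>i<n. tail2 i)) \<longlonglongrightarrow> suminf tail2 - suminf tail2"
    by (intro tendsto_diff tendsto_const summable_LIMSEQ summable_tail2)
  moreover have "(\<Sum>i. tail2 (i + n)) = suminf tail2 - (\<Sum>i<n. tail2 i)" for n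
    using suminf_split_initial_segment[OF summable_tail2, of n] by simp
  ultimately show ?thesis by simp
qed

lemma rseries_close:
  assumes "rapid C"
  obtains e where "e \<longlonglongrightarrow> 0" "!!n x. norm x \<le> 1 ==> norm ((\<Sum>k<n. rterm i C k x) - rseries i C x) \<le> e n"
proof -
  from rterm_bound[OF assms, of i] obtain B where B: "0 \<le> B"
    "!!n x D c. norm x \<le> 1 ==> 0 \<le> c ==> (!!j. norm (D n j) \<le> c * norm (C n j)) ==> norm (rterm i D n x) \<le> c * (B * tail2 n)" by metis
  have b: "norm (rterm i C n x) \<le> 1 * (B * tail2 n)" if "norm x \<le> 1" for n x by (rule B(2)[OF that]) simp_all
  show ?thesis
  proof (rule that)
    have "(%n. 1 * (B * (\<Sum>i. tail2 (i + n)))) \<longlonglongrightarrow> 1 * (B * 0)" by (intro tendsto_mult tendsto_const tail2_lim)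
    then show "(%n. 1 * (B * (\<Sum>i. tail2 (i + n)))) \<longlonglongrightarrow> 0" by simp
    show "norm ((\<Sum>k<n. rterm i C k x) - rseries i C x) \<le> 1 * (B * (\<Sum>i. tail2 (i + n)))" if "norm x \<le> 1" for n x
      unfolding rseries_def by (rule tail_bound(2)) (rule b[OF that])
  qed
qed

text \<open>Differentiating in direction h multiplies the term with ridge direction e^{i\<phi>} by h
  \<bullet> e^{i\<phi>}; that factor is absorbed into the coefficients.\<close>

definition cdir :: "(nat => nat => complex) => complex => nat => nat => complex" where
  "cdir C h n j = C n j * of_real (h \<bullet> cis (pi * real j / real (n + 1)))"

lemma norm_cdir: "norm (cdir C h n j) \<le> norm h * norm (C n j)"
proof -
  have "\<bar>h \<bullet> cis (pi * real j / real (n + 1))\<bar> \<le> norm h"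
    using Cauchy_Schwarz_ineq2[of h "cis (pi * real j / real (n + 1))"] by simp
  from mult_right_mono[OF this norm_ge_zero[of "C n j"]] show ?thesis
    unfolding cdir_def norm_mult norm_of_real by (simp only: mult.commute)
qed

lemma rapid_cdir: assumes "rapid C" shows "rapid (cdir C h)"
  unfolding rapid_def
proof
  fix k
  from assms obtain B where B: "!!n j. j \<le> n ==> norm (C n j) * real (n + 1) ^ k \<le> B" unfolding rapid_def by blast
  have "norm (cdir C h n j) * real (n + 1) ^ k \<le> norm h * B" if "j \<le> n" for n j
  proof -
    have "norm (cdir C h n j) * real (n + 1) ^ k \<le> (norm h * norm (C n j)) * real (n + 1) ^ k"
      by (intro mult_right_mono norm_cdir) simp
    also have "\<dots> \<le> norm h * B" unfolding mult.assoc by (intro mult_left_mono B[OF that]) simp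
    finally show ?thesis .
  qed
  then show "\<exists>B. \<forall>n j. j \<le> n \<longrightarrow> norm (cdir C h n j) * real (n + 1) ^ k \<le> B" by blast
qed

lemma rterm_derivative: "(rterm i C n has_derivative (%h. rterm (Suc i) (cdir C h) n x)) (at x within S)"
proof -
  have "((%x. C n j * of_real (poly q (x \<bullet> cis \<phi>))) has_derivative (%h. C n j * of_real (h \<bullet> cis \<phi>) * of_real (poly (pderiv q) (x \<bullet> cis \<phi>)))) (at x within S)" for j q \<phi>
  proof -
    have "((%x. poly q (x \<bullet> cis \<phi>)) has_derivative (%h. (h \<bullet> cis \<phi>) * poly (pderiv q) (x \<bullet> cis \<phi>))) (at x within S)"
    proof -
      have "(poly q has_derivative (*) (poly (pderiv q) (x \<bullet> cis \<phi>))) (at (x \<bullet> cis \<phi>) within (%x. x \<bullet> cis \<phi>) ` S)"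
        using poly_DERIV[of q "x \<bullet> cis \<phi>"] unfolding has_field_derivative_def by (rule has_derivative_at_withinI)
      from has_derivative_in_compose[OF bounded_linear.has_derivative[OF bounded_linear_inner_left has_derivative_ident] this]
      show ?thesis by (simp add: mult.commute)
    qed
    from has_derivative_mult_right[OF has_derivative_of_real[OF this], of "C n j"]
    show ?thesis by (simp add: mult.assoc)
  qed
  then show ?thesis unfolding rterm_def[abs_def] cdir_def funpow.simps o_def by (rule has_derivative_sum)
qed

text \<open>Termwise differentiation: the tails of the differentiated series are bounded by |h|
  times a null sequence, uniformly on the closed disk, which is convergence of the derivatives in
  operator norm.\<close>

lemma rseries_derivative:
  assumes C: "rapid C" and x: "x \<in> cball 0 1"
  shows "(rseries i C has_derivative (%h. rseries (Suc i) (cdir C h) x)) (at x within cball 0 1)"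
proof -
  let ?S = "cball 0 1 :: complex set"
  from rterm_bound[OF C, of "Suc i"] obtain B where B: "0 \<le> B"
    "!!n x D c. norm x \<le> 1 ==> 0 \<le> c ==> (!!j. norm (D n j) \<le> c * norm (C n j)) ==> norm (rterm (Suc i) D n x) \<le> c * (B * tail2 n)" by metis
  from rterm_bound[OF C, of i] obtain A where A: "0 \<le> A"
    "!!n x D c. norm x \<le> 1 ==> 0 \<le> c ==> (!!j. norm (D n j) \<le> c * norm (C n j)) ==> norm (rterm i D n x) \<le> c * (A * tail2 n)" by metis
  have b: "norm (rterm (Suc i) (cdir C h) n y) \<le> norm h * (B * tail2 n)" if "norm y \<le> 1" for n y h
    by (rule B(2)) (rule that, rule norm_ge_zero, rule norm_cdir)
  have sm: "summable (%n. rterm i C n y)" if "norm y \<le> 1" for y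
    by (rule tail_bound(1)[of _ 1 A]) (rule A(2)[OF that], simp_all)
  have lim: "\<forall>\<^sub>F n in sequentially. \<forall>y\<in>?S. \<forall>h. norm ((\<Sum>k<n. rterm (Suc i) (cdir C h) k y) - rseries (Suc i) (cdir C h) y) \<le> e * norm h"
    if e: "0 < e" for e
  proof -
    have "(%n. B * (\<Sum>i. tail2 (i + n))) \<longlonglongrightarrow> B * 0" by (intro tendsto_mult tendsto_const tail2_lim)
    then have "\<forall>\<^sub>F n in sequentially. B * (\<Sum>i. tail2 (i + n)) < e" using e by (intro order_tendstoD) auto
    then show ?thesis
    proof eventually_elim
      fix n assume n: "B * (\<Sum>i. tail2 (i + n)) < e"
      show "\<forall>y\<in>?S. \<forall>h. norm ((\<Sum>k<n. rterm (Suc i) (cdir C h) k y) - rseries (Suc i) (cdir C h) y) \<le> e * norm h"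
      proof (intro ballI allI)
        fix y h :: complex assume y: "y \<in> ?S"
        have "norm ((\<Sum>k<n. rterm (Suc i) (cdir C h) k y) - rseries (Suc i) (cdir C h) y) \<le> norm h * (B * (\<Sum>i. tail2 (i + n)))"
          unfolding rseries_def by (rule tail_bound(2)) (rule b, use y in simp)
        also have "\<dots> \<le> norm h * e" using n by (intro mult_left_mono) auto
        finally show "norm ((\<Sum>k<n. rterm (Suc i) (cdir C h) k y) - rseries (Suc i) (cdir C h) y) \<le> e * norm h" by (simp only: mult.commute)
      qed
    qed
  qed
  have "\<exists>g. \<forall>y\<in>?S. (%n. rterm i C n y) sums g y \<and> (g has_derivative (%h. rseries (Suc i) (cdir C h) y)) (at y within ?S)"
    by (rule has_derivative_series[where f' = "%n y h. rterm (Suc i) (cdir C h) n y" and x = 0, OF convex_cball rterm_derivative lim _ summable_sums[OF sm]]) simp_all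
  then obtain g where g: "!!y. y \<in> ?S ==> (%n. rterm i C n y) sums g y"
    "!!y. y \<in> ?S ==> (g has_derivative (%h. rseries (Suc i) (cdir C h) y)) (at y within ?S)" by (elim exE) blast
  have "rseries i C y = g y" if "y \<in> ?S" for y using sums_unique[OF g(1)[OF that]] by (simp add: rseries_def)
  then show ?thesis using has_derivative_transform[OF x _ g(2)[OF x]] by simp
qed

text \<open>The coinduction invariant is the whole class of series with rapidly decaying
  coefficients at all orders i, since a single series does not reproduce itself under
  differentiation.\<close>

lemma smooth_rseries:
  assumes "rapid C" shows "smooth_on (cball 0 1) (rseries i C)"
proof -
  have "\<exists>j D. rseries i C = rseries j D \<and> rapid D" using assms by blast
  then show ?thesis
  proof (coinduction arbitrary: i C)
    case (smooth_on i C)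
    then obtain j D where e: "rseries i C = rseries j D" and D: "rapid D" by (elim exE conjE)
    show ?case
    proof (intro exI conjI allI impI)
      show "rseries i C = rseries j D" by (rule e)
      show "(rseries j D has_derivative (%h. rseries (Suc j) (cdir D h) x)) (at x within cball 0 1)" if "x \<in> cball 0 1" for x
        by (rule rseries_derivative[OF D that])
      show "(\<exists>i C. (%x. rseries (Suc j) (cdir D h) x) = rseries i C \<and> (\<exists>j D. rseries i C = rseries j D \<and> rapid D))
          \<or> smooth_on (cball 0 1) (%x. rseries (Suc j) (cdir D h) x)" for h
        using rapid_cdir[OF D] by blast
    qed
  qed
qed

lemma smooth_exp: "smooth_on T (exp :: complex => complex)"
proof -
  have "smooth_on T (%x. c * exp x :: complex)" for c
  proof (coinduction arbitrary: c)
    case smooth_on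
    show ?case
    proof (intro exI conjI allI impI)
      show "(%x. c * exp x) = (%x. c * exp x)" ..
      show "((%x. c * exp x) has_derivative (%h. (c * h) * exp x)) (at x within T)" for x
        by (auto intro!: derivative_eq_intros simp: fun_eq_iff)
      show "(\<exists>d. (%x. (c * h) * exp x) = (%x. d * exp x)) \<or> smooth_on T (%x. (c * h) * exp x)" for h by blast
    qed
  qed
  from this[of 1] show ?thesis by simp
qed

lemma smooth_cis_snd: "smooth_on X (%q :: real \<times> real. cis (k * snd q))"
proof -
  have "smooth_on X (%q :: real \<times> real. \<i> * of_real (k * snd q) :: complex)"
    by (intro smooth_on_bounded_linear bounded_linear_compose[OF bounded_linear_mult_right]
        bounded_linear_compose[OF bounded_linear_of_real] bounded_linear_snd)
  from smooth_on_compose[OF this subset_UNIV smooth_exp] show ?thesis by (simp add: cis_conv_exp)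
qed

section \<open>Decay of the coefficients of smooth boundary functions\<close>

context curved_disk
begin

text \<open>This is \<rho>^2, and \<open>drho\<close> is \<rho> \<rho>'; both are trigonometric
  polynomials in \<alpha>, so smoothness is visible, although \<rho> itself contains a square
  root.\<close>

definition srho :: "real \<times> real => complex" where "srho q = of_real ((rho (snd q))\<^sup>2)"
definition drho :: "real \<times> real => complex" where "drho q = of_real (- (4 * \<kappa> * sin (snd q) * cos (snd q)))"

lemma srho_eq: "srho q = of_real (1 + \<kappa>\<^sup>2) + of_real \<kappa> * (cis (2 * snd q) + cis ((- 2) * snd q))"
proof -
  have "(rho (snd q))\<^sup>2 = 1 + \<kappa>\<^sup>2 + \<kappa> * (2 * cos (2 * snd q))"
    unfolding rho_square cos_double using sin_cos_squared_add[of "snd q"] by algebra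
  then show ?thesis unfolding srho_def by (simp add: complex_eq_iff)
qed

lemma drho_eq: "drho q = (of_real \<kappa> * \<i>) * cis (2 * snd q) + (- of_real \<kappa> * \<i>) * cis ((- 2) * snd q)"
  unfolding drho_def by (simp add: complex_eq_iff sin_double)

lemma smooth_srho: "smooth_on X srho" and smooth_drho: "smooth_on X drho"
  unfolding srho_eq[abs_def] drho_eq[abs_def]
  by (rule smooth_on_add[OF smooth_on_const smooth_on_mult[OF smooth_on_const smooth_on_add[OF smooth_cis_snd smooth_cis_snd]]],
      rule smooth_on_add[OF smooth_on_mult[OF smooth_on_const smooth_cis_snd] smooth_on_mult[OF smooth_on_const smooth_cis_snd]])

lemma C_inf_bdry_L2:
  assumes w: "w \<in> C_inf_bdry" shows "w \<in> L2_bdry \<kappa>"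
proof -
  have p: "periodic_bdry w" and c: "continuous_on UNIV w" using w by (auto simp: C_inf_bdry_def smooth_on_continuous)
  let ?D = "{0..2*pi} \<times> {- (pi/2)..3*pi/2}"
  have "bounded (w ` ?D)"
    by (intro compact_imp_bounded compact_continuous_image continuous_on_subset[OF c subset_UNIV] compact_Times compact_Icc)
  then obtain B where B: "!!x. x \<in> ?D ==> norm (w x) \<le> B" unfolding bounded_iff by blast
  have "norm (w q) \<le> B" for q
  proof -
    have "reduce q \<in> ?D" using reduce_in_fund[of q] by (auto simp: fund_def)
    then have "norm (w (reduce q)) \<le> B" by (rule B)
    then show ?thesis unfolding periodic_bdry_reduce[OF p] .
  qed
  then show ?thesis by (rule L2_bdryI[OF p borel_measurable_continuous_onI[OF c]])
qed

lemma C_inf_bdry_deriv: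
  assumes w: "w \<in> C_inf_bdry"
  obtains w' where "w' \<in> C_inf_bdry" "!!\<beta> \<alpha>. ((%\<alpha>. w (\<beta>, \<alpha>)) has_vector_derivative w' (\<beta>, \<alpha>)) (at \<alpha>)"
proof -
  have p: "periodic_bdry w" and s: "smooth_on UNIV w" using w by (auto simp: C_inf_bdry_def)
  from smooth_on_deriv[OF s] obtain d where d0: "\<forall>x\<in>UNIV. (w has_derivative d x) (at x)" and ds0: "\<forall>h. smooth_on UNIV (%x. d x h)"
    by (elim exE conjE)
  have d: "(w has_derivative d x) (at x)" for x using d0 by (rule bspec) (rule UNIV_I)
  have ds: "smooth_on UNIV (%x. d x h)" for h using ds0 by (rule spec)
  have v: "((%\<alpha>. w (\<beta>, \<alpha>)) has_vector_derivative d (\<beta>, \<alpha>) (0, 1)) (at \<alpha>)" for \<beta> \<alpha>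
  proof -
    have "((%\<alpha>. (\<beta>, \<alpha>)) has_derivative (%h. (0, h))) (at \<alpha>)" by (intro has_derivative_Pair has_derivative_const has_derivative_ident)
    from has_derivative_compose[OF this d] have 1: "((%\<alpha>. w (\<beta>, \<alpha>)) has_derivative (%h. d (\<beta>, \<alpha>) (0, h))) (at \<alpha>)" .
    have eq: "(%h. d (\<beta>, \<alpha>) (0, h)) = (%h. h *\<^sub>R d (\<beta>, \<alpha>) (0, 1))"
    proof
      fix h
      have "d (\<beta>, \<alpha>) (h *\<^sub>R (0, 1)) = h *\<^sub>R d (\<beta>, \<alpha>) (0, 1)"
        by (rule linear_scale[OF has_derivative_linear[OF d]])
      moreover have "h *\<^sub>R (0, 1) = (0 :: real, h)" by simp
      ultimately show "d (\<beta>, \<alpha>) (0, h) = h *\<^sub>R d (\<beta>, \<alpha>) (0, 1)" by (simp only:)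
    qed
    show ?thesis unfolding has_vector_derivative_def by (rule has_derivative_eq_rhs[OF 1 eq])
  qed
  have "periodic_bdry (%x. d x (0, 1))"
  proof -
    have dt: "d (x + t) = d x" if t: "!!x. w (x + t) = w x" for x t
    proof -
      have "((%y. y + t) has_derivative (%h. h)) (at x)" by (auto intro!: derivative_eq_intros)
      from has_derivative_compose[OF this d] have "((%y. w (y + t)) has_derivative d (x + t)) (at x)" .
      then have "(w has_derivative d (x + t)) (at x)" by (simp only: t)
      then show ?thesis by (rule has_derivative_unique[OF _ d])
    qed
    have t1: "w (x + (2 * pi, 0)) = w x" and t2: "w (x + (0, 2 * pi)) = w x" for x
      using p by (cases x, simp add: periodic_bdry_def)+
    show ?thesis unfolding periodic_bdry_def
    proof (intro allI conjI)
      fix \<beta> \<alpha>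
      show "d (\<beta> + 2 * pi, \<alpha>) (0, 1) = d (\<beta>, \<alpha>) (0, 1)" using dt[where x = "(\<beta>, \<alpha>)" and t = "(2 * pi, 0)", OF t1] by simp
      show "d (\<beta>, \<alpha> + 2 * pi) (0, 1) = d (\<beta>, \<alpha>) (0, 1)" using dt[where x = "(\<beta>, \<alpha>)" and t = "(0, 2 * pi)", OF t2] by simp
    qed
  qed
  then have "(%x. d x (0, 1)) \<in> C_inf_bdry" using ds by (simp add: C_inf_bdry_def)
  from that[OF this v] show ?thesis .
qed

text \<open>Integration by parts in the fibre variable: the transpose of the operator below multiplies
  the coefficients by a multiple of \<open>m\<close>.\<close>

lemma cf_derivative:
  assumes w: "w \<in> C_inf_bdry"
  obtains w2 where "w2 \<in> C_inf_bdry" "!!p m. cf w2 p m = (\<i> * of_int m * of_real (1 - \<kappa>\<^sup>2)) * cf w p m"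
proof -
  obtain w' where w': "w' \<in> C_inf_bdry" and v: "!!\<beta> \<alpha>. ((%\<alpha>. w (\<beta>, \<alpha>)) has_vector_derivative w' (\<beta>, \<alpha>)) (at \<alpha>)"
    by (rule C_inf_bdry_deriv[OF w]) (rule that)
  have p: "periodic_bdry w" and c: "continuous_on UNIV w" and s: "smooth_on UNIV w" using w by (auto simp: C_inf_bdry_def smooth_on_continuous)
  have p': "periodic_bdry w'" and c': "continuous_on UNIV w'" and s': "smooth_on UNIV w'" using w' by (auto simp: C_inf_bdry_def smooth_on_continuous)
  \<comment> \<open>This is \<rho> times the fibre derivative of \<rho> w, a first-order operator
    with smooth periodic coefficients, so it can be applied again to its own result.\<close>
  define w2 where "w2 q = srho q * w' q + drho q * w q" for q
  have w2: "w2 \<in> C_inf_bdry"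
  proof -
    have "smooth_on UNIV w2" unfolding w2_def[abs_def]
      by (rule smooth_on_add[OF smooth_on_mult[OF smooth_srho s'] smooth_on_mult[OF smooth_drho s]])
    moreover have "periodic_bdry w2"
      using p p' by (simp add: w2_def periodic_bdry_def srho_def drho_def rho_plus_2pi)
    ultimately show ?thesis by (simp add: C_inf_bdry_def)
  qed
  have "cf w2 p m = (\<i> * of_int m * of_real (1 - \<kappa>\<^sup>2)) * cf w p m" for p m
  proof -
    define K where "K = \<i> * of_int m * complex_of_real (1 - \<kappa>\<^sup>2)"
    define h where "h q = w2 q - K * w q" for q
    have hL: "h \<in> L2_bdry \<kappa>" unfolding h_def[abs_def] by (intro L2_bdry_diff L2_bdry_cmult C_inf_bdry_L2 w w2)
    \<comment> \<open>Periodic in \<alpha>, with derivative equal to h times the conjugate fibre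
      factor of the basis function. Its integral over one period vanishes, and this integral is the
      coefficient of h up to the factor in \<beta>.\<close>
    define g where "g \<beta> \<alpha> = w (\<beta>, \<alpha>) * (of_real (rho \<alpha>) * cis (of_int (- m) * sct \<alpha>))" for \<beta> \<alpha>
    define g' where "g' \<beta> \<alpha> = h (\<beta>, \<alpha>) * (of_real (1 / rho \<alpha>) * cis (of_int (- m) * sct \<alpha>))" for \<beta> \<alpha>
    have gd: "(g \<beta> has_vector_derivative g' \<beta> \<alpha>) (at \<alpha>)" for \<beta> \<alpha>
    proof -
      let ?r = "of_real (rho \<alpha>) :: complex" and ?e = "cis (of_int (- m) * sct \<alpha>)"
      have r: "?r ~= 0" using rho_pos[of \<alpha>] by simp
      have 1: "((%\<alpha>. complex_of_real (rho \<alpha>)) has_vector_derivative of_real (- (4 * \<kappa> * sin \<alpha> * cos \<alpha>) / rho \<alpha>)) (at \<alpha>)"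
        by (rule bounded_linear.has_vector_derivative[OF bounded_linear_of_real has_vector_derivative_rho])
      have "(g \<beta> has_vector_derivative (w (\<beta>, \<alpha>) * (?r * (\<i> * of_int (- m) * of_real ((1 - \<kappa>\<^sup>2) / (rho \<alpha>)\<^sup>2) * ?e)
          + of_real (- (4 * \<kappa> * sin \<alpha> * cos \<alpha>) / rho \<alpha>) * ?e) + w' (\<beta>, \<alpha>) * (?r * ?e))) (at \<alpha>)"
        unfolding g_def[abs_def]
        by (rule has_vector_derivative_mult[OF v has_vector_derivative_mult[OF 1 has_vector_derivative_cis_mult_scat]])
      also have "(w (\<beta>, \<alpha>) * (?r * (\<i> * of_int (- m) * of_real ((1 - \<kappa>\<^sup>2) / (rho \<alpha>)\<^sup>2) * ?e)
          + of_real (- (4 * \<kappa> * sin \<alpha> * cos \<alpha>) / rho \<alpha>) * ?e) + w' (\<beta>, \<alpha>) * (?r * ?e)) = g' \<beta> \<alpha>"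
        using r unfolding g'_def h_def w2_def K_def srho_def drho_def snd_conv
        by (simp add: field_simps power2_eq_square)
      finally show ?thesis .
    qed
    have gc: "continuous_on A (g' \<beta>)" for A \<beta>
    proof -
      have "continuous_on UNIV h" unfolding h_def[abs_def]
        using w2 by (intro continuous_intros c smooth_on_continuous) (simp add: C_inf_bdry_def)
      then have "continuous_on A (%\<alpha>. h (\<beta>, \<alpha>))" by (rule continuous_on_compose2) (auto intro!: continuous_intros)
      then show ?thesis unfolding g'_def[abs_def] using rho_pos
        by (intro continuous_intros continuous_rho continuous_cis_mult_scat) (auto simp: less_imp_neq[symmetric])
    qed
    have g0: "integral\<^sup>L lborel (%\<alpha>. indicator {- (pi/2)..3*pi/2} \<alpha> *\<^sub>R g' \<beta> \<alpha>) = 0" for \<beta>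
    proof -
      have "integral\<^sup>L lborel (%\<alpha>. indicator {- (pi/2)..3*pi/2} \<alpha> *\<^sub>R g' \<beta> \<alpha>) = g \<beta> (3*pi/2) - g \<beta> (- (pi/2))"
        by (rule integral_FTC_Icc[OF _ has_vector_derivative_at_within[OF gd] gc]) simp
      also have "3*pi/2 = - (pi/2) + 2 * pi" by simp
      also have "g \<beta> (- (pi/2) + 2 * pi) = g \<beta> (- (pi/2))"
        using p unfolding g_def scat_plus_2pi cis_int_2pi rho_plus_2pi periodic_bdry_def by (simp only:)
      finally show ?thesis by simp
    qed
    let ?f = "%q. h q * cnj (wv p m q)"
    have f: "?f (\<beta>, \<alpha>) = cis (- (of_int p * \<beta>)) * g' \<beta> \<alpha>" for \<beta> \<alpha>
      unfolding wv_def g'_def fst_conv snd_conv by (simp add: cis_cnj mult_ac)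
    have inner: "integral\<^sup>L lborel (%\<alpha>. indicator {- (pi/2)..3*pi/2} \<alpha> *\<^sub>R ?f (\<beta>, \<alpha>)) = cis (- (of_int p * \<beta>)) * 0" for \<beta>
      by (simp only: f mult_scaleR_right[symmetric] Bochner_Integration.integral_mult_right_zero g0)
    have mf: "?f \<in> borel_measurable borel" using L2_bdry_measurable[OF hL] measurable_wv[of p m] by measurable
    have "cf h p m = 0"
      unfolding cf_def L2_inner_def integral_bm_fubini[OF mf square_integrable_inner[OF L2_bdry_sq[OF hL] wv_sq]] inner by simp
    then show ?thesis
      unfolding h_def[abs_def] cf_diff[OF C_inf_bdry_L2[OF w2] L2_bdry_cmult[OF C_inf_bdry_L2[OF w]]] cf_cmult K_def by simp
  qed
  then show ?thesis by (rule that[OF w2])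
qed

text \<open>Every application of the fibre operator gains one factor m; the starting bound is
  Cauchy-Schwarz with the common norm of the basis. No decay in p is sought, as decay in m turns out
  to control the degree n.\<close>

lemma cf_decay:
  assumes "w \<in> C_inf_bdry"
  shows "\<exists>B. \<forall>p m. norm (cf w p m) * \<bar>real_of_int m\<bar> ^ k \<le> B"
  using assms
proof (induction k arbitrary: w)
  case 0
  have "norm (cf w p m) \<le> L2_norm bm w * n0" for p m
    using L2_cauchy_schwarz[OF L2_bdry_sq[OF C_inf_bdry_L2[OF 0]] wv_sq, of p m] by (simp add: cf_def L2_norm_wv)
  then show ?case by auto
next
  case (Suc k)
  have k1: "1 - \<kappa>\<^sup>2 > 0" using abs_square_less_1[of \<kappa>] kappa_gt kappa_lt by auto
  obtain w2 where w2: "w2 \<in> C_inf_bdry" and e: "!!p m. cf w2 p m = (\<i> * of_int m * of_real (1 - \<kappa>\<^sup>2)) * cf w p m"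
    by (rule cf_derivative[OF Suc.prems]) (rule that)
  from Suc.IH[OF w2] obtain B where B: "!!p m. norm (cf w2 p m) * \<bar>real_of_int m\<bar> ^ k \<le> B" by blast
  have "norm (cf w p m) * \<bar>real_of_int m\<bar> ^ Suc k \<le> B / (1 - \<kappa>\<^sup>2)" for p m
  proof -
    have n: "norm (cf w2 p m) = \<bar>real_of_int m\<bar> * (1 - \<kappa>\<^sup>2) * norm (cf w p m)"
      unfolding e norm_mult norm_of_real using k1 by simp
    have "norm (cf w p m) * \<bar>real_of_int m\<bar> ^ Suc k * (1 - \<kappa>\<^sup>2) = norm (cf w2 p m) * \<bar>real_of_int m\<bar> ^ k"
      unfolding n power_Suc by (simp only: mult_ac)
    also have "\<dots> \<le> B" by (rule B)
    finally show ?thesis using k1 by (simp only: pos_le_divide_eq)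
  qed
  then show ?case by blast
qed

text \<open>The frequency m = 2a + 1 stays small when a is small, whatever n is. By antisymmetry the
  coefficient at 2p - m has the same modulus, and |m| + |2p - m| = 2n + 2, so one of the two
  frequencies is at least n + 1 in modulus and decay in the fibre frequency gives decay in
  n.\<close>

lemma dco_decay:
  assumes u: "u \<in> C_inf_minus \<kappa>" "u \<in> L2_unoriented \<kappa>"
  defines "v \<equiv> A_minus \<kappa> (id_plus_C_minus_sq \<kappa> u)"
  shows "\<exists>B. \<forall>n a. a \<le> n \<longrightarrow> norm (dco v n a) * real (n + 1) ^ k \<le> B"
proof -
  let ?w = "A_minus \<kappa> u"
  have u': "u \<in> L2_influx \<kappa>" "unoriented \<kappa> u" using u(2) by (simp_all add: L2_unoriented_def)
  have w: "?w \<in> C_inf_bdry" using u(1) by (simp add: C_inf_minus_def)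
  from cf_decay[OF w, of k] obtain B where B: "!!p m. norm (cf ?w p m) * \<bar>real_of_int m\<bar> ^ k \<le> B" by blast
  have "norm (dco v n a) * real (n + 1) ^ k \<le> B / n0\<^sup>2" if a: "a \<le> n" for n a
  proof -
    let ?p = "2 * int a - int n" and ?m = "2 * int a + 1" and ?k = "2 * int a - 2 * int n - 1"
    have "sgn ?m ~= sgn (2 * ?p - ?m)" using a by (auto simp: sgn_if)
    \<comment> \<open>Smoothness is given for the extension of u and not for that of its projection;
      at the retained frequencies both have the same coefficients.\<close>
    then have v: "cf v ?p ?m = cf ?w ?p ?m" unfolding v_def cf_id_plus_C_minus_sq[OF u'] by simp
    have "norm (cf ?w ?p ?k) = norm (cf ?w ?p ?m)"
      unfolding anti_cf_pair[OF A_minus_anti_cf[OF u'(1)]] by (simp add: norm_mult parity_sign_def)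
    then have le: "norm (cf ?w ?p ?m) * \<bar>real_of_int ?m\<bar> ^ k \<le> B" "norm (cf ?w ?p ?m) * \<bar>real_of_int ?k\<bar> ^ k \<le> B"
      using B[of ?p ?m] B[of ?p ?k] by simp_all
    have "real (n + 1) \<le> \<bar>real_of_int ?m\<bar> \<or> real (n + 1) \<le> \<bar>real_of_int ?k\<bar>" using a by linarith
    then have "norm (cf ?w ?p ?m) * real (n + 1) ^ k \<le> B"
    proof
      assume "real (n + 1) \<le> \<bar>real_of_int ?m\<bar>"
      then have "norm (cf ?w ?p ?m) * real (n + 1) ^ k \<le> norm (cf ?w ?p ?m) * \<bar>real_of_int ?m\<bar> ^ k"
        by (intro mult_left_mono power_mono) auto
      then show ?thesis using le(1) by (rule order_trans)
    next
      assume "real (n + 1) \<le> \<bar>real_of_int ?k\<bar>"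
      then have "norm (cf ?w ?p ?m) * real (n + 1) ^ k \<le> norm (cf ?w ?p ?m) * \<bar>real_of_int ?k\<bar> ^ k"
        by (intro mult_left_mono power_mono) auto
      then show ?thesis using le(2) by (rule order_trans)
    qed
    moreover have "norm (dco v n a) = norm (cf ?w ?p ?m) / n0\<^sup>2"
      unfolding dco_def v norm_divide norm_of_real by simp
    ultimately show ?thesis by (simp add: divide_right_mono)
  qed
  then show ?thesis by blast
qed

definition rco :: "(nat => nat => complex) => nat => nat => complex" where
  "rco d n j = (\<Sum>a\<le>n. (d n a * of_real (real (n + 1) / (1 - \<kappa>\<^sup>2)) * (-1) ^ a)
     * (of_real (1 / real (n + 1)) * cis ((2 * real a - real n) * (pi * real j / real (n + 1)))))"

lemma zsum_rterm: "zsum d n x = rterm 0 (rco d) n x"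
proof -
  have "zsum d n x = (\<Sum>a\<le>n. \<Sum>j\<le>n. ((d n a * of_real (real (n + 1) / (1 - \<kappa>\<^sup>2)) * (-1) ^ a)
     * (of_real (1 / real (n + 1)) * cis ((2 * real a - real n) * (pi * real j / real (n + 1))))) * ridge n (pi * real j / real (n + 1)) x)"
    unfolding zsum_def zern_def sum_distrib_left by (simp only: mult.assoc)
  also have "\<dots> = (\<Sum>j\<le>n. rco d n j * ridge n (pi * real j / real (n + 1)) x)"
    by (subst sum.swap) (simp only: rco_def sum_distrib_right)
  finally show ?thesis unfolding rterm_def ridge_def by simp
qed

lemma rapid_rco:
  assumes d: "!!k. \<exists>B. \<forall>n a. a \<le> n \<longrightarrow> norm (d n a) * real (n + 1) ^ k \<le> B"
  shows "rapid (rco d)"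
  unfolding rapid_def
proof
  fix k
  \<comment> \<open>The additional power pays for the sum over the n + 1 values of a.\<close>
  from d[of "Suc k"] obtain B where B: "!!n a. a \<le> n ==> norm (d n a) * real (n + 1) ^ Suc k \<le> B" by blast
  have "norm (rco d n j) * real (n + 1) ^ k \<le> B / (1 - \<kappa>\<^sup>2)" for n j
  proof -
    let ?N = "real (n + 1)"
    have "norm (rco d n j) \<le> (\<Sum>a\<le>n. norm (d n a) / (1 - \<kappa>\<^sup>2))"
      unfolding rco_def
    proof (rule sum_norm_le)
      fix a
      have "norm ((d n a * of_real (?N / (1 - \<kappa>\<^sup>2)) * (-1) ^ a) * (of_real (1 / ?N) * cis ((2 * real a - real n) * (pi * real j / ?N))))
        = norm (d n a) * (?N / (1 - \<kappa>\<^sup>2)) * (1 / ?N)"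
        unfolding norm_mult norm_of_real norm_power norm_minus_cancel norm_one power_one norm_cis
        using one_minus_kappa_sq by simp
      then show "norm ((d n a * of_real (?N / (1 - \<kappa>\<^sup>2)) * (-1) ^ a) * (of_real (1 / ?N) * cis ((2 * real a - real n) * (pi * real j / ?N))))
        \<le> norm (d n a) / (1 - \<kappa>\<^sup>2)" by simp
    qed
    then have "norm (rco d n j) * ?N ^ k \<le> (\<Sum>a\<le>n. norm (d n a) / (1 - \<kappa>\<^sup>2)) * ?N ^ k" by (rule mult_right_mono) simp
    also have "\<dots> = (\<Sum>a\<le>n. norm (d n a) * ?N ^ k) / (1 - \<kappa>\<^sup>2)"
      by (simp add: sum_distrib_right sum_divide_distrib)
    also have "(\<Sum>a\<le>n. norm (d n a) * ?N ^ k) \<le> (\<Sum>a\<le>n. B / ?N)"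
    proof (rule sum_mono)
      fix a assume "a \<in> {..n}"
      then have "norm (d n a) * ?N ^ k * ?N \<le> B" using B[of a n] by (simp add: mult_ac)
      then show "norm (d n a) * ?N ^ k \<le> B / ?N" by (simp add: pos_le_divide_eq)
    qed
    also have "(\<Sum>a\<le>n. B / ?N) = B" by simp
    finally show ?thesis using one_minus_kappa_sq by (simp add: divide_right_mono)
  qed
  then show "\<exists>B. \<forall>n j. j \<le> n \<longrightarrow> norm (rco d n j) * real (n + 1) ^ k \<le> B" by blast
qed

text \<open>The Zernike partial sums converge uniformly to a smooth function F, so their chord
  integrals converge to that of F; the same chord integrals converge in L2 to the projection of u.
  Uniqueness of limits in L2 identifies the two almost everywhere, and \<open>lift\<close>
  transports F back to the curved disk.\<close>

lemma part2:
  assumes u: "u \<in> C_inf_minus \<kappa>" and un: "unoriented \<kappa> u"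
  shows "\<exists>f\<in>C_inf_disk. AE p in im. id_plus_C_minus_sq \<kappa> u p = xray \<kappa> f p"
proof -
  have "periodic_influx u" "smooth_on influx_strip u" using u by (auto simp: C_inf_minus_def C_inf_influx_def)
  then have uL: "u \<in> L2_unoriented \<kappa>" using un by (simp add: L2_unoriented_def influx_L2 smooth_on_continuous)
  define v where "v = A_minus \<kappa> (id_plus_C_minus_sq \<kappa> u)"
  note v = projection_coeffs[OF uL, folded v_def]
  define C where "C = rco (dco v)"
  have C: "rapid C" unfolding C_def v_def by (rule rapid_rco) (rule dco_decay[OF u uL])
  define F where "F = rseries 0 C"
  have F: "smooth_on (cball 0 1) F" unfolding F_def by (rule smooth_rseries[OF C])
  have cF: "continuous_on (cball 0 1) F" by (rule smooth_on_continuous[OF F])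
  obtain e where e: "e \<longlonglongrightarrow> 0" and Fe: "!!n x. norm x \<le> 1 ==> norm ((\<Sum>k<n. rterm 0 C k x) - rseries 0 C x) \<le> e n"
    by (rule rseries_close[OF C, of 0]) blast
  define w where "w N q = (\<Sum>n\<le>N. \<Sum>a\<le>n. dco v n a * pz n a q)" for N q
  define G where "G N x = (\<Sum>n\<le>N. 1 * zsum (dco v) n x)" for N x
  have cG: "continuous_on (cball 0 1) (G N)" for N unfolding G_def[abs_def]
    by (intro continuous_intros smooth_on_continuous[OF smooth_zsum])
  have wL: "w N \<in> L2_bdry \<kappa>" for N unfolding w_def[abs_def] by (rule pz_sum_L2)
  have sw: "square_integrable im (w N)" for N by (rule im_norm_le(1)[OF wL])
  have sv: "square_integrable im v" by (rule im_norm_le(1)[OF v(1)])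
  have FG: "norm (F x - G N x) \<le> e (Suc N)" if "x \<in> cball 0 1" for N x
  proof -
    have "G N x = (\<Sum>k<Suc N. rterm 0 C k x)" unfolding G_def zsum_rterm C_def lessThan_Suc_atMost by simp
    then show ?thesis using Fe[of x "Suc N"] that unfolding F_def by (simp add: norm_minus_commute)
  qed
  define K where "K = (1 - \<kappa>\<^sup>2) / (1 - \<bar>\<kappa>\<bar>)"
  have K: "0 \<le> K" using kappa_abs one_minus_kappa_sq by (simp add: K_def)
  have eN: "0 \<le> e (Suc N)" for N using order_trans[OF norm_ge_zero FG[of 0 N]] by simp
  have cw: "chord_integral (G N) p = w N p" if "p \<in> space im" for N p
    unfolding G_def[abs_def] w_def by (rule chord_integral_zsum[OF space_im_inner[OF that]])
  have le1: "L2_norm im (%p. chord_integral F p - w N p) \<le> (K * (2 * e (Suc N))) * sqrt (measure im (space im))" for N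
  proof (rule L2_norm_bounded[OF finite_im])
    show "norm (chord_integral F p - w N p) \<le> K * (2 * e (Suc N))" if "p \<in> space im" for p
      using chord_integral_close[OF cF cG space_im_inner[OF that] FG] unfolding K_def cw[OF that] .
    show "0 \<le> K * (2 * e (Suc N))" using K eN by simp
    show "(%p. chord_integral F p - w N p) \<in> borel_measurable im"
      by (rule square_integrable_measurable[OF square_integrable_diff[OF chord_integral_sq[OF cF] sw]])
  qed
  have "(%N. (K * (2 * e (Suc N))) * sqrt (measure im (space im))) \<longlonglongrightarrow> (K * (2 * 0)) * sqrt (measure im (space im))"
    by (intro tendsto_mult tendsto_const LIMSEQ_Suc[OF e])
  then have l0: "(%N. (K * (2 * e (Suc N))) * sqrt (measure im (space im))) \<longlonglongrightarrow> 0" by simp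
  have l1: "(%N. L2_norm im (%p. chord_integral F p - w N p)) \<longlonglongrightarrow> 0"
    by (rule tendsto_sandwich[OF _ _ tendsto_const l0]) (simp_all add: L2_norm_nonneg le1)
  have l3: "(%N. L2_norm bm (%q. v q - w N q)) \<longlonglongrightarrow> 0" unfolding w_def by (rule pz_series[OF v])
  have l2: "(%N. L2_norm im (%p. v p - w N p)) \<longlonglongrightarrow> 0"
    by (rule tendsto_sandwich[OF _ _ tendsto_const l3]) (simp_all add: L2_norm_nonneg im_norm_le(2)[OF L2_bdry_diff[OF v(1) wL]])
  have "AE p in im. v p = chord_integral F p"
    by (rule L2_limit_unique[OF sw sv chord_integral_sq[OF cF] l2 l1])
  with AE_space[of im] have "AE p in im. id_plus_C_minus_sq \<kappa> u p = xray \<kappa> (lift F) p"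
  proof eventually_elim
    fix p assume p: "p \<in> space im" and eq: "v p = chord_integral F p"
    show "id_plus_C_minus_sq \<kappa> u p = xray \<kappa> (lift F) p"
      unfolding xray_lift[OF F space_im_inner[OF p]] eq[symmetric] v_def A_minus_eq_im[OF p] ..
  qed
  then show ?thesis using lift_smooth[OF F] by blast
qed

end

theorem theorem10:
  fixes \<kappa> :: real
  assumes "-1 < \<kappa>" and "\<kappa> < 1"
  shows "L2_orthogonal_projection_onto (influx_measure \<kappa>) (L2_unoriented \<kappa>)
           (id_plus_C_minus_sq \<kappa>) (xray \<kappa> ` C_inf_disk)
       \<and> (\<forall>u \<in> C_inf_minus \<kappa>. unoriented \<kappa> u \<longrightarrow>
            (\<exists>f\<in>C_inf_disk. AE p in influx_measure \<kappa>. id_plus_C_minus_sq \<kappa> u p = xray \<kappa> f p))"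
proof -
  interpret curved_disk \<kappa> using assms by unfold_locales
  show ?thesis using part1 part2 by blast
qed

end
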